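(* Let $d\ge2$ and let $V=q(|\cdot|)$ be a real-valued radial function, of class $\mathcal C^1$ on $\overline{\mathbb B^d}$. Then $V$ is reconstructed from $(\lambda_k[V])_{k\in\mathbb N_0}$ as follows. 1) The Born approximation $V^{\mathrm B}$ coincides on $\mathbb B^d\setminus\{0\}$ with the compactly supported distribution $V^{\mathrm B}_r$ whose Fourier transform is $$\widehat{V^{\mathrm B}_r}(\xi)=2\pi^{d/2}\sum_{k=0}^\infty\frac{(-1)^k}{k!\,\Gamma(k+d/2)}\left(\frac{|\xi|}{2}\right)^{2k}(\lambda_k[V]-k),\qquad \xi\in\mathbb R^d .$$ 2) There is a unique $\mathcal C^1$ function $W$ on $(0,1]\times(0,1]$ such that $$r\frac{\partial W}{\partial r}(r,s)-s\frac{\partial W}{\partial s}(r,s)=s^2\int_r^1W\Big(\frac r\nu,s\Big)W(\nu,s)\frac{d\nu}{\nu},\qquad r,s\in(0,1),$$ and $W(|x|,1)=V^{\mathrm B}(x)$ for $x\in\mathbb B^d\setminus\{0\}$. Moreover $W(|x|,s)=s^{-2}[V_s]^{\mathrm B}(x)$, where $V_s(x)=s^2V(sx)$ for $s\in(0,1]$. 3) $W(1,|x|)=V(x)$ for $x\in\mathbb B^d\setminus\{0\}$.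
   Context: $\mathbb B^d=\{x\in\mathbb R^d:|x|<1\}$, $\mathbb S^{d-1}=\partial\mathbb B^d$, $|\mathbb S^{d-1}|$ is its surface measure, $\mathbb N_0=\{0,1,2,\dots\}$. Fourier transform: $\widehat f(\xi)=\int f(x)e^{-ix\cdot\xi}dx$, extended to compactly supported distributions by $\widehat f(\xi)=\langle f,e^{-i\xi\cdot x}\rangle$; functions on $\mathbb B^d$ are extended by zero to $\mathbb R^d$. Definition of $\lambda_k[V]$, $k\in\mathbb N_0$: consider solutions $b_k$ on $(0,1]$ of $$-\frac1{r^{d-1}}\frac{d}{dr}\Big(r^{d-1}\frac{d b_k}{dr}\Big)+\Big(\frac{k(k+d-2)}{r^2}+q(r)\Big)b_k=0,\qquad b_k(1)=1,$$ such that $b_k(|x|)Y_k(x/|x|)\in L^2(\mathbb B^d,|x|^{-2}dx)$ for every spherical harmonic $Y_k$ of degree $k$. If there is exactly one such solution, $\lambda_k[V]:=\partial_rb_k(1)$ (this is always the case for all sufficiently large $k$); otherwise $\lambda_k[V]:=k$. When $0$ is not a Dirichlet eigenvalue of $-\Delta+V$ on $\mathbb B^d$, $\lambda_k[V]$ is the eigenvalue of the Dirichlet-to-Neumann map $\Lambda_V$ on the spherical harmonics of degree $k$ (if both prescriptions apply and differ, which can concern only $d=2$, $k=0$, the latter is used). Born approximation: $V^{\mathrm B}$ is the unique radial function that belongs to $L^1(\mathbb B^d,|x|^{2s}dx)$ for some $s>0$ and satisfies $$\frac1{|\mathbb S^{d-1}|}\int_{\mathbb B^d}V^{\mathrm B}(x)|x|^{2k}dx=\lambda_k[V]-k\qquad\text{for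 all sufficiently large integers }k .$$ For $V$ of class $\mathcal C^1$ it is taken to be its continuous representative on $\mathbb B^d\setminus\{0\}$. *)

theory Defs
  imports "HOL-Analysis.Analysis"
begin

section \<open>Differentiability classes\<close>

text \<open>
  Class \<open>C\<^sup>1\<close> up to the part of the boundary that belongs to \<open>S\<close> (one-sided derivatives there);
  used for the closed ball and for the square \<open>(0,1] \<times> (0,1]\<close>.
\<close>

definition C1_on :: "'a::real_normed_vector set \<Rightarrow> ('a \<Rightarrow> real) \<Rightarrow> bool" where
  "C1_on S f \<longleftrightarrow> (\<exists>D :: 'a \<Rightarrow> 'a \<Rightarrow>\<^sub>L real.
     (\<forall>x\<in>S. (f has_derivative blinfun_apply (D x)) (at x within S)) \<and> continuous_on S D)"

definition partial_deriv ::
  "'a::euclidean_space \<Rightarrow> ('a \<Rightarrow> 'b::real_normed_vector) \<Rightarrow> 'a \<Rightarrow> 'b" where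
  "partial_deriv i f x = frechet_derivative f (at x) i"

text \<open>\<open>iter_partial [i\<^sub>1, \<dots>, i\<^sub>m] f = \<partial>\<^bsub>i\<^sub>1\<^esub> \<dots> \<partial>\<^bsub>i\<^sub>m\<^esub> f\<close>; multi-indices are represented by lists of
  basis vectors.\<close>

definition iter_partial ::
  "'a::euclidean_space list \<Rightarrow> ('a \<Rightarrow> 'b::real_normed_vector) \<Rightarrow> 'a \<Rightarrow> 'b" where
  "iter_partial is f = foldr partial_deriv is f"

definition smooth :: "('a::euclidean_space \<Rightarrow> 'b::real_normed_vector) \<Rightarrow> bool" where
  "smooth f \<longleftrightarrow> (\<forall>is. set is \<subseteq> Basis \<longrightarrow> (\<forall>x. iter_partial is f differentiable (at x)))"

text \<open>Only meaningful for open \<open>S\<close>, since the partial derivatives are two-sided.\<close>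

definition C2_on_open :: "'a::euclidean_space set \<Rightarrow> ('a \<Rightarrow> real) \<Rightarrow> bool" where
  "C2_on_open S f \<longleftrightarrow> C1_on S f \<and> (\<forall>i\<in>Basis. C1_on S (partial_deriv i f))"

definition laplacian :: "('a::euclidean_space \<Rightarrow> real) \<Rightarrow> 'a \<Rightarrow> real" where
  "laplacian f x = (\<Sum>i\<in>Basis. iter_partial [i, i] f x)"


section \<open>The numbers \<open>\<lambda>\<^sub>k[V]\<close>\<close>

text \<open>The profile \<open>q\<close> of a radial function \<open>V = q(|\<cdot>|)\<close>.\<close>

definition profile :: "('a::euclidean_space \<Rightarrow> real) \<Rightarrow> real \<Rightarrow> real" where
  "profile V r = (THE c. \<forall>x. norm x = r \<longrightarrow> V x = c)"

text \<open>Only the values of \<open>Y\<close> on the unit sphere matter.\<close>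

definition spherical_harmonic :: "nat \<Rightarrow> ('a::euclidean_space \<Rightarrow> real) \<Rightarrow> bool" where
  "spherical_harmonic k Y \<longleftrightarrow> (\<exists>P :: 'a \<Rightarrow> real.
     real_polynomial_function P \<and>
     (\<forall>t x. P (t *\<^sub>R x) = t ^ k * P x) \<and>
     (\<forall>x. laplacian P x = 0) \<and>
     (\<forall>w\<in>sphere 0 1. Y w = P w))"

text \<open>
  The solutions \<open>b\<^sub>k\<close> on \<open>(0,1]\<close>, made \<open>extensional\<close> so that they can be counted. Here
  \<open>g r\<close> is the derivative of \<open>r \<mapsto> r\<^bsup>d-1\<^esup> b'(r)\<close>.
\<close>

definition radial_solution :: "('a::euclidean_space \<Rightarrow> real) \<Rightarrow> nat \<Rightarrow> (real \<Rightarrow> real) \<Rightarrow> bool" where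
  "radial_solution V k b \<longleftrightarrow>
     b \<in> extensional {0<..1} \<and> b 1 = 1 \<and>
     (\<exists>b' g. \<forall>r\<in>{0<..1}.
        (b has_real_derivative b' r) (at r within {0<..1}) \<and>
        ((\<lambda>t. t ^ (DIM('a) - 1) * b' t) has_real_derivative g r) (at r within {0<..1}) \<and>
        - (1 / r ^ (DIM('a) - 1)) * g r
          + (real k * (real k + real DIM('a) - 2) / r\<^sup>2 + profile V r) * b r = 0) \<and>
     (\<forall>Y :: 'a \<Rightarrow> real. spherical_harmonic k Y \<longrightarrow>
        set_integrable lborel (ball 0 1) (\<lambda>x. (b (norm x) * Y (x /\<^sub>R norm x))\<^sup>2 / (norm x)\<^sup>2))"

text \<open>
  Boundary value problems for \<open>-\<Delta> + V\<close> are understood classically; for \<open>V\<close> of class \<open>C\<^sup>1\<close> on the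
  closed ball this agrees with the weak formulation by elliptic regularity.
\<close>

definition schroedinger_solution :: "('a::euclidean_space \<Rightarrow> real) \<Rightarrow> ('a \<Rightarrow> real) \<Rightarrow> bool" where
  "schroedinger_solution V u \<longleftrightarrow>
     continuous_on (cball 0 1) u \<and> C2_on_open (ball 0 1) u \<and>
     (\<forall>x\<in>ball 0 1. - laplacian u x + V x * u x = 0)"

definition zero_dirichlet_eigenvalue :: "('a::euclidean_space \<Rightarrow> real) \<Rightarrow> bool" where
  "zero_dirichlet_eigenvalue V \<longleftrightarrow> (\<exists>u.
     schroedinger_solution V u \<and> (\<forall>w\<in>sphere 0 1. u w = 0) \<and> (\<exists>x\<in>ball 0 1. u x \<noteq> 0))"

text \<open>\<open>DN_graph V f g\<close> means \<open>\<Lambda>\<^sub>V f = g\<close> on the unit sphere (a function of \<open>f\<close> when \<open>0\<close> is not a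
  Dirichlet eigenvalue).\<close>

definition DN_graph ::
  "('a::euclidean_space \<Rightarrow> real) \<Rightarrow> ('a \<Rightarrow> real) \<Rightarrow> ('a \<Rightarrow> real) \<Rightarrow> bool" where
  "DN_graph V f g \<longleftrightarrow> (\<exists>u. schroedinger_solution V u \<and>
     (\<forall>w\<in>sphere 0 1. u w = f w \<and>
        ((\<lambda>t. u (t *\<^sub>R w)) has_real_derivative g w) (at 1 within {0<..1})))"

definition DN_eigenvalue :: "('a::euclidean_space \<Rightarrow> real) \<Rightarrow> nat \<Rightarrow> real" where
  "DN_eigenvalue V k =
     (THE l. \<forall>Y. spherical_harmonic k Y \<longrightarrow> DN_graph V Y (\<lambda>w. l * Y w))"

text \<open>
  The eigenvalue of the Dirichlet-to-Neumann map has precedence. The two prescriptions differ only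
  for \<open>d = 2\<close>, \<open>k = 0\<close>, where the weighted \<open>L\<^sup>2\<close> condition excludes the regular solution.
\<close>

definition lambda :: "('a::euclidean_space \<Rightarrow> real) \<Rightarrow> nat \<Rightarrow> real" where
  "lambda V k =
     (if \<not> zero_dirichlet_eigenvalue V then DN_eigenvalue V k
      else if \<exists>!b. radial_solution V k b
           then vector_derivative (THE b. radial_solution V k b) (at 1 within {0<..1})
           else real k)"


section \<open>The Born approximation\<close>

text \<open>Surface measure of the unit sphere: \<open>|S\<^bsup>d-1\<^esup>| = d |B\<^sup>d|\<close>.\<close>

definition sphere_area :: "'a::euclidean_space itself \<Rightarrow> real" where
  "sphere_area _ = real DIM('a) * measure lborel (ball (0::'a) 1)"

text \<open>
  The representative is continuous on the punctured ball. It is extended by zero outside the unit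
  ball and, so as to be a single function, is given the value zero at the origin.
\<close>

definition is_born :: "('a::euclidean_space \<Rightarrow> real) \<Rightarrow> ('a \<Rightarrow> real) \<Rightarrow> bool" where
  "is_born V f \<longleftrightarrow>
     (\<forall>x y. norm x = norm y \<longrightarrow> f x = f y) \<and>
     continuous_on (ball 0 1 - {0}) f \<and>
     (\<forall>x. x \<notin> ball 0 1 - {0} \<longrightarrow> f x = 0) \<and>
     (\<exists>s>0. set_integrable lborel (ball 0 1) (\<lambda>x. f x * norm x powr (2 * s))) \<and>
     (\<forall>\<^sub>F k in sequentially.
        1 / sphere_area TYPE('a) * (LINT x:ball 0 1|lborel. f x * norm x ^ (2 * k))
          = lambda V k - real k)"

definition born :: "('a::euclidean_space \<Rightarrow> real) \<Rightarrow> 'a \<Rightarrow> real" where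
  "born V = (THE f. is_born V f)"

definition scaled :: "('a::euclidean_space \<Rightarrow> real) \<Rightarrow> real \<Rightarrow> 'a \<Rightarrow> real" where
  "scaled V s x = s\<^sup>2 * V (s *\<^sub>R x)"


section \<open>Compactly supported distributions\<close>

text \<open>
  Compactly supported distributions are the continuous linear functionals on the Frechet space of
  smooth functions. Only the values of \<open>T\<close> on smooth functions matter.
\<close>

definition cs_distribution :: "(('a::euclidean_space \<Rightarrow> complex) \<Rightarrow> complex) \<Rightarrow> bool" where
  "cs_distribution T \<longleftrightarrow>
     (\<forall>f g. smooth f \<longrightarrow> smooth g \<longrightarrow> T (\<lambda>x. f x + g x) = T f + T g) \<and>
     (\<forall>c f. smooth f \<longrightarrow> T (\<lambda>x. c * f x) = c * T f) \<and>
     (\<exists>K m C. compact K \<and> K \<noteq> {} \<and>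
        (\<forall>f. smooth f \<longrightarrow>
           norm (T f) \<le> C * (\<Sum>is | set is \<subseteq> Basis \<and> length is \<le> m.
                                SUP x\<in>K. norm (iter_partial is f x))))"

definition dist_fourier :: "(('a::euclidean_space \<Rightarrow> complex) \<Rightarrow> complex) \<Rightarrow> 'a \<Rightarrow> complex" where
  "dist_fourier T \<xi> = T (\<lambda>x. exp (- \<i> * complex_of_real (\<xi> \<bullet> x)))"

text \<open>\<open>T\<close> restricted to the open set \<open>\<Omega>\<close> is the function \<open>h\<close>.\<close>

definition coincides_on ::
  "'a::euclidean_space set \<Rightarrow> (('a \<Rightarrow> complex) \<Rightarrow> complex) \<Rightarrow> ('a \<Rightarrow> real) \<Rightarrow> bool" where
  "coincides_on \<Omega> T h \<longleftrightarrow>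
     (\<forall>\<phi>. smooth \<phi> \<and> compact (closure {x. \<phi> x \<noteq> 0}) \<and> closure {x. \<phi> x \<noteq> 0} \<subseteq> \<Omega> \<longrightarrow>
        T \<phi> = (LINT x|lborel. complex_of_real (h x) * \<phi> x))"

definition is_born_distribution ::
  "('a::euclidean_space \<Rightarrow> real) \<Rightarrow> (('a \<Rightarrow> complex) \<Rightarrow> complex) \<Rightarrow> bool" where
  "is_born_distribution V T \<longleftrightarrow> cs_distribution T \<and>
     (\<forall>\<xi>. (\<lambda>k. complex_of_real
              (2 * pi powr (real DIM('a) / 2) *
               ((-1) ^ k / (fact k * Gamma (real k + real DIM('a) / 2))
                 * (norm \<xi> / 2) ^ (2 * k) * (lambda V k - real k))))
            sums dist_fourier T \<xi>)"


section \<open>The evolution problem\<close>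

definition born_flow :: "('a::euclidean_space \<Rightarrow> real) \<Rightarrow> (real \<Rightarrow> real \<Rightarrow> real) \<Rightarrow> bool" where
  "born_flow V W \<longleftrightarrow>
     C1_on ({0<..1} \<times> {0<..1}) (\<lambda>(r, s). W r s) \<and>
     (\<forall>r\<in>{0<..<1}. \<forall>s\<in>{0<..<1}.
        r * deriv (\<lambda>\<rho>. W \<rho> s) r - s * deriv (\<lambda>\<sigma>. W r \<sigma>) s
          = s\<^sup>2 * integral {r..1} (\<lambda>\<nu>. W (r / \<nu>) s * W \<nu> s / \<nu>)) \<and>
     (\<forall>x\<in>ball 0 1 - {0}. W (norm x) 1 = born V x)"

end

(*
  In the logarithmic variables r = exp (-a), s = exp (-x) the evolution equation reads
  dF/da = dF/dx - exp (-2x) (F * F), where * is convolution in a on [0, a]. Integrated along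
  characteristics, with data F(0, x) = q (exp (-x)), it becomes a fixed point equation that is
  contractive in the weighted norm sup |F| (1 + |a|)^2 exp (-p |a|) for large p. The Laplace
  transform in a turns it into the Riccati equation s G' = q - (2k + d) G - s^2 G^2, and
  u = |x|^k c(|x|) Y_k with c' = s G c, c(1) = 1, then solves the radial Schroedinger equation;
  hence lambda_k[V] - k = G(1) is the k-th moment of W(|x|, 1), and the moments determine the
  Born approximation. Rescaling V gives the slices W(., s), and W(1, .) = q by the choice of data.
  Uniqueness of the flow is a Gronwall iteration on the compact sets r s >= p_0.

  For the Fourier representation one subtracts from the test function its Taylor polynomial at 0,
  pairs the rest with the Born approximation, and adds derivatives of the Dirac mass that restore
  the low moments. A compactly supported distribution is determined by its Fourier transform since
  convolution with powers of a trigonometric polynomial approximates test functions, together with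
  all derivatives, by finite sums of exponentials.
*)

theory Submission
  imports Defs "HOL-Probability.Probability"
begin

section \<open>The evolution equation in logarithmic coordinates\<close>

text \<open>Only the quadrant a, x >= 0 matters, yet the unknown lives on the whole plane: data and
  coefficient are reflected to the real line beforehand, so that the fixed point can be sought among
  continuous functions on a space without boundary. The x-derivative is carried as a second unknown,
  because differentiating the integrated equation in a also moves the characteristic and so calls
  for a derivative in x. Growth in a is controlled only up to an exponential. Hence the Laplace
  transform is available for large k alone, which is all that the definition of the Born
  approximation asks for. The restriction k >= 3 has another origin: the harmonic polynomial must
  vanish fast enough at 0 for its product with a radial factor, controlled only through its
  first-order equation, to be a classical C2 solution. One Riccati solution serves both
  prescriptions for lambda. The function u yields the Dirichlet-to-Neumann map, and r^k c(r) solves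
  the radial equation; that no second solution is admissible there is decided by a Wronskian
  together with the weighted L2 condition.\<close>

abbreviation cont2 :: "(real \<Rightarrow> real \<Rightarrow> real) \<Rightarrow> bool" where
  "cont2 F \<equiv> continuous_on UNIV (\<lambda>z. F (fst z) (snd z))"

lemma cont2_comp:
  "cont2 F \<Longrightarrow> continuous_on S f \<Longrightarrow> continuous_on S g \<Longrightarrow> continuous_on S (\<lambda>z. F (f z) (g z))"
  using continuous_on_compose2[of UNIV "\<lambda>z. F (fst z) (snd z)" S "\<lambda>z. (f z, g z)"]
  by (auto intro: continuous_on_Pair)

lemma continuous_comp_UNIV:
  "continuous_on UNIV k \<Longrightarrow> continuous_on S f \<Longrightarrow> continuous_on S (\<lambda>z. k (f z))"
  using continuous_on_compose2[of UNIV k S f] by auto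

lemma integral01_continuous:
  fixes f :: "real \<times> real \<Rightarrow> real \<Rightarrow> real"
  assumes "continuous_on UNIV (\<lambda>z. f (fst z) (snd z))"
  shows "continuous_on UNIV (\<lambda>x. integral {0..1} (f x))"
proof -
  have "continuous_on (UNIV \<times> cbox 0 (1::real)) (\<lambda>(x, t). f x t)"
    using continuous_on_subset[OF assms] by (auto simp: case_prod_unfold)
  from integral_continuous_on_param[OF this] show ?thesis by simp
qed

lemma integral01_deriv:
  fixes f :: "real \<Rightarrow> real \<Rightarrow> real"
  assumes "\<And>x t. ((\<lambda>x. f x t) has_real_derivative f' x t) (at x)" "cont2 f" "cont2 f'"
  shows "((\<lambda>x. integral {0..1} (f x)) has_real_derivative integral {0..1} (f' x)) (at x)"
proof -
  have "((\<lambda>x. integral (cbox 0 1) (f x)) has_field_derivative integral (cbox 0 1) (f' x)) (at x within UNIV)"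
  proof (rule leibniz_rule_field_derivative)
    show "continuous_on (UNIV \<times> cbox 0 1) (\<lambda>(x, t). f' x t)"
      using continuous_on_subset[OF assms(3)] by (auto simp: case_prod_unfold)
    show "f x integrable_on cbox 0 1" for x
      by (rule integrable_continuous) (intro cont2_comp[OF assms(2)] continuous_intros)
  qed (use assms in auto)
  thus ?thesis by simp
qed

text \<open>The convolution \<open>\<integral>\<^sub>0\<^sup>a F(b, y) G(a - b, y) db\<close> with \<open>b = a t\<close>, so that no case distinction on the sign of
  \<open>a\<close> is needed; \<open>Jop\<close> is its Duhamel integral along the characteristics \<open>x + a = const\<close>.\<close>

definition cv :: "(real \<Rightarrow> real \<Rightarrow> real) \<Rightarrow> (real \<Rightarrow> real \<Rightarrow> real) \<Rightarrow> real \<Rightarrow> real \<Rightarrow> real" where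
  "cv F G a y = integral {0..1} (\<lambda>t. a * (F (a * t) y * G (a * (1 - t)) y))"

definition Jop :: "(real \<Rightarrow> real) \<Rightarrow> (real \<Rightarrow> real \<Rightarrow> real) \<Rightarrow> (real \<Rightarrow> real \<Rightarrow> real) \<Rightarrow> real \<Rightarrow> real \<Rightarrow> real" where
  "Jop k F G a x = integral {0..1} (\<lambda>t. a * (k (x + a - a * t) * cv F G (a * t) (x + a - a * t)))"

section \<open>Regularity and bilinearity of the convolution and its Duhamel integral\<close>

lemma cv_cont:
  assumes "cont2 F" "cont2 G"
  shows "cont2 (cv F G)"
  unfolding cv_def
  by (rule integral01_continuous) (intro continuous_intros cont2_comp[OF assms(1)] cont2_comp[OF assms(2)])

lemma Jop_cont:
  assumes "cont2 F" "cont2 G" "continuous_on UNIV k"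
  shows "cont2 (Jop k F G)"
  unfolding Jop_def
  by (rule integral01_continuous)
     (intro continuous_intros cont2_comp[OF cv_cont[OF assms(1,2)]] continuous_comp_UNIV[OF assms(3)])

lemma cv_integrable:
  assumes "cont2 F" "cont2 G"
  shows "(\<lambda>t. a * (F (a * t) y * G (a * (1 - t)) y)) integrable_on {0..1}"
  by (rule integrable_continuous_interval)
     (intro continuous_intros cont2_comp[OF assms(1)] cont2_comp[OF assms(2)])

lemma Jop_integrable:
  assumes "cont2 F" "cont2 G" "continuous_on UNIV k"
  shows "(\<lambda>t. a * (k (x + a - a * t) * cv F G (a * t) (x + a - a * t))) integrable_on {0..1}"
  by (rule integrable_continuous_interval)
     (intro continuous_intros cont2_comp[OF cv_cont[OF assms(1,2)]] continuous_comp_UNIV[OF assms(3)])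

text \<open>Bilinearity in the form used for the contraction: each term on the right carries a
  difference in one slot, so that product bounds become Lipschitz bounds.\<close>

lemma cv_diff:
  assumes "cont2 F" "cont2 G" "cont2 F'" "cont2 G'"
  shows "cv F G a y - cv F' G' a y = cv (\<lambda>a x. F a x - F' a x) G a y + cv F' (\<lambda>a x. G a x - G' a x) a y"
proof -
  have c: "cont2 (\<lambda>a x. F a x - F' a x)" "cont2 (\<lambda>a x. G a x - G' a x)"
    by (intro continuous_intros assms)+
  show ?thesis unfolding cv_def
    by (subst integral_diff[symmetric], intro cv_integrable assms, intro cv_integrable assms,
        subst integral_add[symmetric], rule cv_integrable, (intro assms c)+, rule cv_integrable, (intro assms c)+)
       (simp add: algebra_simps)
qed

lemma Jop_diff:
  assumes "cont2 F" "cont2 G" "cont2 F'" "cont2 G'" "continuous_on UNIV k"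
  shows "Jop k F G a y - Jop k F' G' a y = Jop k (\<lambda>a x. F a x - F' a x) G a y + Jop k F' (\<lambda>a x. G a x - G' a x) a y"
proof -
  have c: "cont2 (\<lambda>a x. F a x - F' a x)" "cont2 (\<lambda>a x. G a x - G' a x)"
    by (intro continuous_intros assms)+
  have eq: "a * (r * cv F G b z) - a * (r * cv F' G' b z) =
     a * (r * cv (\<lambda>a x. F a x - F' a x) G b z) + a * (r * cv F' (\<lambda>a x. G a x - G' a x) b z)" for a r b z
    by (simp only: right_diff_distrib[symmetric] cv_diff[OF assms(1-4)] distrib_left)
  show ?thesis unfolding Jop_def
    by (subst integral_diff[symmetric], intro Jop_integrable assms, intro Jop_integrable assms,
        subst integral_add[symmetric], rule Jop_integrable, (intro assms c)+, rule Jop_integrable, (intro assms c)+)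
       (simp only: eq)
qed

lemma cv_dx:
  assumes "cont2 F" "cont2 G" "cont2 F1" "cont2 G1"
    and "\<And>a x. (F a has_real_derivative F1 a x) (at x)" "\<And>a x. (G a has_real_derivative G1 a x) (at x)"
  shows "(cv F G a has_real_derivative cv F1 G a y + cv F G1 a y) (at y)"
proof -
  have "((\<lambda>y. integral {0..1} (\<lambda>t. a * (F (a * t) y * G (a * (1 - t)) y))) has_real_derivative
     integral {0..1} (\<lambda>t. a * (F1 (a * t) y * G (a * (1 - t)) y) + a * (F (a * t) y * G1 (a * (1 - t)) y))) (at y)"
    by (rule integral01_deriv)
      (auto intro!: derivative_eq_intros assms(5,6) continuous_intros cont2_comp[OF assms(1)] cont2_comp[OF assms(2)] 
       cont2_comp[OF assms(3)] cont2_comp[OF assms(4)] simp: algebra_simps)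
  also have "integral {0..1} (\<lambda>t. a * (F1 (a * t) y * G (a * (1 - t)) y) + a * (F (a * t) y * G1 (a * (1 - t)) y))
     = cv F1 G a y + cv F G1 a y"
    unfolding cv_def by (rule integral_add) (intro cv_integrable assms)+
  finally show ?thesis by (simp add: cv_def[abs_def])
qed

text \<open>In the rescaled integral x enters only through the point \<open>x + a - a * t\<close> of
  the characteristic, once in the coefficient and once in each factor of the convolution; hence
  three terms and no boundary term.\<close>

lemma Jop_dx:
  assumes "cont2 F" "cont2 G" "cont2 F1" "cont2 G1"
    and "\<And>a x. (F a has_real_derivative F1 a x) (at x)" "\<And>a x. (G a has_real_derivative G1 a x) (at x)"
    and "\<And>x. (k has_real_derivative k1 x) (at x)" "continuous_on UNIV k" "continuous_on UNIV k1"
  shows "(Jop k F G a has_real_derivative Jop k1 F G a y + Jop k F1 G a y + Jop k F G1 a y) (at y)"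
proof -
  note cc = cv_cont[OF assms(1,2)] cv_cont[OF assms(3,2)] cv_cont[OF assms(1,4)]
  have K: "((\<lambda>x. k (x + c)) has_real_derivative k1 (x + c)) (at x)" for x c
    using DERIV_shift assms(7) by blast
  have C: "((\<lambda>x. cv F G b (x + c)) has_real_derivative cv F1 G b (x + c) + cv F G1 b (x + c)) (at x)" for x c b
    using DERIV_shift cv_dx[OF assms(1-6)] by blast
  have K': "((\<lambda>x. k (x + a - a * t)) has_real_derivative k1 (x + a - a * t)) (at x)" for x t
    using K[of "a - a * t" x] by (simp add: add_diff_eq)
  have C': "((\<lambda>x. cv F G b (x + a - a * t)) has_real_derivative cv F1 G b (x + a - a * t) + cv F G1 b (x + a - a * t)) (at x)" for x b t
    using C[of b "a - a * t" x] by (simp add: add_diff_eq)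
  have "((\<lambda>x. integral {0..1} (\<lambda>t. a * (k (x + a - a * t) * cv F G (a * t) (x + a - a * t)))) has_real_derivative
     integral {0..1} (\<lambda>t. a * (k1 (y + a - a * t) * cv F G (a * t) (y + a - a * t))
       + a * (k (y + a - a * t) * cv F1 G (a * t) (y + a - a * t)) + a * (k (y + a - a * t) * cv F G1 (a * t) (y + a - a * t)))) (at y)"
    by (rule integral01_deriv)
      (auto intro!: derivative_eq_intros K' C' continuous_intros cont2_comp[OF cc(1)] cont2_comp[OF cc(2)] 
       cont2_comp[OF cc(3)] continuous_comp_UNIV[OF assms(8)] continuous_comp_UNIV[OF assms(9)], simp add: algebra_simps)
  also have "integral {0..1} (\<lambda>t. a * (k1 (y + a - a * t) * cv F G (a * t) (y + a - a * t))
       + a * (k (y + a - a * t) * cv F1 G (a * t) (y + a - a * t)) + a * (k (y + a - a * t) * cv F G1 (a * t) (y + a - a * t)))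
     = Jop k1 F G a y + Jop k F1 G a y + Jop k F G1 a y"
    unfolding Jop_def
    by (subst integral_add integral_add, intro integrable_add Jop_integrable assms, intro Jop_integrable assms)
       (subst integral_add, (intro Jop_integrable assms)+, simp)
  finally show ?thesis by (simp add: Jop_def[abs_def])
qed

text \<open>The factor \<open>(1 + |a|)\<^sup>-\<^sup>2\<close> makes the weight stable under convolution up to a constant that does
  not depend on \<open>p\<close>; the Duhamel integral then gains a factor of order \<open>1 / p\<close>.\<close>

definition om :: "real \<Rightarrow> real \<Rightarrow> real" where
  "om p a = exp (p * \<bar>a\<bar>) / (1 + \<bar>a\<bar>)\<^sup>2"

lemma om_pos: "om p a > 0"
  by (simp add: om_def add_nonneg_pos)

lemma om_le_exp: "om p a \<le> exp (p * \<bar>a\<bar>)"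
proof -
  have "1 \<le> (1 + \<bar>a\<bar>)\<^sup>2" by simp
  thus ?thesis by (simp add: om_def divide_le_eq mult_le_cancel_left1 add_nonneg_pos)
qed

text \<open>The denominator is absorbed by the square of \<open>1 + |a| <= exp |a|\<close>, which
  costs 2 in the exponent. This allows bounded data to be measured in the weighted norm.\<close>

lemma om_ge_1: assumes "p \<ge> 2" shows "om p a \<ge> 1"
proof -
  have "(1 + \<bar>a\<bar>)\<^sup>2 \<le> (exp \<bar>a\<bar>)\<^sup>2"
    by (intro power_mono exp_ge_add_one_self) auto
  also have "\<dots> = exp (2 * \<bar>a\<bar>)" by (simp flip: exp_double)
  also have "\<dots> \<le> exp (p * \<bar>a\<bar>)" using assms by (simp add: mult_right_mono)
  finally show ?thesis by (simp add: om_def le_divide_eq add_nonneg_pos)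
qed

lemma om_continuous: "continuous_on S f \<Longrightarrow> continuous_on S (\<lambda>z. om p (f z))"
  unfolding om_def by (intro continuous_intros) (auto simp: add_nonneg_eq_0_iff)

text \<open>The arguments add up to g, so the exponentials multiply exactly to
  \<open>exp (p * g)\<close>. For the denominators, partial fractions give
  \<open>1 / (u * v) = (1 / u + 1 / v) / (u + v)\<close> with \<open>u + v = 2 + g\<close>; the
  factor 2 is the one in \<open>(x + y)^2 <= 2 * (x^2 + y^2)\<close>.\<close>

lemma om_conv_pointwise:
  assumes "0 \<le> t" "t \<le> 1" "g \<ge> 0"
  shows "om p (g * t) * om p (g * (1 - t)) \<le>
    2 * om p g * (1 / (1 + g * t)\<^sup>2 + 1 / (1 + g * (1 - t))\<^sup>2)"
proof -
  define u v where "u = 1 + g * t" and "v = 1 + g * (1 - t)"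
  have uv: "u \<ge> 1" "v \<ge> 1" using assms by (auto simp: u_def v_def)
  have "om p (g * t) * om p (g * (1 - t)) = exp (p * g) * (1 / (u * v))\<^sup>2"
  proof -
    have a: "\<bar>g * t\<bar> = g * t" "\<bar>g * (1 - t)\<bar> = g * (1 - t)" using assms by auto
    have "exp (p * (g * t)) * exp (p * (g * (1 - t))) = exp (p * g)"
      by (simp add: algebra_simps flip: exp_add)
    thus ?thesis unfolding om_def a by (simp add: u_def v_def power_divide power_mult_distrib)
  qed
  also have "1 / (u * v) = (1 / u + 1 / v) / (2 + g)"
  proof -
    have "u + v = 2 + g" by (simp add: u_def v_def algebra_simps)
    thus ?thesis using uv assms by (simp add: add_divide_distrib[symmetric] divide_simps) 
  qed
  also have "((1 / u + 1 / v) / (2 + g))\<^sup>2 \<le> (2 * ((1 / u)\<^sup>2 + (1 / v)\<^sup>2)) / (1 + g)\<^sup>2"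
    unfolding power_divide
  proof (rule frac_le)
    show "(1 / u + 1 / v)\<^sup>2 \<le> 2 * (1\<^sup>2 / u\<^sup>2 + 1\<^sup>2 / v\<^sup>2)"
      using sum_squares_bound[of "1/u" "1/v"] by (simp add: power2_sum power_divide)
    show "(1 + g)\<^sup>2 \<le> (2 + g)\<^sup>2" using assms by (intro power_mono) auto
  qed (use assms in \<open>auto\<close>)
  also have "exp (p * g) * ((2 * ((1 / u)\<^sup>2 + (1 / v)\<^sup>2)) / (1 + g)\<^sup>2) = 
    2 * om p g * (1 / (1 + g * t)\<^sup>2 + 1 / (1 + g * (1 - t))\<^sup>2)"
    using assms by (simp add: om_def u_def v_def power_divide)
  finally show ?thesis by simp
qed

text \<open>Both masses stay below 1 for every length g. This integrability of the inverse square is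
  the reason for the polynomial factor in the weight.\<close>

lemma inv_sq_integral:
  fixes g :: real
  assumes "g \<ge> 0"
  shows "((\<lambda>t. g * (1 / (1 + g * t)\<^sup>2)) has_integral (1 - 1 / (1 + g))) {0..1}"
    and "((\<lambda>t. g * (1 / (1 + g * (1 - t))\<^sup>2)) has_integral (1 - 1 / (1 + g))) {0..1}"
proof -
  have p: "1 + g * t > 0" if "t \<ge> 0" for t :: real using assms that by (intro add_pos_nonneg) auto
  have d1: "((\<lambda>t. - (1 / (1 + g * t))) has_real_derivative g * (1 / (1 + g * t)\<^sup>2)) (at t within S)" if "t \<ge> 0" for t S
    using p[OF that] by (auto intro!: derivative_eq_intros simp: power2_eq_square)
  have d2: "((\<lambda>t. 1 / (1 + g * (1 - t))) has_real_derivative g * (1 / (1 + g * (1 - t))\<^sup>2)) (at t within S)" if "t \<le> 1" for t S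
    using p[of "1 - t"] that by (auto intro!: derivative_eq_intros simp: power2_eq_square)
  have "((\<lambda>t. g * (1 / (1 + g * t)\<^sup>2)) has_integral (- (1 / (1 + g * 1)) - (- (1 / (1 + g * 0))))) {0..1}"
    by (rule fundamental_theorem_of_calculus)
       (auto intro!: d1[simplified] simp flip: has_real_derivative_iff_has_vector_derivative)
  thus "((\<lambda>t. g * (1 / (1 + g * t)\<^sup>2)) has_integral (1 - 1 / (1 + g))) {0..1}" by (simp add: algebra_simps)
  have "((\<lambda>t. g * (1 / (1 + g * (1 - t))\<^sup>2)) has_integral (1 / (1 + g * (1 - 1)) - (1 / (1 + g * (1 - 0))))) {0..1}"
    by (rule fundamental_theorem_of_calculus)
       (auto intro!: d2[simplified] simp flip: has_real_derivative_iff_has_vector_derivative)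
  thus "((\<lambda>t. g * (1 / (1 + g * (1 - t))\<^sup>2)) has_integral (1 - 1 / (1 + g))) {0..1}" by simp
qed

lemma cv_bound:
  assumes "cont2 F" "cont2 G" and F: "\<And>a x. \<bar>F a x\<bar> \<le> A * om p a" and G: "\<And>a x. \<bar>G a x\<bar> \<le> B * om p a"
  shows "\<bar>cv F G a y\<bar> \<le> 4 * A * B * om p a"
proof -
  define g where "g = \<bar>a\<bar>"
  have om_abs: "om p (a * t) = om p (g * \<bar>t\<bar>)" for t by (simp add: om_def g_def abs_mult)
  have AB: "A \<ge> 0" "B \<ge> 0" using F[of 0 0] G[of 0 0] by (auto simp: om_def)
  define H where "H t = A * B * (2 * om p g) * (g * (1 / (1 + g * t)\<^sup>2) + g * (1 / (1 + g * (1 - t))\<^sup>2))" for t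
  have H: "(H has_integral A * B * (2 * om p g) * ((1 - 1 / (1 + g)) + (1 - 1 / (1 + g)))) {0..1}"
    unfolding H_def by (intro has_integral_mult_right has_integral_add inv_sq_integral) (auto simp: g_def)
  have "norm (cv F G a y) \<le> integral {0..1} H" unfolding cv_def
  proof (rule integral_norm_bound_integral)
    fix t :: real assume t: "t \<in> {0..1}"
    have "norm (a * (F (a * t) y * G (a * (1 - t)) y)) = g * (\<bar>F (a * t) y\<bar> * \<bar>G (a * (1 - t)) y\<bar>)"
      by (simp add: abs_mult g_def)
    also have "\<dots> \<le> g * ((A * om p (a * t)) * (B * om p (a * (1 - t))))"
      by (intro mult_left_mono mult_mono F G) (auto simp: g_def AB om_pos less_imp_le)
    also have "\<dots> = A * B * g * (om p (g * t) * om p (g * (1 - t)))" using t by (simp add: om_abs)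
    also have "\<dots> \<le> A * B * g * (2 * om p g * (1 / (1 + g * t)\<^sup>2 + 1 / (1 + g * (1 - t))\<^sup>2))"
      using t AB by (intro mult_left_mono om_conv_pointwise) (auto simp: g_def)
    also have "\<dots> = H t" by (simp add: H_def algebra_simps)
    finally show "norm (a * (F (a * t) y * G (a * (1 - t)) y)) \<le> H t" .
  qed (use H cv_integrable[OF assms(1,2)] in \<open>auto simp: integrable_on_def\<close>)
  also have "integral {0..1} H = A * B * (2 * om p g) * ((1 - 1 / (1 + g)) + (1 - 1 / (1 + g)))"
    using H by (rule integral_unique)
  \<comment> \<open>Each of the two masses is at most 1, so the constant depends neither on a nor on
    p.\<close>
  also have "\<dots> \<le> A * B * (2 * om p g) * (1 + 1)"
    using AB by (intro mult_left_mono add_mono) (auto simp: g_def om_pos less_imp_le)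
  also have "\<dots> = 4 * A * B * om p a" by (simp add: om_def g_def)
  finally show ?thesis by simp
qed

text \<open>On the positive half line the derivative of the weight is \<open>p - 2 / (1 + x)\<close>
  times the weight, hence at least \<open>p - 2\<close> times the weight; integrating gives the
  gain.\<close>

lemma om_integral_bound:
  assumes "p > 2" "g \<ge> 0"
  shows "integral {0..1} (\<lambda>t. g * om p (g * t)) \<le> om p g / (p - 2)"
proof -
  define D where "D t = g * (p - 2 / (1 + g * t)) * om p (g * t)" for t
  have pos: "1 + g * t > 0" if "t \<ge> 0" for t using assms that by (intro add_pos_nonneg) auto
  have "(D has_integral (exp (p * (g * 1)) / (1 + (g * 1))\<^sup>2 - exp (p * (g * 0)) / (1 + (g * 0))\<^sup>2)) {0..1}"
  proof (rule fundamental_theorem_of_calculus)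
    fix t :: real assume t: "t \<in> {0..1}"
    define w where "w = 1 + g * t"
    have "w > 0" using pos t by (simp add: w_def)
    hence "((\<lambda>t. exp (p * (g * t)) / (1 + (g * t))\<^sup>2) has_real_derivative D t) (at t within {0..1})"
      using t assms pos[of t] unfolding D_def om_def
      by (auto intro!: derivative_eq_intros simp flip: w_def)
        (simp add: field_simps power2_eq_square power4_eq_xxxx flip: w_def)
    thus "((\<lambda>t. exp (p * (g * t)) / (1 + (g * t))\<^sup>2) has_vector_derivative D t) (at t within {0..1})"
      by (simp add: has_real_derivative_iff_has_vector_derivative)
  qed auto
  hence D: "(D has_integral (om p g - 1)) {0..1}" using assms by (simp add: om_def)
  have "(p - 2) * integral {0..1} (\<lambda>t. g * om p (g * t)) = integral {0..1} (\<lambda>t. (p - 2) * (g * om p (g * t)))"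
    by simp
  also have "\<dots> \<le> integral {0..1} D"
  proof (rule integral_le)
    show "(\<lambda>t. (p - 2) * (g * om p (g * t))) integrable_on {0..1}"
      by (rule integrable_continuous_interval) (intro continuous_intros om_continuous)
    show "D integrable_on {0..1}" using D by auto
    fix t :: real assume t: "t \<in> {0..1}"
    have "p - 2 \<le> p - 2 / (1 + g * t)"
      using t assms pos[of t] by (simp add: field_simps)
    hence "(p - 2) * (g * om p (g * t)) \<le> (p - 2 / (1 + g * t)) * (g * om p (g * t))"
      using assms om_pos[of p "g * t"] by (intro mult_right_mono) auto
    thus "(p - 2) * (g * om p (g * t)) \<le> D t" by (simp add: D_def algebra_simps)
  qed
  also have "\<dots> = om p g - 1" using D by (rule integral_unique)
  finally show ?thesis using assms by (simp add: field_simps)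
qed

text \<open>The 4 comes from the convolution and \<open>1 / (p - 2)\<close> from the integral along
  the characteristic. The second factor is the only small parameter of the fixed point
  argument.\<close>

lemma Jop_bound:
  assumes "cont2 F" "cont2 G" and F: "\<And>a x. \<bar>F a x\<bar> \<le> A * om p a" and G: "\<And>a x. \<bar>G a x\<bar> \<le> B * om p a"
    and k: "continuous_on UNIV k" "\<And>x. \<bar>k x\<bar> \<le> K" and p: "p > 2"
  shows "\<bar>Jop k F G a x\<bar> \<le> 4 * K * A * B / (p - 2) * om p a"
proof -
  define g where "g = \<bar>a\<bar>"
  have om_abs: "om p (a * t) = om p (g * \<bar>t\<bar>)" for t by (simp add: om_def g_def abs_mult)
  have AB: "A \<ge> 0" "B \<ge> 0" "K \<ge> 0" using F[of 0 0] G[of 0 0] k(2)[of 0] by (auto simp: om_def)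
  have "norm (Jop k F G a x) \<le> integral {0..1} (\<lambda>t. 4 * K * A * B * (g * om p (g * t)))" unfolding Jop_def
  proof (rule integral_norm_bound_integral)
    show "(\<lambda>t. a * (k (x + a - a * t) * cv F G (a * t) (x + a - a * t))) integrable_on {0..1}"
      by (rule Jop_integrable[OF assms(1,2) k(1)])
    show "(\<lambda>t. 4 * K * A * B * (g * om p (g * t))) integrable_on {0..1}"
      by (rule integrable_continuous_interval) (intro continuous_intros om_continuous)
    fix t :: real assume t: "t \<in> {0..1}"
    have "norm (a * (k (x + a - a * t) * cv F G (a * t) (x + a - a * t))) = 
      g * (\<bar>k (x + a - a * t)\<bar> * \<bar>cv F G (a * t) (x + a - a * t)\<bar>)"
      by (simp add: abs_mult g_def)
    also have "\<dots> \<le> g * (K * (4 * A * B * om p (a * t)))"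
      by (intro mult_left_mono mult_mono k cv_bound assms) (auto simp: g_def AB)
    also have "\<dots> = 4 * K * A * B * (g * om p (g * t))" using t by (simp add: om_abs)
    finally show "norm (a * (k (x + a - a * t) * cv F G (a * t) (x + a - a * t))) \<le> 4 * K * A * B * (g * om p (g * t))" .
  qed
  also have "\<dots> = 4 * K * A * B * integral {0..1} (\<lambda>t. g * om p (g * t))" by simp
  also have "\<dots> \<le> 4 * K * A * B * (om p g / (p - 2))"
    using AB p by (intro mult_left_mono om_integral_bound) (auto simp: g_def)
  also have "\<dots> = 4 * K * A * B / (p - 2) * om p a" by (simp add: om_def g_def)
  finally show ?thesis by simp
qed

section \<open>Total derivatives from partial ones, and rescaled primitives\<close>

text \<open>The hypotheses are asymmetric on purpose: continuity is asked of one partial derivative,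
  while the other has to exist at the given point only.\<close>

lemma has_derivative_of_partials:
  fixes f f1 f2 :: "real \<Rightarrow> real \<Rightarrow> real"
  assumes "((\<lambda>x. f x y) has_real_derivative f1 x y) (at x within X)"
    and "\<And>x y. x \<in> X \<Longrightarrow> y \<in> Y \<Longrightarrow> (f x has_real_derivative f2 x y) (at y within Y)"
    and "continuous_on (X \<times> Y) (\<lambda>z. f2 (fst z) (snd z))" "x \<in> X" "y \<in> Y" "convex Y"
  shows "((\<lambda>(x, y). f x y) has_derivative (\<lambda>(u, v). f1 x y * u + f2 x y * v)) (at (x, y) within X \<times> Y)"
proof -
  have "((\<lambda>(x, y). f x y) has_derivative (\<lambda>(u, v). f1 x y * u + blinfun_apply (blinfun_mult_right (f2 x y)) v))
     (at (x, y) within X \<times> Y)"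
  proof (rule has_derivative_partialsI)
    show "((\<lambda>x. f x y) has_derivative (\<lambda>u. f1 x y * u)) (at x within X)"
      using assms(1) by (simp add: has_field_derivative_def)
    show "(f x has_derivative blinfun_apply (blinfun_mult_right (f2 x y))) (at y within Y)"
      if "x \<in> X" "y \<in> Y" for x y
      using assms(2)[OF that] by (simp add: has_field_derivative_def blinfun_mult_right.rep_eq)
    have "continuous_on (X \<times> Y) (\<lambda>z. blinfun_mult_right (f2 (fst z) (snd z)))"
      by (intro bounded_linear.continuous_on[OF bounded_linear_blinfun_mult_right] assms)
    thus "continuous (at (x, y) within X \<times> Y) (\<lambda>(x, y). blinfun_mult_right (f2 x y))"
      using assms(4,5) by (auto simp: continuous_on_eq_continuous_within case_prod_unfold)
  qed (use assms in auto)
  thus ?thesis by (simp add: blinfun_mult_right.rep_eq)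
qed

text \<open>The rescaled integral is the primitive of g vanishing at 0, with the correct sign for
  negative u as well; for \<open>u >= 0\<close> it is the ordinary integral.\<close>

lemma scaled_integral_FTC:
  fixes g :: "real \<Rightarrow> real"
  assumes "continuous_on UNIV g"
  shows "((\<lambda>u. integral {0..1} (\<lambda>t. u * g (u * t))) has_real_derivative g u) (at u)"
    and "u \<ge> 0 \<Longrightarrow> integral {0..1} (\<lambda>t. u * g (u * t)) = integral {0..u} g"
proof -
  \<comment> \<open>A compact interval with u in its interior, since antiderivatives are taken on
    compact intervals.\<close>
  define N where "N = \<bar>u\<bar> + 1"
  obtain P where P: "\<And>x. x \<in> {-N..N} \<Longrightarrow> (P has_vector_derivative g x) (at x within {-N..N})"
    using antiderivative_continuous[OF continuous_on_subset[OF assms]] by blast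
  have eq: "integral {0..1} (\<lambda>t. v * g (v * t)) = P v - P 0" if v: "v \<in> {-N..N}" for v
  proof -
    have "((\<lambda>t. v * g (v * t)) has_integral (P (v * 1) - P (v * 0))) {0..1}"
    proof (rule fundamental_theorem_of_calculus)
      fix t :: real assume t: "t \<in> {0..1}"
      have "\<bar>v * t\<bar> \<le> \<bar>v\<bar> * 1" using t unfolding abs_mult by (intro mult_left_mono) auto
      hence vt: "v * t \<in> {-N..N}" if "t \<in> {0..1}" for t
        using v that abs_mult[of v t] mult_left_mono[of "\<bar>t\<bar>" 1 "\<bar>v\<bar>"] by auto
      have "(P has_real_derivative g (v * t)) (at (v * t) within (\<lambda>t. v * t) ` {0..1})"
        using P[OF vt[OF t]] vt
        by (auto simp: has_real_derivative_iff_has_vector_derivative intro: has_vector_derivative_within_subset)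
      from DERIV_image_chain[OF this, of v] have "(P \<circ> (\<lambda>t. v * t) has_real_derivative g (v * t) * v) (at t within {0..1})"
        by (auto intro!: derivative_eq_intros)
      thus "((\<lambda>t. P (v * t)) has_vector_derivative v * g (v * t)) (at t within {0..1})"
        by (simp add: has_real_derivative_iff_has_vector_derivative o_def mult.commute)
    qed auto
    from integral_unique[OF this] show ?thesis by (simp only: mult_1_right mult_zero_right)
  qed
  have uN: "u > - N" "u < N" unfolding N_def by linarith+
  hence "(P has_real_derivative g u) (at u)"
    using P[of u] by (simp add: has_real_derivative_iff_has_vector_derivative at_within_Icc_at)
  hence "((\<lambda>v. P v - P 0) has_real_derivative g u) (at u)" by (auto intro!: derivative_eq_intros)
  moreover have ev: "\<forall>\<^sub>F v in nhds u. integral {0..1} (\<lambda>t. v * g (v * t)) = P v - P 0"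
  proof -
    have "\<forall>\<^sub>F v in nhds u. v \<in> {-N<..<N}" by (rule eventually_nhds_in_open) (use uN in auto)
    thus ?thesis by (rule eventually_mono) (rule eq, simp)
  qed
  ultimately show "((\<lambda>u. integral {0..1} (\<lambda>t. u * g (u * t))) has_real_derivative g u) (at u)"
    using DERIV_cong_ev[OF refl ev refl] by blast
  show "integral {0..1} (\<lambda>t. u * g (u * t)) = integral {0..u} g" if "u \<ge> 0"
  proof -
    have "(g has_integral (P u - P 0)) {0..u}"
      using that by (intro fundamental_theorem_of_calculus has_vector_derivative_within_subset[OF P])
         (auto simp: N_def)
    moreover have "u \<in> {-N..N}" using uN by simp
    ultimately show ?thesis using eq by (simp add: integral_unique)
  qed
qed

section \<open>The weighted Banach space and the fixed point\<close>

text \<open>Multiplication by the weight identifies bounded continuous functions under the sup norm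
  with functions under the weighted norm; completeness is inherited through this
  identification.\<close>

definition up :: "real \<Rightarrow> ((real \<times> real) \<Rightarrow>\<^sub>C real) \<Rightarrow> real \<Rightarrow> real \<Rightarrow> real" where
  "up p f a x = om p a * apply_bcontfun f (a, x)"

text \<open>The inverse of \<open>up\<close>. \<open>Bcontfun\<close> is meaningful only on bounded
  continuous functions, so every use comes with a weighted bound.\<close>

definition dn :: "real \<Rightarrow> (real \<Rightarrow> real \<Rightarrow> real) \<Rightarrow> ((real \<times> real) \<Rightarrow>\<^sub>C real)" where
  "dn p H = Bcontfun (\<lambda>z. H (fst z) (snd z) / om p (fst z))"

lemma up_cont: "cont2 (up p f)"
  unfolding up_def by (intro continuous_intros om_continuous) simp

lemma up_bound: "\<bar>up p f a x\<bar> \<le> norm f * om p a"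
  using norm_bounded[of f "(a, x)"] om_pos[of p a] by (simp add: up_def abs_mult mult.commute mult_right_mono)

lemma up_diff: "up p f a x - up p g a x = up p (f - g) a x"
  by (simp add: up_def algebra_simps)

lemma dn_apply:
  assumes "cont2 H" "\<And>a x. \<bar>H a x\<bar> \<le> C * om p a"
  shows "apply_bcontfun (dn p H) z = H (fst z) (snd z) / om p (fst z)"
proof -
  have "(\<lambda>z. H (fst z) (snd z) / om p (fst z)) \<in> bcontfun"
    using assms(2) om_pos[of p]
    by (intro bcontfun_normI[of _ C] continuous_intros assms(1) om_continuous)
       (auto simp: divide_le_eq less_imp_neq[symmetric] order_less_imp_le)
  thus ?thesis by (simp add: dn_def Bcontfun_inverse)
qed

lemma dn_norm:
  assumes "cont2 H" "\<And>a x. \<bar>H a x\<bar> \<le> C * om p a"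
  shows "norm (dn p H) \<le> C"
  using assms(2) om_pos[of p]
  by (intro norm_bound) (auto simp: dn_apply[OF assms] divide_le_eq order_less_imp_le)

lemma dn_dist:
  assumes "cont2 H" "\<And>a x. \<bar>H a x\<bar> \<le> C * om p a" "cont2 H'" "\<And>a x. \<bar>H' a x\<bar> \<le> C' * om p a"
    and "\<And>a x. \<bar>H a x - H' a x\<bar> \<le> D * om p a"
  shows "dist (dn p H) (dn p H') \<le> D"
  using assms(5) om_pos[of p]
  by (intro dist_bound)
     (auto simp: dn_apply[OF assms(1,2)] dn_apply[OF assms(3,4)] dist_real_def divide_le_eq
        order_less_imp_le simp flip: diff_divide_distrib)

text \<open>h is the initial value at a = 0 and e the coefficient of the convolution, both already
  extended to the line. Their derivatives are bounded as well because the fixed point tracks the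
  x-derivative.\<close>

locale evolution_data =
  fixes h h1 e e1 :: "real \<Rightarrow> real" and M :: real
  assumes h_deriv: "\<And>t. (h has_real_derivative h1 t) (at t)" and h1_cont: "continuous_on UNIV h1"
    and e_deriv: "\<And>t. (e has_real_derivative e1 t) (at t)" and e1_cont: "continuous_on UNIV e1"
    and h_bound: "\<And>t. \<bar>h t\<bar> \<le> M" and h1_bound: "\<And>t. \<bar>h1 t\<bar> \<le> M"
    and e_bound: "\<And>t. \<bar>e t\<bar> \<le> M" and e1_bound: "\<And>t. \<bar>e1 t\<bar> \<le> M" and M_pos: "M > 0"
begin

text \<open>The value for which \<open>4 * M * (2 * M) / (p - 2) = 1 / 16\<close>: on the ball of
  radius \<open>2 * M\<close> each slot of a Duhamel term then has Lipschitz constant 1/16.\<close>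

definition p :: real where "p = 2 + 128 * M\<^sup>2"

lemma p_gt_2: "p > 2" using M_pos by (simp add: p_def)

lemma h_cont: "continuous_on UNIV h" and e_cont: "continuous_on UNIV e"
  using h_deriv e_deriv by (auto intro!: continuous_at_imp_continuous_on DERIV_isCont)

text \<open>R0 is the right side of the equation integrated along characteristics. R1 is its formal
  derivative in x, with F1 treated as an independent unknown.\<close>

definition R0 where "R0 F a x = h (x + a) - Jop e F F a x"
definition R1 where "R1 F F1 a x = h1 (x + a) - Jop e1 F F a x - Jop e F1 F a x - Jop e F F1 a x"

lemma R0_cont: "cont2 F \<Longrightarrow> cont2 (R0 F)"
  unfolding R0_def by (intro continuous_intros Jop_cont e_cont continuous_comp_UNIV[OF h_cont])

lemma R1_cont: "cont2 F \<Longrightarrow> cont2 F1 \<Longrightarrow> cont2 (R1 F F1)"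
  unfolding R1_def by (intro continuous_intros Jop_cont e_cont e1_cont continuous_comp_UNIV[OF h1_cont])

lemma M_om: "M \<le> M * om p a"
  using om_ge_1[of p a] p_gt_2 M_pos by simp

lemma R0_bound:
  assumes "cont2 F" "\<And>a x. \<bar>F a x\<bar> \<le> A * om p a"
  shows "\<bar>R0 F a x\<bar> \<le> (M + 4 * M * A * A / (p - 2)) * om p a"
  using Jop_bound[OF assms(1,1) assms(2) assms(2) e_cont e_bound p_gt_2, of a x] h_bound[of "x + a"] M_om[of a]
  unfolding R0_def by (simp add: distrib_right)

lemma R1_bound:
  assumes "cont2 F" "cont2 F1" "\<And>a x. \<bar>F a x\<bar> \<le> A * om p a" "\<And>a x. \<bar>F1 a x\<bar> \<le> B * om p a"
  shows "\<bar>R1 F F1 a x\<bar> \<le> (M + 4 * M * A * A / (p - 2) + 2 * (4 * M * A * B / (p - 2))) * om p a"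
  using Jop_bound[OF assms(1,1) assms(3) assms(3) e1_cont e1_bound p_gt_2, of a x] h1_bound[of "x + a"] M_om[of a]
    Jop_bound[OF assms(1,2) assms(3) assms(4) e_cont e_bound p_gt_2, of a x]
    Jop_bound[OF assms(2,1) assms(4) assms(3) e_cont e_bound p_gt_2, of a x]
    mult.commute[of A B]
  unfolding R1_def distrib_right by (simp only: mult.assoc)

definition step :: "((real \<times> real) \<Rightarrow>\<^sub>C real) \<times> ((real \<times> real) \<Rightarrow>\<^sub>C real) \<Rightarrow> ((real \<times> real) \<Rightarrow>\<^sub>C real) \<times> ((real \<times> real) \<Rightarrow>\<^sub>C real)" where
  "step z = (dn p (R0 (up p (fst z))), dn p (R1 (up p (fst z)) (up p (snd z))))"

text \<open>Pairs of a function and its x-derivative, in the weighted norm: convergence is then C1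
  convergence in x, and the link between the components survives uniform limits. The weight depends
  on a only, so it commutes with differentiation in x.\<close>

definition S :: "(((real \<times> real) \<Rightarrow>\<^sub>C real) \<times> ((real \<times> real) \<Rightarrow>\<^sub>C real)) set" where
  "S = {z. norm (fst z) \<le> 2 * M \<and> norm (snd z) \<le> 2 * M \<and>
   (\<forall>a x. ((\<lambda>x. apply_bcontfun (fst z) (a, x)) has_real_derivative apply_bcontfun (snd z) (a, x)) (at x))}"

lemma S_up: assumes "z \<in> S"
  shows "\<bar>up p (fst z) a x\<bar> \<le> 2 * M * om p a" "\<bar>up p (snd z) a x\<bar> \<le> 2 * M * om p a"
    "(up p (fst z) a has_real_derivative up p (snd z) a x) (at x)"
proof -
  show "\<bar>up p (fst z) a x\<bar> \<le> 2 * M * om p a" "\<bar>up p (snd z) a x\<bar> \<le> 2 * M * om p a"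
    using assms up_bound[of p "fst z" a x] up_bound[of p "snd z" a x] om_pos[of p a]
    by (auto simp: S_def intro: order_trans mult_right_mono)
  show "(up p (fst z) a has_real_derivative up p (snd z) a x) (at x)"
    using assms unfolding up_def[abs_def] S_def by (auto intro!: DERIV_cmult)
qed

lemma R0_deriv:
  assumes "cont2 F" "cont2 F1" "\<And>a x. (F a has_real_derivative F1 a x) (at x)"
  shows "(R0 F a has_real_derivative R1 F F1 a x) (at x)"
proof -
  have "((\<lambda>x. h (x + a) - Jop e F F a x) has_real_derivative h1 (x + a) - (Jop e1 F F a x + Jop e F1 F a x + Jop e F F1 a x)) (at x)"
    using DERIV_shift h_deriv 
    by (intro DERIV_diff Jop_dx assms e_deriv e_cont e1_cont) blast
  thus ?thesis by (simp add: R0_def[abs_def] R1_def algebra_simps)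
qed

text \<open>The first estimate keeps the ball of radius \<open>2 * M\<close> invariant: R1 is the
  data, at most M, and three Duhamel terms of at most M/3 each. The second is the Lipschitz constant
  of one slot.\<close>

lemma bound_arith:
  "4 * M * (2 * M) * (2 * M) / (p - 2) \<le> M / 3" "4 * M * (2 * M) / (p - 2) = 1 / 16"
  using M_pos by (simp_all add: p_def field_simps power2_eq_square)

lemma step_mem: assumes "z \<in> S" shows "step z \<in> S"
proof -
  note u = S_up[OF assms]
  have b0: "\<bar>R0 (up p (fst z)) a x\<bar> \<le> 2 * M * om p a" for a x
    using R0_bound[OF up_cont u(1), of a x] bound_arith(1) om_pos[of p a] M_pos
    by (elim order_trans) (intro mult_right_mono, auto)
  have b1: "\<bar>R1 (up p (fst z)) (up p (snd z)) a x\<bar> \<le> 2 * M * om p a" for a x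
    using R1_bound[OF up_cont up_cont u(1) u(2), of a x] bound_arith(1) om_pos[of p a] M_pos
    by (elim order_trans) (intro mult_right_mono, auto)
  note c = R0_cont[OF up_cont, of p "fst z"] R1_cont[OF up_cont up_cont, of p "fst z" p "snd z"]
  have "((\<lambda>x. R0 (up p (fst z)) a x / om p a) has_real_derivative R1 (up p (fst z)) (up p (snd z)) a x / om p a) (at x)" for a x
    by (intro DERIV_cdivide R0_deriv up_cont u)
  thus ?thesis unfolding S_def step_def
    using dn_norm[OF c(1) b0] dn_norm[OF c(2) b1]
    by (simp add: dn_apply[OF c(1) b0] dn_apply[OF c(2) b1])
qed

lemma abs_add_le_scaled:
  "\<bar>a\<bar> \<le> c * w \<Longrightarrow> \<bar>b\<bar> \<le> d * w \<Longrightarrow> \<bar>a + b\<bar> \<le> (c + d) * (w::real)"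
  unfolding distrib_right by linarith

text \<open>Every Duhamel difference splits into two terms with constant 1/16. With d0 and d1 the
  distances of the components, R0 contributes \<open>d0 / 8\<close> and R1 contributes
  \<open>d0 / 4 + d1 / 8\<close>, altogether at most half of the distance in the product.\<close>

lemma step_contraction:
  assumes z: "z \<in> S" and w: "w \<in> S"
  shows "dist (step z) (step w) \<le> 1 / 2 * dist z w"
proof -
  note uz = S_up[OF z] and uw = S_up[OF w]
  define F F1 G G1 where "F = up p (fst z)" and "F1 = up p (snd z)" and "G = up p (fst w)" and "G1 = up p (snd w)"
  note defs = F_def F1_def G_def G1_def
  define d0 d1 where "d0 = norm (fst z - fst w)" and "d1 = norm (snd z - snd w)"
  have cont: "cont2 F" "cont2 F1" "cont2 G" "cont2 G1" unfolding defs by (rule up_cont)+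
  have bd: "\<And>a x. \<bar>F a x\<bar> \<le> 2 * M * om p a" "\<And>a x. \<bar>F1 a x\<bar> \<le> 2 * M * om p a" 
    "\<And>a x. \<bar>G a x\<bar> \<le> 2 * M * om p a" "\<And>a x. \<bar>G1 a x\<bar> \<le> 2 * M * om p a"
    unfolding defs using uz uw by auto
  define E E1 where "E = (\<lambda>a x. F a x - G a x)" and "E1 = (\<lambda>a x. F1 a x - G1 a x)"
  have E: "cont2 E" "cont2 E1" unfolding E_def E1_def by (intro continuous_intros cont)+
  have Eb: "\<And>a x. \<bar>E a x\<bar> \<le> d0 * om p a" "\<And>a x. \<bar>E1 a x\<bar> \<le> d1 * om p a"
    unfolding E_def E1_def defs up_diff d0_def d1_def by (rule up_bound)+
  have JE: "\<bar>Jop k X Y a x\<bar> \<le> D / 16 * om p a"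
    if "continuous_on UNIV k" "\<And>x. \<bar>k x\<bar> \<le> M" "cont2 X" "cont2 Y"
      "\<And>a x. \<bar>X a x\<bar> \<le> D * om p a" "\<And>a x. \<bar>Y a x\<bar> \<le> 2 * M * om p a" for k X Y D a x
  proof -
    have "4 * M * D * (2 * M) / (p - 2) = D * (4 * M * (2 * M) / (p - 2))" by simp
    also have "\<dots> = D / 16" by (simp only: bound_arith(2))
    finally have eq: "4 * M * D * (2 * M) / (p - 2) = D / 16" .
    show ?thesis using Jop_bound[OF that(3,4,5,6) that(1,2) p_gt_2, of a x] unfolding eq .
  qed
  have JE': "\<bar>Jop k Y X a x\<bar> \<le> D / 16 * om p a"
    if "continuous_on UNIV k" "\<And>x. \<bar>k x\<bar> \<le> M" "cont2 X" "cont2 Y"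
      "\<And>a x. \<bar>X a x\<bar> \<le> D * om p a" "\<And>a x. \<bar>Y a x\<bar> \<le> 2 * M * om p a" for k X Y D a x
  proof -
    have "4 * M * (2 * M) * D / (p - 2) = D * (4 * M * (2 * M) / (p - 2))" by simp
    also have "\<dots> = D / 16" by (simp only: bound_arith(2))
    finally have eq: "4 * M * (2 * M) * D / (p - 2) = D / 16" .
    show ?thesis using Jop_bound[OF that(4,3,6,5) that(1,2) p_gt_2, of a x] unfolding eq .
  qed
  have J: "\<bar>Jop k F F a x - Jop k G G a x\<bar> \<le> d0 / 8 * om p a"
    if k: "continuous_on UNIV k" "\<And>x. \<bar>k x\<bar> \<le> M" for k a x
    unfolding Jop_diff[OF cont(1,1,3,3) k(1)] E_def[symmetric]
    using abs_add_le_scaled[OF JE[OF k E(1) cont(1) Eb(1) bd(1)] JE'[OF k E(1) cont(3) Eb(1) bd(3)]] by simp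
  have J1: "\<bar>Jop e F1 F a x - Jop e G1 G a x\<bar> \<le> (d0 / 16 + d1 / 16) * om p a" for a x
    unfolding Jop_diff[OF cont(2,1,4,3) e_cont] E_def[symmetric] E1_def[symmetric]
    using abs_add_le_scaled[OF JE[OF e_cont e_bound E(2) cont(1) Eb(2) bd(1)] JE'[OF e_cont e_bound E(1) cont(4) Eb(1) bd(4)]]
    by (simp add: add.commute)
  have J2: "\<bar>Jop e F F1 a x - Jop e G G1 a x\<bar> \<le> (d0 / 16 + d1 / 16) * om p a" for a x
    unfolding Jop_diff[OF cont(1,2,3,4) e_cont] E_def[symmetric] E1_def[symmetric]
    using abs_add_le_scaled[OF JE[OF e_cont e_bound E(1) cont(2) Eb(1) bd(2)] JE'[OF e_cont e_bound E(2) cont(3) Eb(2) bd(3)]]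
    by simp
  have 1: "dist (dn p (R0 F)) (dn p (R0 G)) \<le> d0 / 8"
  proof (rule dn_dist[OF R0_cont[OF cont(1)] R0_bound[OF cont(1) bd(1)] R0_cont[OF cont(3)] R0_bound[OF cont(3) bd(3)]])
    show "\<bar>R0 F a x - R0 G a x\<bar> \<le> d0 / 8 * om p a" for a x
      using J[OF e_cont e_bound, of a x] by (simp add: R0_def abs_minus_commute)
  qed
  have 2: "dist (dn p (R1 F F1)) (dn p (R1 G G1)) \<le> d0 / 4 + d1 / 8"
  proof (rule dn_dist[OF R1_cont[OF cont(1,2)] R1_bound[OF cont(1,2) bd(1,2)] R1_cont[OF cont(3,4)] R1_bound[OF cont(3,4) bd(3,4)]])
    show "\<bar>R1 F F1 a x - R1 G G1 a x\<bar> \<le> (d0 / 4 + d1 / 8) * om p a" for a x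
    proof -
      have "\<bar>R1 F F1 a x - R1 G G1 a x\<bar> = \<bar>(Jop e1 F F a x - Jop e1 G G a x) +
          ((Jop e F1 F a x - Jop e G1 G a x) + (Jop e F F1 a x - Jop e G G1 a x))\<bar>"
        unfolding R1_def by linarith
      also have "\<dots> \<le> (d0 / 8 + ((d0 / 16 + d1 / 16) + (d0 / 16 + d1 / 16))) * om p a"
        by (intro abs_add_le_scaled J[OF e1_cont e1_bound] J1 J2)
      also have "\<dots> = (d0 / 4 + d1 / 8) * om p a" by simp
      finally show ?thesis .
    qed
  qed
  have d: "d0 \<le> dist z w" "d1 \<le> dist z w"
    unfolding d0_def d1_def dist_norm[symmetric] by (rule dist_fst_le dist_snd_le)+
  have "dist (step z) (step w) \<le> dist (fst (step z)) (fst (step w)) + dist (snd (step z)) (snd (step w))"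
    unfolding dist_prod_def by (rule sqrt_sum_squares_le_sum) auto
  also have "\<dots> \<le> d0 / 8 + (d0 / 4 + d1 / 8)"
    using 1 2 by (simp add: step_def defs)
  also have "\<dots> \<le> 1 / 2 * dist z w" using d by simp
  finally show ?thesis .
qed

text \<open>Differentiation passes to the limit because the derivative components converge uniformly
  and the functions converge pointwise.\<close>

lemma S_closed: "closed S"
  unfolding closed_sequential_limits
proof (intro allI impI, elim conjE)
  fix X l assume X: "\<forall>n. X n \<in> S" and lim: "X \<longlonglongrightarrow> l"
  have f: "(\<lambda>n. fst (X n)) \<longlonglongrightarrow> fst l" "(\<lambda>n. snd (X n)) \<longlonglongrightarrow> snd l"
    using lim by (auto intro: tendsto_fst tendsto_snd)
  have "norm (fst l) \<le> 2 * M" "norm (snd l) \<le> 2 * M"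
    by (rule LIMSEQ_le_const2[OF tendsto_norm[OF f(1)]] LIMSEQ_le_const2[OF tendsto_norm[OF f(2)]],
        use X in \<open>auto simp: S_def\<close>)+
  moreover have "((\<lambda>x. apply_bcontfun (fst l) (a, x)) has_real_derivative apply_bcontfun (snd l) (a, x)) (at x)" for a x
  proof -
    have pt: "(\<lambda>n. apply_bcontfun (fst (X n)) (a, y)) \<longlonglongrightarrow> apply_bcontfun (fst l) (a, y)" for y
      by (rule tendsto_uniform_limitI[OF tendsto_bcontfun_uniform_limit[OF f(1)]]) simp
    have "\<exists>g. \<forall>x\<in>UNIV. (\<lambda>n. apply_bcontfun (fst (X n)) (a, x)) \<longlonglongrightarrow> g x \<and>
        (g has_derivative (\<lambda>h. apply_bcontfun (snd l) (a, x) * h)) (at x within UNIV)"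
    proof (rule has_derivative_sequence[of UNIV _ "\<lambda>n x h. apply_bcontfun (snd (X n)) (a, x) * h"])
      show "((\<lambda>x. apply_bcontfun (fst (X n)) (a, x)) has_derivative (\<lambda>h. apply_bcontfun (snd (X n)) (a, x) * h)) (at x within UNIV)" for n x
        using X by (auto simp: S_def has_field_derivative_def)
      fix \<epsilon> :: real assume "\<epsilon> > 0"
      then have "\<forall>\<^sub>F n in sequentially. dist (snd (X n)) (snd l) < \<epsilon>" using f(2) by (rule tendstoD[rotated])
      thus "\<forall>\<^sub>F n in sequentially. \<forall>x\<in>UNIV. \<forall>h. norm (apply_bcontfun (snd (X n)) (a, x) * h - apply_bcontfun (snd l) (a, x) * h) \<le> \<epsilon> * norm h"
      proof (eventually_elim, intro ballI allI)
        fix n x and h :: real assume "dist (snd (X n)) (snd l) < \<epsilon>"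
        hence "dist (apply_bcontfun (snd (X n)) (a, x)) (apply_bcontfun (snd l) (a, x)) < \<epsilon>"
          by (rule dist_fun_lt_imp_dist_val_lt)
        hence "\<bar>apply_bcontfun (snd (X n)) (a, x) - apply_bcontfun (snd l) (a, x)\<bar> * \<bar>h\<bar> \<le> \<epsilon> * \<bar>h\<bar>"
          by (intro mult_right_mono) (auto simp: dist_real_def)
        thus "norm (apply_bcontfun (snd (X n)) (a, x) * h - apply_bcontfun (snd l) (a, x) * h) \<le> \<epsilon> * norm h"
          by (simp add: abs_mult flip: left_diff_distrib)
      qed
    qed (use pt[of 0] in auto)
    then obtain g where g: "\<And>x. (\<lambda>n. apply_bcontfun (fst (X n)) (a, x)) \<longlonglongrightarrow> g x"
      "\<And>x. (g has_derivative (\<lambda>h. apply_bcontfun (snd l) (a, x) * h)) (at x)" by auto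
    have "g = (\<lambda>x. apply_bcontfun (fst l) (a, x))" using LIMSEQ_unique[OF g(1) pt] by auto
    thus ?thesis using g(2)[of x] by (simp add: has_field_derivative_def)
  qed
  ultimately show "l \<in> S" by (simp add: S_def)
qed

lemma fixpoint_exists:
  obtains F F1 where "cont2 F" "cont2 F1" "\<And>a x. \<bar>F a x\<bar> \<le> 2 * M * exp (p * \<bar>a\<bar>)"
    "\<And>a x. \<bar>F1 a x\<bar> \<le> 2 * M * exp (p * \<bar>a\<bar>)" "\<And>a x. (F a has_real_derivative F1 a x) (at x)"
    "\<And>a x. F a x = h (x + a) - Jop e F F a x"
proof -
  have "(0, 0) \<in> S" using M_pos by (auto simp: S_def)
  note complete_eq_closed[THEN iffD2, OF S_closed]
  moreover have "S \<noteq> {}" using \<open>(0, 0) \<in> S\<close> by blast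
  moreover have "step ` S \<subseteq> S" using step_mem by (rule image_subsetI)
  ultimately have "\<exists>!z\<in>S. step z = z"
    by (intro Banach_fix[of S "1/2" step] step_contraction) auto
  then obtain z where z: "z \<in> S" "step z = z" by auto
  note u = S_up[OF z(1)]
  \<comment> \<open>The polynomial gain has served its purpose; the Laplace transform only needs the
    exponential.\<close>
  have b: "2 * M * om p a \<le> 2 * M * exp (p * \<bar>a\<bar>)" for a using om_le_exp M_pos by (intro mult_left_mono) auto
  have "up p (fst z) a x = R0 (up p (fst z)) a x" for a x
  proof -
    have "apply_bcontfun (fst z) (a, x) = apply_bcontfun (dn p (R0 (up p (fst z)))) (a, x)"
      using z(2) by (simp add: step_def prod_eq_iff)
    also have "\<dots> = R0 (up p (fst z)) a x / om p a"
      by (subst dn_apply[OF R0_cont[OF up_cont] R0_bound[OF up_cont u(1)]]) simp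
    finally show ?thesis using om_pos[of p a] by (simp add: up_def)
  qed
  hence fp: "up p (fst z) a x = h (x + a) - Jop e (up p (fst z)) (up p (fst z)) a x" for a x
    by (simp add: R0_def)
  show ?thesis
    by (rule that[OF up_cont up_cont order_trans[OF u(1) b] order_trans[OF u(2) b] u(3) fp])
qed

text \<open>The variable a is both the length of the integral and part of the label
  \<open>x + a\<close> of the characteristic. Separating the two roles in \<open>P u y\<close>
  leaves an endpoint term from u and a transport term from y, joined by the chain rule along
  \<open>(a, x + a)\<close>.\<close>

lemma Jop_da:
  assumes "cont2 F" "cont2 F1" "\<And>a x. (F a has_real_derivative F1 a x) (at x)"
  shows "((\<lambda>a. Jop e F F a x) has_real_derivative
    e x * cv F F a x + (Jop e1 F F a x + Jop e F1 F a x + Jop e F F1 a x)) (at a)"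
proof -
  define G where "G b z = e z * cv F F b z" for b z
  define G1 where "G1 b z = e1 z * cv F F b z + e z * (cv F1 F b z + cv F F1 b z)" for b z
  note cc = cv_cont[OF assms(1,1)] cv_cont[OF assms(2,1)] cv_cont[OF assms(1,2)]
  have Gd: "(G b has_real_derivative G1 b z) (at z)" for b z
    unfolding G_def[abs_def] G1_def using cv_dx[OF assms(1,1,2,2) assms(3) assms(3), of b z] e_deriv
    by (auto intro!: derivative_eq_intros)
  have Gc: "cont2 G" and G1c: "cont2 G1"
    unfolding G_def G1_def
    by (intro continuous_intros continuous_comp_UNIV[OF e_cont] continuous_comp_UNIV[OF e1_cont] cc)+
  define P where "P u y = integral {0..1} (\<lambda>t. u * G (u * t) (y - u * t))" for u y
  define P1 where "P1 u y = integral {0..1} (\<lambda>t. u * G1 (u * t) (y - u * t))" for u y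
  have JP: "Jop e F F a x = P a (x + a)" for a x
    by (simp add: Jop_def P_def G_def)
  have dP: "(P u has_real_derivative P1 u y) (at y)" for u y
    unfolding P_def[abs_def] P1_def
  proof (rule integral01_deriv)
    fix y t
    have "((\<lambda>y. G (u * t) (y + (- (u * t)))) has_real_derivative G1 (u * t) (y + (- (u * t)))) (at y)"
      using DERIV_shift Gd by blast
    thus "((\<lambda>y. u * G (u * t) (y - u * t)) has_real_derivative u * G1 (u * t) (y - u * t)) (at y)"
      by (auto intro!: derivative_eq_intros)
  qed (intro continuous_intros cont2_comp[OF Gc] cont2_comp[OF G1c])+
  have cP1: "cont2 P1"
    unfolding P1_def by (rule integral01_continuous) (intro continuous_intros cont2_comp[OF G1c])
  have uP: "((\<lambda>u. P u y) has_real_derivative G u (y - u)) (at u)" for u y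
    unfolding P_def
    by (rule scaled_integral_FTC(1)[of "\<lambda>v. G v (y - v)"]) (intro continuous_intros cont2_comp[OF Gc])
  have D: "((\<lambda>(u, y). P u y) has_derivative (\<lambda>(s, v). G u (y - u) * s + P1 u y * v)) (at (u, y))" for u y
    using has_derivative_of_partials[of P y "\<lambda>u y. G u (y - u)" u UNIV UNIV P1] uP dP cP1 by simp
  have "((\<lambda>a. (a, x + a)) has_derivative (\<lambda>s. (s, s))) (at a)"
    by (auto intro!: derivative_eq_intros)
  from has_derivative_compose[OF this D]
  have "((\<lambda>a. P a (x + a)) has_derivative (\<lambda>s. G a x * s + P1 a (x + a) * s)) (at a)" by simp
  hence "((\<lambda>a. Jop e F F a x) has_real_derivative G a x + P1 a (x + a)) (at a)"
  proof -
    assume "((\<lambda>a. P a (x + a)) has_derivative (\<lambda>s. G a x * s + P1 a (x + a) * s)) (at a)"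
    moreover have "(\<lambda>s. G a x * s + P1 a (x + a) * s) = (*) (G a x + P1 a (x + a))" by (auto simp: distrib_right)
    ultimately show ?thesis by (simp add: JP has_field_derivative_def)
  qed
  \<comment> \<open>Moving x alone changes only the label of the characteristic, so the transport
    term is the x-derivative of the Duhamel integral; uniqueness of derivatives identifies
    it.\<close>
  moreover have "P1 a (x + a) = Jop e1 F F a x + Jop e F1 F a x + Jop e F F1 a x"
  proof -
    have "((\<lambda>x. P a (x + a)) has_real_derivative P1 a (x + a)) (at x)"
      using DERIV_shift dP by blast
    thus ?thesis using Jop_dx[OF assms(1,1,2,2) assms(3) assms(3) e_deriv e_cont e1_cont, of a x] DERIV_unique
      unfolding JP by blast
  qed
  ultimately show ?thesis by (simp add: G_def)
qed

text \<open>The a-derivative and the x-derivative of the integrated equation have the part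
  \<open>h1 (x + a) - J1\<close> in common and differ by the endpoint term
  \<open>e x * cv F F a x\<close>. That difference is the differential equation.\<close>

theorem evolution_exists:
  obtains F F1 where "cont2 F" "cont2 F1" "\<And>a x. \<bar>F a x\<bar> \<le> 2 * M * exp (p * \<bar>a\<bar>)"
    "\<And>a x. \<bar>F1 a x\<bar> \<le> 2 * M * exp (p * \<bar>a\<bar>)" "\<And>a x. (F a has_real_derivative F1 a x) (at x)"
    "\<And>a x. ((\<lambda>a. F a x) has_real_derivative F1 a x - e x * cv F F a x) (at a)" "\<And>x. F 0 x = h x"
proof -
  obtain F F1 where F: "cont2 F" "cont2 F1" "\<And>a x. \<bar>F a x\<bar> \<le> 2 * M * exp (p * \<bar>a\<bar>)"
    "\<And>a x. \<bar>F1 a x\<bar> \<le> 2 * M * exp (p * \<bar>a\<bar>)" "\<And>a x. (F a has_real_derivative F1 a x) (at x)"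
    "\<And>a x. F a x = h (x + a) - Jop e F F a x" using fixpoint_exists by blast
  have "F0": "F 0 x = h x" for x by (subst F(6)) (simp add: Jop_def)
  have "((\<lambda>a. F a x) has_real_derivative F1 a x - e x * cv F F a x) (at a)" for a x
  proof -
    define J1 where "J1 = Jop e1 F F a x + Jop e F1 F a x + Jop e F F1 a x"
    have "((\<lambda>a. h (x + a) - Jop e F F a x) has_real_derivative h1 (x + a) - (e x * cv F F a x + J1)) (at a)"
      unfolding J1_def using DERIV_shift[of h "h1 (x + a)" a x] h_deriv[of "x + a"]
      by (intro DERIV_diff Jop_da F) (simp add: add.commute)
    moreover have "(\<lambda>a. F a x) = (\<lambda>a. h (x + a) - Jop e F F a x)" using F(6) by blast
    moreover have "F1 a x = h1 (x + a) - J1"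
    proof -
      have "R0 F = F" using F(6) by (intro ext) (simp add: R0_def)
      hence "(F a has_real_derivative R1 F F1 a x) (at x)" using R0_deriv[OF F(1,2,5)] by metis
      thus ?thesis using F(5) DERIV_unique by (fastforce simp: R1_def J1_def)
    qed
    ultimately show ?thesis by (simp only: diff_diff_eq add.commute)
  qed
  with F F0 that show ?thesis by blast
qed

end

section \<open>The Laplace transform of the evolution\<close>

text \<open>Fubini, integrating the shifted factor first: by translation invariance its integral
  does not depend on the shift.\<close>

lemma convolution_integral:
  fixes f g :: "real \<Rightarrow> real"
  assumes f: "integrable lborel f" and g: "integrable lborel g"
  shows "integrable lborel (\<lambda>a. \<integral>b. f b * g (a - b) \<partial>lborel)"
    and "(\<integral>a. (\<integral>b. f b * g (a - b) \<partial>lborel) \<partial>lborel) = integral\<^sup>L lborel f * integral\<^sup>L lborel g"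
proof -
  have [measurable]: "f \<in> borel_measurable borel" "g \<in> borel_measurable borel"
    using borel_measurable_integrable[OF f] borel_measurable_integrable[OF g] by auto
  have shift: "integrable lborel (\<lambda>a. u (a - b))" "(\<integral>a. u (a - b) \<partial>lborel) = integral\<^sup>L lborel u"
    if "integrable lborel u" for u :: "real \<Rightarrow> real" and b
    using lborel_integrable_real_affine[OF that, of 1 "-b"] lborel_integral_real_affine[of 1 u "-b"] by simp_all
  have int: "integrable (lborel \<Otimes>\<^sub>M lborel) (\<lambda>(b, a). f b * g (a - b))"
  proof (rule lborel_pair.Fubini_integrable)
    have "integrable lborel (\<lambda>b. norm (f b) * (\<integral>a. norm (g a) \<partial>lborel))"
      using f by (intro integrable_mult_left) simp
    moreover have "(\<integral>a. norm (case (b, a) of (b, a) \<Rightarrow> f b * g (a - b)) \<partial>lborel) = norm (f b) * (\<integral>a. norm (g a) \<partial>lborel)" for b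
      using shift(2)[of "\<lambda>a. norm (g a)" b] g by (simp add: abs_mult)
    ultimately show "integrable lborel (\<lambda>b. \<integral>a. norm (case (b, a) of (b, a) \<Rightarrow> f b * g (a - b)) \<partial>lborel)"
      by presburger
    show "AE b in lborel. integrable lborel (\<lambda>a. case (b, a) of (b, a) \<Rightarrow> f b * g (a - b))"
      using shift(1)[OF g] by auto
  qed measurable
  show "integrable lborel (\<lambda>a. \<integral>b. f b * g (a - b) \<partial>lborel)"
    by (rule lborel_pair.integrable_snd[OF int])
  have "(\<integral>a. (\<integral>b. f b * g (a - b) \<partial>lborel) \<partial>lborel) = (\<integral>b. (\<integral>a. f b * g (a - b) \<partial>lborel) \<partial>lborel)"
    by (rule lborel_pair.Fubini_integral[OF int])
  also have "\<dots> = (\<integral>b. f b * integral\<^sup>L lborel g \<partial>lborel)"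
    by (simp add: shift(2)[OF g])
  finally show "(\<integral>a. (\<integral>b. f b * g (a - b) \<partial>lborel) \<partial>lborel) = integral\<^sup>L lborel f * integral\<^sup>L lborel g"
    by simp
qed

text \<open>By the mean value inequality w dominates every difference quotient, so dominated
  convergence applies along each sequence tending to x.\<close>

lemma has_real_derivative_integral_param:
  fixes f f' :: "real \<Rightarrow> 'a \<Rightarrow> real"
  assumes deriv: "\<And>x a. ((\<lambda>x. f x a) has_real_derivative f' x a) (at x)"
    and int: "\<And>x. integrable N (f x)" and meas: "\<And>x. f' x \<in> borel_measurable N"
    and bound: "\<And>x a. \<bar>f' x a\<bar> \<le> w a" and w: "integrable N w"
  shows "((\<lambda>x. integral\<^sup>L N (f x)) has_real_derivative integral\<^sup>L N (f' x)) (at x)"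
  unfolding has_field_derivative_iff tendsto_at_iff_sequentially comp_def
proof (intro allI impI)
  fix X :: "nat \<Rightarrow> real" assume X: "\<forall>i. X i \<in> UNIV - {x}" "X \<longlonglongrightarrow> x"
  have "(\<lambda>i. \<integral>a. (f (X i) a - f x a) / (X i - x) \<partial>N) \<longlonglongrightarrow> integral\<^sup>L N (f' x)"
  proof (rule integral_dominated_convergence)
    show "AE a in N. (\<lambda>i. (f (X i) a - f x a) / (X i - x)) \<longlonglongrightarrow> f' x a"
      using deriv[of _ x] X unfolding has_field_derivative_iff tendsto_at_iff_sequentially comp_def by auto
    show "AE a in N. norm ((f (X i) a - f x a) / (X i - x)) \<le> w a" for i
    proof (intro AE_I2)
      fix a
      have "norm (f (X i) a - f x a) \<le> w a * norm (X i - x)"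
        by (rule field_differentiable_bound[of UNIV]) (use deriv bound in auto)
      thus "norm ((f (X i) a - f x a) / (X i - x)) \<le> w a"
        using X(1) by (simp add: norm_divide divide_le_eq)
    qed
  qed (use meas w int in \<open>auto intro!: borel_measurable_divide borel_measurable_diff borel_measurable_integrable\<close>)
  moreover have "(\<integral>a. (f (X i) a - f x a) / (X i - x) \<partial>N) = (integral\<^sup>L N (f (X i)) - integral\<^sup>L N (f x)) / (X i - x)" for i
    by (simp add: Bochner_Integration.integral_diff[OF int int])
  ultimately show "(\<lambda>i. (integral\<^sup>L N (f (X i)) - integral\<^sup>L N (f x)) / (X i - x)) \<longlonglongrightarrow> integral\<^sup>L N (f' x)"
    by (simp only:)
qed

lemma exp_integrable:
  fixes G :: "real \<Rightarrow> real"
  assumes "continuous_on UNIV G" "\<And>a. \<bar>G a\<bar> \<le> C * exp (p * \<bar>a\<bar>)" "c > p"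
  shows "integrable lborel (\<lambda>a. indicator {0<..} a * (exp (- (c * a)) * G a))"
    and "integrable lborel (\<lambda>a. indicator {0<..} a * (C * exp (- ((c - p) * a))))"
    and "\<bar>indicator {0<..} a * (exp (- (c * a)) * G a)\<bar> \<le> indicator {0<..} a * (C * exp (- ((c - p) * a)))"
proof -
  have [measurable]: "G \<in> borel_measurable borel" using assms(1) by (rule borel_measurable_continuous_onI)
  have "integrable lborel (\<lambda>a. C * (indicator {0<..} a *\<^sub>R exp (- (a * (c - p)))))"
    using integrable_I0i_exp_mscale[of "c - p"] assms(3) unfolding set_integrable_def
    by (intro integrable_mult_right) simp
  thus w: "integrable lborel (\<lambda>a. indicator {0<..} a * (C * exp (- ((c - p) * a))))"
    by (simp add: mult_ac)
  show b: "\<bar>indicator {0<..} a * (exp (- (c * a)) * G a)\<bar> \<le> indicator {0<..} a * (C * exp (- ((c - p) * a)))" for a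
  proof (cases "a > 0")
    case True
    have "exp (- (c * a)) * \<bar>G a\<bar> \<le> exp (- (c * a)) * (C * exp (p * \<bar>a\<bar>))"
      by (intro mult_left_mono assms) auto
    also have "\<dots> = C * exp (- ((c - p) * a))" using True by (simp add: algebra_simps flip: exp_add)
    finally show ?thesis using True by (simp add: abs_mult)
  qed simp
  show "integrable lborel (\<lambda>a. indicator {0<..} a * (exp (- (c * a)) * G a))"
    by (rule Bochner_Integration.integrable_bound[OF w]) (use b in \<open>auto intro!: AE_I2 intro: order_trans[OF _ abs_ge_self]\<close>)
qed

text \<open>A Lebesgue integral, hence 0 by default if the integrand is not integrable. Identities
  that respect this default are stated without integrability assumptions.\<close>

definition laplace :: "(real \<Rightarrow> real) \<Rightarrow> real \<Rightarrow> real" where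
  "laplace G c = (\<integral>a. indicator {0<..} a * (exp (- (c * a)) * G a) \<partial>lborel)"

lemma laplace_convolution:
  assumes "cont2 F" "\<And>a x. \<bar>F a x\<bar> \<le> C * exp (p * \<bar>a\<bar>)" "c > p"
  shows "integrable lborel (\<lambda>a. indicator {0<..} a * (exp (- (c * a)) * cv F F a x))"
    and "laplace (\<lambda>a. cv F F a x) c = (laplace (\<lambda>a. F a x) c)\<^sup>2"
proof -
  have Fx: "continuous_on UNIV (\<lambda>a. F a x)" by (intro cont2_comp[OF assms(1)] continuous_intros)
  define f where "f a = indicator {0<..} a * (exp (- (c * a)) * F a x)" for a
  have f: "integrable lborel f" unfolding f_def by (rule exp_integrable(1)[OF Fx assms(2,3)])
  have eq: "(\<integral>b. f b * f (a - b) \<partial>lborel) = indicator {0<..} a * (exp (- (c * a)) * cv F F a x)" for a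
  proof (cases "a > 0")
    case True
    have cont: "continuous_on S (\<lambda>b. F b x * F (a - b) x)" for S
      by (intro continuous_intros cont2_comp[OF assms(1)])
    \<comment> \<open>The exponentials combine to a factor independent of b, and the two indicators
      confine b to the interval from 0 to a.\<close>
    have "f b * f (a - b) = exp (- (c * a)) * (indicator {0<..<a} b * (F b x * F (a - b) x))" for b
      by (simp add: f_def indicator_def algebra_simps flip: exp_add)
    hence "(\<integral>b. f b * f (a - b) \<partial>lborel) = exp (- (c * a)) * (LINT b:{0<..<a}|lborel. F b x * F (a - b) x)"
      by (simp add: set_lebesgue_integral_def)
    also have "(LINT b:{0<..<a}|lborel. F b x * F (a - b) x) = integral {0<..<a} (\<lambda>b. F b x * F (a - b) x)"
      by (intro set_borel_integral_eq_integral set_integrable_subset[OF borel_integrable_atLeastAtMost'[of 0 a]] cont) auto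
    also have "\<dots> = integral {0..a} (\<lambda>b. F b x * F (a - b) x)"
      by (simp add: integral_open_interval_real)
    also have "\<dots> = cv F F a x"
      using scaled_integral_FTC(2)[OF cont, of a] True by (simp add: cv_def right_diff_distrib)
    finally show ?thesis using True by simp
  next
    case False
    hence z: "f b * f (a - b) = 0" for b by (auto simp: f_def indicator_def)
    show ?thesis using False by (simp add: z)
  qed
  show "integrable lborel (\<lambda>a. indicator {0<..} a * (exp (- (c * a)) * cv F F a x))"
    using convolution_integral(1)[OF f f] by (simp add: eq)
  show "laplace (\<lambda>a. cv F F a x) c = (laplace (\<lambda>a. F a x) c)\<^sup>2"
    using convolution_integral(2)[OF f f] unfolding eq unfolding laplace_def power2_eq_square f_def .
qed

lemma integral_FTC_half_line:
  fixes P P' :: "real \<Rightarrow> real"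
  assumes "\<And>a. (P has_real_derivative P' a) (at a)" "continuous_on UNIV P'"
    and int: "integrable lborel (\<lambda>a. indicator {0<..} a * P' a)" and lim: "(P \<longlongrightarrow> 0) at_top"
  shows "(\<integral>a. indicator {0<..} a * P' a \<partial>lborel) = - P 0"
proof -
  have "((\<lambda>y. \<integral>a. indicator {..y} a *\<^sub>R (indicator {0<..} a * P' a) \<partial>lborel) \<longlongrightarrow> (\<integral>a. indicator {0<..} a * P' a \<partial>lborel)) at_top"
    by (rule tendsto_integral_at_top[OF _ int]) simp
  moreover have "\<forall>\<^sub>F y in at_top. (\<integral>a. indicator {..y} a *\<^sub>R (indicator {0<..} a * P' a) \<partial>lborel) = P y - P 0"
    using eventually_ge_at_top[of 0]
  proof eventually_elim
    fix y :: real assume "0 \<le> y"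
    have [measurable]: "P' \<in> borel_measurable borel" using assms(2) by (rule borel_measurable_continuous_onI)
    have "(\<integral>a. indicator {..y} a *\<^sub>R (indicator {0<..} a * P' a) \<partial>lborel) = (\<integral>a. indicator {0..y} a *\<^sub>R P' a \<partial>lborel)"
    proof (rule integral_cong_AE)
      show "AE a in lborel. indicator {..y} a *\<^sub>R (indicator {0<..} a * P' a) = indicator {0..y} a *\<^sub>R P' a"
        using AE_lborel_singleton[of 0] by eventually_elim (auto simp: indicator_def)
    qed measurable
    also have "\<dots> = P y - P 0"
      using \<open>0 \<le> y\<close> assms(1) by (intro integral_FTC_atLeastAtMost continuous_on_subset[OF assms(2)])
        (auto simp: has_real_derivative_iff_has_vector_derivative[symmetric] intro: DERIV_subset)
    finally show "(\<integral>a. indicator {..y} a *\<^sub>R (indicator {0<..} a * P' a) \<partial>lborel) = P y - P 0" .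
  qed
  ultimately have "((\<lambda>y. P y - P 0) \<longlongrightarrow> (\<integral>a. indicator {0<..} a * P' a \<partial>lborel)) at_top"
    by (rule Lim_transform_eventually)
  moreover have "((\<lambda>y. P y - P 0) \<longlongrightarrow> 0 - P 0) at_top" by (intro tendsto_intros lim)
  ultimately show ?thesis using tendsto_unique[OF trivial_limit_at_top_linorder] by fastforce
qed

text \<open>The transform of the a-derivative is computed twice: by the evolution equation, where
  the convolution becomes a square, and by integration by parts, with boundary term
  \<open>F 0 x\<close>. Eliminating the transform of F1 leaves an ordinary differential equation in
  x. The bound uniform in x will keep the Riccati solution bounded at the centre of the
  ball.\<close>

lemma laplace_riccati:
  assumes cont: "cont2 F" "cont2 F1" and e: "continuous_on UNIV e"
    and bound: "\<And>a x. \<bar>F a x\<bar> \<le> C * exp (p * \<bar>a\<bar>)" "\<And>a x. \<bar>F1 a x\<bar> \<le> C * exp (p * \<bar>a\<bar>)"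
    and dx: "\<And>a x. (F a has_real_derivative F1 a x) (at x)"
    and da: "\<And>a x. ((\<lambda>a. F a x) has_real_derivative F1 a x - e x * cv F F a x) (at a)"
    and c: "c > p"
  shows "((\<lambda>x. laplace (\<lambda>a. F a x) c) has_real_derivative
           c * laplace (\<lambda>a. F a x) c + e x * (laplace (\<lambda>a. F a x) c)\<^sup>2 - F 0 x) (at x)"
    and "\<exists>K. \<forall>x. \<bar>laplace (\<lambda>a. F a x) c\<bar> \<le> K"
proof -
  have Fx: "continuous_on UNIV (\<lambda>a. F a x)" "continuous_on UNIV (\<lambda>a. F1 a x)" for x
    by (intro cont2_comp[OF cont(1)] cont2_comp[OF cont(2)] continuous_intros)+
  note i0 = exp_integrable[OF Fx(1) bound(1) c] and i1 = exp_integrable[OF Fx(2) bound(2) c]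
  note icv = laplace_convolution[OF cont(1) bound(1) c]
  have "\<bar>laplace (\<lambda>a. F a x) c\<bar> \<le> (\<integral>a. indicator {0<..} a * (C * exp (- ((c - p) * a))) \<partial>lborel)" for x
    unfolding laplace_def real_norm_def[symmetric]
    by (rule Bochner_Integration.integral_norm_bound_integral) (use i0 in auto)
  thus "\<exists>K. \<forall>x. \<bar>laplace (\<lambda>a. F a x) c\<bar> \<le> K" by blast
  have D: "((\<lambda>x. laplace (\<lambda>a. F a x) c) has_real_derivative laplace (\<lambda>a. F1 a x) c) (at x)"
    unfolding laplace_def
  proof (rule has_real_derivative_integral_param)
    show "((\<lambda>x. indicator {0<..} a * (exp (- (c * a)) * F a x)) has_real_derivative 
      indicator {0<..} a * (exp (- (c * a)) * F1 a x)) (at x)" for a x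
      by (intro DERIV_cmult dx)
  qed (use i0 i1 in \<open>auto intro: borel_measurable_integrable\<close>)
  \<comment> \<open>The a-derivative of \<open>exp (- (c * a)) * F a x\<close>, with the evolution
    equation already inserted.\<close>
  define P' where "P' a = exp (- (c * a)) * (F1 a x - e x * cv F F a x) - c * (exp (- (c * a)) * F a x)" for a
  have iP': "indicator {0<..} a * P' a = indicator {0<..} a * (exp (- (c * a)) * F1 a x)
     - e x * (indicator {0<..} a * (exp (- (c * a)) * cv F F a x)) - c * (indicator {0<..} a * (exp (- (c * a)) * F a x))" for a
    by (simp add: P'_def algebra_simps)
  have "(\<integral>a. indicator {0<..} a * P' a \<partial>lborel) = - (exp (- (c * 0)) * F 0 x)"
  proof (rule integral_FTC_half_line)
    show "((\<lambda>a. exp (- (c * a)) * F a x) has_real_derivative P' a) (at a)" for a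
      unfolding P'_def by (rule derivative_eq_intros da refl | simp)+
    show "continuous_on UNIV P'" unfolding P'_def
      by (intro continuous_intros cont2_comp[OF cont(1)] cont2_comp[OF cont(2)] cont2_comp[OF cv_cont[OF cont(1,1)]])
    show "integrable lborel (\<lambda>a. indicator {0<..} a * P' a)"
      unfolding iP' by (intro Bochner_Integration.integrable_diff integrable_mult_right i1 i0 icv)
    have "((\<lambda>a. C * exp (- ((c - p) * a))) \<longlongrightarrow> C * 0) at_top"
      using c by (intro tendsto_intros filterlim_compose[OF exp_at_bot] filterlim_compose[OF filterlim_uminus_at_bot_at_top]
         filterlim_tendsto_pos_mult_at_top[OF tendsto_const] filterlim_ident) auto
    hence "((\<lambda>a. C * exp (- ((c - p) * a))) \<longlongrightarrow> 0) at_top" by simp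
    moreover have "\<forall>\<^sub>F a in at_top. norm (exp (- (c * a)) * F a x) \<le> C * exp (- ((c - p) * a))"
      using eventually_gt_at_top[of 0]
    proof eventually_elim
      fix a :: real assume "a > 0"
      thus "norm (exp (- (c * a)) * F a x) \<le> C * exp (- ((c - p) * a))" using i0(3)[of a x] by simp
    qed
    ultimately show "((\<lambda>a. exp (- (c * a)) * F a x) \<longlongrightarrow> 0) at_top"
      by (rule Lim_null_comparison[rotated])
  qed
  moreover have "(\<integral>a. indicator {0<..} a * P' a \<partial>lborel) = laplace (\<lambda>a. F1 a x) c - e x * (laplace (\<lambda>a. F a x) c)\<^sup>2 - c * laplace (\<lambda>a. F a x) c"
    unfolding iP' icv(2)[symmetric] laplace_def
    by (subst Bochner_Integration.integral_diff Bochner_Integration.integral_mult_right_zero,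
       (intro Bochner_Integration.integrable_diff integrable_mult_right i1 i0 icv)+)+ 
      (simp add: icv(2)[unfolded laplace_def])
  ultimately have "laplace (\<lambda>a. F1 a x) c = c * laplace (\<lambda>a. F a x) c + e x * (laplace (\<lambda>a. F a x) c)\<^sup>2 - F 0 x"
    by simp
  with D show "((\<lambda>x. laplace (\<lambda>a. F a x) c) has_real_derivative
           c * laplace (\<lambda>a. F a x) c + e x * (laplace (\<lambda>a. F a x) c)\<^sup>2 - F 0 x) (at x)" by simp
qed

section \<open>Logarithmic polar coordinates and moments on the ball\<close>

lemma ball_measurable[measurable]: "ball (c::'a::euclidean_space) r \<in> sets borel"
  by simp

lemma nn_integral_lborel_scale:
  fixes f :: "'a::euclidean_space \<Rightarrow> ennreal"
  assumes [measurable]: "f \<in> borel_measurable borel" and "R > 0"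
  shows "(\<integral>\<^sup>+x. f x \<partial>lborel) = ennreal (R ^ DIM('a)) * (\<integral>\<^sup>+x. f (R *\<^sub>R x) \<partial>lborel)"
proof -
  have "(\<integral>\<^sup>+x. f x \<partial>lborel) = (\<integral>\<^sup>+x. f x \<partial>density (distr lborel borel (\<lambda>x::'a. 0 + R *\<^sub>R x)) (\<lambda>_. ennreal (\<bar>R\<bar>^DIM('a))))"
    using lborel_affine[of R "0::'a"] assms(2) by (simp add: ennreal_power)
  also have "\<dots> = ennreal (R ^ DIM('a)) * (\<integral>\<^sup>+x. f (R *\<^sub>R x) \<partial>lborel)"
    using assms(2) by (simp add: nn_integral_density nn_integral_distr nn_integral_cmult)
  finally show ?thesis .
qed

text \<open>
  In the logarithmic radial variable \<open>\<theta> = - ln |x|\<close> a homogeneous weight of degree \<open>0\<close> on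
  \<open>\<real>\<^sup>d\<close> becomes the measure \<open>d m exp (- d \<theta>) d\<theta>\<close>; both measures are determined by the
  masses of the half lines, that is, of balls.
\<close>

lemma polar_log:
  fixes hh :: "'a::euclidean_space \<Rightarrow> real"
  assumes meas[measurable]: "hh \<in> borel_measurable borel" and nonneg: "\<And>x. hh x \<ge> 0"
    and homog: "\<And>t x. t > 0 \<Longrightarrow> hh (t *\<^sub>R x) = hh x"
    and m: "(\<integral>\<^sup>+x. ennreal (hh x) * indicator (ball 0 1) x \<partial>lborel) = ennreal m" "m \<ge> 0"
  shows "distr (density lborel (\<lambda>x. ennreal (hh x))) borel (\<lambda>x. - ln (norm x))
       = density lborel (\<lambda>\<theta>. ennreal (real DIM('a) * m * exp (- (real DIM('a) * \<theta>))))"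
proof (rule measure_eqI_lessThan)
  let ?d = "real DIM('a)"
  have L: "emeasure (distr (density lborel (\<lambda>x. ennreal (hh x))) borel (\<lambda>x. - ln (norm x))) {a<..}
     = ennreal (m * exp (- (?d * a)))" for a
  proof -
    have "emeasure (distr (density lborel (\<lambda>x. ennreal (hh x))) borel (\<lambda>x. - ln (norm x))) {a<..}
      = (\<integral>\<^sup>+x. ennreal (hh x) * indicator {x. - ln (norm x) > a} x \<partial>lborel)"
      by (subst emeasure_distr) (auto simp: emeasure_density vimage_def)
    also have "\<dots> = (\<integral>\<^sup>+x. ennreal (hh x) * indicator (ball 0 (exp (- a))) x \<partial>lborel)"
    proof (rule nn_integral_cong_AE)
      \<comment> \<open>The origin has to be removed, as \<open>- ln (norm x)\<close> is only a
        default value there.\<close>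
      show "AE x in lborel. ennreal (hh x) * indicator {x. - ln (norm x) > a} x = ennreal (hh x) * indicator (ball 0 (exp (- a))) x"
        using AE_lborel_singleton[of 0]
      proof eventually_elim
        fix x :: 'a assume "x \<noteq> 0"
        hence "- ln (norm x) > a \<longleftrightarrow> norm x < exp (- a)"
          by (metis exp_ln exp_less_cancel_iff less_minus_iff minus_minus zero_less_norm_iff neg_less_iff_less)
        thus "ennreal (hh x) * indicator {x. - ln (norm x) > a} x = ennreal (hh x) * indicator (ball 0 (exp (- a))) x"
          by (simp add: indicator_def)
      qed
    qed
    \<comment> \<open>Scaling by \<open>exp (- a)\<close> carries the unit ball to the ball in
      question; homogeneity of degree 0 leaves the weight unchanged, so only the Jacobian
      remains.\<close>
    also have "\<dots> = ennreal (exp (- a) ^ DIM('a)) * (\<integral>\<^sup>+x. ennreal (hh (exp (- a) *\<^sub>R x)) * indicator (ball 0 (exp (- a))) (exp (- a) *\<^sub>R x) \<partial>lborel)"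
      by (rule nn_integral_lborel_scale, measurable)
    also have "(\<lambda>x::'a. ennreal (hh (exp (- a) *\<^sub>R x)) * indicator (ball 0 (exp (- a))) (exp (- a) *\<^sub>R x)) =
       (\<lambda>x. ennreal (hh x) * indicator (ball 0 1) x)"
      by (auto simp: homog indicator_def)
    also have "ennreal (exp (- a) ^ DIM('a)) * (\<integral>\<^sup>+x. ennreal (hh x) * indicator (ball 0 1) x \<partial>lborel) = ennreal (m * exp (- (?d * a)))"
      unfolding m(1) using m(2) by (simp add: ennreal_mult'' mult.commute flip: exp_of_nat_mult)
    finally show ?thesis .
  qed
  show "emeasure (distr (density lborel (\<lambda>x. ennreal (hh x))) borel (\<lambda>x. - ln (norm x))) {a<..} < \<infinity>" for a
    unfolding L by simp
  show "emeasure (distr (density lborel (\<lambda>x. ennreal (hh x))) borel (\<lambda>x. - ln (norm x))) {a<..} =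
      emeasure (density lborel (\<lambda>\<theta>. ennreal (?d * m * exp (- (?d * \<theta>))))) {a<..}" for a
  proof -
    have "emeasure (density lborel (\<lambda>\<theta>. ennreal (?d * m * exp (- (?d * \<theta>))))) {a<..} =
       (\<integral>\<^sup>+\<theta>. ennreal (?d * m * exp (- (?d * \<theta>))) * indicator {a<..} \<theta> \<partial>lborel)"
      by (simp add: emeasure_density)
    also have "\<dots> = (\<integral>\<^sup>+\<theta>. ennreal (?d * m * exp (- (?d * \<theta>))) * indicator {a..} \<theta> \<partial>lborel)"
      by (rule nn_integral_cong_AE, use AE_lborel_singleton[of a] in eventually_elim) (auto simp: indicator_def)
    also have "\<dots> = ennreal (0 - (- (m * exp (- (?d * a)))))"
    proof (rule nn_integral_FTC_atLeast)
      have "((\<lambda>\<theta>. - (m * exp (- (?d * \<theta>)))) \<longlongrightarrow> - (m * 0)) at_top"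
        by (intro tendsto_intros filterlim_compose[OF exp_at_bot] filterlim_compose[OF filterlim_uminus_at_bot_at_top]
         filterlim_tendsto_pos_mult_at_top[OF tendsto_const] filterlim_ident) auto
      thus "((\<lambda>\<theta>. - (m * exp (- (?d * \<theta>)))) \<longlongrightarrow> 0) at_top" by simp
    qed (use m(2) in \<open>auto intro!: derivative_eq_intros\<close>)
    finally show ?thesis unfolding L by simp
  qed
qed auto

lemma polar_log_nn_integral:
  fixes hh :: "'a::euclidean_space \<Rightarrow> real"
  assumes [measurable]: "hh \<in> borel_measurable borel" and nonneg: "\<And>x. hh x \<ge> 0"
    and homog: "\<And>t x. t > 0 \<Longrightarrow> hh (t *\<^sub>R x) = hh x"
    and m: "(\<integral>\<^sup>+x. ennreal (hh x) * indicator (ball 0 1) x \<partial>lborel) = ennreal m" "m \<ge> 0"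
    and [measurable]: "f \<in> borel_measurable borel"
  shows "(\<integral>\<^sup>+x. ennreal (hh x) * f (- ln (norm x)) \<partial>lborel)
       = (\<integral>\<^sup>+\<theta>. ennreal (real DIM('a) * m * exp (- (real DIM('a) * \<theta>))) * f \<theta> \<partial>lborel)"
proof -
  have P: "distr (density lborel (\<lambda>x. ennreal (hh x))) borel (\<lambda>x. - ln (norm x))
       = density lborel (\<lambda>\<theta>. ennreal (real DIM('a) * m * exp (- (real DIM('a) * \<theta>))))"
    by (rule polar_log; fact)
  have "(\<integral>\<^sup>+x. ennreal (hh x) * f (- ln (norm x)) \<partial>lborel) = 
      (\<integral>\<^sup>+\<theta>. f \<theta> \<partial>distr (density lborel (\<lambda>x. ennreal (hh x))) borel (\<lambda>x. - ln (norm x)))"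
    by (simp add: nn_integral_distr nn_integral_density)
  also have "\<dots> = (\<integral>\<^sup>+\<theta>. ennreal (real DIM('a) * m * exp (- (real DIM('a) * \<theta>))) * f \<theta> \<partial>lborel)"
    by (subst P, subst nn_integral_density) measurable
  finally show ?thesis .
qed

lemma polar_log_integral:
  fixes hh :: "'a::euclidean_space \<Rightarrow> real" and f :: "real \<Rightarrow> real"
  assumes [measurable]: "hh \<in> borel_measurable borel" and nonneg: "\<And>x. hh x \<ge> 0"
    and homog: "\<And>t x. t > 0 \<Longrightarrow> hh (t *\<^sub>R x) = hh x"
    and m: "(\<integral>\<^sup>+x. ennreal (hh x) * indicator (ball 0 1) x \<partial>lborel) = ennreal m" "m \<ge> 0"
    and [measurable]: "f \<in> borel_measurable borel"
  shows "integrable lborel (\<lambda>x. hh x * f (- ln (norm x))) \<longleftrightarrow>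
         integrable lborel (\<lambda>\<theta>. real DIM('a) * m * exp (- (real DIM('a) * \<theta>)) * f \<theta>)"
    and "(\<integral>x. hh x * f (- ln (norm x)) \<partial>lborel)
       = (\<integral>\<theta>. real DIM('a) * m * exp (- (real DIM('a) * \<theta>)) * f \<theta> \<partial>lborel)"
proof -
  have P: "distr (density lborel (\<lambda>x. ennreal (hh x))) borel (\<lambda>x. - ln (norm x))
       = density lborel (\<lambda>\<theta>. ennreal (real DIM('a) * m * exp (- (real DIM('a) * \<theta>))))"
    by (rule polar_log; fact)
  let ?D = "distr (density lborel (\<lambda>x. ennreal (hh x))) borel (\<lambda>x. - ln (norm x))"
  have "integrable lborel (\<lambda>x. hh x * f (- ln (norm x))) \<longleftrightarrow> integrable ?D f"
    by (subst integrable_distr_eq, measurable) (simp add: integrable_density nonneg)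
  also have "\<dots> \<longleftrightarrow> integrable lborel (\<lambda>\<theta>. real DIM('a) * m * exp (- (real DIM('a) * \<theta>)) * f \<theta>)"
    using m(2) by (subst P, subst integrable_density) auto
  finally show "integrable lborel (\<lambda>x. hh x * f (- ln (norm x))) \<longleftrightarrow>
         integrable lborel (\<lambda>\<theta>. real DIM('a) * m * exp (- (real DIM('a) * \<theta>)) * f \<theta>)" .
  have "(\<integral>x. hh x * f (- ln (norm x)) \<partial>lborel) = integral\<^sup>L ?D f"
    by (subst integral_distr, measurable) (simp add: integral_density nonneg)
  also have "\<dots> = (\<integral>\<theta>. real DIM('a) * m * exp (- (real DIM('a) * \<theta>)) * f \<theta> \<partial>lborel)"
    using m(2) by (subst P, subst integral_density) auto
  finally show "(\<integral>x. hh x * f (- ln (norm x)) \<partial>lborel)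
       = (\<integral>\<theta>. real DIM('a) * m * exp (- (real DIM('a) * \<theta>)) * f \<theta> \<partial>lborel)" .
qed

lemma bounded_weight_mass:
  fixes hh :: "'a::euclidean_space \<Rightarrow> real"
  assumes [measurable]: "hh \<in> borel_measurable borel" and nonneg: "\<And>x. hh x \<ge> 0" and bound: "\<And>x. hh x \<le> B"
  obtains m where "(\<integral>\<^sup>+x. ennreal (hh x) * indicator (ball 0 1) x \<partial>lborel) = ennreal m" "m \<ge> 0"
proof -
  have "(\<integral>\<^sup>+x. ennreal (hh x) * indicator (ball 0 1) x \<partial>lborel) \<le> (\<integral>\<^sup>+x. ennreal B * indicator (ball (0::'a) 1) x \<partial>lborel)"
    by (intro nn_integral_mono) (auto simp: indicator_def bound ennreal_leI)
  also have "\<dots> < \<infinity>"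
    using emeasure_lborel_ball_finite[of "0::'a" 1] by (subst nn_integral_cmult, measurable, subst nn_integral_indicator) (simp_all add: ennreal_mult_less_top)
  finally show ?thesis using that
    by (metis ennreal_cases less_irrefl infinity_ennreal_def)
qed

section \<open>Gamma and Gaussian integrals, and the moments of the sphere\<close>

text \<open>The substitution \<open>t = exp (- (2 * \<theta>))\<close> in Euler's integral, carried
  out as the logarithmic polar formula in dimension one with the indicator of the positive half line
  as weight, followed by a scaling by 2.\<close>

lemma Gamma_log_integral:
  assumes "z > 0"
  shows "(\<integral>\<^sup>+\<theta>. ennreal (exp (- exp (- (2 * \<theta>))) * exp (- (2 * z * \<theta>))) \<partial>lborel) = ennreal (Gamma z / 2)"
proof -
  define f where "f \<theta> = ennreal (exp (- exp (- \<theta>)) * exp (- ((z - 1) * \<theta>)))" for \<theta> :: real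
  have [measurable]: "f \<in> borel_measurable borel" unfolding f_def by measurable
  have i: "(\<integral>\<^sup>+x. ennreal (indicator {0<..} (x::real)) * indicator (ball 0 1) x \<partial>lborel) = ennreal 1"
  proof -
    have "(\<integral>\<^sup>+x. ennreal (indicator {0<..} (x::real)) * indicator (ball 0 1) x \<partial>lborel) = (\<integral>\<^sup>+x. indicator {0<..<1::real} x \<partial>lborel)"
      by (intro nn_integral_cong) (auto simp: indicator_def)
    thus ?thesis by simp
  qed
  have "ennreal (Gamma z) = (\<integral>\<^sup>+t. ennreal (indicator {0..} t * t powr (z - 1) / exp t) \<partial>lborel)"
    by (rule Gamma_conv_nn_integral_real) (rule assms)
  also have "\<dots> = (\<integral>\<^sup>+t. ennreal (indicator {0<..} (t::real)) * f (- ln (norm t)) \<partial>lborel)"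
  proof (rule nn_integral_cong_AE)
    show "AE t in lborel. ennreal (indicator {0..} t * t powr (z - 1) / exp t) = ennreal (indicator {0<..} t) * f (- ln (norm t))"
      using AE_lborel_singleton[of 0]
      by eventually_elim (auto simp: f_def indicator_def powr_def exp_minus field_simps)
  qed
  also have "\<dots> = (\<integral>\<^sup>+\<theta>. ennreal (real DIM(real) * 1 * exp (- (real DIM(real) * \<theta>))) * f \<theta> \<partial>lborel)"
    by (rule polar_log_nn_integral[OF _ _ _ i]) (auto simp: indicator_def zero_less_mult_iff)
  also have "\<dots> = (\<integral>\<^sup>+\<theta>. ennreal (exp (- exp (- \<theta>)) * exp (- (z * \<theta>))) \<partial>lborel)"
    by (intro nn_integral_cong) (simp add: f_def algebra_simps flip: ennreal_mult exp_add)
  also have "\<dots> = ennreal (2 ^ DIM(real)) * (\<integral>\<^sup>+\<theta>. ennreal (exp (- exp (- (2 *\<^sub>R \<theta>))) * exp (- (z * (2 *\<^sub>R \<theta>)))) \<partial>lborel)"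
    by (rule nn_integral_lborel_scale) auto
  also have "\<dots> = 2 * (\<integral>\<^sup>+\<theta>. ennreal (exp (- exp (- (2 * \<theta>))) * exp (- (2 * z * \<theta>))) \<partial>lborel)"
    by (simp add: mult_ac)
  finally have "ennreal (1 / 2) * ennreal (Gamma z) = ennreal (1 / 2) * (2 * (\<integral>\<^sup>+\<theta>. ennreal (exp (- exp (- (2 * \<theta>))) * exp (- (2 * z * \<theta>))) \<partial>lborel))"
    by simp
  also have "\<dots> = (\<integral>\<^sup>+\<theta>. ennreal (exp (- exp (- (2 * \<theta>))) * exp (- (2 * z * \<theta>))) \<partial>lborel)"
  proof -
    have "ennreal (1 / 2) * 2 = ennreal (1 / 2 * 2)" by (subst ennreal_mult) simp_all
    thus ?thesis by (simp only: mult.assoc[symmetric]) simp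
  qed
  finally show ?thesis using Gamma_real_pos[OF assms] by (subst (asm) ennreal_mult[symmetric]) simp_all
qed

lemma gaussian_exp_nn_integral_real:
  "(\<integral>\<^sup>+y. ennreal (exp (a * y - y\<^sup>2)) \<partial>lborel) = ennreal (sqrt pi * exp (a\<^sup>2 / 4))"
proof -
  \<comment> \<open>Completing the square turns the integrand into a multiple of the normal density
    with mean a/2 and variance 1/2.\<close>
  have "exp (a * y - y\<^sup>2) = (sqrt pi * exp (a\<^sup>2 / 4)) * normal_density (a / 2) (sqrt (1 / 2)) y" for y
  proof -
    have "a * y - y\<^sup>2 = a\<^sup>2 / 4 + - (y - a / 2)\<^sup>2" by (simp add: power2_eq_square algebra_simps)
    hence "exp (a * y - y\<^sup>2) = exp (a\<^sup>2 / 4) * exp (- (y - a / 2)\<^sup>2)" by (simp only: exp_add)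
    thus ?thesis by (simp add: normal_density_def)
  qed
  hence "(\<integral>\<^sup>+y. ennreal (exp (a * y - y\<^sup>2)) \<partial>lborel) =
     ennreal (sqrt pi * exp (a\<^sup>2 / 4)) * (\<integral>\<^sup>+y. ennreal (normal_density (a / 2) (sqrt (1 / 2)) y) \<partial>lborel)"
    by (simp add: ennreal_mult nn_integral_cmult)
  also have "(\<integral>\<^sup>+y. ennreal (normal_density (a / 2) (sqrt (1 / 2)) y) \<partial>lborel) = ennreal 1"
    by (subst nn_integral_eq_integral) (auto simp: integrable_normal_density integral_normal_density)
  finally show ?thesis by simp
qed

lemma gaussian_exp_nn_integral:
  fixes \<xi> :: "'a::euclidean_space"
  shows "(\<integral>\<^sup>+x. ennreal (exp (\<xi> \<bullet> x) * exp (- (norm x)\<^sup>2)) \<partial>lborel) = ennreal (pi powr (real DIM('a) / 2) * exp ((norm \<xi>)\<^sup>2 / 4))"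
proof -
  have e: "ennreal (exp (\<xi> \<bullet> x) * exp (- (norm x)\<^sup>2)) = (\<Prod>b\<in>Basis. ennreal (exp ((\<xi> \<bullet> b) * (x \<bullet> b) - (x \<bullet> b)\<^sup>2)))" for x
  proof -
    have "exp (\<xi> \<bullet> x) * exp (- (norm x)\<^sup>2) = exp (\<Sum>b\<in>Basis. (\<xi> \<bullet> b) * (x \<bullet> b) - (x \<bullet> b)\<^sup>2)"
      by (simp add: euclidean_inner[of \<xi> x] power2_norm_eq_inner[unfolded power2_eq_square] euclidean_inner[of x x] sum_subtractf power2_eq_square flip: exp_add)
    also have "\<dots> = (\<Prod>b\<in>Basis. exp ((\<xi> \<bullet> b) * (x \<bullet> b) - (x \<bullet> b)\<^sup>2))" by (simp add: exp_sum)
    finally show ?thesis by (simp add: prod_ennreal)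
  qed
  have "(\<integral>\<^sup>+x. ennreal (exp (\<xi> \<bullet> x) * exp (- (norm x)\<^sup>2)) \<partial>lborel) = (\<Prod>b\<in>Basis. (\<integral>\<^sup>+y. ennreal (exp ((\<xi> \<bullet> b) * y - y\<^sup>2)) \<partial>lborel))"
    unfolding e by (rule nn_integral_lborel_prod) auto
  also have "\<dots> = (\<Prod>b\<in>Basis. ennreal (sqrt pi * exp ((\<xi> \<bullet> b)\<^sup>2 / 4)))"
    by (simp only: gaussian_exp_nn_integral_real)
  also have "\<dots> = ennreal (\<Prod>b\<in>(Basis::'a set). sqrt pi * exp ((\<xi> \<bullet> b)\<^sup>2 / 4))" by (simp add: prod_ennreal)
  also have "(\<Prod>b\<in>(Basis::'a set). sqrt pi * exp ((\<xi> \<bullet> b)\<^sup>2 / 4)) = sqrt pi ^ DIM('a) * exp (\<Sum>b\<in>Basis. (\<xi> \<bullet> b)\<^sup>2 / 4)"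
    by (simp add: prod.distrib exp_sum)
  also have "(\<Sum>b\<in>Basis. (\<xi> \<bullet> b)\<^sup>2 / 4) = (norm \<xi>)\<^sup>2 / 4"
    by (simp add: power2_norm_eq_inner[unfolded power2_eq_square] euclidean_inner[of \<xi> \<xi>] power2_eq_square sum_divide_distrib)
  also have "sqrt pi ^ DIM('a) = pi powr (real DIM('a) / 2)"
    by (simp add: powr_half_sqrt[symmetric] powr_powr flip: powr_realpow)
  finally show ?thesis .
qed

text \<open>The sum is known only for t different from 0, but a power series is continuous at 0, so
  its constant term is the limit of zeros.\<close>

lemma even_power_series_zero_0:
  fixes a :: "nat \<Rightarrow> real"
  assumes "\<And>t. t \<noteq> 0 \<Longrightarrow> (\<lambda>k. a k * t ^ (2 * k)) sums 0"
  shows "a 0 = 0"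
proof -
  define A where "A n = (if even n then a (n div 2) else 0)" for n
  define f where "f t = (if t = 0 then a 0 else (0::real))" for t :: real
  have "(\<lambda>n. A n * t ^ n) sums f t" for t
  proof (cases "t = 0")
    case False
    have sm: "strict_mono (\<lambda>k::nat. 2 * k)" by (auto intro: strict_monoI)
    have "A n * t ^ n = 0" if "n \<notin> range (\<lambda>k. 2 * k)" for n
      using that by (auto simp: A_def elim!: evenE)
    from sums_mono_reindex[OF sm, of "\<lambda>n. A n * t ^ n" "f t", OF this] assms[OF False] False
    show ?thesis by (simp add: A_def f_def)
  next
    case True
    thus ?thesis using powser_sums_zero[of A] by (simp add: A_def f_def)
  qed
  hence "(f \<longlongrightarrow> A 0) (at 0)" by (intro powser_limit_0[of 1 A f]) auto
  moreover have "(f \<longlongrightarrow> 0) (at 0)"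
    by (rule tendsto_eventually) (auto simp: f_def eventually_at_filter)
  ultimately have "A 0 = 0" using tendsto_unique[of "at (0::real)"] by auto
  thus ?thesis by (simp add: A_def)
qed

text \<open>After the constant term is removed, division by \<open>t^2\<close> gives a series of the
  same kind. This division is why the hypothesis omits t = 0.\<close>

lemma even_power_series_zero:
  fixes a :: "nat \<Rightarrow> real"
  assumes "\<And>t. t \<noteq> 0 \<Longrightarrow> (\<lambda>k. a k * t ^ (2 * k)) sums 0"
  shows "a n = 0"
  using assms
proof (induction n arbitrary: a)
  case 0
  show ?case by (rule even_power_series_zero_0[OF 0])
next
  case (Suc n)
  have "(\<lambda>k. a (Suc k) * t ^ (2 * k)) sums 0" if t: "t \<noteq> 0" for t
  proof -
    have "(\<lambda>k. a (Suc k) * t ^ (2 * Suc k)) sums 0"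
      using sums_Suc_iff[of "\<lambda>k. a k * t ^ (2 * k)" 0] Suc.prems[OF t] even_power_series_zero_0[OF Suc.prems] by simp
    hence "(\<lambda>k. a (Suc k) * t ^ (2 * Suc k) / t\<^sup>2) sums (0 / t\<^sup>2)" by (rule sums_divide)
    thus ?thesis using t by (simp add: power2_eq_square)
  qed
  from Suc.IH[OF this] show ?case by simp
qed

lemma even_power_series_unique:
  fixes a b :: "nat \<Rightarrow> real"
  assumes "\<And>t. (\<lambda>k. a k * t ^ (2 * k)) sums f t" "\<And>t. (\<lambda>k. b k * t ^ (2 * k)) sums f t"
  shows "a = b"
proof
  fix k
  have "(\<lambda>k. (a k - b k) * t ^ (2 * k)) sums 0" for t
    using sums_diff[OF assms(1)[of t] assms(2)[of t]] by (simp add: left_diff_distrib)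
  from even_power_series_zero[of "\<lambda>k. a k - b k", OF this] have "a k - b k = 0" .
  thus "a k = b k" by simp
qed

text \<open>The angular mass \<open>m k\<close> is found from the Gaussian integral. Polar
  coordinates express each Gaussian moment by \<open>m k\<close> and a Gamma value, while the
  generating function of all moments is a Gaussian integral of cosh, known in closed form. Comparing
  coefficients gives \<open>m k\<close>.\<close>

lemma sphere_moment:
  fixes \<xi> :: "'a::euclidean_space"
  obtains m where "\<And>k. (\<integral>\<^sup>+x. ennreal (((\<xi> \<bullet> x) / norm x) ^ (2 * k)) * indicator (ball (0::'a) 1) x \<partial>lborel) = ennreal (m k)"
    "\<And>k. m k \<ge> 0"
    "\<And>k. real DIM('a) * m k / fact (2 * k) =
       2 * pi powr (real DIM('a) / 2) * (norm \<xi> / 2) ^ (2 * k) / (fact k * Gamma (real k + real DIM('a) / 2))"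
proof -
  let ?d = "real DIM('a)"
  define hh where "hh k x = ((\<xi> \<bullet> x) / norm x) ^ (2 * k)" for k and x :: 'a
  have [measurable]: "hh k \<in> borel_measurable borel" for k unfolding hh_def by measurable
  have nonneg: "hh k x \<ge> 0" for k x by (simp add: hh_def)
  have bound: "hh k x \<le> norm \<xi> ^ (2 * k)" for k x
  proof -
    have "\<bar>\<xi> \<bullet> x\<bar> / norm x \<le> norm \<xi>" using Cauchy_Schwarz_ineq2[of \<xi> x] by (cases "x = 0") (auto simp: divide_le_eq)
    hence "(\<bar>\<xi> \<bullet> x\<bar> / norm x) ^ (2 * k) \<le> norm \<xi> ^ (2 * k)" by (intro power_mono) auto
    moreover have "\<bar>\<xi> \<bullet> x\<bar> ^ (2 * k) = (\<xi> \<bullet> x) ^ (2 * k)" by (rule power_even_abs) simp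
    ultimately show ?thesis by (simp add: hh_def power_divide)
  qed
  have homog: "hh k (t *\<^sub>R x) = hh k x" if "t > 0" for t k x using that by (simp add: hh_def)
  have "\<exists>m. (\<integral>\<^sup>+x. ennreal (hh k x) * indicator (ball 0 1) x \<partial>lborel) = ennreal m \<and> m \<ge> 0" for k
    using bounded_weight_mass[of "hh k", OF _ nonneg bound] by auto
  then obtain m where m: "\<And>k. (\<integral>\<^sup>+x. ennreal (hh k x) * indicator (ball 0 1) x \<partial>lborel) = ennreal (m k)" "\<And>k. m k \<ge> 0"
    by metis
  \<comment> \<open>The Gaussian moment of \<open>(\<xi> \<bullet> x) ^ (2 * k)\<close> in polar
    form: angular mass times radial integral.\<close>
  define c where "c k = ?d * m k * (Gamma (real k + ?d / 2) / 2)" for k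
  have zpos: "real k + ?d / 2 > 0" for k by (simp add: add_nonneg_pos)
  have c_pos: "c k \<ge> 0" for k using m(2) Gamma_real_pos[OF zpos[of k]] by (simp add: c_def)
  have c: "(\<integral>\<^sup>+x. ennreal ((\<xi> \<bullet> x) ^ (2 * k) * exp (- (norm x)\<^sup>2)) \<partial>lborel) = ennreal (c k)" for k
  proof -
    define f where "f \<theta> = ennreal (exp (- (2 * real k * \<theta>)) * exp (- exp (- (2 * \<theta>))))" for \<theta> :: real
    have "(\<integral>\<^sup>+x. ennreal ((\<xi> \<bullet> x) ^ (2 * k) * exp (- (norm x)\<^sup>2)) \<partial>lborel) = (\<integral>\<^sup>+x. ennreal (hh k x) * f (- ln (norm x)) \<partial>lborel)"
    proof (rule nn_integral_cong_AE)
      show "AE x in lborel. ennreal ((\<xi> \<bullet> x) ^ (2 * k) * exp (- (norm x)\<^sup>2)) = ennreal (hh k x) * f (- ln (norm x))"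
        using AE_lborel_singleton[of 0]
      proof eventually_elim
        fix x :: 'a assume x: "x \<noteq> 0"
        have "exp (2 * ln (norm x)) = (norm x)\<^sup>2" using x by (simp add: exp_double)
        moreover have "exp (2 * real k * ln (norm x)) = norm x ^ (2 * k)" using x by (simp add: exp_of_nat_mult[of "2 * k", simplified])
        ultimately have "f (- ln (norm x)) = ennreal (norm x ^ (2 * k) * exp (- (norm x)\<^sup>2))" by (simp add: f_def)
        moreover have "hh k x * (norm x ^ (2 * k)) = (\<xi> \<bullet> x) ^ (2 * k)" using x by (simp add: hh_def power_divide)
        ultimately show "ennreal ((\<xi> \<bullet> x) ^ (2 * k) * exp (- (norm x)\<^sup>2)) = ennreal (hh k x) * f (- ln (norm x))"
          using nonneg[of k x] by (simp add: mult.assoc[symmetric] flip: ennreal_mult)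
      qed
    qed
    also have "\<dots> = (\<integral>\<^sup>+\<theta>. ennreal (?d * m k * exp (- (?d * \<theta>))) * f \<theta> \<partial>lborel)"
      by (rule polar_log_nn_integral[OF _ nonneg homog m]) (auto simp: f_def)
    also have "\<dots> = (\<integral>\<^sup>+\<theta>. ennreal (?d * m k) * ennreal (exp (- exp (- (2 * \<theta>))) * exp (- (2 * (real k + ?d / 2) * \<theta>))) \<partial>lborel)"
      by (intro nn_integral_cong) (simp add: f_def m algebra_simps flip: ennreal_mult exp_add)
    also have "\<dots> = ennreal (?d * m k) * ennreal (Gamma (real k + ?d / 2) / 2)"
      by (subst nn_integral_cmult, simp) (simp only: Gamma_log_integral[OF zpos])
    also have "\<dots> = ennreal (c k)" using m(2)[of k] Gamma_real_pos[OF zpos[of k]]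
      by (simp add: c_def flip: ennreal_mult)
    finally show ?thesis .
  qed
  \<comment> \<open>Taking cosh instead of exp keeps only even powers. All terms are then
    nonnegative, so sum and integral may be exchanged without estimates.\<close>
  have s1: "(\<lambda>k. c k / fact (2 * k) * t ^ (2 * k)) sums (pi powr (?d / 2) * exp ((norm \<xi>)\<^sup>2 * t\<^sup>2 / 4))" for t
  proof -
    define E where "E x = exp (- (norm x)\<^sup>2)" for x :: 'a
    have split: "ennreal (1 / 2 * A + 1 / 2 * B) = ennreal (1 / 2) * ennreal A + ennreal (1 / 2) * ennreal B"
      if "A \<ge> 0" "B \<ge> 0" for A B :: real
    proof -
      have "ennreal (1 / 2 * A + 1 / 2 * B) = ennreal (1 / 2 * A) + ennreal (1 / 2 * B)"
        using that by (intro ennreal_plus) auto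
      thus ?thesis using that by (simp only: ennreal_mult zero_le_divide_1_iff zero_le_numeral)
    qed
    have cosh: "(\<lambda>k. (t * (\<xi> \<bullet> x)) ^ (2 * k) / fact (2 * k)) sums cosh (t * (\<xi> \<bullet> x))" for x
    proof -
      have "strict_mono (\<lambda>k::nat. 2 * k)" (is ?S) by (auto intro: strict_monoI)
      have z: "(if even n then (t * (\<xi> \<bullet> x)) ^ n /\<^sub>R fact n else 0) = 0" if "n \<notin> range (\<lambda>k. 2 * k)" for n
        using that by (auto elim!: evenE)
      from sums_mono_reindex[OF \<open>?S\<close>, of "\<lambda>n. if even n then (t * (\<xi> \<bullet> x)) ^ n /\<^sub>R fact n else 0" "cosh (t * (\<xi> \<bullet> x))", OF z] 
      show ?thesis using cosh_converges[of "t * (\<xi> \<bullet> x)"] by (simp add: divide_inverse mult.commute)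
    qed
    have "(\<Sum>k. ennreal (c k / fact (2 * k) * t ^ (2 * k))) = (\<Sum>k. \<integral>\<^sup>+x. ennreal ((t * (\<xi> \<bullet> x)) ^ (2 * k) / fact (2 * k) * E x) \<partial>lborel)"
    proof (intro suminf_cong)
      fix k
      have "(\<integral>\<^sup>+x. ennreal ((t * (\<xi> \<bullet> x)) ^ (2 * k) / fact (2 * k) * E x) \<partial>lborel) = 
        (\<integral>\<^sup>+x. ennreal (t ^ (2 * k) / fact (2 * k)) * ennreal ((\<xi> \<bullet> x) ^ (2 * k) * exp (- (norm x)\<^sup>2)) \<partial>lborel)"
        by (intro nn_integral_cong) (simp add: E_def power_mult_distrib flip: ennreal_mult)
      also have "\<dots> = ennreal (t ^ (2 * k) / fact (2 * k)) * ennreal (c k)"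
        by (subst nn_integral_cmult) (simp_all add: c)
      also have "\<dots> = ennreal (c k / fact (2 * k) * t ^ (2 * k))"
      proof -
        have "0 \<le> t ^ (2 * k) / fact (2 * k)" by simp
        from ennreal_mult[OF this c_pos[of k]] show ?thesis by (simp add: mult.commute)
      qed
      finally show "ennreal (c k / fact (2 * k) * t ^ (2 * k)) = (\<integral>\<^sup>+x. ennreal ((t * (\<xi> \<bullet> x)) ^ (2 * k) / fact (2 * k) * E x) \<partial>lborel)" ..
    qed
    also have "\<dots> = (\<integral>\<^sup>+x. (\<Sum>k. ennreal ((t * (\<xi> \<bullet> x)) ^ (2 * k) / fact (2 * k) * E x)) \<partial>lborel)"
      by (rule nn_integral_suminf[symmetric]) (simp add: E_def)
    also have "\<dots> = (\<integral>\<^sup>+x. ennreal (1 / 2) * ennreal (exp ((t *\<^sub>R \<xi>) \<bullet> x) * exp (- (norm x)\<^sup>2))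
         + ennreal (1 / 2) * ennreal (exp ((- (t *\<^sub>R \<xi>)) \<bullet> x) * exp (- (norm x)\<^sup>2)) \<partial>lborel)"
    proof (intro nn_integral_cong)
      fix x :: 'a
      have "(\<lambda>k. ennreal ((t * (\<xi> \<bullet> x)) ^ (2 * k) / fact (2 * k) * E x)) sums ennreal (cosh (t * (\<xi> \<bullet> x)) * E x)"
        by (subst sums_ennreal, simp add: E_def, simp add: E_def) (rule sums_mult2[OF cosh])
      hence "(\<Sum>k. ennreal ((t * (\<xi> \<bullet> x)) ^ (2 * k) / fact (2 * k) * E x)) = ennreal (cosh (t * (\<xi> \<bullet> x)) * E x)"
        by (simp add: sums_iff)
      also have "cosh (t * (\<xi> \<bullet> x)) * E x = 1 / 2 * (exp ((t *\<^sub>R \<xi>) \<bullet> x) * exp (- (norm x)\<^sup>2)) + 1 / 2 * (exp ((- (t *\<^sub>R \<xi>)) \<bullet> x) * exp (- (norm x)\<^sup>2))"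
        by (simp add: cosh_def E_def algebra_simps)
      finally show "(\<Sum>k. ennreal ((t * (\<xi> \<bullet> x)) ^ (2 * k) / fact (2 * k) * E x)) =
        ennreal (1 / 2) * ennreal (exp ((t *\<^sub>R \<xi>) \<bullet> x) * exp (- (norm x)\<^sup>2))
         + ennreal (1 / 2) * ennreal (exp ((- (t *\<^sub>R \<xi>)) \<bullet> x) * exp (- (norm x)\<^sup>2))"
        by (simp only: split exp_ge_zero mult_nonneg_nonneg)
    qed
    also have "\<dots> = ennreal (1 / 2) * ennreal (pi powr (?d / 2) * exp ((norm (t *\<^sub>R \<xi>))\<^sup>2 / 4)) +
       ennreal (1 / 2) * ennreal (pi powr (?d / 2) * exp ((norm (- (t *\<^sub>R \<xi>)))\<^sup>2 / 4))"
      by (subst nn_integral_add, simp, simp, subst (1 2) nn_integral_cmult, simp, simp)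
         (simp only: gaussian_exp_nn_integral)
    also have "\<dots> = ennreal (pi powr (?d / 2) * exp ((norm \<xi>)\<^sup>2 * t\<^sup>2 / 4))"
      by (subst split[symmetric]) (simp_all add: power_mult_distrib mult.commute)
    finally have "(\<Sum>k. ennreal (c k / fact (2 * k) * t ^ (2 * k))) = ennreal (pi powr (?d / 2) * exp ((norm \<xi>)\<^sup>2 * t\<^sup>2 / 4))" .
    hence "(\<lambda>k. ennreal (c k / fact (2 * k) * t ^ (2 * k))) sums ennreal (pi powr (?d / 2) * exp ((norm \<xi>)\<^sup>2 * t\<^sup>2 / 4))"
      by (simp add: sums_iff)
    thus ?thesis by (subst (asm) sums_ennreal) (auto simp: c_pos)
  qed
  have s2: "(\<lambda>k. pi powr (?d / 2) * (norm \<xi> / 2) ^ (2 * k) / fact k * t ^ (2 * k)) sums (pi powr (?d / 2) * exp ((norm \<xi>)\<^sup>2 * t\<^sup>2 / 4))" for t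
  proof -
    have "(\<lambda>k. pi powr (?d / 2) * ((((norm \<xi>)\<^sup>2 * t\<^sup>2 / 4) ^ k) /\<^sub>R fact k)) sums (pi powr (?d / 2) * exp ((norm \<xi>)\<^sup>2 * t\<^sup>2 / 4))"
      by (intro sums_mult exp_converges)
    also have "(\<lambda>k. pi powr (?d / 2) * ((((norm \<xi>)\<^sup>2 * t\<^sup>2 / 4) ^ k) /\<^sub>R fact k)) = (\<lambda>k. pi powr (?d / 2) * (norm \<xi> / 2) ^ (2 * k) / fact k * t ^ (2 * k))"
    proof
      fix k
      have "(norm \<xi>)\<^sup>2 * t\<^sup>2 / 4 = (norm \<xi> / 2)\<^sup>2 * t\<^sup>2" by (simp add: power_divide)
      hence "((norm \<xi>)\<^sup>2 * t\<^sup>2 / 4) ^ k = (norm \<xi> / 2) ^ (2 * k) * t ^ (2 * k)"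
        by (simp only: power_mult_distrib power_mult)
      thus "pi powr (?d / 2) * ((((norm \<xi>)\<^sup>2 * t\<^sup>2 / 4) ^ k) /\<^sub>R fact k) = pi powr (?d / 2) * (norm \<xi> / 2) ^ (2 * k) / fact k * t ^ (2 * k)"
        by (simp only: real_scaleR_def divide_inverse mult_ac)
    qed
    finally show ?thesis .
  qed
  have "(\<lambda>k. c k / fact (2 * k)) = (\<lambda>k. pi powr (?d / 2) * (norm \<xi> / 2) ^ (2 * k) / fact k)"
    by (rule even_power_series_unique[OF s1 s2])
  hence "?d * m k * Gamma (real k + ?d / 2) / 2 / fact (2 * k) = pi powr (?d / 2) * (norm \<xi> / 2) ^ (2 * k) / fact k" for k
    by (simp add: c_def fun_eq_iff)
  hence "?d * m k / fact (2 * k) = 2 * pi powr (?d / 2) * (norm \<xi> / 2) ^ (2 * k) / (fact k * Gamma (real k + ?d / 2))" for k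
  proof -
    assume *: "\<And>k. ?d * m k * Gamma (real k + ?d / 2) / 2 / fact (2 * k) = pi powr (?d / 2) * (norm \<xi> / 2) ^ (2 * k) / fact k"
    define G where "G = Gamma (real k + ?d / 2)"
    have G: "G > 0" unfolding G_def by (rule Gamma_real_pos[OF zpos])
    have "?d * m k / fact (2 * k) = (?d * m k * G / 2 / fact (2 * k)) * (2 / G)" using G by simp
    also have "\<dots> = pi powr (?d / 2) * (norm \<xi> / 2) ^ (2 * k) / fact k * (2 / G)" unfolding G_def * ..
    also have "\<dots> = 2 * pi powr (?d / 2) * (norm \<xi> / 2) ^ (2 * k) / (fact k * G)" by simp
    finally show ?thesis unfolding G_def .
  qed
  with m show ?thesis by (intro that[of m]) (auto simp: hh_def)
qed

section \<open>Uniqueness of the Born approximation\<close>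

lemma continuous_bounded_unit_interval:
  fixes g :: "real \<Rightarrow> real"
  assumes "continuous_on UNIV g"
  shows "\<exists>B. \<forall>u. 0 \<le> u \<longrightarrow> u \<le> 1 \<longrightarrow> \<bar>g u\<bar> \<le> B"
proof -
  have "compact (g ` {0..1})" by (intro compact_continuous_image continuous_on_subset[OF assms]) auto
  from compact_imp_bounded[OF this] show ?thesis by (force simp: bounded_iff)
qed

text \<open>In \<open>u = exp (- (2 * \<theta>))\<close> the hypothesis says that all power moments
  over the unit interval vanish. Weierstrass approximation extends this to continuous functions of
  u; bumps then localise it, and continuity of w turns an almost everywhere statement into a
  pointwise one.\<close>

lemma exp_moments_zero:
  fixes w :: "real \<Rightarrow> real"
  assumes int: "integrable lborel w" and mom: "\<And>j::nat. (\<integral>\<theta>. w \<theta> * exp (- (2 * real j * \<theta>)) \<partial>lborel) = 0"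
    and supp: "\<And>\<theta>. \<theta> \<le> 0 \<Longrightarrow> w \<theta> = 0" and cont: "continuous_on {0<..} w"
  shows "w \<theta> = 0"
proof -
  have [measurable]: "w \<in> borel_measurable borel" using borel_measurable_integrable[OF int] by simp
  have bint: "integrable lborel (\<lambda>\<theta>. w \<theta> * g (exp (- (2 * \<theta>))))"
    if "\<And>u. 0 \<le> u \<Longrightarrow> u \<le> 1 \<Longrightarrow> \<bar>g u\<bar> \<le> B" and [measurable]: "g \<in> borel_measurable borel" for g :: "real \<Rightarrow> real" and B
  proof (rule Bochner_Integration.integrable_bound[of _ "\<lambda>\<theta>. B * w \<theta>"])
    show "AE \<theta> in lborel. norm (w \<theta> * g (exp (- (2 * \<theta>)))) \<le> norm (B * w \<theta>)"
    proof (rule AE_I2)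
      fix \<theta> :: real
      show "norm (w \<theta> * g (exp (- (2 * \<theta>)))) \<le> norm (B * w \<theta>)"
      proof (cases "\<theta> \<le> 0")
        case False
        hence "\<bar>g (exp (- (2 * \<theta>)))\<bar> \<le> \<bar>B\<bar>" using that(1)[of "exp (- (2 * \<theta>))"] by fastforce
        thus ?thesis unfolding real_norm_def abs_mult by (subst mult.commute) (rule mult_right_mono, simp_all)
      qed (simp add: supp)
    qed
  qed (use int in auto)
  have poly: "integrable lborel (\<lambda>\<theta>. w \<theta> * p (exp (- (2 * \<theta>)))) \<and> (\<integral>\<theta>. w \<theta> * p (exp (- (2 * \<theta>))) \<partial>lborel) = 0"
    if p: "real_polynomial_function p" for p
  proof -
    obtain a n where p: "p = (\<lambda>x. \<Sum>i\<le>n. a i * x ^ i)"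
      using p by (auto simp: real_polynomial_function_iff_sum)
    have m: "integrable lborel (\<lambda>\<theta>. w \<theta> * exp (- (2 * \<theta>)) ^ i)" for i
      by (rule bint[of "\<lambda>u. u ^ i" 1]) (auto simp: power_le_one)
    have z: "(\<integral>\<theta>. w \<theta> * exp (- (2 * \<theta>)) ^ i \<partial>lborel) = 0" for i
      using mom[of i] by (simp add: mult_ac flip: exp_of_nat_mult)
    have e: "w \<theta> * p (exp (- (2 * \<theta>))) = (\<Sum>i\<le>n. a i * (w \<theta> * exp (- (2 * \<theta>)) ^ i))" for \<theta>
      by (simp add: p sum_distrib_left mult_ac)
    show ?thesis unfolding e by (simp add: m z)
  qed
  have contz: "(\<integral>\<theta>. w \<theta> * g (exp (- (2 * \<theta>))) \<partial>lborel) = 0" if g: "continuous_on UNIV g" for g :: "real \<Rightarrow> real"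
  proof -
    have [measurable]: "g \<in> borel_measurable borel" using g by (rule borel_measurable_continuous_onI)
    obtain B where B: "\<And>u. 0 \<le> u \<Longrightarrow> u \<le> 1 \<Longrightarrow> \<bar>g u\<bar> \<le> B"
      using continuous_bounded_unit_interval[OF g] by blast
    have gi: "integrable lborel (\<lambda>\<theta>. w \<theta> * g (exp (- (2 * \<theta>))))" by (rule bint[of g B, OF B]) auto
    define I where "I = (\<integral>\<theta>. \<bar>w \<theta>\<bar> \<partial>lborel)"
    have "\<bar>\<integral>\<theta>. w \<theta> * g (exp (- (2 * \<theta>))) \<partial>lborel\<bar> \<le> \<epsilon> * I" if e: "\<epsilon> > 0" for \<epsilon>
    proof -
      obtain p where p: "real_polynomial_function p" "\<And>u. u \<in> {0..1} \<Longrightarrow> \<bar>g u - p u\<bar> < \<epsilon>"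
        using Stone_Weierstrass_real_polynomial_function[OF compact_Icc continuous_on_subset[OF g subset_UNIV] e, of 0 1] by blast
      note pp = poly[OF p(1)]
      have "(\<integral>\<theta>. w \<theta> * g (exp (- (2 * \<theta>))) \<partial>lborel) = (\<integral>\<theta>. w \<theta> * g (exp (- (2 * \<theta>))) - w \<theta> * p (exp (- (2 * \<theta>))) \<partial>lborel)"
        using pp gi by simp
      also have "norm \<dots> \<le> (\<integral>\<theta>. \<epsilon> * \<bar>w \<theta>\<bar> \<partial>lborel)"
      proof (rule Bochner_Integration.integral_norm_bound_integral)
        fix \<theta> :: real
        show "norm (w \<theta> * g (exp (- (2 * \<theta>))) - w \<theta> * p (exp (- (2 * \<theta>)))) \<le> \<epsilon> * \<bar>w \<theta>\<bar>"
        proof (cases "\<theta> \<le> 0")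
          case False
          hence "\<bar>g (exp (- (2 * \<theta>))) - p (exp (- (2 * \<theta>)))\<bar> \<le> \<epsilon>" using p(2)[of "exp (- (2 * \<theta>))"] by simp
          from mult_left_mono[OF this abs_ge_zero[of "w \<theta>"]] show ?thesis
            unfolding real_norm_def right_diff_distrib[symmetric] abs_mult by (simp only: mult.commute)
        qed (simp add: supp)
      qed (use int pp gi in auto)
      also have "\<dots> = \<epsilon> * I" by (simp add: I_def)
      finally show ?thesis by simp
    qed
    moreover have "I \<ge> 0" by (simp add: I_def)
    ultimately have "\<bar>\<integral>\<theta>. w \<theta> * g (exp (- (2 * \<theta>))) \<partial>lborel\<bar> \<le> 0 + \<epsilon>" if "\<epsilon> > 0" for \<epsilon>
    proof -
      have "\<epsilon> / (I + 1) > 0" using that \<open>I \<ge> 0\<close> by simp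
      hence "\<bar>\<integral>\<theta>. w \<theta> * g (exp (- (2 * \<theta>))) \<partial>lborel\<bar> \<le> \<epsilon> / (I + 1) * I" using \<open>\<And>\<epsilon>. \<epsilon> > 0 \<Longrightarrow> _ \<epsilon>\<close> by blast
      also have "\<dots> \<le> \<epsilon>" using that \<open>I \<ge> 0\<close> by (simp add: field_simps)
      finally show ?thesis by simp
    qed
    hence "\<bar>\<integral>\<theta>. w \<theta> * g (exp (- (2 * \<theta>))) \<partial>lborel\<bar> \<le> 0" by (rule field_le_epsilon)
    thus ?thesis by simp
  qed
  \<comment> \<open>\<sigma> is 1 or -1, so that positive and negative values of w are refuted
    together.\<close>
  have npos: "\<not> \<sigma> * w \<theta>0 > 0" if \<theta>0: "\<theta>0 > 0" and \<sigma>: "\<bar>\<sigma>\<bar> = 1" for \<theta>0 \<sigma>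
  proof
    assume pos: "\<sigma> * w \<theta>0 > 0"
    have "continuous_on {0<..} (\<lambda>\<theta>. \<sigma> * w \<theta>)" by (intro continuous_intros cont)
    hence "isCont (\<lambda>\<theta>. \<sigma> * w \<theta>) \<theta>0" using \<theta>0 by (simp add: continuous_on_eq_continuous_at)
    hence "\<forall>\<^sub>F \<theta> in nhds \<theta>0. \<sigma> * w \<theta> > 0"
      using pos tendsto_at_iff_tendsto_nhds[of "\<lambda>\<theta>. \<sigma> * w \<theta>" \<theta>0]
      by (intro order_tendstoD(1)[of "\<lambda>\<theta>. \<sigma> * w \<theta>"]) (simp_all add: isCont_def)
    then obtain \<delta> where \<delta>: "\<delta> > 0" "\<And>\<theta>. dist \<theta> \<theta>0 < \<delta> \<Longrightarrow> \<sigma> * w \<theta> > 0"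
      unfolding eventually_nhds_metric by auto
    define a b where "a = \<theta>0 - \<delta>" and "b = \<theta>0 + \<delta>"
    have ab: "\<sigma> * w \<theta> > 0" if "a < \<theta>" "\<theta> < b" for \<theta> using \<delta>(2)[of \<theta>] that by (auto simp: a_def b_def dist_real_def)
    \<comment> \<open>A quadratic bump in u, nonzero exactly between the images of a and b. The
      factor \<sigma> gives the integrand a sign, so a vanishing integral makes it vanish almost
      everywhere.\<close>
    define g where "g u = \<sigma> * max 0 ((u - exp (- (2 * b))) * (exp (- (2 * a)) - u))" for u
    have ind: "exp (- (2 * b)) < exp (- (2 * \<theta>)) \<longleftrightarrow> \<theta> < b" "exp (- (2 * \<theta>)) < exp (- (2 * a)) \<longleftrightarrow> a < \<theta>" for \<theta> by auto
    have gpos: "w \<theta> * g (exp (- (2 * \<theta>))) > 0" if "a < \<theta>" "\<theta> < b" for \<theta>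
      using mult_pos_pos[OF ab[OF that] mult_pos_pos[of "exp (- (2 * \<theta>)) - exp (- (2 * b))" "exp (- (2 * a)) - exp (- (2 * \<theta>))"]] that
      by (simp add: g_def max_def mult_ac)
    have gz: "w \<theta> * g (exp (- (2 * \<theta>))) = 0" if "\<not> (a < \<theta> \<and> \<theta> < b)" for \<theta>
    proof -
      have "a < b" using \<delta>(1) by (simp add: a_def b_def)
      have "\<theta> \<le> a \<or> \<theta> \<ge> b" using that by auto
      hence "(exp (- (2 * \<theta>)) - exp (- (2 * b))) * (exp (- (2 * a)) - exp (- (2 * \<theta>))) \<le> 0"
        using \<open>a < b\<close> by (auto simp: mult_le_0_iff)
      thus ?thesis by (simp add: g_def max_def)
    qed
    have gc: "continuous_on UNIV g" unfolding g_def by (intro continuous_intros)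
    have [measurable]: "g \<in> borel_measurable borel" using gc by (rule borel_measurable_continuous_onI)
    obtain B where B: "\<And>u. 0 \<le> u \<Longrightarrow> u \<le> 1 \<Longrightarrow> \<bar>g u\<bar> \<le> B"
      using continuous_bounded_unit_interval[OF gc] by blast
    have gi: "integrable lborel (\<lambda>\<theta>. w \<theta> * g (exp (- (2 * \<theta>))))" by (rule bint[of g B, OF B]) auto
    have "AE \<theta> in lborel. w \<theta> * g (exp (- (2 * \<theta>))) = 0"
    proof -
      have nn: "AE \<theta> in lborel. 0 \<le> w \<theta> * g (exp (- (2 * \<theta>)))"
        using gpos gz by (intro AE_I2) (metis less_imp_le order_refl)
      show ?thesis
        using integral_nonneg_eq_0_iff_AE[OF gi nn] contz[OF gc] by simp
    qed
    hence "AE \<theta> in lborel. \<theta> \<notin> {a<..<b}" by eventually_elim (use gpos in force)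
    hence "emeasure lborel {a<..<b} = 0" by (subst (asm) AE_iff_measurable[of "{a<..<b}"]) auto
    thus False using \<delta>(1) by (simp add: a_def b_def)
  qed
  show ?thesis
  proof (cases "\<theta> \<le> 0")
    case False
    thus ?thesis using npos[of \<theta> 1] npos[of \<theta> "-1"] by force
  qed (rule supp)
qed

section \<open>Radial integrals over the ball as Laplace transforms\<close>

lemma log_measurable:
  fixes F :: "real \<Rightarrow> real"
  assumes "continuous_on {0<..<1} F"
  shows "(\<lambda>\<theta>. indicator {0<..} \<theta> * (exp (- (c * \<theta>)) * F (exp (- \<theta>)))) \<in> borel_measurable borel"
proof -
  have "continuous_on {0<..} (\<lambda>\<theta>. exp (- (c * \<theta>)) * F (exp (- \<theta>)))"
    by (intro continuous_intros continuous_on_compose2[OF assms]) auto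
  from borel_measurable_continuous_on_indicator[OF _ this] show ?thesis by simp
qed

text \<open>Integrability can be read back from the ball only if \<open>m > 0\<close>, since a
  weight of mass zero says nothing about F. The integral identity holds in any case, with defaults
  on both sides.\<close>

lemma ball_integral_log:
  fixes hh :: "'a::euclidean_space \<Rightarrow> real"
  assumes hm[measurable]: "hh \<in> borel_measurable borel" and "\<And>x. hh x \<ge> 0"
    and "\<And>t x. t > 0 \<Longrightarrow> hh (t *\<^sub>R x) = hh x"
    and "(\<integral>\<^sup>+x. ennreal (hh x) * indicator (ball 0 1) x \<partial>lborel) = ennreal m" "m \<ge> 0"
    and F: "continuous_on {0<..<1} F" and f: "\<And>x. norm x < 1 \<Longrightarrow> x \<noteq> 0 \<Longrightarrow> f x = hh x * (F (norm x) * norm x powr c)"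
    and fm[measurable]: "f \<in> borel_measurable borel"
  shows "integrable lborel (\<lambda>\<theta>. indicator {0<..} \<theta> * (exp (- ((c + real DIM('a)) * \<theta>)) * F (exp (- \<theta>)))) \<Longrightarrow> set_integrable lborel (ball 0 1) f"
    and "m > 0 \<Longrightarrow> set_integrable lborel (ball 0 1) f \<Longrightarrow> integrable lborel (\<lambda>\<theta>. indicator {0<..} \<theta> * (exp (- ((c + real DIM('a)) * \<theta>)) * F (exp (- \<theta>))))"
    and "(LINT x:ball 0 1|lborel. f x) = real DIM('a) * m * laplace (\<lambda>\<theta>. F (exp (- \<theta>))) (c + real DIM('a))"
proof -
  define u where "u \<theta> = indicator {0<..} \<theta> * (exp (- (c * \<theta>)) * F (exp (- \<theta>)))" for \<theta>
  have [measurable]: "u \<in> borel_measurable borel" unfolding u_def by (rule log_measurable[OF F])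
  have ae: "AE x in lborel. indicator (ball 0 1) x *\<^sub>R f x = hh x * u (- ln (norm x))"
    using AE_lborel_singleton[of 0]
  proof eventually_elim
    fix x :: 'a assume x: "x \<noteq> 0"
    show "indicator (ball 0 1) x *\<^sub>R f x = hh x * u (- ln (norm x))"
    proof (cases "norm x < 1")
      case True
      thus ?thesis using x by (simp add: u_def f indicator_def powr_def mult.commute)
    next
      case False
      hence "norm x \<ge> 1" by simp
      hence "ln (norm x) \<ge> 0" by (rule ln_ge_zero)
      hence "\<not> - ln (norm x) > 0" by linarith
      hence "u (- ln (norm x)) = 0" by (simp add: u_def indicator_def)
      thus ?thesis using False by simp
    qed
  qed
  have mm: "(\<lambda>x. indicator (ball 0 1) x *\<^sub>R f x) \<in> borel_measurable lborel"
    "(\<lambda>x. hh x * u (- ln (norm x))) \<in> borel_measurable lborel" by measurable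
  have P: "integrable lborel (\<lambda>x. hh x * u (- ln (norm x))) \<longleftrightarrow>
         integrable lborel (\<lambda>\<theta>. real DIM('a) * m * exp (- (real DIM('a) * \<theta>)) * u \<theta>)"
    "(\<integral>x. hh x * u (- ln (norm x)) \<partial>lborel)
       = (\<integral>\<theta>. real DIM('a) * m * exp (- (real DIM('a) * \<theta>)) * u \<theta> \<partial>lborel)"
    by (rule polar_log_integral; (fact | measurable))+
  have e: "real DIM('a) * m * exp (- (real DIM('a) * \<theta>)) * u \<theta> =
     (real DIM('a) * m) * (indicator {0<..} \<theta> * (exp (- ((c + real DIM('a)) * \<theta>)) * F (exp (- \<theta>))))" for \<theta>
    by (simp add: u_def algebra_simps exp_add exp_diff exp_minus divide_inverse)
  have S: "set_integrable lborel (ball 0 1) f \<longleftrightarrow> integrable lborel (\<lambda>\<theta>. (real DIM('a) * m) * (indicator {0<..} \<theta> * (exp (- ((c + real DIM('a)) * \<theta>)) * F (exp (- \<theta>)))))"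
    unfolding set_integrable_def integrable_cong_AE[OF mm ae] P e ..
  show "set_integrable lborel (ball 0 1) f" if "integrable lborel (\<lambda>\<theta>. indicator {0<..} \<theta> * (exp (- ((c + real DIM('a)) * \<theta>)) * F (exp (- \<theta>))))"
    unfolding S using that by (rule integrable_mult_right)
  show "integrable lborel (\<lambda>\<theta>. indicator {0<..} \<theta> * (exp (- ((c + real DIM('a)) * \<theta>)) * F (exp (- \<theta>))))" if "m > 0" "set_integrable lborel (ball 0 1) f"
    using that unfolding S by simp
  have "(LINT x:ball 0 1|lborel. f x) = (\<integral>x. hh x * u (- ln (norm x)) \<partial>lborel)"
    unfolding set_lebesgue_integral_def by (rule integral_cong_AE[OF mm ae])
  also have "\<dots> = real DIM('a) * m * laplace (\<lambda>\<theta>. F (exp (- \<theta>))) (c + real DIM('a))"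
    unfolding P(2) e laplace_def by (rule Bochner_Integration.integral_mult_right_zero)
  finally show "(LINT x:ball 0 1|lborel. f x) = real DIM('a) * m * laplace (\<lambda>\<theta>. F (exp (- \<theta>))) (c + real DIM('a))" .
qed

lemma ball_mass: "(\<integral>\<^sup>+x. ennreal 1 * indicator (ball (0::'a::euclidean_space) 1) x \<partial>lborel) = ennreal (measure lborel (ball (0::'a) 1))"
proof -
  have "emeasure lborel (ball (0::'a) 1) \<noteq> \<infinity>" using emeasure_lborel_ball_finite[of "0::'a" 1] by simp
  thus ?thesis by (simp add: emeasure_eq_ennreal_measure)
qed

lemma ball_measure_pos: "measure lborel (ball (0::'a::euclidean_space) 1) > 0"
  using content_ball_pos[of 1 "0::'a"] by simp

lemma radial_measurable:
  fixes f :: "'a::euclidean_space \<Rightarrow> real"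
  assumes "continuous_on (ball 0 1 - {0}) f" "\<And>x. x \<notin> ball 0 1 - {0} \<Longrightarrow> f x = 0"
  shows "f \<in> borel_measurable borel"
proof -
  have "(\<lambda>x. indicator (ball 0 1 - {0}) x *\<^sub>R f x) \<in> borel_measurable borel"
    by (rule borel_measurable_continuous_on_indicator[OF _ assms(1)]) auto
  moreover have "(\<lambda>x. indicator (ball 0 1 - {0}) x *\<^sub>R f x) = f"
  proof
    show "indicator (ball 0 1 - {0}) x *\<^sub>R f x = f x" for x
      using assms(2)[of x] by (cases "x \<in> ball 0 1 - {0}") simp_all
  qed
  ultimately show ?thesis by (simp only:)
qed

text \<open>The weight 1 has the volume of the ball as its mass, so \<open>sphere_area\<close>
  cancels the constant of the polar formula and normalised moments are values of the Laplace
  transform.\<close>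

lemma radial_moments:
  fixes f :: "'a::euclidean_space \<Rightarrow> real"
  assumes F: "\<And>x. norm x < 1 \<Longrightarrow> x \<noteq> 0 \<Longrightarrow> f x = F (norm x)" "continuous_on {0<..<1} F"
    and f: "\<And>x. x \<notin> ball 0 1 - {0} \<Longrightarrow> f x = 0"
  shows "set_integrable lborel (ball 0 1) (\<lambda>x. f x * norm x powr c) \<longleftrightarrow>
      integrable lborel (\<lambda>\<theta>. indicator {0<..} \<theta> * (exp (- ((c + real DIM('a)) * \<theta>)) * F (exp (- \<theta>))))"
    and "1 / sphere_area TYPE('a) * (LINT x:ball 0 1|lborel. f x * norm x ^ (2 * k)) = laplace (\<lambda>\<theta>. F (exp (- \<theta>))) (2 * real k + real DIM('a))"
    and "continuous_on (ball 0 1 - {0}) f"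
proof -
  have "continuous_on (ball 0 1 - {0}) (\<lambda>x. F (norm x))"
    by (intro continuous_on_compose2[OF F(2)] continuous_intros) auto
  thus cf: "continuous_on (ball 0 1 - {0}) f"
    by (rule continuous_on_eq) (auto simp: F)
  have [measurable]: "f \<in> borel_measurable borel" by (rule radial_measurable[OF cf f])
  note B = ball_integral_log[where hh="\<lambda>_::'a. 1" and m="measure lborel (ball (0::'a) 1)" and F=F,
      OF borel_measurable_const zero_le_one refl ball_mass measure_nonneg F(2)]
  show "set_integrable lborel (ball 0 1) (\<lambda>x. f x * norm x powr c) \<longleftrightarrow>
      integrable lborel (\<lambda>\<theta>. indicator {0<..} \<theta> * (exp (- ((c + real DIM('a)) * \<theta>)) * F (exp (- \<theta>))))"
  proof
    show "integrable lborel (\<lambda>\<theta>. indicator {0<..} \<theta> * (exp (- ((c + real DIM('a)) * \<theta>)) * F (exp (- \<theta>))))"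
      if i: "set_integrable lborel (ball 0 1) (\<lambda>x. f x * norm x powr c)"
      by (rule B(2)[OF _ _ ball_measure_pos i]) (simp_all add: F(1))
    show "set_integrable lborel (ball 0 1) (\<lambda>x. f x * norm x powr c)"
      if i: "integrable lborel (\<lambda>\<theta>. indicator {0<..} \<theta> * (exp (- ((c + real DIM('a)) * \<theta>)) * F (exp (- \<theta>))))"
      by (rule B(1)[OF _ _ i]) (simp_all add: F(1))
  qed
  have "(LINT x:ball 0 1|lborel. f x * norm x ^ (2 * k)) = real DIM('a) * measure lborel (ball (0::'a) 1) * laplace (\<lambda>\<theta>. F (exp (- \<theta>))) (2 * real k + real DIM('a))"
    by (rule B(3)) (simp_all add: F(1) powr_realpow[symmetric])
  thus "1 / sphere_area TYPE('a) * (LINT x:ball 0 1|lborel. f x * norm x ^ (2 * k)) = laplace (\<lambda>\<theta>. F (exp (- \<theta>))) (2 * real k + real DIM('a))"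
    using ball_measure_pos[where 'a='a] by (simp add: sphere_area_def)
qed

lemma is_bornD:
  fixes f :: "'a::euclidean_space \<Rightarrow> real"
  assumes "is_born V f"
  shows "\<And>x y. norm x = norm y \<Longrightarrow> f x = f y" "continuous_on (ball 0 1 - {0}) f"
    "\<And>x. x \<notin> ball 0 1 - {0} \<Longrightarrow> f x = 0"
    "\<exists>s>0. set_integrable lborel (ball 0 1) (\<lambda>x. f x * norm x powr (2 * s))"
    "\<forall>\<^sub>F k in sequentially. 1 / sphere_area TYPE('a) * (LINT x:ball 0 1|lborel. f x * norm x ^ (2 * k))
          = lambda V k - real k"
  using assms unfolding is_born_def by blast+

text \<open>In the logarithmic variable, the difference of two candidates times
  \<open>exp (- ((2 * N + d) * \<theta>))\<close> is integrable for large N. Its moments against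
  \<open>exp (- (2 * j * \<theta>))\<close> are the differences of the moments of order
  \<open>N + j\<close>, hence zero.\<close>

lemma is_born_unique:
  fixes f g :: "'a::euclidean_space \<Rightarrow> real"
  assumes f: "is_born V f" and g: "is_born V g"
  shows "f = g"
proof -
  obtain e :: 'a where e: "norm e = 1" by (meson SOME_Basis norm_Basis)
  define F G where "F r = f (r *\<^sub>R e)" and "G r = g (r *\<^sub>R e)" for r
  have FG: "f x = F (norm x)" "g x = G (norm x)" for x
  proof -
    have "norm x = norm (norm x *\<^sub>R e)" using e by simp
    from is_bornD(1)[OF f this] is_bornD(1)[OF g this] show "f x = F (norm x)" "g x = G (norm x)"
      unfolding F_def G_def .
  qed
  have cF: "continuous_on {0<..<1} F" "continuous_on {0<..<1} G"
    unfolding F_def G_def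
  proof -
    have "e \<noteq> 0" using e by auto
    hence im: "(\<lambda>r. r *\<^sub>R e) ` {0<..<1} \<subseteq> ball 0 1 - {0}" using e by auto
    have ce: "continuous_on {0<..<1} (\<lambda>r. r *\<^sub>R e)" by (intro continuous_intros)
    have "continuous_on (ball 0 1 - {0}) f" "continuous_on (ball 0 1 - {0}) g"
      by (rule is_bornD(2)[OF f] is_bornD(2)[OF g])+
    from this[THEN continuous_on_compose2, OF ce im]
    show "continuous_on {0<..<1} (\<lambda>r. f (r *\<^sub>R e))" "continuous_on {0<..<1} (\<lambda>r. g (r *\<^sub>R e))" by simp_all
  qed
  have zero: "f x = 0" "g x = 0" if "x \<notin> ball 0 1 - {0}" for x
    by (rule is_bornD(3)[OF f that] is_bornD(3)[OF g that])+
  have Mf: "set_integrable lborel (ball 0 1) (\<lambda>x. f x * norm x powr c) \<longleftrightarrow>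
      integrable lborel (\<lambda>\<theta>. indicator {0<..} \<theta> * (exp (- ((c + real DIM('a)) * \<theta>)) * F (exp (- \<theta>))))"
    "1 / sphere_area TYPE('a) * (LINT x:ball 0 1|lborel. f x * norm x ^ (2 * k)) = laplace (\<lambda>\<theta>. F (exp (- \<theta>))) (2 * real k + real DIM('a))" for c k
    by (rule radial_moments(1) radial_moments(2); rule FG(1) cF(1) zero(1); assumption)+
  have Mg: "set_integrable lborel (ball 0 1) (\<lambda>x. g x * norm x powr c) \<longleftrightarrow>
      integrable lborel (\<lambda>\<theta>. indicator {0<..} \<theta> * (exp (- ((c + real DIM('a)) * \<theta>)) * G (exp (- \<theta>))))"
    "1 / sphere_area TYPE('a) * (LINT x:ball 0 1|lborel. g x * norm x ^ (2 * k)) = laplace (\<lambda>\<theta>. G (exp (- \<theta>))) (2 * real k + real DIM('a))" for c k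
    by (rule radial_moments(1) radial_moments(2); rule FG(2) cF(2) zero(2); assumption)+
  obtain s t where st: "set_integrable lborel (ball 0 1) (\<lambda>x. f x * norm x powr (2 * s))"
    "set_integrable lborel (ball 0 1) (\<lambda>x. g x * norm x powr (2 * t))"
    using is_bornD(4)[OF f] is_bornD(4)[OF g] by blast
  \<comment> \<open>Integrability passes to larger exponents because the additional exponential is
    at most 1 on the positive half line.\<close>
  have up: "integrable lborel (\<lambda>\<theta>. indicator {0<..} \<theta> * (exp (- ((c + real DIM('a)) * \<theta>)) * H (exp (- \<theta>))))"
    if H: "continuous_on {0<..<1} H" and i: "integrable lborel (\<lambda>\<theta>. indicator {0<..} \<theta> * (exp (- ((c' + real DIM('a)) * \<theta>)) * H (exp (- \<theta>))))" and "c \<ge> c'" for c c' H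
  proof (rule Bochner_Integration.integrable_bound[OF i])
    show "AE \<theta> in lborel. norm (indicator {0<..} \<theta> * (exp (- ((c + real DIM('a)) * \<theta>)) * H (exp (- \<theta>)))) \<le> norm (indicator {0<..} \<theta> * (exp (- ((c' + real DIM('a)) * \<theta>)) * H (exp (- \<theta>))))"
      using that(3) by (intro AE_I2) (auto simp: indicator_def abs_mult intro!: mult_right_mono)
  qed (use log_measurable[OF H] in simp)
  obtain K where K: "\<And>k. k \<ge> K \<Longrightarrow> 1 / sphere_area TYPE('a) * (LINT x:ball 0 1|lborel. f x * norm x ^ (2 * k)) = 1 / sphere_area TYPE('a) * (LINT x:ball 0 1|lborel. g x * norm x ^ (2 * k))"
  proof -
    have "\<forall>\<^sub>F k in sequentially. 1 / sphere_area TYPE('a) * (LINT x:ball 0 1|lborel. f x * norm x ^ (2 * k)) = 1 / sphere_area TYPE('a) * (LINT x:ball 0 1|lborel. g x * norm x ^ (2 * k))"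
      using is_bornD(5)[OF f] is_bornD(5)[OF g] by eventually_elim (simp only:)
    thus ?thesis using that unfolding eventually_sequentially by blast
  qed
  \<comment> \<open>Beyond the index from which the moments agree and beyond both integrability
    exponents.\<close>
  define N where "N = max K (nat \<lceil>max s t\<rceil>)"
  have N: "N \<ge> K" "real N \<ge> s" "real N \<ge> t" unfolding N_def by linarith+
  have iF: "integrable lborel (\<lambda>\<theta>. indicator {0<..} \<theta> * (exp (- ((2 * real k + real DIM('a)) * \<theta>)) * F (exp (- \<theta>))))" if "k \<ge> N" for k
    by (rule up[OF cF(1) iffD1[OF Mf(1) st(1)]]) (use of_nat_mono[OF that, where 'a=real] N in linarith)
  have iG: "integrable lborel (\<lambda>\<theta>. indicator {0<..} \<theta> * (exp (- ((2 * real k + real DIM('a)) * \<theta>)) * G (exp (- \<theta>))))" if "k \<ge> N" for k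
    by (rule up[OF cF(2) iffD1[OF Mg(1) st(2)]]) (use of_nat_mono[OF that, where 'a=real] N in linarith)
  define w where "w \<theta> = indicator {0<..} \<theta> * (exp (- ((2 * real N + real DIM('a)) * \<theta>)) * F (exp (- \<theta>)))
     - indicator {0<..} \<theta> * (exp (- ((2 * real N + real DIM('a)) * \<theta>)) * G (exp (- \<theta>)))" for \<theta>
  have w0: "w \<theta> = 0" for \<theta>
  proof (rule exp_moments_zero[of w])
    show "integrable lborel w" unfolding w_def using iF iG by simp
    fix j :: nat
    have e: "w \<theta> * exp (- (2 * real j * \<theta>)) = indicator {0<..} \<theta> * (exp (- ((2 * real (N + j) + real DIM('a)) * \<theta>)) * F (exp (- \<theta>)))
     - indicator {0<..} \<theta> * (exp (- ((2 * real (N + j) + real DIM('a)) * \<theta>)) * G (exp (- \<theta>)))" for \<theta>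
      by (simp add: w_def algebra_simps exp_add exp_diff exp_minus divide_inverse)
    show "(\<integral>\<theta>. w \<theta> * exp (- (2 * real j * \<theta>)) \<partial>lborel) = 0"
      unfolding e using iF[of "N + j"] iG[of "N + j"] K[of "N + j"] N(1) unfolding Mf(2) Mg(2) laplace_def by simp
  next
    have "continuous_on {0<..} (\<lambda>\<theta>. exp (- ((2 * real N + real DIM('a)) * \<theta>)) * F (exp (- \<theta>)) - exp (- ((2 * real N + real DIM('a)) * \<theta>)) * G (exp (- \<theta>)))"
      by (intro continuous_intros continuous_on_compose2[OF cF(1)] continuous_on_compose2[OF cF(2)]) auto
    thus "continuous_on {0<..} w" by (rule continuous_on_eq) (simp add: w_def)
  qed (simp add: w_def)
  show ?thesis
  proof
    fix x
    show "f x = g x"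
    proof (cases "x \<in> ball 0 1 - {0}")
      case True
      hence "- ln (norm x) > 0" by simp
      thus ?thesis using w0[of "- ln (norm x)"] True by (simp add: w_def FG)
    qed (simp add: zero)
  qed
qed

lemma born_eqI: "is_born V f \<Longrightarrow> born V = f"
  unfolding born_def using is_born_unique by blast

section \<open>The Dirichlet-to-Neumann eigenvalues\<close>

lemma C1_on_gradient:
  fixes f :: "'a::euclidean_space \<Rightarrow> real"
  assumes "\<And>x. x \<in> S \<Longrightarrow> (f has_derivative (\<lambda>v. g x \<bullet> v)) (at x)" "continuous_on S g"
  shows "C1_on S f"
  unfolding C1_on_def
proof (intro exI conjI ballI)
  show "continuous_on S (\<lambda>x. blinfun_inner_right (g x))"
    by (intro bounded_linear.continuous_on[OF bounded_linear_blinfun_inner_right] assms)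
  show "(f has_derivative blinfun_apply (blinfun_inner_right (g x))) (at x within S)" if "x \<in> S" for x
    using assms(1)[OF that] by (auto simp: blinfun_inner_right.rep_eq intro: has_derivative_at_withinI)
qed

lemma partial_deriv_gradient:
  assumes "(f has_derivative (\<lambda>v. g \<bullet> v)) (at x)"
  shows "partial_deriv i f x = g \<bullet> i"
  using frechet_derivative_at[OF assms] by (simp add: partial_deriv_def)

text \<open>The components of the gradient are polynomials again, so a second application yields the
  Hessian.\<close>

lemma polynomial_gradient:
  fixes P :: "'a::euclidean_space \<Rightarrow> real"
  assumes "real_polynomial_function P"
  obtains g where "\<And>x. (P has_derivative (\<lambda>v. g x \<bullet> v)) (at x)" "\<And>i. real_polynomial_function (\<lambda>x. g x \<bullet> i)"
proof -
  have "\<exists>g. (\<forall>x. (P has_derivative (\<lambda>v. g x \<bullet> v)) (at x)) \<and> (\<forall>i. real_polynomial_function (\<lambda>x. g x \<bullet> i))"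
    using assms
  proof (induction P)
    case (linear f)
    define g where "g = (\<Sum>b\<in>Basis. f b *\<^sub>R b)"
    have "f v = g \<bullet> v" for v
    proof -
      have "f v = f (\<Sum>b\<in>Basis. (v \<bullet> b) *\<^sub>R b)" by (simp add: euclidean_representation)
      also have "\<dots> = (\<Sum>b\<in>Basis. (v \<bullet> b) * f b)"
        using linear by (simp add: bounded_linear.linear linear_sum linear_cmul)
      also have "\<dots> = g \<bullet> v" unfolding g_def inner_sum_left inner_scaleR_left by (intro sum.cong) (auto simp: inner_commute mult.commute)
      finally show ?thesis .
    qed
    hence "(\<lambda>v. g \<bullet> v) = f" by auto
    thus ?case using bounded_linear_imp_has_derivative[OF linear] by (intro exI[of _ "\<lambda>_. g"]) (auto intro: real_polynomial_function.intros)
  next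
    case (const c)
    show ?case by (intro exI[of _ "\<lambda>_. 0"]) (auto intro: real_polynomial_function.intros)
  next
    case (add f1 f2)
    then obtain g1 g2 where "\<And>x. (f1 has_derivative (\<lambda>v. g1 x \<bullet> v)) (at x)" "\<And>i. real_polynomial_function (\<lambda>x. g1 x \<bullet> i)"
      "\<And>x. (f2 has_derivative (\<lambda>v. g2 x \<bullet> v)) (at x)" "\<And>i. real_polynomial_function (\<lambda>x. g2 x \<bullet> i)" by metis
    thus ?case
      by (intro exI[of _ "\<lambda>x. g1 x + g2 x"]) (auto simp: inner_add_left intro!: derivative_intros real_polynomial_function.intros(3))
  next
    case (mult f1 f2)
    then obtain g1 g2 where g: "\<And>x. (f1 has_derivative (\<lambda>v. g1 x \<bullet> v)) (at x)" "\<And>i. real_polynomial_function (\<lambda>x. g1 x \<bullet> i)"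
      "\<And>x. (f2 has_derivative (\<lambda>v. g2 x \<bullet> v)) (at x)" "\<And>i. real_polynomial_function (\<lambda>x. g2 x \<bullet> i)" by metis
    have "((\<lambda>x. f1 x * f2 x) has_derivative (\<lambda>v. (f1 x *\<^sub>R g2 x + f2 x *\<^sub>R g1 x) \<bullet> v)) (at x)" for x
      using has_derivative_mult[OF g(1) g(3)] by (simp add: inner_add_left mult.commute)
    thus ?case
      using mult g by (intro exI[of _ "\<lambda>x. f1 x *\<^sub>R g2 x + f2 x *\<^sub>R g1 x"]) (auto simp: inner_add_left intro!: real_polynomial_function.intros(3) real_polynomial_function.intros(4))
  qed
  thus ?thesis using that by blast
qed

lemma real_polynomial_function_continuous:
  "real_polynomial_function P \<Longrightarrow> continuous_on S P"
  using continuous_real_polymonial_function continuous_at_imp_continuous_on by blast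

lemma gradient_continuous:
  fixes g :: "'a::euclidean_space \<Rightarrow> 'b::euclidean_space"
  assumes "\<And>i. i \<in> Basis \<Longrightarrow> continuous_on S (\<lambda>x. g x \<bullet> i)"
  shows "continuous_on S g"
  using assms continuous_on_componentwise by blast

lemma homogeneous_bound:
  fixes f :: "'a::euclidean_space \<Rightarrow> 'b::real_normed_vector"
  assumes "continuous_on UNIV f" "\<And>t x. t > 0 \<Longrightarrow> f (t *\<^sub>R x) = t ^ n *\<^sub>R f x"
  shows "\<exists>A\<ge>0. \<forall>x. x \<noteq> 0 \<longrightarrow> norm (f x) \<le> A * norm x ^ n"
proof -
  have "compact (f ` sphere 0 1)" by (intro compact_continuous_image continuous_on_subset[OF assms(1)]) auto
  then obtain A where "\<forall>y\<in>f ` sphere 0 1. norm y \<le> A"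
    using compact_imp_bounded[of "f ` sphere 0 1"] unfolding bounded_iff by blast
  hence A: "norm (f x) \<le> A" if "norm x = 1" for x using that by simp
  obtain e :: 'a where "norm e = 1" by (meson SOME_Basis norm_Basis)
  hence "A \<ge> 0" using A[of e] by (meson norm_ge_zero order_trans)
  moreover have "norm (f x) \<le> A * norm x ^ n" if "x \<noteq> 0" for x
  proof -
    have "norm (f x) = norm (f (norm x *\<^sub>R (x /\<^sub>R norm x)))" using that by simp
    also have "\<dots> = norm x ^ n * norm (f (x /\<^sub>R norm x))" using that by (subst assms(2)) auto
    also have "\<dots> \<le> norm x ^ n * A" using that by (intro mult_left_mono A) auto
    finally show ?thesis by (simp add: mult.commute)
  qed
  ultimately show ?thesis by blast
qed

lemma homogeneous_gradient:
  fixes P :: "'a::euclidean_space \<Rightarrow> real"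
  assumes P: "\<And>x. (P has_derivative (\<lambda>v. g x \<bullet> v)) (at x)" and hom: "\<And>t x. t > 0 \<Longrightarrow> P (t *\<^sub>R x) = t ^ Suc n * P x"
    and t: "t > 0"
  shows "g (t *\<^sub>R x) = t ^ n *\<^sub>R g x"
proof -
  have "((\<lambda>x. P (t *\<^sub>R x)) has_derivative (\<lambda>v. g (t *\<^sub>R x) \<bullet> (t *\<^sub>R v))) (at x)"
    by (rule has_derivative_compose[OF _ P]) (auto intro!: derivative_eq_intros)
  moreover have "((\<lambda>x. P (t *\<^sub>R x)) has_derivative (\<lambda>v. t ^ Suc n * (g x \<bullet> v))) (at x)"
    unfolding hom[OF t] by (intro has_derivative_mult_right P)
  ultimately have "(\<lambda>v. g (t *\<^sub>R x) \<bullet> (t *\<^sub>R v)) = (\<lambda>v. t ^ Suc n * (g x \<bullet> v))"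
    by (rule has_derivative_unique)
  hence "t * (g (t *\<^sub>R x) \<bullet> v) = t * ((t ^ n *\<^sub>R g x) \<bullet> v)" for v
    by (auto dest!: fun_cong[of _ _ v])
  hence "g (t *\<^sub>R x) \<bullet> v = (t ^ n *\<^sub>R g x) \<bullet> v" for v using t by simp
  thus ?thesis using vector_eq_rdot by blast
qed

lemma Euler_homogeneous:
  fixes P :: "'a::euclidean_space \<Rightarrow> real"
  assumes P: "(P has_derivative (\<lambda>v. g \<bullet> v)) (at x)" and hom: "\<And>t. t > 0 \<Longrightarrow> P (t *\<^sub>R x) = t ^ n * P x"
  shows "g \<bullet> x = real n * P x"
proof -
  have P1: "(P has_derivative (\<lambda>v. g \<bullet> v)) (at (1 *\<^sub>R x))" using P by simp
  have "((\<lambda>t. P (t *\<^sub>R x)) has_derivative (\<lambda>s. g \<bullet> (s *\<^sub>R x))) (at 1)"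
    by (rule has_derivative_compose[of "\<lambda>t. t *\<^sub>R x" "\<lambda>s. s *\<^sub>R x" 1 UNIV P "\<lambda>v. g \<bullet> v", OF _ P1])
       (auto intro!: derivative_eq_intros)
  hence "((\<lambda>t. P (t *\<^sub>R x)) has_real_derivative g \<bullet> x) (at 1)"
    by (simp add: has_field_derivative_def mult.commute[of _ "g \<bullet> x"])
  moreover have "((\<lambda>t. t ^ n * P x) has_real_derivative real n * P x) (at 1)"
    by (auto intro!: derivative_eq_intros)
  moreover have ev: "\<forall>\<^sub>F t in nhds 1. P (t *\<^sub>R x) = t ^ n * P x"
    using eventually_nhds_in_open[of "{0<..}" "1::real"] by (auto elim!: eventually_mono simp: hom)
  ultimately show ?thesis using DERIV_cong_ev[OF refl ev refl] DERIV_unique by blast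
qed

text \<open>Quadratic decay forces a zero derivative. It takes care of the origin, where the
  formulas for radial factors break down.\<close>

lemma has_derivative_zero_at_0:
  fixes f :: "'a::euclidean_space \<Rightarrow> real"
  assumes "\<And>x. norm x < 1 \<Longrightarrow> \<bar>f x\<bar> \<le> C * norm x ^ 2"
  shows "(f has_derivative (\<lambda>v. 0 \<bullet> v)) (at 0)"
proof -
  have f0: "f 0 = 0" using assms[of 0] by simp
  have "((\<lambda>x. norm (f x) / norm x) \<longlongrightarrow> 0) (at 0)"
  proof (rule Lim_null_comparison)
    show "((\<lambda>x::'a. \<bar>C\<bar> * norm x) \<longlongrightarrow> 0) (at 0)" by (auto intro!: tendsto_eq_intros)
    have "\<forall>\<^sub>F x in at (0::'a). norm x < 1"
      using eventually_at_ball[of 1 "0::'a" UNIV] by (auto elim: eventually_mono)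
    thus "\<forall>\<^sub>F x in at 0. norm (norm (f x) / norm x) \<le> \<bar>C\<bar> * norm x"
    proof eventually_elim
      fix x :: 'a assume "norm x < 1"
      hence "\<bar>f x\<bar> \<le> C * norm x ^ 2" by (rule assms)
      also have "\<dots> \<le> (\<bar>C\<bar> * norm x) * norm x" by (simp add: power2_eq_square mult.assoc mult_right_mono)
      finally show "norm (norm (f x) / norm x) \<le> \<bar>C\<bar> * norm x" by (cases "x = 0") (auto simp: divide_le_eq)
    qed
  qed
  thus ?thesis by (simp add: has_derivative_at f0)
qed

text \<open>The real part of \<open>(x1 + i * x2) ^ k\<close>, which is where two dimensions are
  required. It is harmonic because the squared directional coefficients sum to
  \<open>1 + i^2 = 0\<close>, and it equals 1 at the first basis vector.\<close>

lemma spherical_harmonic_nonzero: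
  assumes "DIM('a::euclidean_space) \<ge> 2"
  obtains Y :: "'a::euclidean_space \<Rightarrow> real" and w where "spherical_harmonic k Y" "w \<in> sphere 0 1" "Y w \<noteq> 0"
proof -
  obtain e1 e2 :: 'a where e: "e1 \<in> Basis" "e2 \<in> Basis" "e1 \<noteq> e2"
    using assms by (metis card_le_Suc0_iff_eq finite_Basis not_less_eq_eq numeral_2_eq_2)
  define Z where "Z x = Complex (x \<bullet> e1) (x \<bullet> e2)" for x :: 'a
  have Zl: "bounded_linear Z"
    unfolding linear_conv_bounded_linear[symmetric]
    by (rule linearI) (auto simp: Z_def complex_eq_iff inner_add_left)
  define P where "P x = Re (Z x ^ k)" for x
  have pw: "real_polynomial_function (\<lambda>x. Re (Z x ^ n)) \<and> real_polynomial_function (\<lambda>x. Im (Z x ^ n))" for n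
  proof (induction n)
    case (Suc n)
    have "real_polynomial_function (\<lambda>x::'a. x \<bullet> e1)" "real_polynomial_function (\<lambda>x::'a. x \<bullet> e2)"
      by (auto intro: real_polynomial_function.intros bounded_linear_inner_left)
    with Suc show ?case by (auto simp: Z_def intro!: real_polynomial_function.intros(3) real_polynomial_function.intros(4) real_polynomial_function_diff)
  qed (auto intro: real_polynomial_function.intros)
  have Zd: "(Z has_derivative Z) (at x)" for x by (rule bounded_linear_imp_has_derivative[OF Zl])
  \<comment> \<open>The complex coefficient c makes the formula applicable to its own
    result.\<close>
  have pd: "partial_deriv i (\<lambda>x. Re (c * Z x ^ n)) x = Re (c * of_nat n * Z i * Z x ^ (n - 1))" for i c n x
  proof -
    have "((\<lambda>x. Re (c * Z x ^ n)) has_derivative (\<lambda>v. Re (c * (of_nat n * Z v * Z x ^ (n - 1))))) (at x)"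
      by (intro bounded_linear.has_derivative[OF bounded_linear_Re] has_derivative_mult_right has_derivative_power Zd)
    from fun_cong[OF frechet_derivative_at[OF this], of i] show ?thesis by (simp only: partial_deriv_def mult.assoc)
  qed
  have "laplacian P x = 0" for x
  proof -
    have "iter_partial [i, i] P x = Re ((of_nat k * of_nat (k - 1) * Z x ^ (k - 2)) * (Z i)\<^sup>2)" for i
    proof -
      have "partial_deriv i P = (\<lambda>x. Re (of_nat k * Z i * Z x ^ (k - 1)))"
        using pd[of i 1 k] by (auto simp: P_def[abs_def])
      hence "iter_partial [i, i] P x = partial_deriv i (\<lambda>x. Re ((of_nat k * Z i) * Z x ^ (k - 1))) x"
        by (simp add: iter_partial_def)
      also have "\<dots> = Re ((of_nat k * Z i) * of_nat (k - 1) * Z i * Z x ^ (k - 1 - 1))" by (rule pd)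
      also have "\<dots> = Re ((of_nat k * of_nat (k - 1) * Z x ^ (k - 2)) * (Z i)\<^sup>2)"
        by (simp add: power2_eq_square mult_ac numeral_2_eq_2)
      finally show ?thesis .
    qed
    hence "laplacian P x = Re ((of_nat k * of_nat (k - 1) * Z x ^ (k - 2)) * (\<Sum>i\<in>Basis. (Z i)\<^sup>2))"
      by (simp add: laplacian_def sum_distrib_left)
    also have "(\<Sum>i\<in>Basis. (Z i)\<^sup>2) = (\<Sum>i\<in>{e1, e2}. (Z i)\<^sup>2)"
      using e by (intro sum.mono_neutral_right) (auto simp: Z_def inner_not_same_Basis complex_eq_iff)
    also have "\<dots> = 0" using e by (simp add: Z_def inner_not_same_Basis complex_eq_iff power2_eq_square)
    finally show ?thesis by simp
  qed
  moreover have "P (t *\<^sub>R x) = t ^ k * P x" for t x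
  proof -
    have "Z (t *\<^sub>R x) = of_real t * Z x" by (simp add: Z_def complex_eq_iff)
    thus ?thesis by (simp add: P_def power_mult_distrib flip: of_real_power)
  qed
  moreover have "real_polynomial_function P" using pw[of k] by (simp add: P_def[abs_def])
  ultimately have "spherical_harmonic k P" unfolding spherical_harmonic_def by blast
  moreover have "Z e1 = 1" using e by (simp add: Z_def inner_not_same_Basis complex_eq_iff)
  hence "P e1 \<noteq> 0" by (simp add: P_def)
  ultimately show ?thesis using e(1) by (intro that[of P e1]) auto
qed

section \<open>Uniqueness of the Dirichlet-to-Neumann data\<close>

lemma schroedinger_solution_diff:
  assumes u: "schroedinger_solution V u" and v: "schroedinger_solution V (v :: 'a::euclidean_space \<Rightarrow> real)"
  shows "schroedinger_solution V (\<lambda>x. u x - v x)"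
proof -
  let ?B = "ball (0::'a) 1"
  have C1_diff: "C1_on ?B (\<lambda>x. f x - g x)" if fg: "C1_on ?B f" "C1_on ?B g" for f g
  proof -
    obtain D E where "\<forall>x\<in>?B. (f has_derivative blinfun_apply (D x)) (at x within ?B)" "continuous_on ?B D"
      "\<forall>x\<in>?B. (g has_derivative blinfun_apply (E x)) (at x within ?B)" "continuous_on ?B E"
      using fg unfolding C1_on_def by blast
    thus ?thesis unfolding C1_on_def
      by (intro exI[of _ "\<lambda>x. D x - E x"]) (auto simp: minus_blinfun.rep_eq intro!: derivative_intros continuous_intros)
  qed
  have diffble: "f differentiable (at x)" if "C1_on ?B f" "x \<in> ?B" for f x
    using that by (auto simp: C1_on_def differentiable_def at_within_open[OF _ open_ball])
  have pd: "partial_deriv i (\<lambda>x. f x - g x) x = partial_deriv i f x - partial_deriv i g x"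
    if "C1_on ?B f" "C1_on ?B g" "x \<in> ?B" for f g i x
  proof -
    have "(f has_derivative frechet_derivative f (at x)) (at x)" "(g has_derivative frechet_derivative g (at x)) (at x)"
      using diffble that by (auto simp: frechet_derivative_works[symmetric])
    from fun_cong[OF frechet_derivative_at[OF has_derivative_diff[OF this]], of i] show ?thesis
      by (simp only: partial_deriv_def)
  qed
  \<comment> \<open>The rule for differences of partial derivatives holds on the ball only, so
    second derivatives are compared through functions that agree on this open set.\<close>
  have C1_cong: "C1_on ?B f" if "C1_on ?B g" "\<And>x. x \<in> ?B \<Longrightarrow> f x = g x" for f g
  proof -
    obtain D where D: "\<forall>x\<in>?B. (g has_derivative blinfun_apply (D x)) (at x within ?B)" "continuous_on ?B D"
      using \<open>C1_on ?B g\<close> unfolding C1_on_def by blast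
    have "(f has_derivative blinfun_apply (D x)) (at x within ?B)" if x: "x \<in> ?B" for x
      by (rule has_derivative_transform[OF x _ D(1)[rule_format, OF x]]) fact
    with D(2) show ?thesis unfolding C1_on_def by blast
  qed
  have pd_cong: "partial_deriv i f x = partial_deriv i g x" if x: "x \<in> ?B" and eq: "\<And>x. x \<in> ?B \<Longrightarrow> f x = g x"
    for f g :: "'a \<Rightarrow> real" and i x
  proof -
    have "(f has_derivative D) (at x) \<longleftrightarrow> (g has_derivative D) (at x)" for D
      using has_derivative_transform_within_open[of f D x UNIV ?B g, OF _ open_ball x eq]
        has_derivative_transform_within_open[of g D x UNIV ?B f, OF _ open_ball x eq[symmetric]] by blast
    thus ?thesis by (simp add: partial_deriv_def frechet_derivative_def)
  qed
  have C: "C1_on ?B u" "C1_on ?B v" "\<And>i. i \<in> Basis \<Longrightarrow> C1_on ?B (partial_deriv i u)" "\<And>i. i \<in> Basis \<Longrightarrow> C1_on ?B (partial_deriv i v)"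
    using u v by (auto simp: schroedinger_solution_def C2_on_open_def)
  have "C2_on_open ?B (\<lambda>x. u x - v x)" unfolding C2_on_open_def
  proof (intro conjI ballI)
    fix i :: 'a assume i: "i \<in> Basis"
    show "C1_on ?B (partial_deriv i (\<lambda>x. u x - v x))"
      by (rule C1_cong[OF C1_diff[OF C(3,4)[OF i]]]) (rule pd[OF C(1,2)])
  qed (rule C1_diff[OF C(1,2)])
  moreover have "laplacian (\<lambda>x. u x - v x) x = laplacian u x - laplacian v x" if x: "x \<in> ?B" for x
  proof -
    have "iter_partial [i, i] (\<lambda>x. u x - v x) x = iter_partial [i, i] u x - iter_partial [i, i] v x" if i: "i \<in> Basis" for i
    proof -
      have "partial_deriv i (partial_deriv i (\<lambda>x. u x - v x)) x = partial_deriv i (\<lambda>x. partial_deriv i u x - partial_deriv i v x) x"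
        by (rule pd_cong[OF x]) (rule pd[OF C(1,2)])
      also have "\<dots> = partial_deriv i (partial_deriv i u) x - partial_deriv i (partial_deriv i v) x"
        by (rule pd[OF C(3,4)[OF i] x])
      finally show ?thesis by (simp add: iter_partial_def)
    qed
    thus ?thesis by (simp add: laplacian_def sum_subtractf)
  qed
  ultimately show ?thesis using u v
    by (auto simp: schroedinger_solution_def right_diff_distrib intro!: continuous_intros)
qed

text \<open>Two solutions with the same boundary values differ by a solution with zero boundary
  values, which vanishes if 0 is not a Dirichlet eigenvalue. One-sided derivatives at 1 are unique
  as 1 is a limit point of the interval.\<close>

lemma DN_graph_unique:
  fixes V :: "'a::euclidean_space \<Rightarrow> real"
  assumes "\<not> zero_dirichlet_eigenvalue V" "DN_graph V f g1" "DN_graph V f g2" "w \<in> sphere 0 1"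
  shows "g1 w = g2 w"
proof -
  obtain u where u: "schroedinger_solution V u" "\<And>w. w \<in> sphere 0 1 \<Longrightarrow> u w = f w"
    "\<And>w. w \<in> sphere 0 1 \<Longrightarrow> ((\<lambda>t. u (t *\<^sub>R w)) has_real_derivative g1 w) (at 1 within {0<..1})"
    using assms(2) by (auto simp: DN_graph_def)
  obtain v where v: "schroedinger_solution V v" "\<And>w. w \<in> sphere 0 1 \<Longrightarrow> v w = f w"
    "\<And>w. w \<in> sphere 0 1 \<Longrightarrow> ((\<lambda>t. v (t *\<^sub>R w)) has_real_derivative g2 w) (at 1 within {0<..1})"
    using assms(3) by (auto simp: DN_graph_def)
  have eq: "u x = v x" if "x \<in> cball 0 1" for x
  proof (cases "x \<in> ball 0 1")
    case True
    have "\<forall>w\<in>sphere 0 1. u w - v w = 0" using u(2) v(2) by simp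
    hence "\<not> (\<exists>x\<in>ball 0 1. u x - v x \<noteq> 0)"
      using schroedinger_solution_diff[OF u(1) v(1)] assms(1) unfolding zero_dirichlet_eigenvalue_def by blast
    thus ?thesis using True by auto
  next
    case False
    thus ?thesis using that u(2) v(2) by auto
  qed
  have "((\<lambda>t. v (t *\<^sub>R w)) has_real_derivative g1 w) (at 1 within {0<..1})"
    using has_derivative_transform[OF _ _ u(3)[OF assms(4), unfolded has_field_derivative_def], of "\<lambda>t. v (t *\<^sub>R w)"]
      assms(4) eq by (auto simp: has_field_derivative_def)
  moreover have "at (1::real) within {0<..1} \<noteq> bot"
  proof -
    have "{0<..1::real} - {1} = {0<..<1}" by auto
    thus ?thesis by (simp add: at_within_eq_bot_iff)
  qed
  ultimately show ?thesis using v(3)[OF assms(4)] has_field_derivative_unique by blast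
qed

section \<open>The regular solution obtained from the Riccati equation\<close>

lemma radial_has_derivative:
  fixes x :: "'a::euclidean_space"
  assumes "(\<phi> has_real_derivative D) (at (norm x))" "x \<noteq> 0"
  shows "((\<lambda>x. \<phi> (norm x)) has_derivative (\<lambda>v. D / norm x * (x \<bullet> v))) (at x)"
proof -
  have "(norm has_derivative (\<lambda>v. v \<bullet> sgn x)) (at x)"
    by (rule has_derivative_norm[OF assms(2)])
  from has_derivative_compose[OF this assms(1)[unfolded has_field_derivative_def]]
  show ?thesis by (simp add: sgn_div_norm inner_commute divide_inverse mult_ac)
qed

lemma continuous_on_ball_puncture:
  fixes f :: "'a::euclidean_space \<Rightarrow> 'b::real_normed_vector"
  assumes "continuous_on (ball 0 1 - {0}) f" "f 0 = 0" "\<And>x. norm x < 1 \<Longrightarrow> norm (f x) \<le> C * norm x"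
  shows "continuous_on (ball 0 1) f"
  unfolding continuous_on_eq_continuous_within
proof
  fix x :: 'a assume x: "x \<in> ball 0 1"
  show "continuous (at x within ball 0 1) f"
  proof (cases "x = 0")
    case True
    have "(f \<longlongrightarrow> 0) (at 0 within ball 0 1)"
    proof (rule Lim_null_comparison)
      show "((\<lambda>x::'a. C * norm x) \<longlongrightarrow> 0) (at 0 within ball 0 1)" by (auto intro!: tendsto_eq_intros)
      show "\<forall>\<^sub>F x in at 0 within ball 0 1. norm (f x) \<le> C * norm x"
        using assms(3) by (auto simp: eventually_at_filter)
    qed
    thus ?thesis using True assms(2) by (simp add: continuous_within)
  next
    case False
    have "open (ball 0 1 - {0::'a})" by auto
    hence "isCont f x" using assms(1) False x by (simp add: continuous_on_eq_continuous_at)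
    thus ?thesis by (rule continuous_at_imp_continuous_at_within)
  qed
qed

text \<open>The exponential of a primitive of \<open>s * G s\<close>, normalised at 1. Boundedness
  of G extends \<open>s * G s\<close> continuously by 0 to the centre, so c lives on the compact
  interval and lies between positive constants.\<close>

lemma radial_factor_exists:
  fixes G G' :: "real \<Rightarrow> real"
  assumes G: "\<And>s. s \<in> {0<..1} \<Longrightarrow> (G has_real_derivative G' s) (at s within {0<..1})"
    and K: "\<And>s. s \<in> {0<..1} \<Longrightarrow> \<bar>G s\<bar> \<le> K"
  obtains c m M where "continuous_on {0..1} c" "c 1 = (1::real)"
    "\<And>s. s \<in> {0<..1} \<Longrightarrow> (c has_real_derivative s * G s * c s) (at s within {0<..1})"
    "m > 0" "\<And>s. s \<in> {0..1} \<Longrightarrow> m \<le> c s" "\<And>s. s \<in> {0..1} \<Longrightarrow> c s \<le> M"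
proof -
  have cG: "continuous_on {0<..1} G" by (rule DERIV_continuous_on) (rule G)
  have c0: "continuous_on {0..1} (\<lambda>s. s * G s)"
    unfolding continuous_on_eq_continuous_within
  proof
    fix x :: real assume x: "x \<in> {0..1}"
    show "continuous (at x within {0..1}) (\<lambda>s. s * G s)"
    proof (cases "x = 0")
      case True
      have "((\<lambda>s. s * G s) \<longlongrightarrow> 0) (at 0 within {0..1})"
      proof (rule Lim_null_comparison)
        show "((\<lambda>s. K * s) \<longlongrightarrow> 0) (at 0 within {0..1})" by (auto intro!: tendsto_eq_intros)
        have "norm (s * G s) \<le> K * s" if "s \<in> {0..1}" "s \<noteq> 0" for s
          using K[of s] that by (simp add: abs_mult mult.commute mult_right_mono)
        thus "\<forall>\<^sub>F s in at 0 within {0..1}. norm (s * G s) \<le> K * s"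
          by (auto simp: eventually_at_filter)
      qed
      thus ?thesis using True by (simp add: continuous_within)
    next
      case False
      have "continuous (at x within {0<..1}) (\<lambda>s. s * G s)"
        using cG x False by (intro continuous_intros) (auto simp: continuous_on_eq_continuous_within)
      moreover have "at x within {0..1} = at x within {0<..1}"
        by (rule at_within_nhd[of _ "{0<..}"]) (use x False in auto)
      ultimately show ?thesis by simp
    qed
  qed
  obtain P where P: "\<And>x. x \<in> {0..1} \<Longrightarrow> (P has_vector_derivative x * G x) (at x within {0..1})"
    using antiderivative_continuous[OF c0] by blast
  have Pd: "(P has_real_derivative s * G s) (at s within {0..1})" if "s \<in> {0..1}" for s
    using P[OF that] by (simp add: has_real_derivative_iff_has_vector_derivative)
  have cP: "continuous_on {0..1} P" by (rule DERIV_continuous_on) (rule Pd)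
  define c where "c s = exp (P s - P 1)" for s
  have cc: "continuous_on {0..1} c" unfolding c_def by (intro continuous_intros cP)
  have cpt: "compact (c ` {0..1})" by (intro compact_continuous_image cc) auto
  have ne: "c ` {0..1} \<noteq> {}" by auto
  obtain m where m: "m \<in> c ` {0..1}" "\<And>y. y \<in> c ` {0..1} \<Longrightarrow> m \<le> y"
    using compact_attains_inf[OF cpt ne] by blast
  obtain M where M: "\<And>y. y \<in> c ` {0..1} \<Longrightarrow> y \<le> M"
    using compact_attains_sup[OF cpt ne] by blast
  have "(c has_real_derivative s * G s * c s) (at s within {0<..1})" if s: "s \<in> {0<..1}" for s
  proof -
    have "(P has_real_derivative s * G s) (at s within {0<..1})"
      by (rule DERIV_subset[OF Pd]) (use s in auto)
    thus ?thesis unfolding c_def[abs_def] by (auto intro!: derivative_eq_intros)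
  qed
  moreover have "m > 0" using m(1) by (auto simp: c_def)
  ultimately show ?thesis using that[of c m M] cc m(2) M by (auto simp: c_def)
qed

text \<open>Writing the radial solution as \<open>r ^ k * c r\<close> removes the centrifugal term,
  and setting \<open>c' = s * G * c\<close> lowers the order, which leaves the Riccati equation for
  G. The bound \<open>k >= 3\<close> serves the regularity of u at the origin.\<close>

locale radial_riccati =
  fixes V :: "'a::euclidean_space \<Rightarrow> real" and q G c :: "real \<Rightarrow> real" and k :: nat and K m M :: real
  assumes dim: "DIM('a) \<ge> 2" and k: "k \<ge> 3"
    and V: "\<And>x. x \<in> cball 0 1 \<Longrightarrow> V x = q (norm x)" and q_cont: "continuous_on {0..1} q"
    and G_deriv: "\<And>s. s \<in> {0<..1} \<Longrightarrow>
       (G has_real_derivative (q s - (2 * real k + real DIM('a)) * G s - s\<^sup>2 * (G s)\<^sup>2) / s) (at s within {0<..1})"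
    and G_bound: "\<And>s. s \<in> {0<..1} \<Longrightarrow> \<bar>G s\<bar> \<le> K"
    and c_cont: "continuous_on {0..1} c" and c1: "c 1 = 1"
    and c_deriv: "\<And>s. s \<in> {0<..1} \<Longrightarrow> (c has_real_derivative s * G s * c s) (at s within {0<..1})"
    and c_bound: "m > 0" "\<And>s. s \<in> {0..1} \<Longrightarrow> m \<le> c s" "\<And>s. s \<in> {0..1} \<Longrightarrow> c s \<le> M"
begin

definition d :: real where "d = real DIM('a)"
text \<open>\<open>N r / r\<close> is the derivative of G. The numerator stays bounded near 0, while
  no bound on the quotient is available there.\<close>

definition N :: "real \<Rightarrow> real" where "N r = q r - (2 * real k + d) * G r - r\<^sup>2 * (G r)\<^sup>2"

lemma K_nonneg: "K \<ge> 0" using G_bound[of 1] by auto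
lemma M_pos: "M > 0" using c_bound(1) c_bound(2,3)[of 1] by auto

lemma interior: "0 < r \<Longrightarrow> r < 1 \<Longrightarrow> at r within {0<..1} = at (r::real)"
  by (rule at_within_interior) simp

lemma G_cont: "continuous_on {0<..1} G" by (rule DERIV_continuous_on) (rule G_deriv)

lemma N_bound: "\<exists>K2\<ge>0. \<forall>r\<in>{0<..1}. \<bar>N r\<bar> \<le> K2"
proof -
  have "compact (q ` {0..1})" by (intro compact_continuous_image q_cont) auto
  from compact_imp_bounded[OF this] obtain Q where Q: "\<forall>y\<in>q ` {0..1}. norm y \<le> Q" unfolding bounded_iff by blast
  have "\<bar>N r\<bar> \<le> Q + (2 * real k + d) * K + K\<^sup>2" if r: "r \<in> {0<..1}" for r
  proof -
    have "\<bar>q r\<bar> \<le> Q" using Q r by auto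
    moreover have "\<bar>(2 * real k + d) * G r\<bar> \<le> (2 * real k + d) * K"
      unfolding abs_mult using G_bound[OF r] by (simp add: d_def mult_left_mono)
    moreover have "\<bar>r\<^sup>2 * (G r)\<^sup>2\<bar> \<le> 1 * K\<^sup>2"
      unfolding abs_mult using r G_bound[OF r] power_mono[of "\<bar>G r\<bar>" K 2] by (intro mult_mono) (auto simp: power_le_one)
    ultimately show ?thesis unfolding N_def by linarith
  qed
  thus ?thesis by (intro exI[of _ "max 0 (Q + (2 * real k + d) * K + K\<^sup>2)"]) (auto intro: order_trans[OF _ max.cobounded2])
qed

context
  fixes P :: "'a \<Rightarrow> real"
  assumes poly: "real_polynomial_function P" and hom: "\<And>t x. P (t *\<^sub>R x) = t ^ k * P x"
    and harm: "\<And>x. laplacian P x = 0"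
begin

definition u where "u x = c (norm x) * P x"

text \<open>Away from the origin this is the product rule. At the origin, u and its gradient are of
  second order and the Hessian of first order in |x|, so the extension by zero is C2. In the
  Laplacian, Euler's identity and harmonicity of P leave \<open>c * P\<close> times
  \<open>r^2 * G^2 + (2 * k + d) * G + N\<close>, which is q.\<close>

lemma DN_solution:
  "schroedinger_solution V u"
proof -
  let ?B = "ball (0::'a) 1"
  obtain g where g: "\<And>x. (P has_derivative (\<lambda>v. g x \<bullet> v)) (at x)" and gp: "\<And>i. real_polynomial_function (\<lambda>x. g x \<bullet> i)"
    using polynomial_gradient[OF poly] by blast
  have "\<exists>h. \<forall>x. ((\<lambda>x. g x \<bullet> i) has_derivative (\<lambda>v. h x \<bullet> v)) (at x) \<and> (\<forall>j. real_polynomial_function (\<lambda>x. h x \<bullet> j))" for i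
    using polynomial_gradient[OF gp[of i]] by metis
  then obtain h where h: "\<And>i x. ((\<lambda>x. g x \<bullet> i) has_derivative (\<lambda>v. h i x \<bullet> v)) (at x)"
    and hp: "\<And>i j. real_polynomial_function (\<lambda>x. h i x \<bullet> j)" by metis
  have cP: "continuous_on S P" for S by (rule real_polynomial_function_continuous[OF poly])
  have cg: "continuous_on S g" for S by (rule gradient_continuous) (rule real_polynomial_function_continuous[OF gp])
  have ch: "continuous_on S (h i)" for S i by (rule gradient_continuous) (rule real_polynomial_function_continuous[OF hp])
  \<comment> \<open>P has degree n + 3, so gradient and Hessian are homogeneous of degree n + 2 and
    n + 1; even the Hessian vanishes at the origin.\<close>
  obtain n where n: "k = Suc (Suc (Suc n))" using k by (metis add_Suc_right add_0_right le_Suc_ex numeral_3_eq_3 add_Suc)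
  have hom1: "g (t *\<^sub>R x) = t ^ Suc (Suc n) *\<^sub>R g x" if "t > 0" for t x
    by (rule homogeneous_gradient[OF g _ that]) (simp add: hom n)
  have hom2: "h i (t *\<^sub>R x) = t ^ Suc n *\<^sub>R h i x" if "t > 0" for t x i
    by (rule homogeneous_gradient[OF h _ that]) (simp add: hom1)
  have euler: "g x \<bullet> x = real k * P x" for x by (rule Euler_homogeneous[OF g]) (rule hom)
  have P0: "P 0 = 0" using hom[of 0 0] n by simp
  obtain A0 A1 where A0: "A0 \<ge> 0" "\<And>x. x \<noteq> 0 \<Longrightarrow> norm (P x) \<le> A0 * norm x ^ k"
    and A1: "A1 \<ge> 0" "\<And>x. x \<noteq> 0 \<Longrightarrow> norm (g x) \<le> A1 * norm x ^ Suc (Suc n)"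
    using homogeneous_bound[of P k, OF cP] homogeneous_bound[of g, OF cg hom1] hom by auto
  have "\<exists>A2\<ge>0. \<forall>x. x \<noteq> 0 \<longrightarrow> norm (h i x) \<le> A2 * norm x ^ Suc n" for i
    by (rule homogeneous_bound[OF ch hom2])
  then obtain A2 where A2: "\<And>i. A2 i \<ge> 0" "\<And>i x. x \<noteq> 0 \<Longrightarrow> norm (h i x) \<le> A2 i * norm x ^ Suc n" by metis
  obtain K2 where K2: "K2 \<ge> 0" "\<And>r. r \<in> {0<..1} \<Longrightarrow> \<bar>N r\<bar> \<le> K2" using N_bound by blast
  have Pb: "\<bar>P x\<bar> \<le> A0 * norm x ^ 3" if "x \<noteq> 0" "norm x < 1" for x
  proof -
    have "norm x ^ k \<le> norm x ^ 3" using that k by (intro power_decreasing) auto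
    thus ?thesis using A0(1) A0(2)[OF that(1)] by (auto intro: order_trans mult_left_mono)
  qed
  have gb: "norm (g x) \<le> A1 * norm x ^ 2" if "x \<noteq> 0" "norm x < 1" for x
  proof -
    have "norm x ^ Suc (Suc n) \<le> norm x ^ 2" using that by (intro power_decreasing) auto
    thus ?thesis using A1(1) A1(2)[OF that(1)] by (auto intro: order_trans mult_left_mono)
  qed
  have hb: "norm (h i x) \<le> A2 i * norm x" if "x \<noteq> 0" "norm x < 1" for x i
  proof -
    have "norm x ^ Suc n \<le> norm x ^ 1" using that by (intro power_decreasing) auto
    thus ?thesis using A2(1)[of i] A2(2)[OF that(1), of i] by (auto intro: order_trans mult_left_mono)
  qed
  \<comment> \<open>The gradient of u, and in \<open>hu i\<close> the gradient of its i-th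
    component, from \<open>grad c = G * c * x\<close> and \<open>grad G = N / |x|^2 * x\<close>. The
    value 0 at the origin is the limit.\<close>
  define gu where "gu x = (if x = 0 then 0 else c (norm x) *\<^sub>R ((G (norm x) * P x) *\<^sub>R x + g x))" for x
  define hu where "hu i x = (if x = 0 then 0 else c (norm x) *\<^sub>R
     ((G (norm x) * (G (norm x) * P x * (x \<bullet> i) + g x \<bullet> i)) *\<^sub>R x + (N (norm x) / (norm x)\<^sup>2 * P x * (x \<bullet> i)) *\<^sub>R x
       + (G (norm x) * (x \<bullet> i)) *\<^sub>R g x + (G (norm x) * P x) *\<^sub>R i + h i x))" for i x
  have range: "norm x \<in> {0<..1}" "norm x \<in> {0..1}" if "x \<noteq> 0" "norm x < 1" for x :: 'a using that by auto
  have cd: "((\<lambda>x. c (norm x)) has_derivative (\<lambda>v. G (norm x) * c (norm x) * (x \<bullet> v))) (at x)" if x: "x \<noteq> 0" "norm x < 1" for x :: 'a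
  proof -
    have "(c has_real_derivative norm x * G (norm x) * c (norm x)) (at (norm x))"
      using c_deriv[OF range(1)[OF x]] interior[of "norm x"] x by simp
    from radial_has_derivative[OF this x(1)] show ?thesis using x by simp
  qed
  have Gd: "((\<lambda>x. G (norm x)) has_derivative (\<lambda>v. N (norm x) / (norm x)\<^sup>2 * (x \<bullet> v))) (at x)" if x: "x \<noteq> 0" "norm x < 1" for x :: 'a
  proof -
    have "(G has_real_derivative N (norm x) / norm x) (at (norm x))"
      using G_deriv[OF range(1)[OF x]] interior[of "norm x"] x by (simp add: N_def d_def)
    from radial_has_derivative[OF this x(1)] show ?thesis by (simp add: power2_eq_square)
  qed
  have cb: "\<bar>c (norm x)\<bar> \<le> M" if "norm x < 1" for x :: 'a
    using c_bound(1) c_bound(2,3)[of "norm x"] that by auto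
  have ub: "\<bar>u x\<bar> \<le> M * A0 * norm x ^ 2" if "norm x < 1" for x
  proof (cases "x = 0")
    case False
    have "\<bar>P x\<bar> \<le> A0 * norm x ^ 2"
      using Pb[OF False that] A0(1) power_decreasing[of 2 3 "norm x"] that
      by (auto intro: order_trans mult_left_mono)
    hence "\<bar>c (norm x)\<bar> * \<bar>P x\<bar> \<le> M * (A0 * norm x ^ 2)"
      using cb[OF that] M_pos by (intro mult_mono) auto
    thus ?thesis by (simp add: u_def abs_mult mult.assoc)
  qed (simp add: u_def P0)
  have ud: "(u has_derivative (\<lambda>v. gu x \<bullet> v)) (at x)" if "x \<in> ?B" for x
  proof (cases "x = 0")
    case True
    thus ?thesis using has_derivative_zero_at_0[of u, OF ub] by (simp add: gu_def)
  next
    case False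
    show ?thesis unfolding u_def[abs_def]
      using has_derivative_mult[OF cd[OF False] g[of x]] that False
      by (simp add: gu_def inner_add_left algebra_simps)
  qed
  define C1 where "C1 = M * (K * A0 + A1)"
  have gub: "norm (gu x) \<le> C1 * norm x ^ 2" if x: "norm x < 1" for x
  proof (cases "x = 0")
    case False
    have G: "\<bar>G (norm x)\<bar> \<le> K" using G_bound[OF range(1)[OF False x]] .
    have p: "norm x ^ 3 * norm x \<le> norm x ^ 2"
      using power_decreasing[of 2 4 "norm x"] x by (simp add: power4_eq_xxxx power3_eq_cube)
    have "norm ((G (norm x) * P x) *\<^sub>R x) \<le> (K * (A0 * norm x ^ 3)) * norm x"
      unfolding norm_scaleR real_norm_def abs_mult using G Pb[OF False x] K_nonneg A0
      by (intro mult_mono mult_nonneg_nonneg) auto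
    also have "\<dots> = K * A0 * (norm x ^ 3 * norm x)" by simp
    also have "\<dots> \<le> K * A0 * norm x ^ 2" using p K_nonneg A0 by (intro mult_left_mono) auto
    finally have "norm ((G (norm x) * P x) *\<^sub>R x + g x) \<le> (K * A0 + A1) * norm x ^ 2"
      using gb[OF False x] norm_triangle_ineq[of "(G (norm x) * P x) *\<^sub>R x" "g x"] by (simp add: distrib_right)
    hence "\<bar>c (norm x)\<bar> * norm ((G (norm x) * P x) *\<^sub>R x + g x) \<le> M * ((K * A0 + A1) * norm x ^ 2)"
      using cb[OF x] M_pos by (intro mult_mono) auto
    thus ?thesis using False by (simp add: gu_def C1_def mult.assoc)
  qed (simp add: gu_def)
  have C1n: "C1 \<ge> 0" using M_pos K_nonneg A0 A1 by (simp add: C1_def)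
  have gud: "((\<lambda>x. gu x \<bullet> i) has_derivative (\<lambda>v. hu i x \<bullet> v)) (at x)" if x: "x \<in> ?B" and i: "i \<in> Basis" for x i
  proof (cases "x = 0")
    case True
    have "\<bar>gu x \<bullet> i\<bar> \<le> C1 * norm x ^ 2" if "norm x < 1" for x
      using gub[OF that] Basis_le_norm[OF i, of "gu x"] by linarith
    from has_derivative_zero_at_0[of "\<lambda>x. gu x \<bullet> i", OF this] show ?thesis using True by (simp add: hu_def)
  next
    case False
    have nx: "norm x < 1" using x by simp
    have "((\<lambda>x. c (norm x) * (G (norm x) * P x * (x \<bullet> i) + g x \<bullet> i)) has_derivative
      (\<lambda>v. c (norm x) * ((G (norm x) * P x) * (v \<bullet> i) + (G (norm x) * (g x \<bullet> v) + N (norm x) / (norm x)\<^sup>2 * (x \<bullet> v) * P x) * (x \<bullet> i) + h i x \<bullet> v)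
         + (G (norm x) * c (norm x) * (x \<bullet> v)) * (G (norm x) * P x * (x \<bullet> i) + g x \<bullet> i))) (at x)"
      by (intro has_derivative_mult has_derivative_add cd[OF False nx] Gd[OF False nx] g h bounded_linear_imp_has_derivative bounded_linear_inner_left)
    also have "(\<lambda>v. c (norm x) * ((G (norm x) * P x) * (v \<bullet> i) + (G (norm x) * (g x \<bullet> v) + N (norm x) / (norm x)\<^sup>2 * (x \<bullet> v) * P x) * (x \<bullet> i) + h i x \<bullet> v)
         + (G (norm x) * c (norm x) * (x \<bullet> v)) * (G (norm x) * P x * (x \<bullet> i) + g x \<bullet> i)) = (\<lambda>v. hu i x \<bullet> v)"
      using False by (simp add: hu_def inner_add_left algebra_simps inner_commute[of _ i] fun_eq_iff)
    finally have D: "((\<lambda>x. c (norm x) * (G (norm x) * P x * (x \<bullet> i) + g x \<bullet> i)) has_derivative (\<lambda>v. hu i x \<bullet> v)) (at x)" .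
    show ?thesis
      by (rule has_derivative_transform_within_open[OF D, of "- {0}"]) (use False in \<open>auto simp: gu_def inner_add_left\<close>)
  qed
  have cc: "continuous_on (?B - {0}) (\<lambda>x. c (norm x))"
    by (intro continuous_on_compose2[OF c_cont] continuous_intros) auto
  have cG: "continuous_on (?B - {0}) (\<lambda>x. G (norm x))"
    by (intro continuous_on_compose2[OF G_cont] continuous_intros) auto
  have cq: "continuous_on (?B - {0}) (\<lambda>x. q (norm x))"
    by (intro continuous_on_compose2[OF q_cont] continuous_intros) auto
  have guc: "continuous_on ?B gu"
  proof (rule continuous_on_ball_puncture)
    have "continuous_on (?B - {0}) (\<lambda>x. c (norm x) *\<^sub>R ((G (norm x) * P x) *\<^sub>R x + g x))"
      by (intro continuous_intros cc cG cP cg)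
    thus "continuous_on (?B - {0}) gu" by (rule continuous_on_eq) (simp add: gu_def)
    show "norm (gu x) \<le> C1 * norm x" if "norm x < 1" for x
    proof -
      have "norm x ^ 2 \<le> norm x" using power_decreasing[of 1 2 "norm x"] that by simp
      thus ?thesis using gub[OF that] C1n by (auto intro: order_trans mult_left_mono)
    qed
  qed (simp add: gu_def)
  have huc: "continuous_on ?B (hu i)" if i: "i \<in> Basis" for i
  proof (rule continuous_on_ball_puncture)
    have "continuous_on (?B - {0}) (\<lambda>x. c (norm x) *\<^sub>R
     ((G (norm x) * (G (norm x) * P x * (x \<bullet> i) + g x \<bullet> i)) *\<^sub>R x + (N (norm x) / (norm x)\<^sup>2 * P x * (x \<bullet> i)) *\<^sub>R x
       + (G (norm x) * (x \<bullet> i)) *\<^sub>R g x + (G (norm x) * P x) *\<^sub>R i + h i x))"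
      unfolding N_def by (intro continuous_intros cc cG cP cg ch cq) auto
    thus "continuous_on (?B - {0}) (hu i)" by (rule continuous_on_eq) (simp add: hu_def)
    define C2 where "C2 = M * (K * (K * A0 + A1) + K2 * A0 + K * A1 + K * A0 + A2 i)"
    show "norm (hu i x) \<le> C2 * norm x" if x: "norm x < 1" for x
    proof (cases "x = 0")
      case False
      define r where "r = norm x"
      have r: "0 < r" "r < 1" using False x by (auto simp: r_def)
      have pw: "r ^ j \<le> r" if "j \<ge> 1" for j using power_decreasing[of 1 j r] r that by simp
      have G: "\<bar>G r\<bar> \<le> K" using G_bound[of r] r by auto
      have Nr: "\<bar>N r\<bar> \<le> K2" using K2(2)[of r] r by auto
      have xi: "\<bar>x \<bullet> i\<bar> \<le> r" using Basis_le_norm[OF i, of x] by (simp add: r_def)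
      have gi: "\<bar>g x \<bullet> i\<bar> \<le> A1 * r ^ 2" using Basis_le_norm[OF i, of "g x"] gb[OF False x] by (simp add: r_def)
      have Px: "\<bar>P x\<bar> \<le> A0 * r ^ 3" using Pb[OF False x] by (simp add: r_def)
      have gx: "norm (g x) \<le> A1 * r ^ 2" using gb[OF False x] by (simp add: r_def)
      have hx: "norm (h i x) \<le> A2 i * r" using hb[OF False x] by (simp add: r_def)
      have t0: "\<bar>G r * P x * (x \<bullet> i)\<bar> \<le> K * A0 * 1"
      proof -
        have "\<bar>G r * P x * (x \<bullet> i)\<bar> \<le> K * (A0 * r ^ 3) * r"
          unfolding abs_mult using G Px xi K_nonneg A0 r by (intro mult_mono mult_nonneg_nonneg) auto
        also have "\<dots> = K * A0 * r ^ 4" by (simp add: power4_eq_xxxx power3_eq_cube)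
        also have "\<dots> \<le> K * A0 * 1" using r K_nonneg A0 by (intro mult_left_mono) (auto simp: power_le_one)
        finally show ?thesis .
      qed
      have gi1: "\<bar>g x \<bullet> i\<bar> \<le> A1 * 1"
        using gi mult_left_mono[OF power_le_one[of r 2], of A1] r A1 by auto
      have t1: "norm ((G r * (G r * P x * (x \<bullet> i) + g x \<bullet> i)) *\<^sub>R x) \<le> K * (K * A0 + A1) * r"
        unfolding norm_scaleR real_norm_def abs_mult[of "G r"] r_def[symmetric] using G t0 gi1 K_nonneg r A0 A1
        by (intro mult_mono mult_nonneg_nonneg) auto
      \<comment> \<open>The only term with a negative power of r. The cubic decay of P and the
        factor \<open>x \<bullet> i\<close> absorb it.\<close>
      have "\<bar>P x\<bar> * \<bar>x \<bullet> i\<bar> \<le> (A0 * r ^ 3) * r" using Px xi A0 r by (intro mult_mono) auto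
      moreover have "\<bar>N r\<bar> / r\<^sup>2 \<le> K2 / r\<^sup>2" by (intro divide_right_mono Nr) simp
      ultimately have "\<bar>N r\<bar> / r\<^sup>2 * (\<bar>P x\<bar> * \<bar>x \<bullet> i\<bar>) \<le> K2 / r\<^sup>2 * ((A0 * r ^ 3) * r)"
        using K2 by (intro mult_mono[of "\<bar>N r\<bar> / r\<^sup>2" "K2 / r\<^sup>2"]) auto
      also have "\<dots> = K2 * A0 * r\<^sup>2" using r by (simp add: power2_eq_square power3_eq_cube)
      also have "\<dots> \<le> K2 * A0 * 1" using r K2 A0 by (intro mult_left_mono) (auto simp: power_le_one)
      finally have "\<bar>N r\<bar> / r\<^sup>2 * (\<bar>P x\<bar> * \<bar>x \<bullet> i\<bar>) * r \<le> K2 * A0 * 1 * r"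
        using r by (intro mult_right_mono) auto
      moreover have "norm ((N r / r\<^sup>2 * P x * (x \<bullet> i)) *\<^sub>R x) = \<bar>N r\<bar> / r\<^sup>2 * (\<bar>P x\<bar> * \<bar>x \<bullet> i\<bar>) * r"
        by (simp add: abs_mult r_def)
      ultimately have t2: "norm ((N r / r\<^sup>2 * P x * (x \<bullet> i)) *\<^sub>R x) \<le> K2 * A0 * r" by (simp only: mult_1_right)
      have "norm ((G r * (x \<bullet> i)) *\<^sub>R g x) \<le> (K * 1) * (A1 * r ^ 2)"
        unfolding norm_scaleR real_norm_def abs_mult using G xi gx K_nonneg A1 r by (intro mult_mono mult_nonneg_nonneg) auto
      also have "\<dots> \<le> K * A1 * r" using pw[of 2] K_nonneg A1 by (simp add: mult.assoc mult_left_mono)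
      finally have t3: "norm ((G r * (x \<bullet> i)) *\<^sub>R g x) \<le> K * A1 * r" .
      have "norm ((G r * P x) *\<^sub>R i) \<le> (K * (A0 * r ^ 3)) * 1"
        unfolding norm_scaleR real_norm_def abs_mult using G Px K_nonneg A0 r i by (intro mult_mono mult_nonneg_nonneg) auto
      also have "\<dots> \<le> K * A0 * r" using pw[of 3] K_nonneg A0 by (simp add: mult.assoc mult_left_mono)
      finally have t4: "norm ((G r * P x) *\<^sub>R i) \<le> K * A0 * r" .
      have "norm ((G r * (G r * P x * (x \<bullet> i) + g x \<bullet> i)) *\<^sub>R x + (N r / r\<^sup>2 * P x * (x \<bullet> i)) *\<^sub>R x
         + (G r * (x \<bullet> i)) *\<^sub>R g x + (G r * P x) *\<^sub>R i + h i x)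
        \<le> K * (K * A0 + A1) * r + K2 * A0 * r + K * A1 * r + K * A0 * r + A2 i * r"
        by (intro norm_triangle_mono t1 t2 t3 t4 hx)
      hence "\<bar>c r\<bar> * norm ((G r * (G r * P x * (x \<bullet> i) + g x \<bullet> i)) *\<^sub>R x + (N r / r\<^sup>2 * P x * (x \<bullet> i)) *\<^sub>R x
         + (G r * (x \<bullet> i)) *\<^sub>R g x + (G r * P x) *\<^sub>R i + h i x)
        \<le> M * (K * (K * A0 + A1) * r + K2 * A0 * r + K * A1 * r + K * A0 * r + A2 i * r)"
        using cb[OF x] M_pos by (intro mult_mono) (auto simp: r_def)
      moreover have "hu i x = c r *\<^sub>R ((G r * (G r * P x * (x \<bullet> i) + g x \<bullet> i)) *\<^sub>R x + (N r / r\<^sup>2 * P x * (x \<bullet> i)) *\<^sub>R x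
         + (G r * (x \<bullet> i)) *\<^sub>R g x + (G r * P x) *\<^sub>R i + h i x)"
        using False by (simp only: hu_def r_def if_False)
      moreover have "M * (K * (K * A0 + A1) * r + K2 * A0 * r + K * A1 * r + K * A0 * r + A2 i * r) = C2 * r"
        by (simp add: C2_def algebra_simps)
      ultimately have "norm (hu i x) \<le> C2 * r" by (simp only: norm_scaleR real_norm_def)
      thus ?thesis by (simp only: r_def)
    qed (simp add: hu_def)
  qed (simp add: hu_def)
  have pu: "partial_deriv i u x = gu x \<bullet> i" if "x \<in> ?B" for i x by (rule partial_deriv_gradient[OF ud[OF that]])
  have pud: "(partial_deriv i u has_derivative (\<lambda>v. hu i x \<bullet> v)) (at x)" if "x \<in> ?B" "i \<in> Basis" for i x
    by (rule has_derivative_transform_within_open[OF gud[OF that] open_ball that(1)]) (simp add: pu)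
  have C2: "C2_on_open ?B u"
    unfolding C2_on_open_def using C1_on_gradient[OF ud guc] C1_on_gradient[OF pud huc] by blast
  have lapP: "(\<Sum>i\<in>Basis. h i x \<bullet> i) = 0" for x
  proof -
    have "partial_deriv i P = (\<lambda>x. g x \<bullet> i)" for i using partial_deriv_gradient[OF g] by blast
    hence "iter_partial [i, i] P x = h i x \<bullet> i" for i
      using partial_deriv_gradient[OF h] by (simp add: iter_partial_def)
    thus ?thesis using harm[of x] by (simp add: laplacian_def)
  qed
  have lap: "laplacian u x = V x * u x" if x: "x \<in> ?B" for x
  proof (cases "x = 0")
    case True
    have "laplacian u x = (\<Sum>i\<in>Basis. hu i x \<bullet> i)"
      using partial_deriv_gradient[OF pud[OF x]] by (simp add: laplacian_def iter_partial_def)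
    thus ?thesis using True by (simp add: hu_def u_def P0)
  next
    case False
    define r where "r = norm x"
    have r: "r > 0" using False by (simp add: r_def)
    have s1: "(\<Sum>i\<in>Basis. (x \<bullet> i) * (x \<bullet> i)) = r\<^sup>2" by (simp add: r_def power2_norm_eq_inner flip: euclidean_inner)
    have s2: "(\<Sum>i\<in>Basis. (g x \<bullet> i) * (x \<bullet> i)) = real k * P x" by (simp add: euler flip: euclidean_inner)
    have s3: "(\<Sum>i\<in>(Basis::'a set). i \<bullet> i) = d" by (simp add: d_def)
    have "laplacian u x = (\<Sum>i\<in>Basis. hu i x \<bullet> i)"
      using partial_deriv_gradient[OF pud[OF x]] by (simp add: laplacian_def iter_partial_def)
    also have "\<dots> = (\<Sum>i\<in>Basis. c r * (G r * G r * P x * ((x \<bullet> i) * (x \<bullet> i)) + 2 * G r * ((g x \<bullet> i) * (x \<bullet> i))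
       + N r / r\<^sup>2 * P x * ((x \<bullet> i) * (x \<bullet> i)) + G r * P x * (i \<bullet> i) + h i x \<bullet> i))"
      using False by (intro sum.cong) (simp_all add: hu_def r_def[symmetric] inner_add_left algebra_simps)
    also have "\<dots> = c r * (G r * G r * P x * r\<^sup>2 + 2 * G r * (real k * P x) + N r / r\<^sup>2 * P x * r\<^sup>2 + G r * P x * d + 0)"
      by (simp only: sum_distrib_left[symmetric] sum.distrib s1 s2 s3 lapP)
    \<comment> \<open>The Riccati equation enters here: N is q minus exactly the remaining radial
      terms.\<close>
    also have "\<dots> = q r * (c r * P x)"
    proof -
      have "N r / r\<^sup>2 * P x * r\<^sup>2 = N r * P x" using r by simp
      thus ?thesis by (simp only:) (simp add: N_def algebra_simps power2_eq_square)
    qed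
    also have "\<dots> = V x * u x" using V[of x] x by (simp add: u_def r_def)
    finally show ?thesis .
  qed
  have "continuous_on (cball 0 1) u" unfolding u_def[abs_def]
    by (intro continuous_intros cP continuous_on_compose2[OF c_cont]) auto
  with C2 lap show ?thesis by (simp add: schroedinger_solution_def)
qed

lemma DN_graph_solution:
  assumes "\<And>w. w \<in> sphere 0 1 \<Longrightarrow> Y w = P w"
  shows "DN_graph V Y (\<lambda>w. (real k + G 1) * Y w)"
  unfolding DN_graph_def
proof (intro exI conjI ballI)
  show "schroedinger_solution V u" by (rule DN_solution)
  fix w :: 'a assume w: "w \<in> sphere 0 1"
  show "u w = Y w" using w assms[OF w] c1 by (simp add: u_def)
  have "((\<lambda>t. c t * (t ^ k * P w)) has_real_derivative (1 * G 1 * c 1) * (1 ^ k * P w) + (real k * 1 ^ (k - 1) * P w) * c 1) (at 1 within {0<..1})"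
    by (intro DERIV_mult c_deriv) (auto intro!: derivative_eq_intros)
  hence "((\<lambda>t. c t * (t ^ k * P w)) has_real_derivative (real k + G 1) * Y w) (at 1 within {0<..1})"
    using c1 assms[OF w] by (simp add: algebra_simps)
  thus "((\<lambda>t. u (t *\<^sub>R w)) has_real_derivative (real k + G 1) * Y w) (at 1 within {0<..1})"
    unfolding has_field_derivative_def
    by (rule has_derivative_transform[rotated 2]) (use w in \<open>auto simp: u_def hom\<close>)
qed

end

text \<open>The solution has boundary derivative \<open>k + c'(1) = k + G 1\<close>. A spherical
  harmonic that is nonzero somewhere on the sphere makes this number the only candidate.\<close>

lemma DN_eigenvalue_eq:
  assumes "\<not> zero_dirichlet_eigenvalue V"
  shows "DN_eigenvalue V k = real k + G 1"
  unfolding DN_eigenvalue_def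
proof (rule the_equality)
  show "\<forall>Y. spherical_harmonic k Y \<longrightarrow> DN_graph V Y (\<lambda>w. (real k + G 1) * Y w)"
    using DN_graph_solution unfolding spherical_harmonic_def by blast
  fix l assume l: "\<forall>Y. spherical_harmonic k Y \<longrightarrow> DN_graph V Y (\<lambda>w. l * Y w)"
  obtain Y :: "'a \<Rightarrow> real" and w where Y: "spherical_harmonic k Y" "w \<in> sphere 0 1" "Y w \<noteq> 0"
    using spherical_harmonic_nonzero[OF dim] by blast
  have "DN_graph V Y (\<lambda>w. (real k + G 1) * Y w)"
    using DN_graph_solution Y(1) unfolding spherical_harmonic_def by blast
  from DN_graph_unique[OF assms l[rule_format, OF Y(1)] this Y(2)] Y(3) show "l = real k + G 1" by simp
qed

end

section \<open>The radial equation and its admissible solutions\<close>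

lemma profile_eq:
  fixes V :: "'a::euclidean_space \<Rightarrow> real"
  assumes "\<And>x. x \<in> cball 0 1 \<Longrightarrow> V x = q (norm x)" "r \<in> {0<..1}"
  shows "profile V r = q r"
  unfolding profile_def
proof (rule the_equality)
  show "\<forall>x. norm x = r \<longrightarrow> V x = q r" using assms by auto
  obtain e :: 'a where "norm e = 1" by (meson SOME_Basis norm_Basis)
  hence e: "norm (r *\<^sub>R e) = r" using assms(2) by simp
  fix c assume "\<forall>x. norm x = r \<longrightarrow> V x = c"
  hence "V (r *\<^sub>R e) = c" using e by blast
  moreover have "V (r *\<^sub>R e) = q r" using assms e by simp
  ultimately show "c = q r" by simp
qed

lemma at_1_nontrivial: "at (1::real) within {0<..1} \<noteq> bot"
proof -
  have "{0<..1::real} - {1} = {0<..<1}" by auto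
  thus ?thesis by (simp add: at_within_eq_bot_iff)
qed

context radial_riccati
begin

definition b where "b r = r ^ k * c r"
definition b1 where "b1 r = r ^ (k - 1) * c r * (real k + r\<^sup>2 * G r)"
definition \<kappa> where "\<kappa> = real k * (real k + d - 2)"

lemma profile_V: "r \<in> {0<..1} \<Longrightarrow> profile V r = q r"
  by (rule profile_eq) (auto simp: V)

lemma b_deriv: assumes "r \<in> {0<..1}" shows "(b has_real_derivative b1 r) (at r within {0<..1})"
proof -
  have "((\<lambda>r. r ^ k * c r) has_real_derivative (r ^ k * (r * G r * c r) + real k * r ^ (k - 1) * c r)) (at r within {0<..1})"
    by (rule derivative_eq_intros c_deriv[OF assms] refl | simp add: mult_ac)+
  moreover have "r ^ k * (r * G r * c r) + real k * r ^ (k - 1) * c r = b1 r"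
  proof -
    have "r ^ k = r ^ (k - 1) * r" using power_minus_mult[of k r] k by simp
    thus ?thesis by (simp only: b1_def) (simp add: algebra_simps power2_eq_square)
  qed
  ultimately show ?thesis by (simp add: b_def[abs_def])
qed

lemma b_flux:
  assumes r: "r \<in> {0<..1}"
  shows "((\<lambda>t. t ^ (DIM('a) - 1) * b1 t) has_real_derivative r ^ (DIM('a) - 1) * ((\<kappa> / r\<^sup>2 + q r) * b r)) (at r within {0<..1})"
proof -
  \<comment> \<open>The flux \<open>r ^ (d - 1) * b'\<close> is a power of r times
    \<open>c * (k + r^2 * G)\<close>. Its exponent d + k - 2 is written as a successor, so that the
    power rule involves no truncated subtraction.\<close>
  obtain n where n: "DIM('a) - 1 + (k - 1) = Suc n" using dim k by (cases "DIM('a) - 1 + (k - 1)") auto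
  have nr: "real (Suc n) = d + real k - 2" using n dim k by (simp add: d_def)
  have fl: "(\<lambda>t. t ^ (DIM('a) - 1) * b1 t) = (\<lambda>t. t ^ Suc n * c t * (real k + t\<^sup>2 * G t))"
    by (simp only: b1_def n[symmetric] power_add mult.assoc)
  have "((\<lambda>t. t ^ Suc n * c t * (real k + t\<^sup>2 * G t)) has_real_derivative
     (real (Suc n) * r ^ n * c r + r * G r * c r * r ^ Suc n) * (real k + r\<^sup>2 * G r)
      + (2 * r * G r + N r / r * r\<^sup>2) * (r ^ Suc n * c r)) (at r within {0<..1})"
  proof -
    have p1: "((\<lambda>t. t ^ Suc n) has_real_derivative real (Suc n) * r ^ n) (at r within {0<..1})"
      using DERIV_pow[of "Suc n" r "{0<..1}"] by simp
    have p2: "((\<lambda>t. t\<^sup>2) has_real_derivative 2 * r) (at r within {0<..1})"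
      using DERIV_pow[of 2 r "{0<..1}"] by simp
    have gd: "(G has_real_derivative N r / r) (at r within {0<..1})"
      using G_deriv[OF r] unfolding N_def d_def .
    have p3: "((\<lambda>t. real k + t\<^sup>2 * G t) has_real_derivative 2 * r * G r + N r / r * r\<^sup>2) (at r within {0<..1})"
      using DERIV_add[OF DERIV_const[of "real k"] DERIV_mult[OF p2 gd]] by simp
    show ?thesis by (rule DERIV_mult[OF DERIV_mult[OF p1 c_deriv[OF r]] p3])
  qed
  also have "(real (Suc n) * r ^ n * c r + r * G r * c r * r ^ Suc n) * (real k + r\<^sup>2 * G r)
      + (2 * r * G r + N r / r * r\<^sup>2) * (r ^ Suc n * c r) = r ^ n * c r * (\<kappa> + r\<^sup>2 * q r)"
  proof -
    have "N r / r * r\<^sup>2 = r * N r" using r by (simp add: power2_eq_square)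
    thus ?thesis unfolding nr by (simp only:) (simp add: N_def \<kappa>_def algebra_simps power2_eq_square)
  qed
  also have "\<dots> = r ^ (DIM('a) - 1) * ((\<kappa> / r\<^sup>2 + q r) * b r)"
  proof -
    have "r ^ (DIM('a) - 1) * r ^ k = r ^ (DIM('a) - 1 + (k - 1)) * r"
      using power_minus_mult[of k r] k by (simp only: power_add mult.assoc)
    also have "\<dots> = r ^ n * r\<^sup>2" unfolding n by (simp add: power2_eq_square)
    finally have "r ^ (DIM('a) - 1) * ((\<kappa> / r\<^sup>2 + q r) * b r) = (r ^ n * r\<^sup>2) * ((\<kappa> / r\<^sup>2 + q r) * c r)"
      by (simp add: b_def mult_ac)
    also have "\<dots> = r ^ n * c r * (\<kappa> + r\<^sup>2 * q r)" using r by (simp add: field_simps)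
    finally show ?thesis ..
  qed
  finally show ?thesis unfolding fl .
qed

lemma b_pos: "r \<in> {0<..1} \<Longrightarrow> b r > 0"
  using c_bound(1) c_bound(2)[of r] by (auto simp: b_def intro!: mult_pos_pos)

lemma radial_solution_b: "radial_solution V k (restrict b {0<..1})"
proof -
  have "(restrict b {0<..1} has_real_derivative b1 r) (at r within {0<..1})" if "r \<in> {0<..1}" for r
    using has_derivative_transform[OF that _ b_deriv[OF that, unfolded has_field_derivative_def], of "restrict b {0<..1}"]
    by (simp add: has_field_derivative_def)
  moreover have "- (1 / r ^ (DIM('a) - 1)) * (r ^ (DIM('a) - 1) * ((\<kappa> / r\<^sup>2 + q r) * b r))
          + (real k * (real k + real DIM('a) - 2) / r\<^sup>2 + profile V r) * restrict b {0<..1} r = 0" if "r \<in> {0<..1}" for r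
    using that profile_V[OF that] by (simp add: \<kappa>_def d_def)
  moreover have "set_integrable lborel (ball 0 1) (\<lambda>x. (restrict b {0<..1} (norm x) * Y (x /\<^sub>R norm x))\<^sup>2 / (norm x)\<^sup>2)"
    if Y: "spherical_harmonic k Y" for Y :: "'a \<Rightarrow> real"
  proof -
    obtain P where P: "real_polynomial_function P" "\<forall>w\<in>sphere 0 1. Y w = P w"
      using Y unfolding spherical_harmonic_def by blast
    have cP: "continuous_on S P" for S by (rule real_polynomial_function_continuous[OF P(1)])
    have "compact (P ` sphere 0 1)" by (intro compact_continuous_image cP) auto
    from compact_imp_bounded[OF this] obtain A where A: "\<forall>y\<in>P ` sphere 0 1. norm y \<le> A" unfolding bounded_iff by blast
    have cb: "continuous_on {0<..<1} b" unfolding b_def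
      by (intro continuous_intros continuous_on_subset[OF c_cont]) auto
    define f where "f x = (b (norm x) * P (x /\<^sub>R norm x))\<^sup>2 / (norm x)\<^sup>2" for x :: 'a
    have "continuous_on (ball 0 1 - {0}) f" unfolding f_def
      by (intro continuous_intros continuous_on_compose2[OF cb] continuous_on_compose2[OF cP[of UNIV]]) auto
    from borel_measurable_continuous_on_indicator[OF _ this]
    have fm: "(\<lambda>x. indicator (ball 0 1 - {0}) x *\<^sub>R f x) \<in> borel_measurable borel" by simp
    have eq: "indicator (ball 0 1) x *\<^sub>R ((restrict b {0<..1} (norm x) * Y (x /\<^sub>R norm x))\<^sup>2 / (norm x)\<^sup>2) = indicator (ball 0 1 - {0}) x *\<^sub>R f x" for x
      using P(2) by (cases "x = 0") (auto simp: f_def indicator_def)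
    have fb: "norm (indicator (ball 0 1 - {0}) x *\<^sub>R f x) \<le> norm (indicator (ball 0 1) x *\<^sub>R (M * A)\<^sup>2)" for x :: 'a
    proof (cases "x \<in> ball 0 1 - {0}")
      case True
      have Px: "\<bar>P (x /\<^sub>R norm x)\<bar> \<le> A" using A True by auto
      have c: "\<bar>c (norm x)\<bar> \<le> M" using c_bound(1) c_bound(2,3)[of "norm x"] True by auto
      \<comment> \<open>One power of |x| is enough: b is of order |x|, and its square cancels the
        weight.\<close>
      have "norm x ^ k \<le> norm x ^ 1" using True k by (intro power_decreasing) auto
      hence "\<bar>b (norm x)\<bar> \<le> norm x * M" unfolding b_def abs_mult using c by (intro mult_mono) auto
      hence "\<bar>b (norm x) * P (x /\<^sub>R norm x)\<bar> \<le> (norm x * M) * A" unfolding abs_mult using Px M_pos by (intro mult_mono) auto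
      hence "\<bar>b (norm x) * P (x /\<^sub>R norm x)\<bar>\<^sup>2 \<le> (norm x * M * A)\<^sup>2" by (intro power_mono) auto
      hence "f x \<le> (norm x * M * A)\<^sup>2 / (norm x)\<^sup>2" unfolding f_def by (intro divide_right_mono) auto
      also have "\<dots> = (M * A)\<^sup>2" using True by (simp add: power_mult_distrib)
      finally show ?thesis using True by (simp add: f_def)
    qed simp
    show ?thesis unfolding set_integrable_def eq
    proof (rule Bochner_Integration.integrable_bound[of _ "\<lambda>x. indicator (ball 0 1) x *\<^sub>R (M * A)\<^sup>2"])
      show "integrable lborel (\<lambda>x. indicator (ball (0::'a) 1) x *\<^sub>R (M * A)\<^sup>2)"
        using emeasure_lborel_ball_finite[of "0::'a" 1] by (intro integrable_real_indicator[THEN integrable_scaleR_left]) auto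
    qed (use fm fb in auto)
  qed
  moreover have "restrict b {0<..1} 1 = 1" by (simp add: b_def c1)
  ultimately show ?thesis using b_flux unfolding radial_solution_def
    by (intro conjI exI[of _ b1] exI[of _ "\<lambda>r. r ^ (DIM('a) - 1) * ((\<kappa> / r\<^sup>2 + q r) * b r)"]) (auto simp del: One_nat_def)
qed

text \<open>Excludes the singular solution of the radial equation, which is of order \<open>r powr (2 - d - k)\<close>.\<close>

lemma nonintegrable_blowup:
  fixes F :: "real \<Rightarrow> real" and Y :: "'a \<Rightarrow> real"
  assumes F: "continuous_on {0<..<1} F" and Y: "spherical_harmonic k Y" and w: "w \<in> sphere 0 1" "Y w \<noteq> 0"
    and big: "\<epsilon> > 0" "r0 > 0" "\<And>r. 0 < r \<Longrightarrow> r < 1 \<Longrightarrow> r < r0 \<Longrightarrow> \<epsilon> * r powr (- d) \<le> F r"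
  shows "\<not> set_integrable lborel (ball 0 1) (\<lambda>x. F (norm x) * (Y (x /\<^sub>R norm x))\<^sup>2)"
proof
  assume int: "set_integrable lborel (ball 0 1) (\<lambda>x. F (norm x) * (Y (x /\<^sub>R norm x))\<^sup>2)"
  obtain P where P: "real_polynomial_function P" "\<forall>w\<in>sphere 0 1. Y w = P w"
    using Y unfolding spherical_harmonic_def by blast
  have cP: "continuous_on S P" for S by (rule real_polynomial_function_continuous[OF P(1)])
  have [measurable]: "P \<in> borel_measurable borel" using cP by (rule borel_measurable_continuous_onI)
  have "compact (P ` sphere 0 1)" by (intro compact_continuous_image cP) auto
  from compact_imp_bounded[OF this] obtain A where A: "\<forall>y\<in>P ` sphere 0 1. norm y \<le> A" unfolding bounded_iff by blast
  \<comment> \<open>The homogeneous extension of degree 0 of the square of the spherical harmonic,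
    as required by the polar formula.\<close>
  define hh where "hh x = (P (x /\<^sub>R norm x))\<^sup>2" for x
  have hm[measurable]: "hh \<in> borel_measurable borel" unfolding hh_def by measurable
  have hn: "hh x \<ge> 0" for x by (simp add: hh_def)
  have hhom: "hh (t *\<^sub>R x) = hh x" if "t > 0" for t x
  proof -
    have "inverse (norm (t *\<^sub>R x)) * t = inverse (norm x)" using that by (simp add: field_simps)
    thus ?thesis unfolding hh_def by (simp only: scaleR_scaleR)
  qed
  \<comment> \<open>At the origin \<open>x /\<^sub>R norm x\<close> is 0, so the value of P at 0 has
    to be included in the bound.\<close>
  have "hh x \<le> max (A\<^sup>2) ((P 0)\<^sup>2)" for x
  proof (cases "x = 0")
    case False
    hence "\<bar>P (x /\<^sub>R norm x)\<bar> \<le> A" using A by auto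
    hence "\<bar>P (x /\<^sub>R norm x)\<bar>\<^sup>2 \<le> A\<^sup>2" by (intro power_mono) auto
    thus ?thesis by (simp add: hh_def)
  qed (simp add: hh_def)
  then obtain mm where mm: "(\<integral>\<^sup>+x. ennreal (hh x) * indicator (ball 0 1) x \<partial>lborel) = ennreal mm" "mm \<ge> 0"
    using bounded_weight_mass[OF hm hn] by blast
  \<comment> \<open>By homogeneity the weight is positive at w/2, hence on a small ball around it,
    which has positive measure.\<close>
  have "mm \<noteq> 0"
  proof
    assume "mm = 0"
    hence "(\<integral>\<^sup>+x. ennreal (hh x) * indicator (ball 0 1) x \<partial>lborel) = 0" using mm(1) by simp
    hence ae: "AE x in lborel. ennreal (hh x) * indicator (ball 0 1) x = 0"
      by (subst (asm) nn_integral_0_iff_AE, measurable)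
    have "\<exists>\<delta>>0. \<forall>x\<in>ball (w /\<^sub>R 2) \<delta>. hh x \<noteq> 0 \<and> x \<in> ball 0 1"
    proof -
      have w2: "w /\<^sub>R 2 \<in> ball 0 1 - {0}" using w(1) by auto
      have "continuous_on (ball 0 1 - {0}) hh" unfolding hh_def
        by (intro continuous_intros continuous_on_compose2[OF cP[of UNIV]]) auto
      hence "open ((ball 0 1 - {0}) \<inter> hh -` {0<..})" by (intro continuous_open_preimage) auto
      moreover have "hh (w /\<^sub>R 2) > 0" 
      proof -
        have "hh (w /\<^sub>R 2) = hh w" using hhom[of "inverse 2" w] by simp
        also have "hh w = (Y w)\<^sup>2" using w(1) P(2) by (simp add: hh_def)
        finally show ?thesis using w(2) by simp
      qed
      ultimately obtain \<delta> where "\<delta> > 0" and sub: "ball (w /\<^sub>R 2) \<delta> \<subseteq> (ball 0 1 - {0}) \<inter> hh -` {0<..}"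
        using w2 unfolding open_contains_ball by blast
      show ?thesis
      proof (intro exI[of _ \<delta>] conjI ballI)
        fix x assume "x \<in> ball (w /\<^sub>R 2) \<delta>"
        hence "x \<in> (ball 0 1 - {0}) \<inter> hh -` {0<..}" using sub by blast
        thus "hh x \<noteq> 0" "x \<in> ball 0 1" by auto
      qed (rule \<open>\<delta> > 0\<close>)
    qed
    then obtain \<delta> where \<delta>: "\<delta> > 0" "\<And>x. x \<in> ball (w /\<^sub>R 2) \<delta> \<Longrightarrow> hh x \<noteq> 0 \<and> x \<in> ball 0 1" by blast
    from ae have "AE x in lborel. x \<notin> ball (w /\<^sub>R 2) \<delta>"
    proof (eventually_elim, intro notI)
      fix x assume z: "ennreal (hh x) * indicator (ball 0 1) x = 0" and "x \<in> ball (w /\<^sub>R 2) \<delta>"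
      hence "hh x \<noteq> 0" "x \<in> ball 0 1" using \<delta>(2) by blast+
      thus False using z hn[of x] by simp
    qed
    hence "emeasure lborel (ball (w /\<^sub>R 2) \<delta>) = 0" by (subst (asm) AE_iff_measurable[of "ball (w /\<^sub>R 2) \<delta>"]) auto
    hence "measure lborel (ball (w /\<^sub>R 2) \<delta>) = 0" by (simp add: measure_def)
    thus False using content_ball_pos[OF \<delta>(1), of "w /\<^sub>R 2"] by simp
  qed
  define f where "f x = indicator (ball 0 1) x *\<^sub>R (F (norm x) * (Y (x /\<^sub>R norm x))\<^sup>2)" for x
  have fm: "f \<in> borel_measurable borel"
    using borel_measurable_integrable[OF int[unfolded set_integrable_def]] by (simp add: f_def[abs_def])
  have fi: "set_integrable lborel (ball 0 1) f"
  proof -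
    have "indicator (ball 0 1) x *\<^sub>R f x = indicator (ball 0 1) x *\<^sub>R (F (norm x) * (Y (x /\<^sub>R norm x))\<^sup>2)" for x
      by (simp add: f_def indicator_def)
    thus ?thesis using int by (simp only: set_integrable_def)
  qed
  have "integrable lborel (\<lambda>\<theta>. indicator {0<..} \<theta> * (exp (- ((0 + real DIM('a)) * \<theta>)) * F (exp (- \<theta>))))"
  proof (rule ball_integral_log(2)[OF hm hn hhom mm F _ fm _ fi])
    show "mm > 0" using mm(2) \<open>mm \<noteq> 0\<close> by simp
    show "f x = hh x * (F (norm x) * norm x powr 0)" if "norm x < 1" "x \<noteq> 0" for x
      using that P(2) by (simp add: f_def hh_def)
  qed
  hence i2: "integrable lborel (\<lambda>\<theta>. indicator {0<..} \<theta> * (exp (- (d * \<theta>)) * F (exp (- \<theta>))))" by (simp add: d_def)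
  \<comment> \<open>For \<theta> > a the radius \<open>exp (- \<theta>)\<close> lies below r0. The
    lower bound for F then makes the transformed integrand at least \<epsilon> on a half line, which
    has infinite measure.\<close>
  define a where "a = max 1 (- ln r0)"
  have "integrable lborel (\<lambda>\<theta>. indicator {a<..} \<theta> *\<^sub>R \<epsilon>)"
  proof (rule Bochner_Integration.integrable_bound[OF i2])
    show "AE \<theta> in lborel. norm (indicator {a<..} \<theta> *\<^sub>R \<epsilon>) \<le> norm (indicator {0<..} \<theta> * (exp (- (d * \<theta>)) * F (exp (- \<theta>))))"
    proof (rule AE_I2)
      fix \<theta> :: real
      show "norm (indicator {a<..} \<theta> *\<^sub>R \<epsilon>) \<le> norm (indicator {0<..} \<theta> * (exp (- (d * \<theta>)) * F (exp (- \<theta>))))"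
      proof (cases "\<theta> > a")
        case True
        hence th: "\<theta> > 0" "- \<theta> < ln r0" by (auto simp: a_def)
        have "exp (- \<theta>) < r0" using th(2) big(2) by (metis exp_less_mono exp_ln)
        hence "\<epsilon> * exp (- \<theta>) powr (- d) \<le> F (exp (- \<theta>))" using th by (intro big) auto
        hence "\<epsilon> * exp (d * \<theta>) \<le> F (exp (- \<theta>))" by (simp add: powr_def)
        hence "exp (- (d * \<theta>)) * (\<epsilon> * exp (d * \<theta>)) \<le> exp (- (d * \<theta>)) * F (exp (- \<theta>))" by (intro mult_left_mono) auto
        moreover have "exp (- (d * \<theta>)) * (\<epsilon> * exp (d * \<theta>)) = \<epsilon>" by (simp add: exp_minus)
        ultimately have "\<epsilon> \<le> exp (- (d * \<theta>)) * F (exp (- \<theta>))" by (simp only:)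
        thus ?thesis using True th(1) big(1) by simp
      qed simp
    qed
  qed auto
  from integrable_mult_right[OF this, of "1 / \<epsilon>"]
  have "integrable lborel (indicator {a<..} :: real \<Rightarrow> real)" using big(1) by simp
  hence "emeasure lborel {a<..} < \<infinity>" by (simp add: integrable_indicator_iff)
  moreover have "emeasure lborel {a<..} = \<infinity>"
  proof (rule ccontr)
    assume fin: "emeasure lborel {a<..} \<noteq> \<infinity>"
    have "ennreal (real n) \<le> emeasure lborel {a<..}" for n
    proof -
      have "{a<..<a + real n} \<subseteq> {a<..}" by auto
      from emeasure_mono[OF this, of lborel] show ?thesis by simp
    qed
    thus False using fin by (metis ennreal_Ex_less_of_nat ennreal_of_nat_eq_real_of_nat leD top.not_eq_extremum infinity_ennreal_def)
  qed
  ultimately show False by simp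
qed

text \<open>The Wronskian of v and b, weighted by \<open>r ^ (d - 1)\<close>, is a constant w0, and
  \<open>v / b\<close> has derivative \<open>w0 / (r ^ (d - 1) * b^2)\<close>. If w0 were nonzero,
  \<open>v / b\<close> would grow like a negative power of r and violate the integrability
  condition; so v is a multiple of b, and the normalisation at 1 fixes the multiple.\<close>

lemma radial_solution_unique:
  assumes sol: "radial_solution V k v"
  shows "v = restrict b {0<..1}"
proof -
  let ?S = "{0<..1::real}"
  obtain v1 g where ext: "v \<in> extensional ?S" and v_1: "v 1 = 1"
    and v1: "\<And>r. r \<in> ?S \<Longrightarrow> (v has_real_derivative v1 r) (at r within ?S)"
    and fl: "\<And>r. r \<in> ?S \<Longrightarrow> ((\<lambda>t. t ^ (DIM('a) - 1) * v1 t) has_real_derivative g r) (at r within ?S)"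
    and ode: "\<And>r. r \<in> ?S \<Longrightarrow> - (1 / r ^ (DIM('a) - 1)) * g r + (real k * (real k + real DIM('a) - 2) / r\<^sup>2 + profile V r) * v r = 0"
    and int: "\<And>Y :: 'a \<Rightarrow> real. spherical_harmonic k Y \<Longrightarrow> set_integrable lborel (ball 0 1) (\<lambda>x. (v (norm x) * Y (x /\<^sub>R norm x))\<^sup>2 / (norm x)\<^sup>2)"
    using sol unfolding radial_solution_def by blast
  have gr: "g r = r ^ (DIM('a) - 1) * ((\<kappa> / r\<^sup>2 + q r) * v r)" if r: "r \<in> ?S" for r
  proof -
    have p: "r ^ (DIM('a) - 1) > 0" using r by simp
    have "(\<kappa> / r\<^sup>2 + q r) * v r = g r / r ^ (DIM('a) - 1)"
      using ode[OF r] profile_V[OF r] by (simp add: \<kappa>_def d_def)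
    thus ?thesis using less_imp_neq[OF p] by (metis nonzero_eq_divide_eq mult.commute)
  qed
  define J where "J r = r ^ (DIM('a) - 1)" for r :: real
  have Jpos: "J r > 0" if "r \<in> ?S" for r using that by (simp add: J_def)
  \<comment> \<open>The weighted Wronskian. It is constant because both functions solve the same
    equation in divergence form.\<close>
  define W where "W r = b r * (J r * v1 r) - v r * (J r * b1 r)" for r
  have "(W has_real_derivative 0) (at r within ?S)" if r: "r \<in> ?S" for r
  proof -
    have "(W has_real_derivative (b r * g r + b1 r * (J r * v1 r)) - (v r * (J r * ((\<kappa> / r\<^sup>2 + q r) * b r)) + v1 r * (J r * b1 r))) (at r within ?S)"
      unfolding W_def[abs_def] J_def
      by (intro DERIV_diff DERIV_mult' b_deriv[OF r] v1[OF r] fl[OF r] b_flux[OF r])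
    thus ?thesis unfolding gr[OF r] J_def by (simp add: mult_ac)
  qed
  hence "\<exists>w0. \<forall>r\<in>?S. W r = w0" by (intro has_field_derivative_zero_constant) auto
  then obtain w0 where w0: "\<And>r. r \<in> ?S \<Longrightarrow> W r = w0" by blast
  define y where "y r = v r / b r" for r
  have yd: "(y has_real_derivative w0 / (J r * (b r)\<^sup>2)) (at r within ?S)" if r: "r \<in> ?S" for r
  proof -
    have "(y has_real_derivative (v1 r * b r - v r * b1 r) / (b r * b r)) (at r within ?S)"
      unfolding y_def[abs_def] using b_pos[OF r] by (intro DERIV_divide v1[OF r] b_deriv[OF r]) auto
    moreover have "(v1 r * b r - v r * b1 r) * J r = w0" using w0[OF r] by (simp add: W_def algebra_simps)
    hence "(v1 r * b r - v r * b1 r) / (b r * b r) = w0 / (J r * (b r)\<^sup>2)"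
    proof -
      assume "(v1 r * b r - v r * b1 r) * J r = w0"
      from this[symmetric] show ?thesis using Jpos[OF r] b_pos[OF r] by (simp add: power2_eq_square)
    qed
    ultimately show ?thesis by simp
  qed
  have y1: "y 1 = 1" by (simp add: y_def v_1 b_def c1)
  have "w0 = 0"
  proof (rule ccontr)
    assume nz: "w0 \<noteq> 0"
    define \<sigma> where "\<sigma> = sgn w0"
    have \<sigma>: "\<sigma> * w0 = \<bar>w0\<bar>" "\<bar>\<sigma>\<bar> = 1" using nz by (auto simp: \<sigma>_def sgn_if)
    define n where "n = 2 * k + DIM('a) - 2"
    have n: "n > 0" "2 * k + (DIM('a) - 1) = Suc n" using k dim by (auto simp: n_def)
    \<comment> \<open>Chosen so that the derivative of \<open>a / r ^ n\<close> never exceeds that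
      of \<open>\<sigma> * y\<close> in modulus: \<open>J * b^2\<close> equals
      \<open>r ^ (n + 1) * c^2\<close>, and c is at most M.\<close>
    define a where "a = \<bar>w0\<bar> / (M\<^sup>2 * real n)"
    have a: "a > 0" using nz M_pos n by (simp add: a_def)
    \<comment> \<open>z increases, so \<open>z r <= z 1\<close> bounds \<open>\<sigma> * y\<close>
      from above by a constant minus \<open>a / r ^ n\<close>; this forces blow-up at 0.\<close>
    define z where "z r = \<sigma> * y r + a * (1 / r ^ n)" for r
    have zd: "(z has_real_derivative \<bar>w0\<bar> / (J r * (b r)\<^sup>2) - a * (real n / r ^ Suc n)) (at r within ?S)" if r: "r \<in> ?S" for r
    proof -
      have "((\<lambda>r. 1 / r ^ n) has_real_derivative - (real n / r ^ Suc n)) (at r within ?S)"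
      proof -
        have r0: "r \<noteq> 0" using r by simp
        define p where "p = r ^ (n - 1)"
        have p: "p \<noteq> 0" "r ^ n = p * r" using r0 power_minus_mult[OF n(1), of r] by (auto simp: p_def)
        have "((\<lambda>r. r ^ n) has_real_derivative real n * p) (at r within ?S)"
          using DERIV_pow[of n r ?S] by (simp add: p_def)
        from DERIV_inverse_fun[OF this] r0 p(1)
        have "((\<lambda>r. inverse (r ^ n)) has_real_derivative - (real n * p * inverse ((p * r) ^ 2))) (at r within ?S)"
          unfolding p(2) by (simp add: numeral_2_eq_2)
        moreover have "- (real n * p * inverse ((p * r) ^ 2)) = - (real n / r ^ Suc n)"
          using p(1) r0 by (simp add: p(2) field_simps power2_eq_square)
        ultimately show ?thesis by (simp add: inverse_eq_divide)
      qed
      from DERIV_add[OF DERIV_cmult[OF yd[OF r], of \<sigma>] DERIV_cmult[OF this, of a]]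
      show ?thesis unfolding z_def[abs_def] using \<sigma>(1) by simp
    qed
    have zpos: "\<bar>w0\<bar> / (J r * (b r)\<^sup>2) - a * (real n / r ^ Suc n) \<ge> 0" if r: "r \<in> ?S" for r
    proof -
      have "c r > 0" using c_bound(1) c_bound(2)[of r] r by auto
      hence cM: "(c r)\<^sup>2 \<le> M\<^sup>2" using c_bound(3)[of r] r by (intro power_mono) auto
      have "J r * (b r)\<^sup>2 = r ^ Suc n * (c r)\<^sup>2"
      proof -
        have "r ^ Suc n = (r ^ k)\<^sup>2 * r ^ (DIM('a) - 1)" by (simp only: n(2)[symmetric] power_add power_even_eq)
        thus ?thesis by (simp only: J_def b_def power_mult_distrib mult_ac)
      qed
      also have "\<dots> \<le> r ^ Suc n * M\<^sup>2" using r cM by (intro mult_left_mono) auto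
      finally have "\<bar>w0\<bar> / (r ^ Suc n * M\<^sup>2) \<le> \<bar>w0\<bar> / (J r * (b r)\<^sup>2)"
        using Jpos[OF r] b_pos[OF r] M_pos r by (intro divide_left_mono mult_pos_pos) auto
      moreover have "a * (real n / r ^ Suc n) = \<bar>w0\<bar> / (r ^ Suc n * M\<^sup>2)" using n(1) by (simp add: a_def)
      ultimately show ?thesis by simp
    qed
    have zmono: "z r \<le> z 1" if r: "r \<in> ?S" for r
    proof (rule DERIV_nonneg_imp_increasing_open[of r 1 z, OF _ _])
      show "r \<le> 1" using r by simp
      show "\<exists>y. (z has_real_derivative y) (at x) \<and> 0 \<le> y" if "r < x" "x < 1" for x
        using zd[of x] zpos[of x] interior[of x] that r by auto
      show "continuous_on {r..1} z"
        by (rule continuous_on_subset[OF DERIV_continuous_on[OF zd]]) (use r in auto)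
    qed
    \<comment> \<open>Below r0 the constant \<open>1 + a\<close> is at most a quarter of
      \<open>a / r ^ n\<close>, so at least half of that term survives.\<close>
    define r0 where "r0 = min 1 (a / (4 * (1 + a)))"
    have r0: "r0 > 0" using a by (simp add: r0_def)
    obtain Y :: "'a \<Rightarrow> real" and w where Y: "spherical_harmonic k Y" "w \<in> sphere 0 1" "Y w \<noteq> 0"
      using spherical_harmonic_nonzero[OF dim] by blast
    define F where "F r = (v r)\<^sup>2 / r\<^sup>2" for r
    define \<epsilon> where "\<epsilon> = (m * (a / 2))\<^sup>2"
    have "continuous_on ?S v" by (rule DERIV_continuous_on) (rule v1)
    hence "continuous_on {0<..<1} v" by (rule continuous_on_subset) auto
    hence "continuous_on {0<..<1} F" unfolding F_def by (intro continuous_intros) auto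
    moreover have "\<epsilon> > 0" using c_bound(1) a by (simp add: \<epsilon>_def)
    moreover have "\<epsilon> * r powr (- d) \<le> F r" if r: "0 < r" "r < 1" "r < r0" for r
    proof -
      have rS: "r \<in> ?S" using r by auto
      have "r ^ n \<le> r ^ 1" using r n by (intro power_decreasing) auto
      also have "\<dots> \<le> a / (4 * (1 + a))" using r by (simp add: r0_def)
      finally have "4 * (1 + a) \<le> a / r ^ n" using a r by (simp add: field_simps)
      moreover have "\<sigma> * y r + a / r ^ n \<le> \<sigma> + a" using zmono[OF rS] y1 by (simp add: z_def)
      ultimately have "a / 2 * (1 / r ^ n) \<le> - (\<sigma> * y r)" using \<sigma>(2) a by auto
      also have "\<dots> \<le> \<bar>y r\<bar>" using \<sigma>(2) by (metis abs_ge_minus_self abs_mult mult_1)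
      finally have yb: "a / 2 * (1 / r ^ n) \<le> \<bar>y r\<bar>" .
      have vb: "v r = b r * y r" using b_pos[OF rS] by (simp add: y_def)
      have "m * r ^ k \<le> b r" using c_bound(2)[of r] r by (simp add: b_def mult.commute)
      hence "(m * r ^ k) * (a / 2 * (1 / r ^ n)) \<le> b r * \<bar>y r\<bar>" using yb c_bound(1) a r b_pos[OF rS] by (intro mult_mono) auto
      also have "\<dots> = \<bar>v r\<bar>" using b_pos[OF rS] by (simp add: vb abs_mult)
      finally have "((m * r ^ k) * (a / 2 * (1 / r ^ n)))\<^sup>2 \<le> (v r)\<^sup>2"
        using c_bound(1) a r by (simp add: abs_le_square_iff[symmetric])
      moreover have "\<epsilon> * (r ^ k / r ^ n)\<^sup>2 = ((m * r ^ k) * (a / 2 * (1 / r ^ n)))\<^sup>2"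
        by (simp add: \<epsilon>_def power_mult_distrib power_divide)
      ultimately have "\<epsilon> * (r ^ k / r ^ n)\<^sup>2 / r\<^sup>2 \<le> F r" unfolding F_def by (simp add: divide_right_mono)
      \<comment> \<open>With \<open>n = 2 * k + d - 2\<close> the exponent
        \<open>2 * n + 2 - 2 * k\<close> is at least d, the borderline for integrability at the
        origin in dimension d.\<close>
      moreover have "r powr (- d) \<le> (r ^ k / r ^ n)\<^sup>2 / r\<^sup>2"
      proof -
        define D where "D = DIM('a)"
        have pos: "r ^ j > 0" for j using r by simp
        have "2 * k + D \<le> 2 * n + 2" using dim k by (simp add: n_def D_def)
        hence "r ^ (2 * n + 2) \<le> r ^ (2 * k + D)" using r by (intro power_decreasing) auto
        hence H: "r ^ (2 * n + 2) \<le> r ^ (2 * k) * r ^ D" by (simp only: power_add)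
        have "r powr (- d) = 1 / r ^ D" using r by (simp add: d_def D_def powr_minus_divide powr_realpow)
        also have "\<dots> = r ^ (2 * k) / (r ^ (2 * k) * r ^ D)" using r by simp
        also have "\<dots> \<le> r ^ (2 * k) / r ^ (2 * n + 2)"
          by (rule divide_left_mono[OF H]) (intro less_imp_le[OF pos] mult_pos_pos pos)+
        also have "\<dots> = (r ^ k / r ^ n)\<^sup>2 / r\<^sup>2"
          by (simp only: power_divide power_add power_even_eq divide_divide_eq_left)
        finally show ?thesis .
      qed
      hence "\<epsilon> * r powr (- d) \<le> \<epsilon> * ((r ^ k / r ^ n)\<^sup>2 / r\<^sup>2)" using \<open>\<epsilon> > 0\<close> by (intro mult_left_mono) auto
      ultimately show ?thesis by simp
    qed
    ultimately have "\<not> set_integrable lborel (ball 0 1) (\<lambda>x. F (norm x) * (Y (x /\<^sub>R norm x))\<^sup>2)"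
      using nonintegrable_blowup[OF _ Y, of F \<epsilon> r0] r0 by blast
    moreover have "(\<lambda>x. (v (norm x) * Y (x /\<^sub>R norm x))\<^sup>2 / (norm x)\<^sup>2) = (\<lambda>x. F (norm x) * (Y (x /\<^sub>R norm x))\<^sup>2)"
      by (auto simp: F_def power_mult_distrib)
    ultimately show False using int[OF Y(1)] by metis
  qed
  hence "\<exists>c. \<forall>r\<in>?S. y r = c" using yd by (intro has_field_derivative_zero_constant) auto
  hence "y r = 1" if "r \<in> ?S" for r using y1 that by (metis greaterThanAtMost_iff order_refl zero_less_one)
  hence "v r = b r" if "r \<in> ?S" for r using b_pos[OF that] that by (simp add: y_def)
  thus ?thesis using ext by (intro extensionalityI[of _ ?S]) auto
qed

text \<open>Both branches of the definition give the same number, since the radial profile of u is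
  \<open>b r = r ^ k * c r\<close>, whose derivative at 1 is \<open>k + G 1\<close>.\<close>

theorem lambda_eq: "lambda V k = real k + G 1"
proof (cases "zero_dirichlet_eigenvalue V")
  case False
  thus ?thesis using DN_eigenvalue_eq by (simp add: lambda_def)
next
  case True
  have ex: "\<exists>!b. radial_solution V k b" by (intro ex1I[of _ "restrict b {0<..1}"] radial_solution_b radial_solution_unique)
  have "(THE b. radial_solution V k b) = restrict b {0<..1}"
    by (rule the_equality, rule radial_solution_b, rule radial_solution_unique)
  moreover have "vector_derivative (restrict b {0<..1}) (at 1 within {0<..1}) = b1 1"
  proof (rule vector_derivative_within[OF at_1_nontrivial])
    have "(restrict b {0<..1} has_real_derivative b1 1) (at 1 within {0<..1})"
      using has_derivative_transform[OF _ _ b_deriv[of 1, unfolded has_field_derivative_def], of "restrict b {0<..1}"]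
      by (simp add: has_field_derivative_def)
    thus "(restrict b {0<..1} has_vector_derivative b1 1) (at 1 within {0<..1})"
      by (simp add: has_real_derivative_iff_has_vector_derivative)
  qed
  ultimately show ?thesis using True ex by (simp add: lambda_def b1_def c1)
qed

end

theorem lambda_of_riccati:
  fixes V :: "'a::euclidean_space \<Rightarrow> real"
  assumes "DIM('a) \<ge> 2" "k \<ge> 3" "\<And>x. x \<in> cball 0 1 \<Longrightarrow> V x = q (norm x)" "continuous_on {0..1} q"
    and "\<And>s. s \<in> {0<..1} \<Longrightarrow>
       (G has_real_derivative (q s - (2 * real k + real DIM('a)) * G s - s\<^sup>2 * (G s)\<^sup>2) / s) (at s within {0<..1})"
    and "\<And>s. s \<in> {0<..1} \<Longrightarrow> \<bar>G s\<bar> \<le> K"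
  shows "lambda V k = real k + G 1"
proof -
  show ?thesis
  proof (rule radial_factor_exists[of G "\<lambda>s. (q s - (2 * real k + real DIM('a)) * G s - s\<^sup>2 * (G s)\<^sup>2) / s" K])
    fix c m M
    assume c: "continuous_on {0..1} c" "c 1 = 1"
      "\<And>s. s \<in> {0<..1} \<Longrightarrow> (c has_real_derivative s * G s * c s) (at s within {0<..1})"
      "m > 0" "\<And>s. s \<in> {0..1} \<Longrightarrow> m \<le> c s" "\<And>s. s \<in> {0..1} \<Longrightarrow> c s \<le> M"
    interpret radial_riccati V q G c k K m M
      by unfold_locales (fact assms c)+
    show ?thesis by (rule lambda_eq)
  qed (fact assms)+
qed

section \<open>The flow on the unit square\<close>

abbreviation unit_square :: "(real \<times> real) set" where "unit_square \<equiv> {0<..1} \<times> {0<..1}"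

lemma C1_on_imp_continuous: "C1_on S f \<Longrightarrow> continuous_on S f"
  unfolding C1_on_def by (meson has_derivative_continuous continuous_on_eq_continuous_within)

text \<open>Connects the derivative within the square with the two-sided \<open>deriv\<close> of the
  flow equation: at interior points they agree, and the coefficients of the linear map are the
  partial derivatives.\<close>

lemma C1_on_partials:
  assumes C1: "C1_on unit_square (\<lambda>(r, s). W r s)" and rs: "r \<in> {0<..<1}" "s \<in> {0<..<1}"
  shows "((\<lambda>(r, s). W r s) has_derivative
     (\<lambda>(u, v). deriv (\<lambda>\<rho>. W \<rho> s) r * u + deriv (\<lambda>\<sigma>. W r \<sigma>) s * v)) (at (r, s))"
proof -
  obtain D where D: "\<forall>x\<in>unit_square. ((\<lambda>(r, s). W r s) has_derivative blinfun_apply (D x)) (at x within unit_square)"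
    using C1 unfolding C1_on_def by blast
  have "(r, s) \<in> interior unit_square" using rs by (simp add: interior_Times)
  hence "at (r, s) within unit_square = at (r, s)" by (rule at_within_interior)
  moreover have "(r, s) \<in> unit_square" using rs by simp
  ultimately have d: "((\<lambda>(r, s). W r s) has_derivative blinfun_apply (D (r, s))) (at (r, s))"
    using D by (metis (no_types, lifting))
  interpret L: bounded_linear "blinfun_apply (D (r, s))" by (rule blinfun.bounded_linear_right)
  have "((\<lambda>\<rho>. (\<rho>, s)) has_derivative (\<lambda>u. (u, 0))) (at r)" by (auto intro!: derivative_eq_intros)
  from has_derivative_compose[OF this d]
  have "((\<lambda>\<rho>. W \<rho> s) has_derivative (\<lambda>u. blinfun_apply (D (r, s)) (u, 0))) (at r)" by simp
  moreover have "(\<lambda>u. blinfun_apply (D (r, s)) (u, 0)) = (*) (blinfun_apply (D (r, s)) (1, 0))"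
  proof
    show "blinfun_apply (D (r, s)) (u, 0) = blinfun_apply (D (r, s)) (1, 0) * u" for u
      using L.scaleR[of u "(1, 0)"] by simp
  qed
  ultimately have "((\<lambda>\<rho>. W \<rho> s) has_real_derivative blinfun_apply (D (r, s)) (1, 0)) (at r)"
    by (simp only: has_field_derivative_def)
  hence 1: "deriv (\<lambda>\<rho>. W \<rho> s) r = blinfun_apply (D (r, s)) (1, 0)" by (rule DERIV_imp_deriv)
  have "((\<lambda>\<sigma>. (r, \<sigma>)) has_derivative (\<lambda>u. (0, u))) (at s)" by (auto intro!: derivative_eq_intros)
  from has_derivative_compose[OF this d]
  have "((\<lambda>\<sigma>. W r \<sigma>) has_derivative (\<lambda>u. blinfun_apply (D (r, s)) (0, u))) (at s)" by simp
  moreover have "(\<lambda>u. blinfun_apply (D (r, s)) (0, u)) = (*) (blinfun_apply (D (r, s)) (0, 1))"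
  proof
    show "blinfun_apply (D (r, s)) (0, u) = blinfun_apply (D (r, s)) (0, 1) * u" for u
      using L.scaleR[of u "(0, 1)"] by simp
  qed
  ultimately have "((\<lambda>\<sigma>. W r \<sigma>) has_real_derivative blinfun_apply (D (r, s)) (0, 1)) (at s)"
    by (simp only: has_field_derivative_def)
  hence 2: "deriv (\<lambda>\<sigma>. W r \<sigma>) s = blinfun_apply (D (r, s)) (0, 1)" by (rule DERIV_imp_deriv)
  have "blinfun_apply (D (r, s)) = (\<lambda>(u, v). deriv (\<lambda>\<rho>. W \<rho> s) r * u + deriv (\<lambda>\<sigma>. W r \<sigma>) s * v)"
  proof
    fix z :: "real \<times> real"
    obtain u v where z: "z = (u, v)" by (cases z)
    have "z = u *\<^sub>R (1, 0) + v *\<^sub>R (0, 1)" by (simp add: z)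
    hence "blinfun_apply (D (r, s)) z = u *\<^sub>R blinfun_apply (D (r, s)) (1, 0) + v *\<^sub>R blinfun_apply (D (r, s)) (0, 1)"
      by (simp only: L.add L.scaleR)
    thus "blinfun_apply (D (r, s)) z = (case z of (u, v) \<Rightarrow> deriv (\<lambda>\<rho>. W \<rho> s) r * u + deriv (\<lambda>\<sigma>. W r \<sigma>) s * v)"
      by (simp add: z 1 2)
  qed
  with d show ?thesis by simp
qed

text \<open>Multiplicative convolution of a slice with itself; in logarithmic variables it is the
  additive convolution \<open>cv\<close>.\<close>

definition mconv :: "(real \<Rightarrow> real \<Rightarrow> real) \<Rightarrow> real \<Rightarrow> real \<Rightarrow> real" where
  "mconv W r s = integral {r..1} (\<lambda>\<nu>. W (r / \<nu>) s * W \<nu> s / \<nu>)"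

definition flow_eq :: "(real \<Rightarrow> real \<Rightarrow> real) \<Rightarrow> bool" where
  "flow_eq W \<longleftrightarrow> C1_on unit_square (\<lambda>(r, s). W r s) \<and>
     (\<forall>r\<in>{0<..<1}. \<forall>s\<in>{0<..<1}.
        r * deriv (\<lambda>\<rho>. W \<rho> s) r - s * deriv (\<lambda>\<sigma>. W r \<sigma>) s = s\<^sup>2 * mconv W r s)"

section \<open>Characteristics and uniqueness of the flow\<close>

text \<open>The characteristics are the hyperbolas \<open>r * s = p\<close>. Parametrised by t = s,
  the transport operator is -t times the derivative along them.\<close>

lemma flow_characteristic:
  assumes "flow_eq W" "0 < p" "p < t" "t < 1"
  shows "((\<lambda>t. W (p / t) t) has_real_derivative - t * mconv W (p / t) t) (at t)"
proof -
  have rt: "p / t \<in> {0<..<1}" "t \<in> {0<..<1}" using assms by (auto simp: field_simps)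
  define a where "a = deriv (\<lambda>\<rho>. W \<rho> t) (p / t)"
  define b where "b = deriv (\<lambda>\<sigma>. W (p / t) \<sigma>) t"
  have pde: "p / t * a - t * b = t\<^sup>2 * mconv W (p / t) t"
    using assms(1) rt unfolding flow_eq_def a_def b_def by blast
  have d: "((\<lambda>(r, s). W r s) has_derivative (\<lambda>(u, v). a * u + b * v)) (at (p / t, t))"
    unfolding a_def b_def using assms(1) rt by (intro C1_on_partials) (auto simp: flow_eq_def)
  have "((\<lambda>t. p / t) has_real_derivative - (p / t\<^sup>2)) (at t)"
    using rt by (auto intro!: derivative_eq_intros simp: power2_eq_square)
  hence "((\<lambda>t. (p / t, t)) has_derivative (\<lambda>h. (- (p / t\<^sup>2) * h, h))) (at t)"
    unfolding has_field_derivative_def by (rule has_derivative_Pair[OF _ has_derivative_ident])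
  from has_derivative_compose[OF this d]
  have "((\<lambda>t. W (p / t) t) has_derivative (\<lambda>h. a * (- (p / t\<^sup>2) * h) + b * h)) (at t)" by simp
  moreover have "(\<lambda>h. a * (- (p / t\<^sup>2) * h) + b * h) = (*) (- t * mconv W (p / t) t)"
  proof
    fix h
    have t0: "t \<noteq> 0" using rt by simp
    have "a * (- (p / t\<^sup>2)) + b = - ((p / t * a - t * b) / t)" using t0 by (simp add: field_simps power2_eq_square)
    also have "\<dots> = - t * mconv W (p / t) t" unfolding pde using t0 by (simp add: power2_eq_square)
    finally have "(a * (- (p / t\<^sup>2)) + b) * h = - t * mconv W (p / t) t * h" by simp
    thus "a * (- (p / t\<^sup>2) * h) + b * h = - t * mconv W (p / t) t * h" by (simp add: algebra_simps)
  qed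
  ultimately show ?thesis by (simp add: has_field_derivative_def)
qed

lemma flow_section_continuous:
  assumes "continuous_on unit_square (\<lambda>(r, s). W r s)" "s \<in> {0<..1}" "r \<in> {0<..1}"
  shows "continuous_on {r..1} (\<lambda>\<nu>. W (r / \<nu>) s * W \<nu> s / \<nu>)"
proof -
  have 1: "continuous_on {r..1} (\<lambda>\<nu>. case (r / \<nu>, s) of (r, s) \<Rightarrow> W r s)"
    by (rule continuous_on_compose2[OF assms(1)]) (use assms in \<open>auto intro!: continuous_intros simp: divide_le_eq\<close>)
  have 2: "continuous_on {r..1} (\<lambda>\<nu>. case (\<nu>, s) of (r, s) \<Rightarrow> W r s)"
    by (rule continuous_on_compose2[OF assms(1)]) (use assms in \<open>auto intro!: continuous_intros\<close>)
  show ?thesis using 1 2 assms(3) by (auto intro!: continuous_intros)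
qed

text \<open>For \<nu> in [r, 1] both \<nu> and \<open>r / \<nu>\<close> lie in [r, 1], so the
  convolution at (r, s) only involves points of the compact set \<open>r * s >= p0\<close>, which is
  also preserved along characteristics towards s = 1. Iterating the integrated equation for the
  difference produces the terms of an exponential series.\<close>

lemma flow_unique:
  assumes W: "flow_eq W" and W': "flow_eq W'" and eq: "\<And>r. r \<in> {0<..<1} \<Longrightarrow> W' r 1 = W r 1"
    and r0: "r0 \<in> {0<..1}" and s0: "s0 \<in> {0<..1}"
  shows "W' r0 s0 = W r0 s0"
proof -
  define p0 where "p0 = r0 * s0"
  have p0: "p0 > 0" using r0 s0 by (simp add: p0_def)
  have cW: "continuous_on unit_square (\<lambda>(r, s). W r s)" "continuous_on unit_square (\<lambda>(r, s). W' r s)"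
    using W W' by (auto simp: flow_eq_def intro: C1_on_imp_continuous)
  define E where "E r s = W' r s - W r s" for r s
  have cE: "continuous_on unit_square (\<lambda>(r, s). E r s)"
    using continuous_on_diff[OF cW(2) cW(1)] by (simp add: E_def case_prod_unfold)
  \<comment> \<open>The data agree for r < 1 by assumption; the corner (1, 1) follows by
    continuity.\<close>
  have E1: "E r 1 = 0" if "r \<in> {0<..1}" for r
  proof -
    have "continuous_on {1/2..1} (\<lambda>r. case (r, 1) of (r, s) \<Rightarrow> E r s)"
      by (rule continuous_on_compose2[OF cE]) (auto intro!: continuous_intros)
    hence c: "continuous_on (closure {1/2<..<1::real}) (\<lambda>r. E r 1)" by simp
    have z: "E r 1 = 0" if "r \<in> {1/2<..<1}" for r using eq[of r] that by (simp add: E_def)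
    have "(1::real) \<in> closure {1/2<..<1}" by simp
    from continuous_constant_on_closure[OF c z this] have "E 1 1 = 0" .
    thus ?thesis using eq[of r] that by (cases "r = 1") (auto simp: E_def)
  qed
  define Z where "Z = ({p0..1} \<times> {p0..1}) \<inter> {z. fst z * snd z \<ge> p0}"
  have "closed {z::real\<times>real. fst z * snd z \<ge> p0}" by (intro closed_Collect_le continuous_intros)
  hence Zc: "compact Z" unfolding Z_def by (intro compact_Int_closed compact_Times) auto
  have Zs: "Z \<subseteq> unit_square" using p0 by (auto simp: Z_def)
  have Zin: "(r, s) \<in> Z" if "r \<in> {0<..1}" "s \<in> {0<..1}" "r * s \<ge> p0" for r s
  proof -
    have "p0 \<le> r" using order_trans[OF that(3) mult_left_mono[of s 1 r]] that by simp
    moreover have "p0 \<le> s" using order_trans[OF that(3) mult_right_mono[of r 1 s]] that by simp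
    ultimately show ?thesis using that by (auto simp: Z_def)
  qed
  have bd: "\<exists>B. \<forall>z\<in>Z. \<bar>U (fst z) (snd z)\<bar> \<le> B" if "continuous_on unit_square (\<lambda>(r, s). U r s)" for U :: "real \<Rightarrow> real \<Rightarrow> real"
  proof -
    have "compact ((\<lambda>(r, s). U r s) ` Z)" by (intro compact_continuous_image continuous_on_subset[OF that Zs] Zc)
    from compact_imp_bounded[OF this] show ?thesis unfolding bounded_iff by (auto simp: case_prod_unfold)
  qed
  obtain B1 B2 where B: "\<forall>z\<in>Z. \<bar>W (fst z) (snd z)\<bar> \<le> B1" "\<forall>z\<in>Z. \<bar>W' (fst z) (snd z)\<bar> \<le> B2"
    using bd[OF cW(1)] bd[OF cW(2)] by blast
  define M where "M = max 0 (max B1 B2)"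
  have M: "M \<ge> 0" "\<And>r s. (r, s) \<in> Z \<Longrightarrow> \<bar>W r s\<bar> \<le> M" "\<And>r s. (r, s) \<in> Z \<Longrightarrow> \<bar>W' r s\<bar> \<le> M"
    using B by (fastforce simp: M_def)+
  \<comment> \<open>\<open>2 * M\<close> comes from the difference of two products,
    \<open>1 / p0\<close> from the factor \<open>1 / \<nu>\<close>.\<close>
  define C where "C = 2 * M / p0"
  have C: "C \<ge> 0" using M p0 by (simp add: C_def)
  have conv: "\<bar>mconv W' r s - mconv W r s\<bar> \<le> C * K"
    if rs: "r \<in> {0<..1}" "s \<in> {0<..1}" "r * s \<ge> p0" and K: "\<And>\<rho>. (\<rho>, s) \<in> Z \<Longrightarrow> \<bar>E \<rho> s\<bar> \<le> K" for r s K
  proof -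
    have K0: "K \<ge> 0" using K[OF Zin[OF rs]] by linarith
    have i: "(\<lambda>\<nu>. W (r / \<nu>) s * W \<nu> s / \<nu>) integrable_on {r..1}" "(\<lambda>\<nu>. W' (r / \<nu>) s * W' \<nu> s / \<nu>) integrable_on {r..1}"
      by (intro integrable_continuous_interval flow_section_continuous cW rs)+
    have "mconv W' r s - mconv W r s = integral {r..1} (\<lambda>\<nu>. W' (r / \<nu>) s * W' \<nu> s / \<nu> - W (r / \<nu>) s * W \<nu> s / \<nu>)"
      unfolding mconv_def by (rule Henstock_Kurzweil_Integration.integral_diff[OF i(2) i(1), symmetric])
    also have "norm \<dots> \<le> integral {r..1} (\<lambda>\<nu>. C * K)"
    proof (rule integral_norm_bound_integral)
      fix \<nu> assume nu: "\<nu> \<in> {r..1}"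
      have z1: "(\<nu>, s) \<in> Z"
      proof (rule Zin)
        show "p0 \<le> \<nu> * s" using order_trans[OF rs(3) mult_right_mono[of r \<nu> s]] rs nu by simp
      qed (use rs nu in auto)
      have z2: "(r / \<nu>, s) \<in> Z"
      proof (rule Zin)
        have "r \<le> r / \<nu>" using rs nu by (simp add: le_divide_eq mult_left_le)
        thus "p0 \<le> r / \<nu> * s" using order_trans[OF rs(3) mult_right_mono[of r "r / \<nu>" s]] rs by simp
      qed (use rs nu in \<open>auto simp: divide_le_eq\<close>)
      have "\<nu> \<ge> p0" using z1 by (simp add: Z_def)
      have "W' (r / \<nu>) s * W' \<nu> s - W (r / \<nu>) s * W \<nu> s = E (r / \<nu>) s * W' \<nu> s + W (r / \<nu>) s * E \<nu> s"
        by (simp add: E_def algebra_simps)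
      also have "\<bar>\<dots>\<bar> \<le> K * M + M * K"
        by (rule order_trans[OF abs_triangle_ineq]) 
           (unfold abs_mult, intro add_mono mult_mono K M z1 z2, auto intro: K0 M)
      finally have num: "\<bar>W' (r / \<nu>) s * W' \<nu> s - W (r / \<nu>) s * W \<nu> s\<bar> \<le> 2 * M * K" by (simp add: mult_ac)
      have "norm (W' (r / \<nu>) s * W' \<nu> s / \<nu> - W (r / \<nu>) s * W \<nu> s / \<nu>) = \<bar>W' (r / \<nu>) s * W' \<nu> s - W (r / \<nu>) s * W \<nu> s\<bar> / \<nu>"
        using \<open>\<nu> \<ge> p0\<close> p0 by (simp add: diff_divide_distrib[symmetric])
      also have "\<dots> \<le> (2 * M * K) / p0" using num \<open>\<nu> \<ge> p0\<close> p0 M K0 by (intro frac_le) auto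
      also have "\<dots> = C * K" by (simp add: C_def)
      finally show "norm (W' (r / \<nu>) s * W' \<nu> s / \<nu> - W (r / \<nu>) s * W \<nu> s / \<nu>) \<le> C * K" .
    qed (use i in \<open>auto intro: Henstock_Kurzweil_Integration.integrable_diff\<close>)
    also have "\<dots> = (1 - r) * (C * K)" using rs by simp
    also have "\<dots> \<le> 1 * (C * K)" using rs C K0 by (intro mult_right_mono) auto
    finally show ?thesis by simp
  qed
  have iter: "\<bar>E r s\<bar> \<le> 2 * M * (C * (1 - s)) ^ n / fact n" if "r \<in> {0<..1}" "s \<in> {0<..1}" "r * s \<ge> p0" for r s n
    using that
  proof (induction n arbitrary: r s)
    case 0
    thus ?case using M(2,3)[OF Zin[OF 0]] by (simp add: E_def)
  next
    case (Suc n)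
    define p where "p = r * s"
    have p: "p > 0" "p \<ge> p0" "p \<le> s" "p \<le> 1" using Suc.prems p0 mult_le_one[of r s] mult_right_mono[of r 1 s] by (auto simp: p_def)
    have r: "r = p / s" using Suc.prems by (simp add: p_def)
    define B where "B = 2 * M * C ^ Suc n / fact (Suc n)"
    have "\<sigma> * E (p / s) s \<le> B * (1 - s) ^ Suc n" if \<sigma>: "\<bar>\<sigma>\<bar> = 1" for \<sigma>
    proof -
      \<comment> \<open>A barrier: along the hyperbola, the claimed bound minus
        \<open>\<sigma> * E\<close> is nonincreasing in t and vanishes at t = 1, so it is
        nonnegative at t = s. The two signs of \<sigma> give the absolute value.\<close>
      define \<psi> where "\<psi> t = B * (1 - t) ^ Suc n - \<sigma> * E (p / t) t" for t
      have "\<psi> s \<ge> \<psi> 1"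
      proof (rule DERIV_nonpos_imp_decreasing_open[of s 1 \<psi>])
        show "s \<le> 1" using Suc.prems by simp
        have "continuous_on {s..1} (\<lambda>t. case (p / t, t) of (r, s) \<Rightarrow> E r s)"
          by (rule continuous_on_compose2[OF cE]) (use Suc.prems p in \<open>auto intro!: continuous_intros simp: divide_le_eq\<close>)
        thus "continuous_on {s..1} \<psi>" unfolding \<psi>_def by (auto intro!: continuous_intros)
        fix t assume t: "s < t" "t < 1"
        have pt: "p < t" "0 < t" using t p by auto
        have rt: "p / t \<in> {0<..1}" "t \<in> {0<..1}" "p / t * t \<ge> p0" using pt t p by (auto simp: divide_le_eq)
        define D where "D = - t * mconv W' (p / t) t - (- t * mconv W (p / t) t)"
        have "((\<lambda>t. E (p / t) t) has_real_derivative D) (at t)"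
          unfolding E_def D_def using p pt t by (intro DERIV_diff flow_characteristic W W') auto
        hence "(\<psi> has_real_derivative - (B * (real (Suc n) * (1 - t) ^ n)) - \<sigma> * D) (at t)"
          unfolding \<psi>_def[abs_def] by (auto intro!: derivative_eq_intros simp del: power_Suc)
        moreover have "- (B * (real (Suc n) * (1 - t) ^ n)) - \<sigma> * D \<le> 0"
        proof -
          have "\<bar>mconv W' (p / t) t - mconv W (p / t) t\<bar> \<le> C * (2 * M * (C * (1 - t)) ^ n / fact n)"
          proof (rule conv[OF rt])
            show "\<bar>E \<rho> t\<bar> \<le> 2 * M * (C * (1 - t)) ^ n / fact n" if "(\<rho>, t) \<in> Z" for \<rho>
              using that p0 by (intro Suc.IH) (auto simp: Z_def)
          qed
          also have "C * (2 * M * (C * (1 - t)) ^ n / fact n) = B * (real (Suc n) * (1 - t) ^ n)"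
            unfolding B_def power_mult_distrib fact_Suc power_Suc by (simp add: divide_simps mult_ac del: of_nat_Suc)
          finally have "t * \<bar>mconv W' (p / t) t - mconv W (p / t) t\<bar> \<le> 1 * (B * (real (Suc n) * (1 - t) ^ n))"
            using pt t by (intro mult_mono) auto
          moreover have "\<bar>\<sigma> * D\<bar> = t * \<bar>mconv W' (p / t) t - mconv W (p / t) t\<bar>"
            using pt \<sigma> by (simp add: D_def abs_mult flip: right_diff_distrib)
          ultimately show ?thesis by linarith
        qed
        ultimately show "\<exists>y. (\<psi> has_real_derivative y) (at t) \<and> y \<le> 0" by blast
      qed
      moreover have "\<psi> 1 = 0" using E1[of p] p by (simp add: \<psi>_def)
      ultimately have "0 \<le> \<psi> s" by simp
      thus ?thesis unfolding \<psi>_def by linarith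
    qed
    from this[of 1] this[of "-1"] have "\<bar>E r s\<bar> \<le> B * (1 - s) ^ Suc n" unfolding r by simp
    also have "\<dots> = 2 * M * (C * (1 - s)) ^ Suc n / fact (Suc n)" by (simp only: B_def power_mult_distrib) simp
    finally show ?case .
  qed
  have "(\<lambda>n. inverse (fact n) * (C * (1 - s0)) ^ n) \<longlonglongrightarrow> 0"
    by (rule summable_LIMSEQ_zero[OF summable_exp])
  hence "(\<lambda>n. 2 * M * (inverse (fact n) * (C * (1 - s0)) ^ n)) \<longlonglongrightarrow> 2 * M * 0" by (intro tendsto_intros)
  moreover have "\<bar>E r0 s0\<bar> \<le> 2 * M * (inverse (fact n) * (C * (1 - s0)) ^ n)" for n
    using iter[OF r0 s0, of n] by (simp add: p0_def divide_inverse mult_ac)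
  ultimately have "\<bar>E r0 s0\<bar> \<le> 2 * M * 0" by (intro LIMSEQ_le_const) auto
  thus ?thesis by (simp add: E_def)
qed

section \<open>Existence of the flow\<close>

text \<open>Even reflection of the derivative. The function itself becomes
  \<open>2 * f 0 - f (- t)\<close> on the negative side, whence the factor 3 in the bound.\<close>

lemma reflect_C1:
  fixes f f' :: "real \<Rightarrow> real"
  assumes f: "\<And>t. t \<ge> 0 \<Longrightarrow> (f has_real_derivative f' t) (at t within {0..})" and c: "continuous_on {0..} f'"
    and b: "\<And>t. t \<ge> 0 \<Longrightarrow> \<bar>f t\<bar> \<le> M" "\<And>t. t \<ge> 0 \<Longrightarrow> \<bar>f' t\<bar> \<le> M"
  obtains E E' where "\<And>t. (E has_real_derivative E' t) (at t)" "continuous_on UNIV E'"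
    "\<And>t. \<bar>E t\<bar> \<le> 3 * M" "\<And>t. \<bar>E' t\<bar> \<le> 3 * M" "\<And>t. t \<ge> 0 \<Longrightarrow> E t = f t"
proof -
  define E' where "E' t = f' \<bar>t\<bar>" for t
  have cE': "continuous_on UNIV E'" unfolding E'_def
    by (rule continuous_on_compose2[OF c]) (auto intro!: continuous_intros)
  define E where "E t = f 0 + integral {0..1} (\<lambda>s. t * E' (t * s))" for t
  have M: "M \<ge> 0" using b(1)[of 0] by linarith
  have Epos: "E t = f t" if "t \<ge> 0" for t
  proof -
    have "(f' has_integral (f t - f 0)) {0..t}"
    proof (rule fundamental_theorem_of_calculus[OF that])
      fix x assume "x \<in> {0..t}"
      thus "(f has_vector_derivative f' x) (at x within {0..t})"
        using DERIV_subset[OF f[of x], of "{0..t}"] by (simp add: has_real_derivative_iff_has_vector_derivative subset_eq)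
    qed
    hence "integral {0..t} E' = f t - f 0"
      by (subst integral_cong[of "{0..t}" E' f']) (auto simp: E'_def integral_unique)
    thus ?thesis using scaled_integral_FTC(2)[OF cE' that] by (simp add: E_def)
  qed
  have Eneg: "E t = 2 * f 0 - f (- t)" if "t \<le> 0" for t
  proof -
    have "E t = f 0 + integral {0..1} (\<lambda>s. - ((- t) * E' ((- t) * s)))" by (simp add: E_def E'_def)
    also have "\<dots> = f 0 - (E (- t) - f 0)" unfolding E_def by (subst Henstock_Kurzweil_Integration.integral_neg) simp
    also have "E (- t) = f (- t)" using that by (intro Epos) simp
    finally show ?thesis by simp
  qed
  show ?thesis
  proof (rule that)
    show "(E has_real_derivative E' t) (at t)" for t
      unfolding E_def[abs_def] using DERIV_add[OF DERIV_const scaled_integral_FTC(1)[OF cE', of t], of "f 0"] by simp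
    show "continuous_on UNIV E'" by (rule cE')
    show "\<bar>E t\<bar> \<le> 3 * M" for t
    proof (cases "t \<ge> 0")
      case True thus ?thesis using Epos b(1)[of t] M by simp
    next
      case False thus ?thesis using Eneg[of t] b(1)[of "- t"] b(1)[of 0] by simp
    qed
    show "\<bar>E' t\<bar> \<le> 3 * M" for t using b(2)[of "\<bar>t\<bar>"] M by (simp add: E'_def)
  qed (rule Epos)
qed

text \<open>Under \<open>a = - ln r\<close> and \<open>x = - ln s\<close> the derivatives
  \<open>r * d/dr\<close> and \<open>s * d/ds\<close> become -d/da and -d/dx, and the coefficient
  \<open>exp (- (2 * x))\<close> becomes \<open>s^2\<close>.\<close>

lemma flow_from_evolution:
  fixes F F1 :: "real \<Rightarrow> real \<Rightarrow> real"
  assumes cont: "cont2 F" "cont2 F1"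
    and dx: "\<And>a x. (F a has_real_derivative F1 a x) (at x)"
    and da: "\<And>a x. ((\<lambda>a. F a x) has_real_derivative F1 a x - e x * cv F F a x) (at a)"
    and e: "continuous_on UNIV e" "\<And>x. x \<ge> 0 \<Longrightarrow> e x = exp (- (2 * x))"
  shows "flow_eq (\<lambda>r s. F (- ln r) (- ln s))"
proof -
  define W where "W r s = F (- ln r) (- ln s)" for r s
  define W1 where "W1 r s = - ((F1 (- ln r) (- ln s) - e (- ln s) * cv F F (- ln r) (- ln s)) / r)" for r s
  define W2 where "W2 r s = - (F1 (- ln r) (- ln s) / s)" for r s
  have d1: "((\<lambda>r. W r s) has_real_derivative W1 r s) (at r)" if "r > 0" for r s
  proof -
    have "((\<lambda>r. - ln r) has_real_derivative - (1 / r)) (at r)" using that by (auto intro!: derivative_eq_intros)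
    from DERIV_chain2[OF da this] show ?thesis by (simp add: W_def[abs_def] W1_def)
  qed
  have d2: "(W r has_real_derivative W2 r s) (at s)" if "s > 0" for r s
  proof -
    have "((\<lambda>r. - ln r) has_real_derivative - (1 / s)) (at s)" using that by (auto intro!: derivative_eq_intros)
    from DERIV_chain2[OF dx this] show ?thesis by (simp add: W_def[abs_def] W2_def)
  qed
  have c1: "continuous_on unit_square (\<lambda>z. W1 (fst z) (snd z))" unfolding W1_def
    by (intro continuous_intros cont2_comp[OF cont(2)] cont2_comp[OF cv_cont[OF cont(1,1)]] continuous_comp_UNIV[OF e(1)]) auto
  have c2: "continuous_on unit_square (\<lambda>z. W2 (fst z) (snd z))" unfolding W2_def
    by (intro continuous_intros cont2_comp[OF cont(2)]) auto
  have "C1_on unit_square (\<lambda>(r, s). W r s)" unfolding C1_on_def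
  proof (intro exI conjI ballI)
    define D where "D z = W1 (fst z) (snd z) *\<^sub>R fst_blinfun + W2 (fst z) (snd z) *\<^sub>R (snd_blinfun :: (real \<times> real) \<Rightarrow>\<^sub>L real)" for z
    show "continuous_on unit_square D" unfolding D_def by (intro continuous_intros c1 c2)
    fix z :: "real \<times> real" assume z: "z \<in> unit_square"
    obtain r s where rs: "z = (r, s)" by (cases z)
    have "((\<lambda>(r, s). W r s) has_derivative (\<lambda>(u, v). W1 r s * u + W2 r s * v)) (at (r, s) within unit_square)"
    proof (rule has_derivative_of_partials)
      show "((\<lambda>x. W x s) has_real_derivative W1 r s) (at r within {0<..1})" using z rs by (intro DERIV_subset[OF d1]) auto
      show "(W x has_real_derivative W2 x y) (at y within {0<..1})" if "x \<in> {0<..1}" "y \<in> {0<..1}" for x y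
        using that by (intro DERIV_subset[OF d2]) auto
    qed (use c2 z rs in auto)
    moreover have "blinfun_apply (D (r, s)) = (\<lambda>(u, v). W1 r s * u + W2 r s * v)"
      by (auto simp: D_def plus_blinfun.rep_eq scaleR_blinfun.rep_eq fst_blinfun.rep_eq snd_blinfun.rep_eq)
    ultimately show "((\<lambda>(r, s). W r s) has_derivative blinfun_apply (D z)) (at z within unit_square)" by (simp add: rs)
  qed
  moreover have "r * deriv (\<lambda>\<rho>. W \<rho> s) r - s * deriv (\<lambda>\<sigma>. W r \<sigma>) s = s\<^sup>2 * mconv W r s"
    if r: "r \<in> {0<..<1}" and s: "s \<in> {0<..<1}" for r s
  proof -
    define a where "a = - ln r"
    have "deriv (\<lambda>\<rho>. W \<rho> s) r = W1 r s" "deriv (\<lambda>\<sigma>. W r \<sigma>) s = W2 r s"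
      using DERIV_imp_deriv[OF d1] DERIV_imp_deriv[OF d2, of s r] r s by auto
    hence "r * deriv (\<lambda>\<rho>. W \<rho> s) r - s * deriv (\<lambda>\<sigma>. W r \<sigma>) s = e (- ln s) * cv F F a (- ln s)"
      using r s by (simp add: W1_def W2_def a_def)
    also have "e (- ln s) = s\<^sup>2" using s e(2)[of "- ln s"] by (simp add: exp_double[symmetric] flip: ln_powr)
    also have "cv F F a (- ln s) = mconv W r s"
    proof -
      \<comment> \<open>The substitution \<nu> = g t, which maps the unit interval onto [r, 1] and
        satisfies \<open>d\<nu> / \<nu> = a * dt\<close>.\<close>
      define g where "g t = exp (- (a * (1 - t)))" for t
      have cW: "continuous_on {r..1} (\<lambda>\<nu>. W (r / \<nu>) s * W \<nu> s / \<nu>)" unfolding W_def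
        by (intro continuous_intros cont2_comp[OF cont(1)]) (use r in auto)
      have g01: "g 0 = r" "g 1 = 1" using r by (auto simp: g_def a_def)
      have a0: "a > 0" using r by (simp add: a_def)
      have sub: "g ` {0..1} \<subseteq> {r..1}"
      proof safe
        fix t :: real assume t: "t \<in> {0..1}"
        have "a * (1 - t) \<le> a * 1" using a0 t by (intro mult_left_mono) auto
        hence "exp (- a) \<le> g t" by (simp add: g_def)
        moreover have "exp (- a) = r" using r by (simp add: a_def)
        moreover have "g t \<le> 1" using a0 t by (simp add: g_def)
        ultimately show "g t \<in> {r..1}" by simp
      qed
      have gd: "(g has_real_derivative a * g t) (at t within {0..1})" for t
        unfolding g_def by (auto intro!: derivative_eq_intros)
      have "((\<lambda>t. (a * g t) *\<^sub>R (W (r / g t) s * W (g t) s / g t)) has_integral integral {g 0..g 1} (\<lambda>\<nu>. W (r / \<nu>) s * W \<nu> s / \<nu>)) {0..1}"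
        by (rule has_integral_substitution[OF _ _ sub cW gd]) (use g01 r in auto)
      hence "mconv W r s = integral {0..1} (\<lambda>t. (a * g t) *\<^sub>R (W (r / g t) s * W (g t) s / g t))"
        unfolding g01 mconv_def by (simp add: integral_unique)
      also have "\<dots> = cv F F a (- ln s)" unfolding cv_def
      proof (rule integral_cong)
        fix t :: real assume "t \<in> {0..1}"
        have gp: "g t > 0" by (simp add: g_def)
        have "- ln (g t) = a * (1 - t)" by (simp add: g_def)
        moreover have "- ln (r / g t) = a * t" using r gp by (simp add: ln_div g_def a_def algebra_simps)
        ultimately show "(a * g t) *\<^sub>R (W (r / g t) s * W (g t) s / g t) = a * (F (a * t) (- ln s) * F (a * (1 - t)) (- ln s))"
          using gp by (simp add: W_def)
      qed
      finally show ?thesis ..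
    qed
    finally show ?thesis .
  qed
  ultimately show ?thesis by (simp add: flow_eq_def W_def[abs_def])
qed

lemma radial_profile_C1:
  fixes V :: "'a::euclidean_space \<Rightarrow> real"
  assumes V: "\<And>x. x \<in> cball 0 1 \<Longrightarrow> V x = q (norm x)" and C1: "C1_on (cball 0 1) V"
  obtains q1 where "\<And>r. r \<in> {0..1} \<Longrightarrow> (q has_real_derivative q1 r) (at r within {0..1})" "continuous_on {0..1} q1"
proof -
  obtain D where D: "\<And>x. x \<in> cball 0 1 \<Longrightarrow> (V has_derivative blinfun_apply (D x)) (at x within cball 0 1)" and cD: "continuous_on (cball 0 1) D"
    using C1 unfolding C1_on_def by blast
  obtain e :: 'a where e: "norm e = 1" by (meson SOME_Basis norm_Basis)
  have im: "(\<lambda>r. r *\<^sub>R e) ` {0..1} \<subseteq> cball 0 1" using e by auto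
  define q1 where "q1 r = blinfun_apply (D (r *\<^sub>R e)) e" for r
  have "(q has_real_derivative q1 r) (at r within {0..1})" if r: "r \<in> {0..1}" for r
  proof -
    have re: "r *\<^sub>R e \<in> cball 0 1" using im r by blast
    have l: "((\<lambda>r. r *\<^sub>R e) has_derivative (\<lambda>h. h *\<^sub>R e)) (at r within {0..1})" by (auto intro!: derivative_eq_intros)
    have "((\<lambda>r. V (r *\<^sub>R e)) has_derivative (\<lambda>h. blinfun_apply (D (r *\<^sub>R e)) (h *\<^sub>R e))) (at r within {0..1})"
      by (rule has_derivative_in_compose[OF l has_derivative_subset[OF D[OF re] im]])
    moreover have "(\<lambda>h. blinfun_apply (D (r *\<^sub>R e)) (h *\<^sub>R e)) = (*) (q1 r)"
      by (auto simp: q1_def blinfun.scaleR_right)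
    ultimately have d: "((\<lambda>r. V (r *\<^sub>R e)) has_derivative (*) (q1 r)) (at r within {0..1})" by simp
    show ?thesis unfolding has_field_derivative_def
      by (rule has_derivative_transform[OF r _ d]) (use V e in auto)
  qed
  moreover have "continuous_on {0..1} q1" unfolding q1_def
    by (intro continuous_intros continuous_on_compose2[OF cD]) (use im in auto)
  ultimately show ?thesis using that by blast
qed

lemma radial_evolution_exists:
  fixes q q1 :: "real \<Rightarrow> real"
  assumes q: "\<And>r. r \<in> {0..1} \<Longrightarrow> (q has_real_derivative q1 r) (at r within {0..1})" "continuous_on {0..1} q1"
  obtains F F1 e C p where "cont2 F" "cont2 F1" "\<And>a x. \<bar>F a x\<bar> \<le> C * exp (p * \<bar>a\<bar>)" "\<And>a x. \<bar>F1 a x\<bar> \<le> C * exp (p * \<bar>a\<bar>)"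
    "\<And>a x. (F a has_real_derivative F1 a x) (at x)"
    "\<And>a x. ((\<lambda>a. F a x) has_real_derivative F1 a x - e x * cv F F a x) (at a)"
    "continuous_on UNIV e" "\<And>x. x \<ge> 0 \<Longrightarrow> e x = exp (- (2 * x))" "\<And>x. x \<ge> 0 \<Longrightarrow> F 0 x = q (exp (- x))"
proof -
  have cq: "continuous_on {0..1} q" by (rule DERIV_continuous_on) (rule q(1))
  have bd: "\<exists>B. \<forall>r\<in>{0..1}. \<bar>f r\<bar> \<le> B" if "continuous_on {0..1} f" for f :: "real \<Rightarrow> real"
  proof -
    have "compact (f ` {0..1})" by (intro compact_continuous_image that) auto
    from compact_imp_bounded[OF this] show ?thesis unfolding bounded_iff by auto
  qed
  obtain B1 B2 where B: "\<forall>r\<in>{0..1}. \<bar>q r\<bar> \<le> B1" "\<forall>r\<in>{0..1}. \<bar>q1 r\<bar> \<le> B2" using bd[OF cq] bd[OF q(2)] by blast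
  \<comment> \<open>The 2 bounds the derivative of the coefficient \<open>exp (- (2 * t))\<close> on
    the half line.\<close>
  define M where "M = max 2 (max B1 B2)"
  have M: "M \<ge> 2" "\<And>r. r \<in> {0..1} \<Longrightarrow> \<bar>q r\<bar> \<le> M" "\<And>r. r \<in> {0..1} \<Longrightarrow> \<bar>q1 r\<bar> \<le> M"
    using B by (fastforce simp: M_def)+
  define h where "h t = q (exp (- t))" for t :: real
  define h1 where "h1 t = - exp (- t) * q1 (exp (- t))" for t :: real
  have im: "(\<lambda>t. exp (- t)) ` {0..} \<subseteq> {0..1::real}" by auto
  have hd: "(h has_real_derivative h1 t) (at t within {0..})" if t: "t \<ge> 0" for t
  proof -
    have et: "exp (- t) \<in> {0..1}" using t by simp
    have "(q has_real_derivative q1 (exp (- t))) (at (exp (- t)) within (\<lambda>t. exp (- t)) ` {0..})"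
      by (rule DERIV_subset[OF q(1)[OF et] im])
    moreover have "((\<lambda>t. exp (- t)) has_real_derivative - exp (- t)) (at t within {0..})"
      by (auto intro!: derivative_eq_intros)
    ultimately have "(q \<circ> (\<lambda>t. exp (- t)) has_real_derivative q1 (exp (- t)) * - exp (- t)) (at t within {0..})"
      by (rule DERIV_image_chain)
    thus ?thesis by (simp add: h_def[abs_def] h1_def o_def mult.commute)
  qed
  have ch1: "continuous_on {0..} h1" unfolding h1_def
    by (intro continuous_intros continuous_on_compose2[OF q(2)]) auto
  have hb: "\<bar>h t\<bar> \<le> M" "\<bar>h1 t\<bar> \<le> M" if t: "t \<ge> 0" for t
  proof -
    have et: "exp (- t) \<in> {0..1}" using t by simp
    show "\<bar>h t\<bar> \<le> M" unfolding h_def by (rule M(2)[OF et])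
    have "\<bar>h1 t\<bar> \<le> 1 * M" unfolding h1_def abs_mult using et M(3)[OF et] by (intro mult_mono) auto
    thus "\<bar>h1 t\<bar> \<le> M" by simp
  qed
  obtain H H1 where H: "\<And>t. (H has_real_derivative H1 t) (at t)" "continuous_on UNIV H1"
    "\<And>t. \<bar>H t\<bar> \<le> 3 * M" "\<And>t. \<bar>H1 t\<bar> \<le> 3 * M" "\<And>t. t \<ge> 0 \<Longrightarrow> H t = h t"
    using reflect_C1[of h h1 M, OF hd ch1 hb] by blast
  define e0 where "e0 t = exp (- (2 * t))" for t :: real
  define e1 where "e1 t = - 2 * exp (- (2 * t))" for t :: real
  have ed: "(e0 has_real_derivative e1 t) (at t within {0..})" for t
    unfolding e0_def e1_def by (auto intro!: derivative_eq_intros)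
  have ce1: "continuous_on {0..} e1" unfolding e1_def by (intro continuous_intros)
  have eb: "\<bar>e0 t\<bar> \<le> M" "\<bar>e1 t\<bar> \<le> M" if t: "t \<ge> 0" for t
  proof -
    have "exp (- (2 * t)) \<le> 1" using t by simp
    moreover have "\<bar>e0 t\<bar> = exp (- (2 * t))" "\<bar>e1 t\<bar> = 2 * exp (- (2 * t))" by (simp_all add: e0_def e1_def abs_mult)
    ultimately show "\<bar>e0 t\<bar> \<le> M" "\<bar>e1 t\<bar> \<le> M" using M(1) by linarith+
  qed
  obtain E E1 where E: "\<And>t. (E has_real_derivative E1 t) (at t)" "continuous_on UNIV E1"
    "\<And>t. \<bar>E t\<bar> \<le> 3 * M" "\<And>t. \<bar>E1 t\<bar> \<le> 3 * M" "\<And>t. t \<ge> 0 \<Longrightarrow> E t = e0 t"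
    using reflect_C1[of e0 e1 M, OF ed ce1 eb] by blast
  interpret evolution_data H H1 E E1 "3 * M"
    by unfold_locales (use H E M(1) in auto)
  obtain F F1 where F: "cont2 F" "cont2 F1" "\<And>a x. \<bar>F a x\<bar> \<le> 2 * (3 * M) * exp (p * \<bar>a\<bar>)"
    "\<And>a x. \<bar>F1 a x\<bar> \<le> 2 * (3 * M) * exp (p * \<bar>a\<bar>)" "\<And>a x. (F a has_real_derivative F1 a x) (at x)"
    "\<And>a x. ((\<lambda>a. F a x) has_real_derivative F1 a x - E x * cv F F a x) (at a)" "\<And>x. F 0 x = H x"
    using evolution_exists by blast
  show ?thesis
    by (rule that[OF F(1-6) e_cont]) (simp_all add: E(5) e0_def F(7) H(5) h_def)
qed

section \<open>The slices of the flow as Born approximations\<close>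

text \<open>Starting the Laplace transform at depth \<open>- ln \<sigma>\<close> amounts to
  rescaling the potential: \<open>\<sigma>^2 * L (- ln (\<sigma> * s))\<close> solves the Riccati
  equation with profile \<open>\<sigma>^2 * q (\<sigma> * s)\<close>. Its value at s = 1 is both the
  moment of the slice and \<open>lambda - k\<close>.\<close>

lemma is_born_flow:
  fixes V :: "'a::euclidean_space \<Rightarrow> real"
  assumes dim: "DIM('a) \<ge> 2" and V: "\<And>x. x \<in> cball 0 1 \<Longrightarrow> V x = q (norm x)" and cq: "continuous_on {0..1} q"
    and F: "cont2 F" "cont2 F1" "\<And>a x. \<bar>F a x\<bar> \<le> C * exp (p * \<bar>a\<bar>)" "\<And>a x. \<bar>F1 a x\<bar> \<le> C * exp (p * \<bar>a\<bar>)"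
    "\<And>a x. (F a has_real_derivative F1 a x) (at x)"
    "\<And>a x. ((\<lambda>a. F a x) has_real_derivative F1 a x - e x * cv F F a x) (at a)"
    "continuous_on UNIV e" "\<And>x. x \<ge> 0 \<Longrightarrow> e x = exp (- (2 * x))" "\<And>x. x \<ge> 0 \<Longrightarrow> F 0 x = q (exp (- x))"
    and \<sigma>: "\<sigma> \<in> {0<..1}"
  shows "is_born (scaled V \<sigma>) (\<lambda>x. if x \<in> ball 0 1 - {0} then \<sigma>\<^sup>2 * F (- ln (norm x)) (- ln \<sigma>) else 0)"
proof -
  let ?d = "real DIM('a)"
  define f where "f x = (if x \<in> ball 0 1 - {0} then \<sigma>\<^sup>2 * F (- ln (norm x)) (- ln \<sigma>) else 0)" for x :: 'a
  define \<Phi> where "\<Phi> r = \<sigma>\<^sup>2 * F (- ln r) (- ln \<sigma>)" for r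
  have c\<Phi>: "continuous_on {0<..<1} \<Phi>" unfolding \<Phi>_def
    by (intro continuous_intros cont2_comp[OF F(1)]) auto
  have f\<Phi>: "f x = \<Phi> (norm x)" if "norm x < 1" "x \<noteq> 0" for x using that by (simp add: f_def \<Phi>_def)
  have f0: "f x = 0" if "x \<notin> ball 0 1 - {0}" for x unfolding f_def using that by (rule if_not_P)
  have moments: "set_integrable lborel (ball 0 1) (\<lambda>x. f x * norm x powr c) \<longleftrightarrow>
      integrable lborel (\<lambda>\<theta>. indicator {0<..} \<theta> * (exp (- ((c + ?d) * \<theta>)) * \<Phi> (exp (- \<theta>))))"
    "1 / sphere_area TYPE('a) * (LINT x:ball 0 1|lborel. f x * norm x ^ (2 * k)) = laplace (\<lambda>\<theta>. \<Phi> (exp (- \<theta>))) (2 * real k + ?d)"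
    "continuous_on (ball 0 1 - {0}) f" for c k
    by ((rule radial_moments(1) radial_moments(2) radial_moments(3)[of f \<Phi>]); rule f\<Phi> c\<Phi> f0; assumption)+
  have Fx: "continuous_on UNIV (\<lambda>a. F a x)" for x by (intro cont2_comp[OF F(1)] continuous_intros)
  have "\<forall>x y. norm x = norm y \<longrightarrow> f x = f y"
    by (auto simp: f_def)
  moreover have "\<exists>s>0. set_integrable lborel (ball 0 1) (\<lambda>x. f x * norm x powr (2 * s))"
  proof (intro exI conjI)
    \<comment> \<open>Any s with \<open>2 * s + d > p\<close> would do, since the slice is bounded
      by a multiple of \<open>|x| powr (- p)\<close>.\<close>
    define s where "s = max 1 p"
    show "s > 0" by (simp add: s_def)
    have "p < 2 * s + ?d" using dim by (auto simp: s_def max_def)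
    from integrable_mult_right[OF exp_integrable(1)[OF Fx F(3) this], of "\<sigma>\<^sup>2" "- ln \<sigma>"]
    show "set_integrable lborel (ball 0 1) (\<lambda>x. f x * norm x powr (2 * s))"
      unfolding moments(1) by (simp add: \<Phi>_def mult_ac)
  qed
  moreover have "\<forall>\<^sub>F k in sequentially. 1 / sphere_area TYPE('a) * (LINT x:ball 0 1|lborel. f x * norm x ^ (2 * k))
          = lambda (scaled V \<sigma>) k - real k"
    unfolding eventually_sequentially
  proof (intro exI allI impI)
    \<comment> \<open>\<open>k >= 3\<close> is for the classical solution at the origin,
      \<open>k >= p\<close> for the convergence of the transform.\<close>
    fix k assume k: "k \<ge> max 3 (nat \<lceil>p\<rceil>)"
    have k3: "k \<ge> 3" using k by simp
    have "real k \<ge> p" using k by linarith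
    hence kp: "2 * real k + ?d > p" using dim by linarith
    define c where "c = 2 * real k + ?d"
    define L where "L x = laplace (\<lambda>a. F a x) c" for x
    note R = laplace_riccati[OF F(1,2,7,3,4,5,6) kp, folded c_def]
    obtain K where K: "\<And>x. \<bar>L x\<bar> \<le> K" using R(2) unfolding L_def by blast
    \<comment> \<open>As s tends to 0, \<open>- ln (\<sigma> * s)\<close> tends to infinity; the
      bound on L uniform in x keeps G bounded there.\<close>
    define G where "G s = \<sigma>\<^sup>2 * L (- ln (\<sigma> * s))" for s
    have "lambda (scaled V \<sigma>) k = real k + G 1"
    proof (rule lambda_of_riccati[OF dim k3])
      show "scaled V \<sigma> x = (\<lambda>r. \<sigma>\<^sup>2 * q (\<sigma> * r)) (norm x)" if "x \<in> cball 0 1" for x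
      proof -
        have "norm (\<sigma> *\<^sub>R x) \<le> 1" using \<sigma> that by (simp add: mult_le_one)
        thus ?thesis using V[of "\<sigma> *\<^sub>R x"] \<sigma> by (simp add: scaled_def)
      qed
      show "continuous_on {0..1} (\<lambda>r. \<sigma>\<^sup>2 * q (\<sigma> * r))"
        by (intro continuous_intros continuous_on_compose2[OF cq]) (use \<sigma> in \<open>auto simp: mult_le_one\<close>)
      show "\<bar>G s\<bar> \<le> \<sigma>\<^sup>2 * K" if "s \<in> {0<..1}" for s
        using K by (simp add: G_def abs_mult mult_left_mono)
      fix s :: real assume s: "s \<in> {0<..1}"
      define x where "x = - ln (\<sigma> * s)"
      have \<sigma>s: "\<sigma> * s > 0" "\<sigma> * s \<le> 1" using \<sigma> s by (auto intro: mult_le_one)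
      have x0: "x \<ge> 0" using \<sigma>s by (simp add: x_def)
      have ex: "exp (- x) = \<sigma> * s" using \<sigma>s by (simp add: x_def)
      have e2: "e x = (\<sigma> * s)\<^sup>2"
      proof -
        have "e x = exp (- x) * exp (- x)" using F(8)[OF x0] by (simp flip: exp_add)
        thus ?thesis by (simp only: ex power2_eq_square)
      qed
      have Ld: "(L has_real_derivative c * L x + e x * (L x)\<^sup>2 - F 0 x) (at x)"
        using R(1)[of x] unfolding L_def .
      have "((\<lambda>s. - ln (\<sigma> * s)) has_real_derivative - (1 / s)) (at s)"
        using \<sigma> s \<sigma>s by (auto intro!: derivative_eq_intros simp: field_simps)
      from DERIV_cmult[OF DERIV_chain2[OF Ld[unfolded x_def] this], of "\<sigma>\<^sup>2"]
      have "(G has_real_derivative \<sigma>\<^sup>2 * ((c * L x + e x * (L x)\<^sup>2 - F 0 x) * - (1 / s))) (at s)"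
        by (simp add: G_def[abs_def] x_def)
      moreover have "\<sigma>\<^sup>2 * ((c * L x + e x * (L x)\<^sup>2 - F 0 x) * - (1 / s)) = (\<sigma>\<^sup>2 * q (\<sigma> * s) - (2 * real k + ?d) * G s - s\<^sup>2 * (G s)\<^sup>2) / s"
        using s unfolding e2 F(9)[OF x0] ex G_def x_def[symmetric] c_def[symmetric]
        by (simp add: field_simps power2_eq_square)
      ultimately show "(G has_real_derivative (\<sigma>\<^sup>2 * q (\<sigma> * s) - (2 * real k + ?d) * G s - s\<^sup>2 * (G s)\<^sup>2) / s) (at s within {0<..1})"
        by (simp add: has_field_derivative_at_within)
    qed
    moreover have "laplace (\<lambda>\<theta>. \<Phi> (exp (- \<theta>))) c = G 1"
    proof -
      have "laplace (\<lambda>\<theta>. \<Phi> (exp (- \<theta>))) c = (\<integral>a. \<sigma>\<^sup>2 * (indicator {0<..} a * (exp (- (c * a)) * F a (- ln \<sigma>))) \<partial>lborel)"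
        by (simp add: laplace_def \<Phi>_def mult_ac)
      thus ?thesis by (simp add: G_def L_def laplace_def)
    qed
    ultimately show "1 / sphere_area TYPE('a) * (LINT x:ball 0 1|lborel. f x * norm x ^ (2 * k)) = lambda (scaled V \<sigma>) k - real k"
      unfolding moments(2) c_def[symmetric] by simp
  qed
  ultimately have "is_born (scaled V \<sigma>) f" unfolding is_born_def using moments(3) f0 by blast
  thus ?thesis unfolding f_def[abs_def] .
qed

text \<open>The slice at s = 1 shows that a Born approximation exists and equals the initial data of
  the flow; the other slices and the edge r = 1 are then read off from F.\<close>

theorem radial_flow:
  fixes V :: "'a::euclidean_space \<Rightarrow> real" and q :: "real \<Rightarrow> real"
  assumes dim: "DIM('a) \<ge> 2"
    and V: "\<And>x. x \<in> cball 0 1 \<Longrightarrow> V x = q (norm x)"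
    and C1: "C1_on (cball 0 1) V"
  shows "is_born V (born V)"
    and "\<exists>W. born_flow V W \<and>
            (\<forall>W'. born_flow V W' \<longrightarrow> (\<forall>r\<in>{0<..1}. \<forall>s\<in>{0<..1}. W' r s = W r s)) \<and>
            (\<forall>s\<in>{0<..1}. \<forall>x\<in>ball 0 1 - {0}. W (norm x) s = born (scaled V s) x / s\<^sup>2) \<and>
            (\<forall>x\<in>ball 0 1 - {0}. W 1 (norm x) = V x)"
proof -
  obtain q1 where q1: "\<And>r. r \<in> {0..1} \<Longrightarrow> (q has_real_derivative q1 r) (at r within {0..1})" "continuous_on {0..1} q1"
    using radial_profile_C1[of V q, OF V C1] by blast
  have cq: "continuous_on {0..1} q" by (rule DERIV_continuous_on) (rule q1(1))
  obtain F F1 e C p where F: "cont2 F" "cont2 F1" "\<And>a x. \<bar>F a x\<bar> \<le> C * exp (p * \<bar>a\<bar>)" "\<And>a x. \<bar>F1 a x\<bar> \<le> C * exp (p * \<bar>a\<bar>)"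
    "\<And>a x. (F a has_real_derivative F1 a x) (at x)"
    "\<And>a x. ((\<lambda>a. F a x) has_real_derivative F1 a x - e x * cv F F a x) (at a)"
    "continuous_on UNIV e" "\<And>x. x \<ge> 0 \<Longrightarrow> e x = exp (- (2 * x))" "\<And>x. x \<ge> 0 \<Longrightarrow> F 0 x = q (exp (- x))"
    by (rule radial_evolution_exists[of q q1]) (erule q1(1), rule q1(2), rule that, assumption+)
  have ib: "is_born (scaled V s) (\<lambda>x. if x \<in> ball 0 1 - {0} then s\<^sup>2 * F (- ln (norm x)) (- ln s) else 0)"
    if "s \<in> {0<..1}" for s
    by (rule is_born_flow[OF dim _ cq F that]) (rule V)
  have sc1: "scaled V 1 = V" by (simp add: scaled_def fun_eq_iff)
  have b: "born (scaled V s) x = s\<^sup>2 * F (- ln (norm x)) (- ln s)" if s: "s \<in> {0<..1}" and x: "x \<in> ball 0 1 - {0}" for s x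
    unfolding born_eqI[OF ib[OF s]] using x by (rule if_P)
  show "is_born V (born V)" using ib[of 1] born_eqI[OF ib[of 1]] by (simp only: sc1) simp
  define W where "W r s = F (- ln r) (- ln s)" for r s
  have fl: "flow_eq W" unfolding W_def[abs_def] by (rule flow_from_evolution[OF F(1,2,5,6,7,8)])
  have W1: "W (norm x) 1 = born V x" if "x \<in> ball 0 1 - {0}" for x
    using b[of 1 x] that by (simp add: W_def sc1)
  have bf: "born_flow V W'' \<longleftrightarrow> flow_eq W'' \<and> (\<forall>x\<in>ball 0 1 - {0}. W'' (norm x) 1 = born V x)" for W''
    unfolding born_flow_def flow_eq_def mconv_def by blast
  show "\<exists>W. born_flow V W \<and>
            (\<forall>W'. born_flow V W' \<longrightarrow> (\<forall>r\<in>{0<..1}. \<forall>s\<in>{0<..1}. W' r s = W r s)) \<and>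
            (\<forall>s\<in>{0<..1}. \<forall>x\<in>ball 0 1 - {0}. W (norm x) s = born (scaled V s) x / s\<^sup>2) \<and>
            (\<forall>x\<in>ball 0 1 - {0}. W 1 (norm x) = V x)"
  proof (intro exI conjI allI impI ballI)
    show "born_flow V W" unfolding bf using fl W1 by blast
    show "W' r s = W r s" if W': "born_flow V W'" and rs: "r \<in> {0<..1}" "s \<in> {0<..1}" for W' r s
    proof (rule flow_unique[OF fl _ _ rs])
      show "flow_eq W'" using W' unfolding bf by blast
      obtain u :: 'a where u: "norm u = 1" by (meson SOME_Basis norm_Basis)
      fix \<rho> :: real assume \<rho>: "\<rho> \<in> {0<..<1}"
      hence x: "\<rho> *\<^sub>R u \<in> ball 0 1 - {0}" "norm (\<rho> *\<^sub>R u) = \<rho>" using u by auto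
      have "W' (norm (\<rho> *\<^sub>R u)) 1 = born V (\<rho> *\<^sub>R u)" using W' x(1) unfolding bf by blast
      thus "W' \<rho> 1 = W \<rho> 1" using W1[OF x(1)] unfolding x(2) by simp
    qed
    show "W (norm x) s = born (scaled V s) x / s\<^sup>2" if "s \<in> {0<..1}" "x \<in> ball 0 1 - {0}" for s x
      unfolding b[OF that] W_def using that(1) by simp
    show "W 1 (norm x) = V x" if "x \<in> ball 0 1 - {0}" for x
    proof -
      have "- ln (norm x) \<ge> 0" using that by simp
      from F(9)[OF this] show ?thesis using that V[of x] by (simp add: W_def)
    qed
  qed
qed

section \<open>Injectivity of the Fourier transform\<close>

lemma iter_partial_simps:
  "iter_partial [] f = f"
  "iter_partial (b # is) f = partial_deriv b (iter_partial is f)"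
  "iter_partial (is @ [b]) f = iter_partial is (partial_deriv b f)"
  by (simp_all add: iter_partial_def)

lemma partial_deriv_eqI: "(f has_derivative D) (at x) \<Longrightarrow> partial_deriv b f x = D b"
  by (simp add: partial_deriv_def frechet_derivative_at[symmetric])

lemma smooth_differentiable:
  "smooth f \<Longrightarrow> set is \<subseteq> Basis \<Longrightarrow> (iter_partial is f has_derivative frechet_derivative (iter_partial is f) (at x)) (at x)"
  by (simp add: smooth_def frechet_derivative_works)

lemma smooth_continuous: "smooth f \<Longrightarrow> set is \<subseteq> Basis \<Longrightarrow> continuous_on UNIV (iter_partial is f)"
  by (auto simp: smooth_def intro!: continuous_at_imp_continuous_on differentiable_imp_continuous_within)

lemma smooth_partial_deriv:
  assumes "smooth f" "b \<in> Basis"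
  shows "smooth (partial_deriv b f)"
  unfolding smooth_def
proof (intro allI impI)
  fix "is" :: "'a list" and x assume "set is \<subseteq> Basis"
  hence "set (is @ [b]) \<subseteq> Basis" using assms(2) by simp
  hence "iter_partial (is @ [b]) f differentiable at x" using assms(1) unfolding smooth_def by blast
  thus "iter_partial is (partial_deriv b f) differentiable at x" by (simp only: iter_partial_simps)
qed

lemma iter_partial_add:
  assumes "smooth f" "smooth g" "set is \<subseteq> Basis"
  shows "iter_partial is (\<lambda>x. f x + g x) = (\<lambda>x. iter_partial is f x + iter_partial is g x)"
  using assms(3)
proof (induction "is")
  case (Cons b "is")
  hence i: "set is \<subseteq> Basis" by simp
  show ?case unfolding iter_partial_simps Cons.IH[OF i]
  proof
    fix x
    show "partial_deriv b (\<lambda>x. iter_partial is f x + iter_partial is g x) x =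
       partial_deriv b (iter_partial is f) x + partial_deriv b (iter_partial is g) x"
      unfolding partial_deriv_eqI[OF has_derivative_add[OF smooth_differentiable[OF assms(1) i] smooth_differentiable[OF assms(2) i]]]
      by (simp add: partial_deriv_def)
  qed
qed (simp add: iter_partial_simps)

lemma iter_partial_cmult:
  fixes f :: "'a::euclidean_space \<Rightarrow> complex"
  assumes "smooth f" "set is \<subseteq> Basis"
  shows "iter_partial is (\<lambda>x. c * f x) = (\<lambda>x. c * iter_partial is f x)"
  using assms(2)
proof (induction "is")
  case (Cons b "is")
  hence i: "set is \<subseteq> Basis" by simp
  show ?case unfolding iter_partial_simps Cons.IH[OF i]
  proof
    fix x
    show "partial_deriv b (\<lambda>x. c * iter_partial is f x) x = c * partial_deriv b (iter_partial is f) x"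
      unfolding partial_deriv_eqI[OF has_derivative_mult_right[OF smooth_differentiable[OF assms(1) i]]]
      by (simp add: partial_deriv_def)
  qed
qed (simp add: iter_partial_simps)

lemma smooth_add: "smooth f \<Longrightarrow> smooth g \<Longrightarrow> smooth (\<lambda>x. f x + g x)"
  unfolding smooth_def by (auto simp: iter_partial_add smooth_def intro!: differentiable_add)

lemma smooth_cmult: "smooth f \<Longrightarrow> smooth (\<lambda>x. c * f x)" for f :: "'a::euclidean_space \<Rightarrow> complex"
  unfolding smooth_def by (auto simp: iter_partial_cmult smooth_def intro!: differentiable_mult)

section \<open>Exponentials and trigonometric polynomials\<close>

abbreviation wave :: "'a::euclidean_space \<Rightarrow> 'a \<Rightarrow> complex" where
  "wave \<xi> \<equiv> (\<lambda>x. exp (- \<i> * complex_of_real (\<xi> \<bullet> x)))"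

lemma partial_deriv_wave:
  "(wave \<xi> has_derivative (\<lambda>v. wave \<xi> x * (- \<i> * complex_of_real (\<xi> \<bullet> v)))) (at x)"
  "partial_deriv b (wave \<xi>) = (\<lambda>x. (- \<i> * complex_of_real (\<xi> \<bullet> b)) * wave \<xi> x)"
proof -
  have d: "(wave \<xi> has_derivative (\<lambda>v. wave \<xi> x * (- \<i> * complex_of_real (\<xi> \<bullet> v)))) (at x)" for x
  proof -
    have "((\<lambda>x. - \<i> * complex_of_real (\<xi> \<bullet> x)) has_derivative (\<lambda>v. - \<i> * complex_of_real (\<xi> \<bullet> v))) (at x)"
      by (auto intro!: derivative_eq_intros)
    from has_derivative_compose[OF this DERIV_exp[unfolded has_field_derivative_def]] show ?thesis .
  qed
  show "(wave \<xi> has_derivative (\<lambda>v. wave \<xi> x * (- \<i> * complex_of_real (\<xi> \<bullet> v)))) (at x)" by (rule d)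
  show "partial_deriv b (wave \<xi>) = (\<lambda>x. (- \<i> * complex_of_real (\<xi> \<bullet> b)) * wave \<xi> x)"
    unfolding fun_eq_iff partial_deriv_eqI[OF d] by (simp add: mult_ac)
qed

lemma smooth_wave: "smooth (wave \<xi>)"
proof -
  have "\<exists>c. iter_partial is (wave \<xi>) = (\<lambda>x. c * wave \<xi> x)" if "set is \<subseteq> Basis" for "is"
    using that
  proof (induction "is")
    case Nil
    show ?case by (rule exI[of _ 1]) (simp add: iter_partial_simps)
  next
    case (Cons b "is")
    then obtain c where "iter_partial is (wave \<xi>) = (\<lambda>x. c * wave \<xi> x)" by auto
    hence e: "iter_partial (b # is) (wave \<xi>) = partial_deriv b (\<lambda>x. c * wave \<xi> x)" by (simp only: iter_partial_simps)
    show ?case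
    proof (intro exI ext)
      show "iter_partial (b # is) (wave \<xi>) x = (c * (- \<i> * complex_of_real (\<xi> \<bullet> b))) * wave \<xi> x" for x
        unfolding e partial_deriv_eqI[OF has_derivative_mult_right[OF partial_deriv_wave(1)]] by (simp add: mult_ac)
    qed
  qed
  moreover have "(\<lambda>x. c * wave \<xi> x) differentiable at x" for c x
    unfolding differentiable_def by (rule exI, rule has_derivative_mult_right, rule partial_deriv_wave(1))
  ultimately show ?thesis unfolding smooth_def by metis
qed

text \<open>Finite sums of exponentials with arbitrary real frequencies. A distribution is
  determined on them by its Fourier transform and linearity alone.\<close>

inductive trig_poly :: "('a::euclidean_space \<Rightarrow> complex) \<Rightarrow> bool" where
  trig_wave: "trig_poly (\<lambda>x. c * wave \<xi> x)"
| trig_add: "trig_poly f \<Longrightarrow> trig_poly g \<Longrightarrow> trig_poly (\<lambda>x. f x + g x)"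

lemma trig_poly_smooth: "trig_poly f \<Longrightarrow> smooth f"
  by (induction rule: trig_poly.induct) (intro smooth_cmult smooth_wave smooth_add; assumption)+

lemma trig_poly_continuous: "trig_poly f \<Longrightarrow> continuous_on UNIV f"
  using smooth_continuous[OF trig_poly_smooth, of f "[]"] by (simp add: iter_partial_simps)

lemma trig_poly_const: "trig_poly (\<lambda>x. c)"
  using trig_wave[of c 0] by simp

lemma trig_poly_wave_mult: "trig_poly f \<Longrightarrow> trig_poly (\<lambda>x. (c * wave \<xi> x) * f x)"
proof (induction rule: trig_poly.induct)
  case (trig_wave c' \<eta>)
  have "(\<lambda>x. (c * wave \<xi> x) * (c' * wave \<eta> x)) = (\<lambda>x. (c * c') * wave (\<xi> + \<eta>) x)"
    by (simp add: inner_add_left algebra_simps flip: exp_add)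
  thus ?case by (simp only: trig_poly.trig_wave)
next
  case (trig_add f g)
  from trig_poly.trig_add[OF trig_add.IH] show ?case by (simp only: ring_distribs)
qed

lemma trig_poly_mult: "trig_poly f \<Longrightarrow> trig_poly g \<Longrightarrow> trig_poly (\<lambda>x. f x * g x)"
proof (induction rule: trig_poly.induct)
  case (trig_wave c \<xi>)
  thus ?case by (rule trig_poly_wave_mult)
next
  case (trig_add f f')
  from trig_poly.trig_add[OF trig_add.IH] trig_add.prems show ?case by (simp only: ring_distribs)
qed

lemma trig_poly_power: "trig_poly f \<Longrightarrow> trig_poly (\<lambda>x. f x ^ n)"
  by (induction n) (simp_all add: trig_poly_const trig_poly_mult)

lemma trig_poly_sum: "finite A \<Longrightarrow> (\<And>a. a \<in> A \<Longrightarrow> trig_poly (f a)) \<Longrightarrow> trig_poly (\<lambda>x. \<Sum>a\<in>A. f a x)"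
  by (induction A rule: finite_induct) (simp_all add: trig_poly_const trig_add)

lemma trig_poly_cos: "trig_poly (\<lambda>x. complex_of_real (cos (\<xi> \<bullet> x)))"
proof -
  have "trig_poly (\<lambda>x. 1/2 * wave \<xi> x + 1/2 * wave (- \<xi>) x)" by (intro trig_add trig_wave)
  moreover have "(\<lambda>x. 1/2 * wave \<xi> x + 1/2 * wave (- \<xi>) x) = (\<lambda>x. complex_of_real (cos (\<xi> \<bullet> x)))"
    by (simp add: cos_of_real[symmetric] cos_exp_eq fun_eq_iff add_divide_distrib)
  ultimately show ?thesis by (simp only:)
qed

lemma integrable_compact_support:
  fixes h :: "'a::euclidean_space \<Rightarrow> 'b::{banach, second_countable_topology}"
  assumes "continuous_on UNIV h" "\<And>z. norm z > R \<Longrightarrow> h z = 0"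
  shows "integrable lborel h"
proof -
  have "integrable lborel (\<lambda>x. indicator (cball 0 R) x *\<^sub>R h x)"
    by (rule borel_integrable_compact) (auto intro: continuous_on_subset[OF assms(1)])
  moreover have "(\<lambda>x. indicator (cball 0 R) x *\<^sub>R h x) = h"
    using assms(2) by (auto simp: indicator_def fun_eq_iff)
  ultimately show ?thesis by simp
qed

lemma integral_reflect_translate:
  fixes h :: "'a::euclidean_space \<Rightarrow> 'b::{banach, second_countable_topology}"
  assumes [measurable]: "h \<in> borel_measurable borel"
  shows "(\<integral>y. h (x - y) \<partial>lborel) = (\<integral>y. h y \<partial>lborel)"
proof -
  have "(lborel :: 'a measure) = distr lborel borel (\<lambda>y. x + (-1) *\<^sub>R y)"
    by (subst lborel_affine[of "-1" x]) (simp_all add: density_1)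
  hence "(\<integral>y. h y \<partial>lborel) = (\<integral>y. h y \<partial>distr lborel borel (\<lambda>y. x + (-1) *\<^sub>R y))" by simp
  also have "\<dots> = (\<integral>y. h (x - y) \<partial>lborel)" by (subst integral_distr) simp_all
  finally show ?thesis ..
qed

text \<open>The kernel k will be a trigonometric polynomial, which is not integrable; convergence
  rests on the compact support of the other factor.\<close>

definition convol :: "('a::euclidean_space \<Rightarrow> complex) \<Rightarrow> ('a \<Rightarrow> complex) \<Rightarrow> 'a \<Rightarrow> complex" where
  "convol k \<phi> x = (\<integral>z. k z * \<phi> (x - z) \<partial>lborel)"

lemma convol_integrand:
  fixes k \<phi> :: "'a::euclidean_space \<Rightarrow> complex"
  assumes k: "continuous_on UNIV k" and \<phi>: "continuous_on UNIV \<phi>" "\<And>x. norm x \<ge> 1 \<Longrightarrow> \<phi> x = 0"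
  shows "continuous_on UNIV (\<lambda>z. k z * \<phi> (x - z))" "integrable lborel (\<lambda>z. k z * \<phi> (x - z))"
    and "norm z > norm x + 1 \<Longrightarrow> k z * \<phi> (x - z) = 0"
proof -
  show c: "continuous_on UNIV (\<lambda>z. k z * \<phi> (x - z))"
    by (intro continuous_intros k continuous_on_compose2[OF \<phi>(1)]) auto
  have z: "k z * \<phi> (x - z) = 0" if "norm z > norm x + 1" for z
    using that norm_triangle_ineq3[of x z] by (simp add: \<phi>(2))
  show "norm z > norm x + 1 \<Longrightarrow> k z * \<phi> (x - z) = 0" by (rule z)
  show "integrable lborel (\<lambda>z. k z * \<phi> (x - z))" by (rule integrable_compact_support[OF c z])
qed

text \<open>The exponential of x - u factorises, so convolving it with \<phi> multiplies it by a
  constant, a Fourier coefficient of \<phi>.\<close>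

lemma trig_poly_convol:
  assumes "trig_poly k" and \<phi>: "continuous_on UNIV \<phi>" "\<And>x. norm x \<ge> 1 \<Longrightarrow> \<phi> x = 0"
  shows "trig_poly (convol k \<phi>)"
  using assms(1)
proof (induction rule: trig_poly.induct)
  case (trig_wave c \<xi>)
  have [measurable]: "\<phi> \<in> borel_measurable borel" using \<phi>(1) by (rule borel_measurable_continuous_onI)
  have "convol (\<lambda>x. c * wave \<xi> x) \<phi> x = (c * (\<integral>y. wave (- \<xi>) y * \<phi> y \<partial>lborel)) * wave \<xi> x" for x
  proof -
    have "convol (\<lambda>x. c * wave \<xi> x) \<phi> x = (\<integral>y. (\<lambda>u. (c * wave \<xi> (x - u)) * \<phi> u) (x - y) \<partial>lborel)"
      by (simp add: convol_def)
    also have "\<dots> = (\<integral>u. (c * wave \<xi> (x - u)) * \<phi> u \<partial>lborel)"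
      by (rule integral_reflect_translate) measurable
    also have "\<dots> = (\<integral>u. (c * wave \<xi> x) * (wave (- \<xi>) u * \<phi> u) \<partial>lborel)"
      by (intro Bochner_Integration.integral_cong refl)
         (simp add: inner_diff_right right_diff_distrib exp_diff exp_minus field_simps)
    also have "\<dots> = (c * wave \<xi> x) * (\<integral>u. wave (- \<xi>) u * \<phi> u \<partial>lborel)" by (rule integral_mult_right_zero)
    finally show ?thesis by (simp only: mult_ac)
  qed
  thus ?case using trig_poly.trig_wave by (simp only: )
next
  case (trig_add f g)
  note c = trig_add.hyps[THEN trig_poly_continuous]
  have "convol (\<lambda>x. f x + g x) \<phi> = (\<lambda>x. convol f \<phi> x + convol g \<phi> x)"
    unfolding convol_def fun_eq_iff ring_distribs
    by (intro allI Bochner_Integration.integral_add convol_integrand(2)[OF c(1) \<phi>] convol_integrand(2)[OF c(2) \<phi>])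
  with trig_poly.trig_add[OF trig_add.IH] show ?case by simp
qed

lemma vector_derivative_quotient:
  fixes f :: "real \<Rightarrow> 'b::real_normed_vector"
  assumes "(f has_vector_derivative D) (at 0)"
  shows "((\<lambda>h. (f h - f 0) /\<^sub>R h) \<longlongrightarrow> D) (at 0)"
proof -
  have "((\<lambda>h. norm (f h - f 0 - h *\<^sub>R D) / norm h) \<longlongrightarrow> 0) (at 0)"
    using assms by (simp add: has_vector_derivative_def has_derivative_at)
  moreover have "\<forall>\<^sub>F h in at 0. norm (f h - f 0 - h *\<^sub>R D) / norm h = norm ((f h - f 0) /\<^sub>R h - D)"
  proof (rule eventually_at_filter[THEN iffD2], rule always_eventually, intro allI impI)
    fix h :: real assume h: "h \<noteq> 0"
    have "(f h - f 0) /\<^sub>R h - D = (f h - f 0 - h *\<^sub>R D) /\<^sub>R h" using h by (simp add: scaleR_diff_right)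
    thus "norm (f h - f 0 - h *\<^sub>R D) / norm h = norm ((f h - f 0) /\<^sub>R h - D)" by (simp add: divide_inverse mult.commute)
  qed
  ultimately have "((\<lambda>h. norm ((f h - f 0) /\<^sub>R h - D)) \<longlongrightarrow> 0) (at 0)" by (rule Lim_transform_eventually)
  thus ?thesis by (simp only: tendsto_norm_zero_iff Lim_null[of _ D])
qed

text \<open>Differentiability of the convolution is supplied by the caller, so only the limit of
  difference quotients along b is to be found; it passes under the integral by dominated
  convergence.\<close>

lemma partial_deriv_convol:
  fixes k \<phi> :: "'a::euclidean_space \<Rightarrow> complex"
  assumes k: "continuous_on UNIV k" and d: "\<And>x. (\<phi> has_derivative \<phi>' x) (at x)" "continuous_on UNIV (\<lambda>x. \<phi>' x b)"
    and z: "\<And>x. norm x \<ge> 1 \<Longrightarrow> \<phi> x = 0" "\<And>x. norm x \<ge> 1 \<Longrightarrow> \<phi>' x b = 0"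
    and b: "b \<in> Basis" and c: "convol k \<phi> differentiable at x"
  shows "partial_deriv b (convol k \<phi>) x = convol k (\<lambda>x. \<phi>' x b) x"
proof -
  have c\<phi>: "continuous_on UNIV \<phi>" using d(1) by (auto intro!: continuous_at_imp_continuous_on has_derivative_continuous)
  have line: "((\<lambda>h. \<phi> (u + h *\<^sub>R b)) has_vector_derivative \<phi>' (u + h *\<^sub>R b) b) (at h)" for u h
  proof -
    have "((\<lambda>h. u + h *\<^sub>R b) has_vector_derivative b) (at h)" by (auto intro!: derivative_eq_intros)
    from vector_derivative_diff_chain_within[OF this, of \<phi> "\<phi>' (u + h *\<^sub>R b)"] d(1)
    show ?thesis by (simp add: o_def has_derivative_at_withinI)
  qed
  have "compact ((\<lambda>x. \<phi>' x b) ` cball 0 1)" by (intro compact_continuous_image continuous_on_subset[OF d(2)]) auto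
  from compact_imp_bounded[OF this] obtain M0 where "\<forall>y\<in>(\<lambda>x. \<phi>' x b) ` cball 0 1. norm y \<le> M0"
    unfolding bounded_iff by blast
  hence M0: "\<And>x. norm x \<le> 1 \<Longrightarrow> norm (\<phi>' x b) \<le> M0" by auto
  define M where "M = max 0 M0"
  have M: "norm (\<phi>' x b) \<le> M" for x
    using M0[of x] z(2)[of x] by (cases "norm x \<le> 1") (auto simp: M_def)
  have lip: "norm (\<phi> (u + h *\<^sub>R b) - \<phi> u) \<le> M * \<bar>h\<bar>" for u h
  proof -
    have "norm ((\<lambda>h. \<phi> (u + h *\<^sub>R b)) h - (\<lambda>h. \<phi> (u + h *\<^sub>R b)) 0) \<le> M * norm (h - 0)"
    proof (rule differentiable_bound[of UNIV])
      show "((\<lambda>h. \<phi> (u + h *\<^sub>R b)) has_derivative (\<lambda>s. s *\<^sub>R \<phi>' (u + t *\<^sub>R b) b)) (at t within UNIV)" for t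
        using line[of u t] by (simp add: has_vector_derivative_def)
      show "onorm (\<lambda>s. s *\<^sub>R \<phi>' (u + t *\<^sub>R b) b) \<le> M" for t
        by (rule onorm_le) (simp add: M mult_right_mono mult.commute[of _ "norm (\<phi>' (u + t *\<^sub>R b) b)"])
    qed auto
    thus ?thesis by simp
  qed
  define g where "g h z = k z * ((\<phi> (x - z + h *\<^sub>R b) - \<phi> (x - z)) /\<^sub>R h)" for h z
  have "((\<lambda>h. \<integral>z. g h z \<partial>lborel) \<longlongrightarrow> (\<integral>z. k z * \<phi>' (x - z) b \<partial>lborel)) (at 0)"
    unfolding tendsto_at_iff_sequentially
  proof (intro allI impI)
    fix X :: "nat \<Rightarrow> real" assume X: "\<forall>i. X i \<in> UNIV - {0}" "X \<longlonglongrightarrow> 0"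
    have "eventually (\<lambda>i. \<bar>X i\<bar> < 1) sequentially" using order_tendstoD(2)[OF tendsto_rabs[OF X(2)], of 1] by simp
    then obtain i0 where i0: "\<And>i. i \<ge> i0 \<Longrightarrow> \<bar>X i\<bar> < 1" unfolding eventually_sequentially by blast
    \<comment> \<open>Dropping finitely many terms gives \<open>|Y i| < 1\<close>; all quotients
      then vanish for |z| > |x| + 2, and one compactly supported function dominates them.\<close>
    define Y where "Y i = X (i + i0)" for i
    have Y: "Y i \<noteq> 0" "\<bar>Y i\<bar> < 1" for i using X(1) i0[of "i + i0"] by (auto simp: Y_def)
    have Y0: "Y \<longlonglongrightarrow> 0" unfolding Y_def by (rule LIMSEQ_ignore_initial_segment[OF X(2)])
    have "(\<lambda>i. \<integral>z. g (Y i) z \<partial>lborel) \<longlonglongrightarrow> (\<integral>z. k z * \<phi>' (x - z) b \<partial>lborel)"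
    proof (rule integral_dominated_convergence[where w="\<lambda>z. indicator (cball 0 (norm x + 2)) z *\<^sub>R (norm (k z) * M)"])
      have "continuous_on UNIV (\<lambda>z. k z * \<phi>' (x - z) b)"
        by (intro continuous_intros k continuous_on_compose2[OF d(2)]) auto
      thus "(\<lambda>z. k z * \<phi>' (x - z) b) \<in> borel_measurable lborel" by (simp add: borel_measurable_continuous_onI)
      have "continuous_on UNIV (g (Y i))" for i unfolding g_def
        by (intro continuous_intros k continuous_on_compose2[OF c\<phi>]) auto
      thus "g (Y i) \<in> borel_measurable lborel" for i by (simp add: borel_measurable_continuous_onI)
      show "integrable lborel (\<lambda>z. indicator (cball 0 (norm x + 2)) z *\<^sub>R (norm (k z) * M))"
        by (intro borel_integrable_compact continuous_intros continuous_on_subset[OF k]) auto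
      show "AE z in lborel. (\<lambda>i. g (Y i) z) \<longlonglongrightarrow> k z * \<phi>' (x - z) b"
      proof (rule AE_I2)
        fix z
        have "((\<lambda>h. (\<phi> (x - z + h *\<^sub>R b) - \<phi> (x - z)) /\<^sub>R h) \<longlongrightarrow> \<phi>' (x - z) b) (at 0)"
          using vector_derivative_quotient[OF line[of "x - z" 0]] by simp
        hence "((\<lambda>h. (\<phi> (x - z + h *\<^sub>R b) - \<phi> (x - z)) /\<^sub>R h) \<circ> Y) \<longlonglongrightarrow> \<phi>' (x - z) b"
          unfolding tendsto_at_iff_sequentially using Y Y0 by auto
        thus "(\<lambda>i. g (Y i) z) \<longlonglongrightarrow> k z * \<phi>' (x - z) b" unfolding g_def o_def by (intro tendsto_intros)
      qed
      show "AE z in lborel. norm (g (Y i) z) \<le> indicator (cball 0 (norm x + 2)) z *\<^sub>R (norm (k z) * M)" for i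
      proof (rule AE_I2)
        fix z
        show "norm (g (Y i) z) \<le> indicator (cball 0 (norm x + 2)) z *\<^sub>R (norm (k z) * M)"
        proof (cases "norm z \<le> norm x + 2")
          case True
          have "norm ((\<phi> (x - z + Y i *\<^sub>R b) - \<phi> (x - z)) /\<^sub>R Y i) \<le> (M * \<bar>Y i\<bar>) / \<bar>Y i\<bar>"
            using divide_right_mono[OF lip[of "x - z" "Y i"], of "\<bar>Y i\<bar>"] by (simp add: divide_inverse mult.commute)
          also have "\<dots> = M" using Y(1)[of i] by simp
          finally show ?thesis using True unfolding g_def norm_mult by (simp add: mult_left_mono)
        next
          case False
          have 1: "norm (x - z) \<ge> 2" using False norm_triangle_ineq3[of x z] by simp
          have "norm (x - z) \<le> norm (x - z + Y i *\<^sub>R b) + norm (Y i *\<^sub>R b)"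
            using norm_triangle_ineq4[of "x - z + Y i *\<^sub>R b" "Y i *\<^sub>R b"] by simp
          moreover have "norm (Y i *\<^sub>R b) \<le> 1" using Y(2)[of i] b by simp
          ultimately have "norm (x - z + Y i *\<^sub>R b) \<ge> 1" using 1 by linarith
          moreover have "M \<ge> 0" by (simp add: M_def)
          ultimately show ?thesis using 1 by (simp add: g_def z(1))
        qed
      qed
    qed
    thus "((\<lambda>h. \<integral>z. g h z \<partial>lborel) \<circ> X) \<longlonglongrightarrow> (\<integral>z. k z * \<phi>' (x - z) b \<partial>lborel)"
      unfolding Y_def o_def by (rule LIMSEQ_offset)
  qed
  moreover have "(\<integral>z. g h z \<partial>lborel) = (convol k \<phi> (x + h *\<^sub>R b) - convol k \<phi> x) /\<^sub>R h" for h
  proof -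
    have "(convol k \<phi> (x + h *\<^sub>R b) - convol k \<phi> x) = (\<integral>z. k z * \<phi> (x + h *\<^sub>R b - z) - k z * \<phi> (x - z) \<partial>lborel)"
      unfolding convol_def by (rule Bochner_Integration.integral_diff[symmetric]; rule convol_integrand(2)[OF k c\<phi> z(1)])
    moreover have "g h z = (k z * \<phi> (x + h *\<^sub>R b - z) - k z * \<phi> (x - z)) /\<^sub>R h" for z
      by (simp add: g_def algebra_simps)
    ultimately show ?thesis by simp
  qed
  ultimately have lim: "((\<lambda>h. (convol k \<phi> (x + h *\<^sub>R b) - convol k \<phi> x) /\<^sub>R h) \<longlongrightarrow> convol k (\<lambda>x. \<phi>' x b) x) (at 0)"
    by (simp add: convol_def)
  obtain D where D: "(convol k \<phi> has_derivative D) (at x)" using c unfolding differentiable_def by blast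
  have "((\<lambda>h. x + h *\<^sub>R b) has_vector_derivative b) (at 0)" by (auto intro!: derivative_eq_intros)
  from vector_derivative_diff_chain_within[OF this, of "convol k \<phi>" D] D
  have "((\<lambda>h. convol k \<phi> (x + h *\<^sub>R b)) has_vector_derivative D b) (at 0)"
    by (simp add: o_def has_derivative_at_withinI)
  hence "((\<lambda>h. (convol k \<phi> (x + h *\<^sub>R b) - convol k \<phi> x) /\<^sub>R h) \<longlongrightarrow> D b) (at 0)"
    using vector_derivative_quotient by force
  from tendsto_unique[OF _ this lim] show ?thesis by (simp add: partial_deriv_eqI[OF D])
qed

text \<open>Smoothness of the left side comes for free, as the convolution is itself a trigonometric
  polynomial. All derivatives fall on \<phi>.\<close>

lemma iter_partial_convol:
  fixes k \<phi> :: "'a::euclidean_space \<Rightarrow> complex"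
  assumes k: "trig_poly k" and \<phi>: "smooth \<phi>" "\<And>is x. norm x \<ge> 1 \<Longrightarrow> set is \<subseteq> Basis \<Longrightarrow> iter_partial is \<phi> x = 0"
    and i: "set is \<subseteq> Basis"
  shows "iter_partial is (convol k \<phi>) = convol k (iter_partial is \<phi>)"
  using i
proof (induction "is")
  case (Cons b "is")
  hence i: "set is \<subseteq> Basis" and b: "b \<in> Basis" by auto
  have bi: "set (b # is) \<subseteq> Basis" using Cons.prems .
  have s: "smooth (convol k \<phi>)"
    using trig_poly_convol[OF k smooth_continuous[OF \<phi>(1), of "[]"]] \<phi>(2)[of _ "[]"]
    by (intro trig_poly_smooth) (simp add: iter_partial_simps)
  show ?case
  proof
    fix x
    have "partial_deriv b (convol k (iter_partial is \<phi>)) x = convol k (\<lambda>x. frechet_derivative (iter_partial is \<phi>) (at x) b) x"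
    proof (rule partial_deriv_convol[OF trig_poly_continuous[OF k] smooth_differentiable[OF \<phi>(1) i] _ _ _ b])
      show "continuous_on UNIV (\<lambda>x. frechet_derivative (iter_partial is \<phi>) (at x) b)"
        using smooth_continuous[OF \<phi>(1) bi] by (simp add: iter_partial_simps partial_deriv_def[abs_def])
      show "frechet_derivative (iter_partial is \<phi>) (at x) b = 0" if "norm x \<ge> 1" for x
        using \<phi>(2)[OF that bi] by (simp add: iter_partial_simps partial_deriv_def)
      show "convol k (iter_partial is \<phi>) differentiable at x"
        using s i unfolding Cons.IH[OF i, symmetric] smooth_def by blast
    qed (rule \<phi>(2)[OF _ i])
    thus "iter_partial (b # is) (convol k \<phi>) x = convol k (iter_partial (b # is) \<phi>) x"
      by (simp add: iter_partial_simps Cons.IH[OF i] partial_deriv_def[abs_def])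
  qed
qed (simp add: iter_partial_simps)

section \<open>Concentrating kernels and approximation of test functions\<close>

text \<open>An average of cosines with frequencies 1/\<rho>, shifted and scaled into [0, 1]. For |z|
  <= \<rho> the phases stay within [-1, 1], where cos equals 1 only at 0, so all other maxima lie
  outside the ball.\<close>

lemma trig_poly_kernel:
  fixes \<rho> :: real
  assumes "\<rho> > 0"
  obtains \<kappa> :: "'a::euclidean_space \<Rightarrow> real" where "continuous_on UNIV \<kappa>" "trig_poly (\<lambda>z. complex_of_real (\<kappa> z))"
    "\<And>z. \<kappa> z \<ge> 0" "\<kappa> 0 = 1" "\<And>z. z \<noteq> 0 \<Longrightarrow> norm z \<le> \<rho> \<Longrightarrow> \<kappa> z < 1"
proof -
  define \<kappa> where "\<kappa> z = 1/2 + 1 / (2 * real DIM('a)) * (\<Sum>b\<in>Basis. cos ((b /\<^sub>R \<rho>) \<bullet> z))" for z :: 'a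
  have "trig_poly (\<lambda>z. 1/2 + complex_of_real (1 / (2 * real DIM('a))) * (\<Sum>b\<in>Basis. complex_of_real (cos ((b /\<^sub>R \<rho>) \<bullet> (z::'a)))))"
    by (intro trig_add trig_poly_mult trig_poly_sum trig_poly_const trig_poly_cos finite_Basis)
  hence "trig_poly (\<lambda>z. complex_of_real (\<kappa> z))" by (simp add: \<kappa>_def)
  moreover have "continuous_on UNIV \<kappa>" unfolding \<kappa>_def by (intro continuous_intros)
  moreover have "\<kappa> z \<ge> 0" for z
  proof -
    have "(\<Sum>b\<in>(Basis::'a set). - 1) \<le> (\<Sum>b\<in>Basis. cos ((b /\<^sub>R \<rho>) \<bullet> z))" by (intro sum_mono cos_ge_minus_one)
    hence "1 / (2 * real DIM('a)) * (- real DIM('a)) \<le> 1 / (2 * real DIM('a)) * (\<Sum>b\<in>Basis. cos ((b /\<^sub>R \<rho>) \<bullet> z))"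
      by (intro mult_left_mono) (simp_all add: sum_negf)
    thus ?thesis by (simp add: \<kappa>_def)
  qed
  moreover have "\<kappa> 0 = 1" by (simp add: \<kappa>_def)
  moreover have "\<kappa> z < 1" if z: "z \<noteq> 0" "norm z \<le> \<rho>" for z
  proof -
    obtain b where b: "b \<in> Basis" "b \<bullet> z \<noteq> 0" using z(1) by (metis euclidean_all_zero_iff inner_commute)
    define t where "t = \<bar>(b /\<^sub>R \<rho>) \<bullet> z\<bar>"
    have "\<bar>b \<bullet> z\<bar> \<le> \<rho>" using Basis_le_norm[OF b(1), of z] z(2) by (simp add: inner_commute)
    hence t: "0 < t" "t \<le> 1" using b(2) assms by (auto simp: t_def abs_mult divide_simps)
    have "cos t < cos 0" using t pi_gt3 by (intro cos_monotone_0_pi) auto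
    hence "cos ((b /\<^sub>R \<rho>) \<bullet> z) < 1" by (simp add: t_def)
    hence "(\<Sum>b\<in>(Basis::'a set). cos ((b /\<^sub>R \<rho>) \<bullet> z)) < (\<Sum>b\<in>(Basis::'a set). 1)"
      using b(1) by (intro sum_strict_mono_ex1) auto
    hence "1 / (2 * real DIM('a)) * (\<Sum>b\<in>Basis. cos ((b /\<^sub>R \<rho>) \<bullet> z)) < 1 / (2 * real DIM('a)) * real DIM('a)"
      by (intro mult_strict_left_mono) auto
    also have "\<dots> = 1/2" by simp
    finally show ?thesis unfolding \<kappa>_def by linarith
  qed
  ultimately show ?thesis using that by blast
qed

text \<open>Powers of a function with a single maximum concentrate there. Away from 0 the kernel is
  at most \<eta>, near 0 it is at least \<mu> > \<eta>; relative to the total mass the tail is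
  therefore of order \<open>(\<eta> / \<mu>) ^ n\<close>, while uniform continuity of g handles the
  centre.\<close>

lemma kernel_concentration:
  fixes \<kappa> :: "'a::euclidean_space \<Rightarrow> real" and g :: "'a \<Rightarrow> complex"
  assumes \<kappa>: "continuous_on UNIV \<kappa>" "\<And>z. \<kappa> z \<ge> 0" "\<kappa> 0 = 1" "\<And>z. z \<noteq> 0 \<Longrightarrow> norm z \<le> R + 1 \<Longrightarrow> \<kappa> z < 1"
    and R: "R \<ge> 0" and g: "continuous_on UNIV g" "\<And>x. norm x \<ge> 1 \<Longrightarrow> g x = 0" and \<epsilon>: "\<epsilon> > 0"
  defines "I \<equiv> (\<lambda>n::nat. \<integral>z. indicator (cball 0 (R + 1)) z *\<^sub>R \<kappa> z ^ n \<partial>lborel)"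
  shows "\<forall>\<^sub>F n in sequentially. \<forall>x\<in>cball 0 R.
      norm (inverse (complex_of_real (I n)) * convol (\<lambda>z. complex_of_real (\<kappa> z) ^ n) g x - g x) \<le> \<epsilon>"
proof -
  define B where "B = cball (0::'a) (R + 1)"
  have c\<kappa>: "continuous_on S (\<lambda>z. \<kappa> z ^ n)" for n S
    by (intro continuous_intros continuous_on_subset[OF \<kappa>(1)]) auto
  have iI: "integrable lborel (\<lambda>z. indicator B z *\<^sub>R \<kappa> z ^ n)" for n
    unfolding B_def by (intro borel_integrable_compact c\<kappa>) auto
  have "compact (g ` cball 0 1)" by (intro compact_continuous_image continuous_on_subset[OF g(1)]) auto
  from compact_imp_bounded[OF this] obtain M0 where "\<forall>y\<in>g ` cball 0 1. norm y \<le> M0" unfolding bounded_iff by blast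
  hence M0: "norm x \<le> 1 \<Longrightarrow> norm (g x) \<le> M0" for x by auto
  define M where "M = max 0 M0"
  have M: "norm (g x) \<le> M" "M \<ge> 0" for x
    using M0[of x] g(2)[of x] by (cases "norm x \<le> 1"; auto simp: M_def)+
  \<comment> \<open>The radius \<open>2 * R + 1\<close> contains both x and x - z whenever |x| <= R
    and |z| <= R + 1.\<close>
  have "uniformly_continuous_on (cball 0 (2 * R + 1)) g"
    by (intro compact_uniformly_continuous continuous_on_subset[OF g(1)]) auto
  then obtain \<delta> where \<delta>: "\<delta> > 0" "\<And>x y. norm x \<le> 2 * R + 1 \<Longrightarrow> norm y \<le> 2 * R + 1 \<Longrightarrow> norm (y - x) < \<delta> \<Longrightarrow> norm (g y - g x) < \<epsilon> / 2"
    unfolding uniformly_continuous_on_def dist_norm using half_gt_zero[OF \<epsilon>] by (metis mem_cball_0)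
  \<comment> \<open>If \<delta> exceeds R + 1 there is nothing to bound and 0 serves; otherwise the
    maximum over a compact shell is below 1.\<close>
  obtain \<eta> where \<eta>: "0 \<le> \<eta>" "\<eta> < 1" "\<And>z. \<delta> \<le> norm z \<Longrightarrow> norm z \<le> R + 1 \<Longrightarrow> \<kappa> z \<le> \<eta>"
  proof (cases "cball 0 (R + 1) - ball 0 \<delta> = ({} :: 'a set)")
    case True
    have no: "\<not> (\<delta> \<le> norm z \<and> norm z \<le> R + 1)" for z :: 'a
    proof
      assume "\<delta> \<le> norm z \<and> norm z \<le> R + 1"
      hence "z \<in> cball 0 (R + 1) - ball 0 \<delta>" by simp
      thus False unfolding True by simp
    qed
    show ?thesis by (rule that[of 0]) (use no in auto)
  next
    case False
    have "compact (cball 0 (R + 1) - ball 0 \<delta> :: 'a set)" by (intro compact_diff) auto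
    from continuous_attains_sup[OF this False continuous_on_subset[OF \<kappa>(1)]]
    obtain z0 where z0: "z0 \<in> cball 0 (R + 1) - ball 0 \<delta>" "\<And>z. z \<in> cball 0 (R + 1) - ball 0 \<delta> \<Longrightarrow> \<kappa> z \<le> \<kappa> z0" by auto
    have "\<kappa> z0 < 1" using z0(1) \<delta>(1) by (intro \<kappa>(4)) auto
    thus ?thesis using that[OF \<kappa>(2)] z0(2) by simp
  qed
  \<comment> \<open>The midpoint of \<eta> and 1: still reached by the kernel near 0, yet strictly
    above the tail.\<close>
  define \<mu> where "\<mu> = (1 + \<eta>) / 2"
  have \<mu>: "\<eta> < \<mu>" "\<mu> < 1" "0 < \<mu>" using \<eta> by (auto simp: \<mu>_def)
  have "isCont \<kappa> 0" using \<kappa>(1) by (simp add: continuous_on_eq_continuous_at)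
  hence "\<exists>d>0. \<forall>z. dist z 0 < d \<longrightarrow> dist (\<kappa> z) (\<kappa> 0) < 1 - \<mu>"
    unfolding continuous_at_eps_delta using \<mu>(2) by (simp add: dist_norm)
  then obtain d where d: "d > 0" "\<And>z. norm z < d \<Longrightarrow> \<bar>\<kappa> z - 1\<bar> < 1 - \<mu>" by (auto simp: dist_norm \<kappa>(3))
  define \<delta>' where "\<delta>' = min (d / 2) (R + 1)"
  have \<delta>': "\<delta>' > 0" "\<delta>' \<le> R + 1" using d(1) R by (auto simp: \<delta>'_def)
  have low: "\<kappa> z \<ge> \<mu>" if "norm z \<le> \<delta>'" for z using d(2)[of z] that d(1) by (simp add: \<delta>'_def)
  define m where "m = measure lborel (cball (0::'a) \<delta>')"
  have m: "m > 0" using content_cball_pos[OF \<delta>'(1), of "0::'a"] by (simp add: m_def)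
  have In: "I n = (\<integral>z. indicator B z *\<^sub>R \<kappa> z ^ n \<partial>lborel)" for n by (simp add: I_def B_def)
  have I: "I n \<ge> \<mu> ^ n * m" for n
  proof -
    have "(\<integral>z. indicator (cball 0 \<delta>') z *\<^sub>R \<mu> ^ n \<partial>(lborel :: 'a measure)) \<le> (\<integral>z. indicator B z *\<^sub>R \<kappa> z ^ n \<partial>(lborel :: 'a measure))"
    proof (rule integral_mono[OF borel_integrable_compact iI])
      show "indicator (cball 0 \<delta>') z *\<^sub>R \<mu> ^ n \<le> indicator B z *\<^sub>R \<kappa> z ^ n" for z
        using \<delta>'(2) \<mu>(3) \<kappa>(2)[of z] low[of z] by (auto simp: indicator_def B_def intro: power_mono)
    qed auto
    moreover have "(\<integral>z. indicator (cball (0::'a) \<delta>') z *\<^sub>R \<mu> ^ n \<partial>lborel) = \<mu> ^ n * m" by (simp add: m_def)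
    ultimately show ?thesis by (simp only: In)
  qed
  have Ipos: "I n > 0" for n using less_le_trans[OF mult_pos_pos[OF zero_less_power[OF \<mu>(3)] m] I] .
  have main: "norm (inverse (complex_of_real (I n)) * convol (\<lambda>z. complex_of_real (\<kappa> z) ^ n) g x - g x)
      \<le> \<epsilon> / 2 + 2 * M * measure lborel B / m * (\<eta> / \<mu>) ^ n" if x: "norm x \<le> R" for n x
  proof -
    have ck: "continuous_on UNIV (\<lambda>z. complex_of_real (\<kappa> z) ^ n)" by (intro continuous_intros \<kappa>(1))
    note gi = convol_integrand[OF ck g]
    have i1: "integrable lborel (\<lambda>z. indicator B z *\<^sub>R (complex_of_real (\<kappa> z) ^ n * g (x - z)))"
      unfolding B_def by (intro borel_integrable_compact continuous_on_subset[OF gi(1)]) auto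
    have i2: "integrable lborel (\<lambda>z. indicator B z *\<^sub>R (complex_of_real (\<kappa> z) ^ n * g x))"
      unfolding B_def by (intro borel_integrable_compact continuous_intros continuous_on_subset[OF ck]) auto
    have "convol (\<lambda>z. complex_of_real (\<kappa> z) ^ n) g x = (\<integral>z. indicator B z *\<^sub>R (complex_of_real (\<kappa> z) ^ n * g (x - z)) \<partial>lborel)"
      unfolding convol_def
    proof (rule Bochner_Integration.integral_cong[OF refl])
      fix z
      show "complex_of_real (\<kappa> z) ^ n * g (x - z) = indicator B z *\<^sub>R (complex_of_real (\<kappa> z) ^ n * g (x - z))"
        using gi(3)[where z=z and x=x] x by (cases "z \<in> B") (auto simp: B_def)
    qed
    moreover have "complex_of_real (I n) * g x = (\<integral>z. indicator B z *\<^sub>R (complex_of_real (\<kappa> z) ^ n * g x) \<partial>lborel)"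
    proof -
      have "complex_of_real (I n) = (\<integral>z. complex_of_real (indicator B z *\<^sub>R \<kappa> z ^ n) \<partial>lborel)"
        unfolding In by (rule integral_complex_of_real[symmetric])
      hence "complex_of_real (I n) * g x = (\<integral>z. complex_of_real (indicator B z *\<^sub>R \<kappa> z ^ n) * g x \<partial>lborel)" by simp
      thus ?thesis by (simp add: scaleR_conv_of_real mult_ac)
    qed
    ultimately have "convol (\<lambda>z. complex_of_real (\<kappa> z) ^ n) g x - complex_of_real (I n) * g x
        = (\<integral>z. indicator B z *\<^sub>R (complex_of_real (\<kappa> z) ^ n * g (x - z)) - indicator B z *\<^sub>R (complex_of_real (\<kappa> z) ^ n * g x) \<partial>lborel)"
      by (simp add: Bochner_Integration.integral_diff[OF i1 i2])
    also have "norm \<dots> \<le> (\<integral>z. \<epsilon> / 2 * (indicator B z *\<^sub>R \<kappa> z ^ n) + 2 * M * \<eta> ^ n * indicator B z \<partial>lborel)"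
    proof (rule Bochner_Integration.integral_norm_bound_integral)
      show "integrable lborel (\<lambda>z. \<epsilon> / 2 * (indicator B z *\<^sub>R \<kappa> z ^ n) + 2 * M * \<eta> ^ n * indicator B z)"
      proof (intro Bochner_Integration.integrable_add integrable_mult_right iI)
        show "integrable lborel (indicat_real B)" using iI[of 0] by simp
      qed
      show "integrable lborel (\<lambda>z. indicator B z *\<^sub>R (complex_of_real (\<kappa> z) ^ n * g (x - z)) - indicator B z *\<^sub>R (complex_of_real (\<kappa> z) ^ n * g x))"
        by (rule Bochner_Integration.integrable_diff[OF i1 i2])
      show "norm (indicator B z *\<^sub>R (complex_of_real (\<kappa> z) ^ n * g (x - z)) - indicator B z *\<^sub>R (complex_of_real (\<kappa> z) ^ n * g x))
        \<le> \<epsilon> / 2 * (indicator B z *\<^sub>R \<kappa> z ^ n) + 2 * M * \<eta> ^ n * indicator B z" for z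
      proof (cases "z \<in> B")
        case True
        hence z: "norm z \<le> R + 1" by (simp add: B_def)
        have e: "norm (complex_of_real (\<kappa> z) ^ n * g (x - z) - complex_of_real (\<kappa> z) ^ n * g x) = \<kappa> z ^ n * norm (g (x - z) - g x)"
          using \<kappa>(2)[of z] by (simp add: norm_mult norm_power flip: right_diff_distrib)
        have k0: "\<kappa> z ^ n \<ge> 0" using \<kappa>(2) by simp
        have "\<kappa> z ^ n * norm (g (x - z) - g x) \<le> \<epsilon> / 2 * \<kappa> z ^ n + 2 * M * \<eta> ^ n"
        proof (cases "norm z < \<delta>")
          case True
          have "norm (x - z) \<le> 2 * R + 1" using norm_triangle_ineq4[of x z] x z by linarith
          from \<delta>(2)[OF _ this, of x] have "norm (g (x - z) - g x) \<le> \<epsilon> / 2" using x R True by simp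
          from mult_left_mono[OF this k0] have "\<kappa> z ^ n * norm (g (x - z) - g x) \<le> \<epsilon> / 2 * \<kappa> z ^ n" by (simp add: mult_ac)
          moreover have "2 * M * \<eta> ^ n \<ge> 0" using M(2) \<eta>(1) by simp
          ultimately show ?thesis by linarith
        next
          case False
          have "\<kappa> z ^ n \<le> \<eta> ^ n" using \<eta>(3)[of z] False z \<kappa>(2)[of z] by (intro power_mono) auto
          moreover have "norm (g (x - z) - g x) \<le> 2 * M" using norm_triangle_ineq4[of "g (x - z)" "g x"] M(1)[of x] M(1)[of "x - z"] by linarith
          ultimately have "\<kappa> z ^ n * norm (g (x - z) - g x) \<le> \<eta> ^ n * (2 * M)" using \<eta>(1) by (intro mult_mono) auto
          moreover have "\<epsilon> / 2 * \<kappa> z ^ n \<ge> 0" using \<epsilon> k0 by simp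
          ultimately show ?thesis by (simp add: mult_ac)
        qed
        thus ?thesis using True by (simp only: indicator_simps scaleR_one e mult_1_right)
      qed simp
    qed
    also have "\<dots> = \<epsilon> / 2 * I n + 2 * M * \<eta> ^ n * measure lborel B"
    proof -
      have iB: "integrable lborel (indicat_real B)" using iI[of 0] by simp
      show ?thesis unfolding In
        by (subst Bochner_Integration.integral_add) (use iI[of n] iB in \<open>auto simp del: integral_mult_right_zero simp: integral_mult_right_zero\<close>)
    qed
    finally have 1: "norm (convol (\<lambda>z. complex_of_real (\<kappa> z) ^ n) g x - complex_of_real (I n) * g x) \<le> \<epsilon> / 2 * I n + 2 * M * \<eta> ^ n * measure lborel B" .
    have "inverse (complex_of_real (I n)) * convol (\<lambda>z. complex_of_real (\<kappa> z) ^ n) g x - g x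
        = inverse (complex_of_real (I n)) * (convol (\<lambda>z. complex_of_real (\<kappa> z) ^ n) g x - complex_of_real (I n) * g x)"
      using Ipos[of n] by (simp add: right_diff_distrib)
    hence "norm (inverse (complex_of_real (I n)) * convol (\<lambda>z. complex_of_real (\<kappa> z) ^ n) g x - g x)
        = norm (convol (\<lambda>z. complex_of_real (\<kappa> z) ^ n) g x - complex_of_real (I n) * g x) / I n"
      using Ipos[of n] by (simp add: norm_mult norm_inverse divide_inverse mult.commute)
    also have "\<dots> \<le> (\<epsilon> / 2 * I n + 2 * M * \<eta> ^ n * measure lborel B) / I n"
      using 1 Ipos[of n] by (intro divide_right_mono) auto
    also have "\<dots> = \<epsilon> / 2 + 2 * M * \<eta> ^ n * measure lborel B / I n" using Ipos[of n] by (simp add: add_divide_distrib)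
    also have "2 * M * \<eta> ^ n * measure lborel B / I n \<le> 2 * M * \<eta> ^ n * measure lborel B / (\<mu> ^ n * m)"
      using I[of n] M(2) \<eta>(1) \<mu>(3) m by (intro divide_left_mono) (auto intro!: mult_pos_pos Ipos)
    also have "2 * M * \<eta> ^ n * measure lborel B / (\<mu> ^ n * m) = 2 * M * measure lborel B / m * (\<eta> / \<mu>) ^ n"
      by (simp add: power_divide mult_ac)
    finally show ?thesis by simp
  qed
  have "(\<lambda>n. 2 * M * measure lborel B / m * (\<eta> / \<mu>) ^ n) \<longlonglongrightarrow> 2 * M * measure lborel B / m * 0"
    using \<eta>(1) \<mu> by (intro tendsto_intros LIMSEQ_realpow_zero) auto
  hence "\<forall>\<^sub>F n in sequentially. 2 * M * measure lborel B / m * (\<eta> / \<mu>) ^ n < \<epsilon> / 2"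
    using half_gt_zero[OF \<epsilon>] by (intro order_tendstoD(2)) auto
  thus ?thesis
  proof eventually_elim
    case (elim n)
    show ?case
    proof
      fix x :: 'a assume "x \<in> cball 0 R"
      hence "norm x \<le> R" by simp
      from main[OF this, of n] elim show "norm (inverse (complex_of_real (I n)) * convol (\<lambda>z. complex_of_real (\<kappa> z) ^ n) g x - g x) \<le> \<epsilon>"
        by linarith
    qed
  qed
qed

text \<open>Kernel and normalisation do not depend on the derivative considered: differentiation
  moves onto \<phi>, and the concentration estimate is applied to each derivative
  separately.\<close>

lemma trig_poly_approximation:
  fixes \<phi> :: "'a::euclidean_space \<Rightarrow> complex"
  assumes \<phi>: "smooth \<phi>" "\<And>is x. norm x \<ge> 1 \<Longrightarrow> set is \<subseteq> Basis \<Longrightarrow> iter_partial is \<phi> x = 0" and R: "R \<ge> 0"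
  obtains \<psi> where "\<And>n::nat. trig_poly (\<psi> n)"
    "\<And>is \<epsilon>. set is \<subseteq> Basis \<Longrightarrow> \<epsilon> > 0 \<Longrightarrow>
       \<forall>\<^sub>F n in sequentially. \<forall>x\<in>cball 0 R. norm (iter_partial is (\<psi> n) x - iter_partial is \<phi> x) \<le> \<epsilon>"
proof -
  obtain \<kappa> :: "'a \<Rightarrow> real" where \<kappa>: "continuous_on UNIV \<kappa>" "trig_poly (\<lambda>z. complex_of_real (\<kappa> z))"
    "\<And>z. \<kappa> z \<ge> 0" "\<kappa> 0 = 1" "\<And>z. z \<noteq> 0 \<Longrightarrow> norm z \<le> R + 1 \<Longrightarrow> \<kappa> z < 1"
    using trig_poly_kernel[of "R + 1"] R by (metis add_nonneg_pos zero_less_one)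
  define I where "I n = (\<integral>z. indicator (cball 0 (R + 1)) z *\<^sub>R \<kappa> z ^ n \<partial>lborel)" for n :: nat
  define k where "k n z = complex_of_real (\<kappa> z) ^ n" for n z
  define \<psi> where "\<psi> n x = inverse (complex_of_real (I n)) * convol (k n) \<phi> x" for n x
  have k: "trig_poly (k n)" for n unfolding k_def by (rule trig_poly_power[OF \<kappa>(2)])
  have c: "trig_poly (convol (k n) \<phi>)" for n
    using trig_poly_convol[OF k smooth_continuous[OF \<phi>(1), of "[]"]] \<phi>(2)[of _ "[]"] by (simp add: iter_partial_simps)
  show ?thesis
  proof (rule that)
    show "trig_poly (\<psi> n)" for n unfolding \<psi>_def[abs_def] by (intro trig_poly_mult trig_poly_const c)
    fix "is" :: "'a list" and \<epsilon> :: real assume i: "set is \<subseteq> Basis" and \<epsilon>: "\<epsilon> > 0"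
    have e: "iter_partial is (convol (k n) \<phi>) = convol (k n) (iter_partial is \<phi>)" for n
      by (rule iter_partial_convol[OF k \<phi>(1) _ i]) (rule \<phi>(2))
    have "iter_partial is (\<psi> n) x = inverse (complex_of_real (I n)) * convol (k n) (iter_partial is \<phi>) x" for n x
      unfolding \<psi>_def[abs_def] iter_partial_cmult[OF trig_poly_smooth[OF c] i] e ..
    thus "\<forall>\<^sub>F n in sequentially. \<forall>x\<in>cball 0 R. norm (iter_partial is (\<psi> n) x - iter_partial is \<phi> x) \<le> \<epsilon>"
      using kernel_concentration[OF \<kappa>(1,3,4,5) R smooth_continuous[OF \<phi>(1) i] \<phi>(2)[OF _ i] \<epsilon>]
      unfolding I_def k_def by simp
  qed
qed

section \<open>Continuity of distributions and injectivity\<close>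

lemma iter_partial_zero_on_open:
  assumes U: "open U" "\<And>x. x \<in> U \<Longrightarrow> \<phi> x = 0" and x: "x \<in> U"
  shows "iter_partial is \<phi> x = 0"
  using x
proof (induction "is" arbitrary: x)
  case Nil thus ?case using U(2) by (simp add: iter_partial_simps)
next
  case (Cons b "is")
  have "(iter_partial is \<phi> has_derivative (\<lambda>_. 0)) (at x)"
    by (rule has_derivative_transform_within_open[OF has_derivative_const U(1) Cons.prems]) (simp add: Cons.IH)
  from partial_deriv_eqI[OF this] show ?case by (simp add: iter_partial_simps)
qed

lemma cs_distribution_diff:
  assumes T: "cs_distribution T" and f: "smooth f" "smooth g"
  shows "T (\<lambda>x. f x - g x) = T f - T g"
proof -
  have "T (\<lambda>x. f x + (-1) * g x) = T f + (-1) * T g"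
    using T f smooth_cmult[OF f(2), of "-1"] unfolding cs_distribution_def by metis
  thus ?thesis by simp
qed

lemma iter_partial_diff:
  fixes f g :: "'a::euclidean_space \<Rightarrow> complex"
  assumes "smooth f" "smooth g" "set is \<subseteq> Basis"
  shows "iter_partial is (\<lambda>x. f x - g x) = (\<lambda>x. iter_partial is f x - iter_partial is g x)" "smooth (\<lambda>x. f x - g x)"
  using iter_partial_add[OF assms(1) smooth_cmult[OF assms(2), of "-1"] assms(3)] iter_partial_cmult[OF assms(2,3), of "-1"]
    smooth_add[OF assms(1) smooth_cmult[OF assms(2), of "-1"]] by simp_all

lemma finite_multi_indices: "finite {is :: 'a::euclidean_space list. set is \<subseteq> Basis \<and> length is \<le> m}"
  by (rule finite_lists_length_le[OF finite_Basis])

text \<open>The continuity estimate involves finitely many derivatives on one compact set. Any ball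
  containing that set is large enough, hence the condition \<open>r >= R\<close>, which lets two
  distributions share a radius.\<close>

lemma cs_distribution_limit:
  fixes T :: "('a::euclidean_space \<Rightarrow> complex) \<Rightarrow> complex"
  assumes T: "cs_distribution T"
  obtains R where "\<And>r \<phi> \<psi>. r \<ge> R \<Longrightarrow> smooth \<phi> \<Longrightarrow> (\<And>n. smooth (\<psi> n)) \<Longrightarrow>
     (\<And>is \<epsilon>. set is \<subseteq> Basis \<Longrightarrow> \<epsilon> > 0 \<Longrightarrow>
       \<forall>\<^sub>F n in sequentially. \<forall>x\<in>cball 0 r. norm (iter_partial is (\<psi> n) x - iter_partial is \<phi> x) \<le> \<epsilon>) \<Longrightarrow>
     (\<lambda>n::nat. T (\<psi> n)) \<longlonglongrightarrow> T \<phi>"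
proof -
  obtain K m C where K: "compact K" "K \<noteq> {}"
    "\<And>f. smooth f \<Longrightarrow> norm (T f) \<le> C * (\<Sum>is | set is \<subseteq> Basis \<and> length is \<le> m. SUP x\<in>K. norm (iter_partial is f x))"
    using T unfolding cs_distribution_def by blast
  obtain R where "\<forall>x\<in>K. norm x \<le> R" using compact_imp_bounded[OF K(1)] unfolding bounded_iff by blast
  hence R: "K \<subseteq> cball 0 R" by auto
  define S where "S = {is :: 'a list. set is \<subseteq> Basis \<and> length is \<le> m}"
  have S: "finite S" unfolding S_def by (rule finite_multi_indices)
  show ?thesis
  proof (rule that[of R])
    fix r \<phi> and \<psi> :: "nat \<Rightarrow> 'a \<Rightarrow> complex" assume r: "r \<ge> R" and \<phi>: "smooth \<phi>" and \<psi>: "\<And>n. smooth (\<psi> n)"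
      and lim: "\<And>is \<epsilon>. set is \<subseteq> Basis \<Longrightarrow> \<epsilon> > 0 \<Longrightarrow>
       \<forall>\<^sub>F n in sequentially. \<forall>x\<in>cball 0 r. norm (iter_partial is (\<psi> n) x - iter_partial is \<phi> x) \<le> \<epsilon>"
    show "(\<lambda>n. T (\<psi> n)) \<longlonglongrightarrow> T \<phi>"
    proof (rule LIMSEQ_I)
      fix e :: real assume e: "e > 0"
      \<comment> \<open>The summand 1 avoids division by zero, and the factor 1/2 leaves room for a
        strict inequality.\<close>
      define \<epsilon> where "\<epsilon> = e / 2 / (\<bar>C\<bar> * real (card S) + 1)"
      have den: "\<bar>C\<bar> * real (card S) + 1 > 0" by (intro add_nonneg_pos) auto
      hence \<epsilon>: "\<epsilon> > 0" using e by (simp add: \<epsilon>_def)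
      have "\<forall>\<^sub>F n in sequentially. \<forall>is\<in>S. \<forall>x\<in>cball 0 r. norm (iter_partial is (\<psi> n) x - iter_partial is \<phi> x) \<le> \<epsilon>"
        using lim[OF _ \<epsilon>] by (intro eventually_ball_finite[OF S]) (auto simp: S_def)
      then obtain n0 where n0: "\<And>n is x. n \<ge> n0 \<Longrightarrow> is \<in> S \<Longrightarrow> x \<in> cball 0 r \<Longrightarrow> norm (iter_partial is (\<psi> n) x - iter_partial is \<phi> x) \<le> \<epsilon>"
        unfolding eventually_sequentially by blast
      have "norm (T (\<psi> n) - T \<phi>) < e" if n: "n \<ge> n0" for n
      proof -
        have "norm (T (\<psi> n) - T \<phi>) = norm (T (\<lambda>x. \<psi> n x - \<phi> x))" by (simp add: cs_distribution_diff[OF T \<psi> \<phi>])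
        also have "\<dots> \<le> C * (\<Sum>is\<in>S. SUP x\<in>K. norm (iter_partial is (\<lambda>x. \<psi> n x - \<phi> x) x))"
          unfolding S_def by (rule K(3)[OF iter_partial_diff(2)[OF \<psi> \<phi>, of "[]"]]) simp
        also have "\<dots> \<le> \<bar>C\<bar> * (\<Sum>is\<in>S. \<epsilon>)"
        proof -
          \<comment> \<open>The suprema must be nonnegative in order to replace C, whose sign is
            unknown, by its absolute value.\<close>
          have s: "0 \<le> (SUP x\<in>K. norm (iter_partial is (\<lambda>x. \<psi> n x - \<phi> x) x)) \<and> (SUP x\<in>K. norm (iter_partial is (\<lambda>x. \<psi> n x - \<phi> x) x)) \<le> \<epsilon>"
            if "is \<in> S" for "is"
          proof
            have i: "set is \<subseteq> Basis" using that by (simp add: S_def)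
            have b: "norm (iter_partial is (\<lambda>x. \<psi> n x - \<phi> x) x) \<le> \<epsilon>" if "x \<in> K" for x
              using n0[OF n \<open>is \<in> S\<close>, of x] that R r unfolding iter_partial_diff(1)[OF \<psi> \<phi> i] by fastforce
            show "(SUP x\<in>K. norm (iter_partial is (\<lambda>x. \<psi> n x - \<phi> x) x)) \<le> \<epsilon>" by (rule cSUP_least[OF K(2) b])
            obtain x where x: "x \<in> K" using K(2) by blast
            have "norm (iter_partial is (\<lambda>x. \<psi> n x - \<phi> x) x) \<le> (SUP x\<in>K. norm (iter_partial is (\<lambda>x. \<psi> n x - \<phi> x) x))"
              by (rule cSUP_upper[OF x]) (use b in \<open>auto intro!: bdd_aboveI[where M=\<epsilon>]\<close>)
            thus "0 \<le> (SUP x\<in>K. norm (iter_partial is (\<lambda>x. \<psi> n x - \<phi> x) x))" by (rule order_trans[OF norm_ge_zero])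
          qed
          show ?thesis using s by (intro mult_mono sum_mono sum_nonneg) auto
        qed
        also have "\<dots> = (\<bar>C\<bar> * real (card S)) * \<epsilon>" by simp
        also have "\<dots> \<le> (\<bar>C\<bar> * real (card S) + 1) * \<epsilon>" using \<epsilon> by (intro mult_right_mono) auto
        also have "\<dots> = e / 2" unfolding \<epsilon>_def using den by (intro nonzero_mult_div_cancel_left[THEN trans[OF times_divide_eq_right]]) auto
        also have "\<dots> < e" using e by simp
        finally show ?thesis .
      qed
      thus "\<exists>no. \<forall>n\<ge>no. norm (T (\<psi> n) - T \<phi>) < e" by blast
    qed
  qed
qed

text \<open>Equality of the transforms is equality on exponentials, hence on trigonometric
  polynomials; continuity carries it to their limits. Support in the unit ball is all that is needed
  later.\<close>

lemma dist_fourier_inj: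
  fixes T T' :: "('a::euclidean_space \<Rightarrow> complex) \<Rightarrow> complex"
  assumes T: "cs_distribution T" "cs_distribution T'" and eq: "\<And>\<xi>. dist_fourier T \<xi> = dist_fourier T' \<xi>"
    and \<phi>: "smooth \<phi>" "\<And>is x. norm x \<ge> 1 \<Longrightarrow> set is \<subseteq> Basis \<Longrightarrow> iter_partial is \<phi> x = 0"
  shows "T \<phi> = T' \<phi>"
proof -
  have trig: "T \<psi> = T' \<psi>" if "trig_poly \<psi>" for \<psi>
    using that
  proof (induction rule: trig_poly.induct)
    case (trig_wave c \<xi>)
    have w: "S (\<lambda>x. c * wave \<xi> x) = c * dist_fourier S \<xi>" if "cs_distribution S" for S
      using that smooth_wave[of \<xi>] unfolding cs_distribution_def dist_fourier_def by blast
    show ?case by (simp only: w[OF T(1)] w[OF T(2)] eq)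
  next
    case (trig_add f g)
    have a: "S (\<lambda>x. f x + g x) = S f + S g" if "cs_distribution S" for S
      using that trig_add.hyps[THEN trig_poly_smooth] unfolding cs_distribution_def by blast
    show ?case by (simp only: a[OF T(1)] a[OF T(2)] trig_add.IH)
  qed
  obtain R1 where R1: "\<And>r \<phi> \<psi>. r \<ge> R1 \<Longrightarrow> smooth \<phi> \<Longrightarrow> (\<And>n. smooth (\<psi> n)) \<Longrightarrow>
     (\<And>is \<epsilon>. set is \<subseteq> Basis \<Longrightarrow> \<epsilon> > 0 \<Longrightarrow>
       \<forall>\<^sub>F n in sequentially. \<forall>x\<in>cball 0 r. norm (iter_partial is (\<psi> n) x - iter_partial is \<phi> x) \<le> \<epsilon>) \<Longrightarrow>
     (\<lambda>n::nat. T (\<psi> n)) \<longlonglongrightarrow> T \<phi>" by (rule cs_distribution_limit[OF T(1)]) blast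
  obtain R2 where R2: "\<And>r \<phi> \<psi>. r \<ge> R2 \<Longrightarrow> smooth \<phi> \<Longrightarrow> (\<And>n. smooth (\<psi> n)) \<Longrightarrow>
     (\<And>is \<epsilon>. set is \<subseteq> Basis \<Longrightarrow> \<epsilon> > 0 \<Longrightarrow>
       \<forall>\<^sub>F n in sequentially. \<forall>x\<in>cball 0 r. norm (iter_partial is (\<psi> n) x - iter_partial is \<phi> x) \<le> \<epsilon>) \<Longrightarrow>
     (\<lambda>n::nat. T' (\<psi> n)) \<longlonglongrightarrow> T' \<phi>" by (rule cs_distribution_limit[OF T(2)]) blast
  define R where "R = max 0 (max R1 R2)"
  have R: "R \<ge> 0" "R \<ge> R1" "R \<ge> R2" by (auto simp: R_def)
  obtain \<psi> where \<psi>: "\<And>n::nat. trig_poly (\<psi> n)"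
    "\<And>is \<epsilon>. set is \<subseteq> Basis \<Longrightarrow> \<epsilon> > 0 \<Longrightarrow>
       \<forall>\<^sub>F n in sequentially. \<forall>x\<in>cball 0 R. norm (iter_partial is (\<psi> n) x - iter_partial is \<phi> x) \<le> \<epsilon>"
    by (rule trig_poly_approximation[OF \<phi> R(1)]) blast+
  have "(\<lambda>n. T (\<psi> n)) \<longlonglongrightarrow> T \<phi>" by (rule R1[OF R(2) \<phi>(1) trig_poly_smooth[OF \<psi>(1)] \<psi>(2)])
  moreover have "(\<lambda>n. T' (\<psi> n)) \<longlonglongrightarrow> T' \<phi>" by (rule R2[OF R(3) \<phi>(1) trig_poly_smooth[OF \<psi>(1)] \<psi>(2)])
  ultimately show ?thesis using trig[OF \<psi>(1)] by (simp add: LIMSEQ_unique)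
qed

section \<open>The regularised Born distribution\<close>

text \<open>The operator \<open>(x . grad) ^ j\<close> applied at y, with direction and base point
  kept apart: at y = 0 and as a function of x it is j! times the Taylor term of degree j.\<close>

primrec ray_deriv :: "nat \<Rightarrow> 'a::euclidean_space \<Rightarrow> ('a \<Rightarrow> complex) \<Rightarrow> 'a \<Rightarrow> complex" where
  "ray_deriv 0 x \<phi> y = \<phi> y"
| "ray_deriv (Suc j) x \<phi> y = (\<Sum>b\<in>Basis. complex_of_real (x \<bullet> b) * ray_deriv j x (partial_deriv b \<phi>) y)"

text \<open>The k-th power of the Laplacian at y. Evaluated at 0 it is the rotation invariant
  derivative of order 2k of the Dirac mass.\<close>

primrec lap_iter :: "nat \<Rightarrow> ('a::euclidean_space \<Rightarrow> complex) \<Rightarrow> 'a \<Rightarrow> complex" where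
  "lap_iter 0 \<phi> y = \<phi> y"
| "lap_iter (Suc k) \<phi> y = (\<Sum>b\<in>Basis. lap_iter k (partial_deriv b (partial_deriv b \<phi>)) y)"

lemma partial_deriv_linear:
  fixes f g :: "'a::euclidean_space \<Rightarrow> complex"
  assumes "smooth f" "b \<in> Basis"
  shows "smooth g \<Longrightarrow> partial_deriv b (\<lambda>x. f x + g x) = (\<lambda>x. partial_deriv b f x + partial_deriv b g x)"
    and "partial_deriv b (\<lambda>x. c * f x) = (\<lambda>x. c * partial_deriv b f x)"
  using iter_partial_add[of f g "[b]"] iter_partial_cmult[of f "[b]" c] assms by (simp_all add: iter_partial_simps)

lemma ray_deriv_linear:
  assumes "smooth f"
  shows "smooth g \<Longrightarrow> ray_deriv j x (\<lambda>x. f x + g x) y = ray_deriv j x f y + ray_deriv j x g y"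
    and "ray_deriv j x (\<lambda>x. c * f x) y = c * ray_deriv j x f y"
  using assms
proof (induction j arbitrary: f g)
  case (Suc j)
  { case 1
    thus ?case by (simp add: partial_deriv_linear smooth_partial_deriv Suc.IH distrib_left sum.distrib)
  next
    case 2
    thus ?case by (simp add: partial_deriv_linear smooth_partial_deriv Suc.IH sum_distrib_left mult_ac)
  }
qed simp_all

lemma lap_iter_linear:
  assumes "smooth f"
  shows "smooth g \<Longrightarrow> lap_iter j (\<lambda>x. f x + g x) y = lap_iter j f y + lap_iter j g y"
    and "lap_iter j (\<lambda>x. c * f x) y = c * lap_iter j f y"
  using assms
proof (induction j arbitrary: f g)
  case (Suc j)
  { case 1
    thus ?case by (simp add: partial_deriv_linear smooth_partial_deriv Suc.IH sum.distrib)
  next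
    case 2
    thus ?case by (simp add: partial_deriv_linear smooth_partial_deriv Suc.IH sum_distrib_left)
  }
qed simp_all

lemma ray_deriv_bound:
  fixes \<phi> :: "'a::euclidean_space \<Rightarrow> complex"
  assumes "\<And>is. set is \<subseteq> Basis \<Longrightarrow> length is = j \<Longrightarrow> norm (iter_partial is \<phi> y) \<le> B"
  shows "norm (ray_deriv j x \<phi> y) \<le> (real DIM('a) * norm x) ^ j * B"
  using assms
proof (induction j arbitrary: \<phi>)
  case 0
  show ?case using 0[of "[]"] by (simp add: iter_partial_simps)
next
  case (Suc j)
  have "norm (ray_deriv j x (partial_deriv b \<phi>) y) \<le> (real DIM('a) * norm x) ^ j * B" if "b \<in> Basis" for b
  proof (rule Suc.IH)
    fix "is" :: "'a list" assume "set is \<subseteq> Basis" "length is = j"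
    thus "norm (iter_partial is (partial_deriv b \<phi>) y) \<le> B"
      using Suc.prems[of "is @ [b]"] that by (simp add: iter_partial_simps)
  qed
  hence "norm (complex_of_real (x \<bullet> b) * ray_deriv j x (partial_deriv b \<phi>) y) \<le> norm x * ((real DIM('a) * norm x) ^ j * B)"
    if "b \<in> Basis" for b
    unfolding norm_mult norm_of_real using that by (intro mult_mono Basis_le_norm) auto
  hence "norm (ray_deriv (Suc j) x \<phi> y) \<le> (\<Sum>b\<in>(Basis::'a set). norm x * ((real DIM('a) * norm x) ^ j * B))"
    unfolding ray_deriv.simps by (rule sum_norm_le)
  thus ?case by simp
qed

lemma lap_iter_bound:
  fixes \<phi> :: "'a::euclidean_space \<Rightarrow> complex"
  assumes "\<And>is. set is \<subseteq> Basis \<Longrightarrow> length is = 2 * k \<Longrightarrow> norm (iter_partial is \<phi> y) \<le> B"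
  shows "norm (lap_iter k \<phi> y) \<le> real DIM('a) ^ k * B"
  using assms
proof (induction k arbitrary: \<phi>)
  case 0
  show ?case using 0[of "[]"] by (simp add: iter_partial_simps)
next
  case (Suc k)
  have "norm (lap_iter k (partial_deriv b (partial_deriv b \<phi>)) y) \<le> real DIM('a) ^ k * B" if "b \<in> Basis" for b
  proof (rule Suc.IH)
    fix "is" :: "'a list" assume i: "set is \<subseteq> Basis" "length is = 2 * k"
    have "norm (iter_partial ((is @ [b]) @ [b]) \<phi> y) \<le> B" using i that by (intro Suc.prems) auto
    thus "norm (iter_partial is (partial_deriv b (partial_deriv b \<phi>)) y) \<le> B" by (simp only: iter_partial_simps)
  qed
  hence "norm (lap_iter (Suc k) \<phi> y) \<le> (\<Sum>b\<in>(Basis::'a set). real DIM('a) ^ k * B)"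
    unfolding lap_iter.simps by (intro sum_norm_le)
  thus ?case by simp
qed

lemma ray_deriv_continuous: "continuous_on UNIV (\<lambda>x. ray_deriv j x \<phi> y)"
  by (induction j arbitrary: \<phi>) (auto intro!: continuous_intros)

text \<open>When the base point moves in the direction x itself, each t-derivative raises the order
  by one. This is the chain of derivatives for Taylor's formula along the ray.\<close>

lemma ray_deriv_along:
  assumes "smooth \<phi>"
  shows "((\<lambda>t. ray_deriv j x \<phi> (t *\<^sub>R x)) has_vector_derivative ray_deriv (Suc j) x \<phi> (t *\<^sub>R x)) (at t within S)"
  using assms
proof (induction j arbitrary: \<phi>)
  case 0
  define D where "D = frechet_derivative \<phi> (at (t *\<^sub>R x))"
  have D: "(\<phi> has_derivative D) (at (t *\<^sub>R x))"
    using smooth_differentiable[OF 0, of "[]"] by (simp add: iter_partial_simps D_def)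
  have "((\<lambda>t. t *\<^sub>R x) has_vector_derivative x) (at t within S)" by (auto intro!: derivative_eq_intros)
  from vector_derivative_diff_chain_within[OF this, of \<phi> D] D
  have "((\<lambda>t. \<phi> (t *\<^sub>R x)) has_vector_derivative D x) (at t within S)" by (simp add: o_def has_derivative_at_withinI)
  moreover have "D x = (\<Sum>b\<in>Basis. complex_of_real (x \<bullet> b) * D b)"
  proof -
    interpret linear D by (rule has_derivative_linear[OF D])
    have "D x = D (\<Sum>b\<in>Basis. (x \<bullet> b) *\<^sub>R b)" by (simp add: euclidean_representation)
    thus ?thesis by (simp add: sum scaleR scaleR_conv_of_real)
  qed
  ultimately show ?case by (simp add: D_def partial_deriv_def)
next
  case (Suc j)
  have "((\<lambda>t. \<Sum>b\<in>Basis. complex_of_real (x \<bullet> b) * ray_deriv j x (partial_deriv b \<phi>) (t *\<^sub>R x)) has_vector_derivative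
     (\<Sum>b\<in>Basis. complex_of_real (x \<bullet> b) * ray_deriv (Suc j) x (partial_deriv b \<phi>) (t *\<^sub>R x))) (at t within S)"
    by (intro has_vector_derivative_sum has_vector_derivative_mult_right Suc.IH smooth_partial_deriv Suc.prems)
  thus ?case by (simp only: ray_deriv.simps(2)[of "Suc j"]) simp
qed

definition taylor_remainder :: "nat \<Rightarrow> ('a::euclidean_space \<Rightarrow> complex) \<Rightarrow> 'a \<Rightarrow> complex" where
  "taylor_remainder N \<phi> x = \<phi> x - (\<Sum>j<N. ray_deriv j x \<phi> 0 / fact j)"

text \<open>The integral form of the remainder along the segment from 0 to x, which stays inside the
  unit ball. The power of the dimension counts the index lists of length N.\<close>

lemma taylor_remainder_bound:
  fixes \<phi> :: "'a::euclidean_space \<Rightarrow> complex"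
  assumes \<phi>: "smooth \<phi>" and N: "N > 0" and x: "norm x \<le> 1"
    and B: "\<And>is y. norm y \<le> 1 \<Longrightarrow> set is \<subseteq> Basis \<Longrightarrow> length is = N \<Longrightarrow> norm (iter_partial is \<phi> y) \<le> B"
  shows "norm (taylor_remainder N \<phi> x) \<le> (real DIM('a) * norm x) ^ N * B"
proof -
  have tx: "norm (t *\<^sub>R x) \<le> 1" if "t \<in> {0..1}" for t
    using that x by (simp add: mult_le_one)
  have rb: "norm (ray_deriv N u \<phi> y) \<le> (real DIM('a) * norm u) ^ N * B" if "norm y \<le> 1" for u y
    by (rule ray_deriv_bound) (rule B[OF that])
  have nn: "(real DIM('a) * norm x) ^ N * B \<ge> 0"
    using order_trans[OF norm_ge_zero rb[of 0 x]] by simp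
  have "((\<lambda>t. ((1 - t) ^ (N - 1) / fact (N - 1)) *\<^sub>R ray_deriv N x \<phi> (t *\<^sub>R x)) has_integral
      \<phi> (1 *\<^sub>R x) - (\<Sum>i<N. ((1 - 0) ^ i / fact i) *\<^sub>R ray_deriv i x \<phi> (0 *\<^sub>R x))) {0..1}"
    by (rule Taylor_has_integral[OF N _ _ zero_le_one, where f="\<lambda>t. \<phi> (t *\<^sub>R x)" and Df="\<lambda>j t. ray_deriv j x \<phi> (t *\<^sub>R x)"])
       (auto intro!: ray_deriv_along[OF \<phi>] simp del: ray_deriv.simps(2))
  moreover have "\<phi> (1 *\<^sub>R x) - (\<Sum>i<N. ((1 - 0) ^ i / fact i) *\<^sub>R ray_deriv i x \<phi> (0 *\<^sub>R x)) = taylor_remainder N \<phi> x"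
    by (simp add: taylor_remainder_def scaleR_conv_of_real divide_inverse mult.commute)
  ultimately have hi: "((\<lambda>t. ((1 - t) ^ (N - 1) / fact (N - 1)) *\<^sub>R ray_deriv N x \<phi> (t *\<^sub>R x)) has_integral taylor_remainder N \<phi> x) (cbox 0 1)"
    by simp
  have "norm (taylor_remainder N \<phi> x) \<le> (real DIM('a) * norm x) ^ N * B * measure lborel (cbox 0 (1::real))"
  proof (rule has_integral_bound[OF nn hi])
    fix t :: real assume "t \<in> cbox 0 1"
    hence t: "t \<in> {0..1}" by simp
    have "(1 - t) ^ (N - 1) \<le> 1" using t by (intro power_le_one) auto
    also have "(1::real) \<le> fact (N - 1)" by (rule fact_ge_1)
    finally have "(1 - t) ^ (N - 1) / fact (N - 1) \<le> 1" by simp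
    hence "\<bar>(1 - t) ^ (N - 1) / fact (N - 1)\<bar> \<le> 1" using t by simp
    from mult_mono[OF this rb[OF tx[OF t], where u=x]]
    show "norm (((1 - t) ^ (N - 1) / fact (N - 1)) *\<^sub>R ray_deriv N x \<phi> (t *\<^sub>R x)) \<le> (real DIM('a) * norm x) ^ N * B"
      by simp
  qed
  thus ?thesis by simp
qed

text \<open>The seminorm of \<open>cs_distribution\<close> with the closed unit ball as compact set.
  The ball is star-shaped about 0, so this seminorm also controls Taylor remainders.\<close>

definition ball_seminorm :: "nat \<Rightarrow> ('a::euclidean_space \<Rightarrow> complex) \<Rightarrow> real" where
  "ball_seminorm m \<phi> = (\<Sum>is | set is \<subseteq> Basis \<and> length is \<le> m. SUP x\<in>cball 0 1. norm (iter_partial is \<phi> x))"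

lemma partial_le_ball_seminorm:
  assumes \<phi>: "smooth \<phi>" and i: "set is \<subseteq> Basis" "length is \<le> m" and y: "norm y \<le> 1"
  shows "norm (iter_partial is \<phi> y) \<le> ball_seminorm m \<phi>"
proof -
  have upper: "norm (iter_partial js \<phi> z) \<le> (SUP x\<in>cball 0 1. norm (iter_partial js \<phi> x))" if "set js \<subseteq> Basis" "norm z \<le> 1" for js z
  proof (rule cSUP_upper)
    have "compact ((\<lambda>x. norm (iter_partial js \<phi> x)) ` cball 0 1)"
      by (intro compact_continuous_image continuous_intros continuous_on_subset[OF smooth_continuous[OF \<phi> that(1)]]) auto
    thus "bdd_above ((\<lambda>x. norm (iter_partial js \<phi> x)) ` cball 0 1)" by (intro bounded_imp_bdd_above compact_imp_bounded)
  qed (use that in simp)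
  have "(SUP x\<in>cball 0 1. norm (iter_partial is \<phi> x)) \<le> ball_seminorm m \<phi>"
    unfolding ball_seminorm_def
  proof (rule member_le_sum[OF _ _ finite_multi_indices])
    show "0 \<le> (SUP x\<in>cball 0 1. norm (iter_partial js \<phi> x))"
      if "js \<in> {is. set is \<subseteq> Basis \<and> length is \<le> m} - {is}" for js
      using order_trans[OF norm_ge_zero upper[of js 0]] that by simp
  qed (use i in simp)
  thus ?thesis using upper[OF i(1) y] by linarith
qed

text \<open>The Taylor polynomial is subtracted because \<open>f\<close> need not be integrable near the origin; the
  derivatives of the Dirac mass at the origin restore the finitely many moments lost this way.\<close>

definition regularised :: "('a::euclidean_space \<Rightarrow> real) \<Rightarrow> nat \<Rightarrow> (nat \<Rightarrow> real) \<Rightarrow> ('a \<Rightarrow> complex) \<Rightarrow> complex" where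
  "regularised f K a \<phi> = (\<integral>x. complex_of_real (f x) * taylor_remainder (2 * K) \<phi> x \<partial>lborel)
     + (\<Sum>k<K. complex_of_real (a k) * lap_iter k \<phi> 0)"

text \<open>The remainder vanishes to order \<open>2 * K\<close> at the origin, which turns the
  integrability of \<open>f * |x| ^ (2 * K)\<close> into that of the product, with a bound linear in
  the seminorm.\<close>

lemma regularised_integrable:
  fixes f :: "'a::euclidean_space \<Rightarrow> real"
  assumes f[measurable]: "f \<in> borel_measurable borel" "\<And>x. norm x \<ge> 1 \<Longrightarrow> f x = 0"
    "integrable lborel (\<lambda>x. f x * norm x ^ (2 * K))" and K: "K > 0" and \<phi>: "smooth \<phi>"
  shows "norm (complex_of_real (f x) * taylor_remainder (2 * K) \<phi> x)
      \<le> norm (f x * norm x ^ (2 * K)) * (real DIM('a) ^ (2 * K) * ball_seminorm (2 * K) \<phi>)"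
    and "integrable lborel (\<lambda>x. complex_of_real (f x) * taylor_remainder (2 * K) \<phi> x)"
proof -
  show b: "norm (complex_of_real (f x) * taylor_remainder (2 * K) \<phi> x)
      \<le> norm (f x * norm x ^ (2 * K)) * (real DIM('a) ^ (2 * K) * ball_seminorm (2 * K) \<phi>)" for x
  proof (cases "norm x < 1")
    case True
    have "norm (taylor_remainder (2 * K) \<phi> x) \<le> (real DIM('a) * norm x) ^ (2 * K) * ball_seminorm (2 * K) \<phi>"
      by (rule taylor_remainder_bound[OF \<phi>]) (use K True in \<open>auto intro!: partial_le_ball_seminorm \<phi>\<close>)
    from mult_left_mono[OF this, of "\<bar>f x\<bar>"] show ?thesis
      by (simp add: norm_mult abs_mult power_mult_distrib mult_ac)
  qed (simp add: f(2))
  have "continuous_on UNIV \<phi>" using smooth_continuous[OF \<phi>, of "[]"] by (simp add: iter_partial_simps)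
  hence "continuous_on UNIV (taylor_remainder (2 * K) \<phi>)"
    unfolding taylor_remainder_def[abs_def] by (intro continuous_intros ray_deriv_continuous) auto
  hence [measurable]: "taylor_remainder (2 * K) \<phi> \<in> borel_measurable borel" by (rule borel_measurable_continuous_onI)
  show "integrable lborel (\<lambda>x. complex_of_real (f x) * taylor_remainder (2 * K) \<phi> x)"
  proof (rule Bochner_Integration.integrable_bound)
    show "integrable lborel (\<lambda>x. norm (f x * norm x ^ (2 * K)) * (real DIM('a) ^ (2 * K) * ball_seminorm (2 * K) \<phi>))"
      by (intro integrable_mult_left integrable_norm f(3))
    show "AE x in lborel. norm (complex_of_real (f x) * taylor_remainder (2 * K) \<phi> x)
        \<le> norm (norm (f x * norm x ^ (2 * K)) * (real DIM('a) ^ (2 * K) * ball_seminorm (2 * K) \<phi>))"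
      using order_trans[OF b abs_ge_self] by (intro AE_I2) simp
  qed measurable
qed

lemma cs_distribution_regularised:
  fixes f :: "'a::euclidean_space \<Rightarrow> real"
  assumes f: "f \<in> borel_measurable borel" "\<And>x. norm x \<ge> 1 \<Longrightarrow> f x = 0"
    "integrable lborel (\<lambda>x. f x * norm x ^ (2 * K))" and K: "K > 0"
  shows "cs_distribution (regularised f K a)"
  unfolding cs_distribution_def
proof (intro conjI allI impI)
  have i: "integrable lborel (\<lambda>x. complex_of_real (f x) * taylor_remainder (2 * K) \<phi> x)" if "smooth \<phi>" for \<phi>
    by (rule regularised_integrable(2)[OF f(1) _ f(3) K that]) (rule f(2))
  fix \<phi> \<psi> :: "'a \<Rightarrow> complex" assume \<phi>: "smooth \<phi>" and \<psi>: "smooth \<psi>"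
  have "taylor_remainder (2 * K) (\<lambda>x. \<phi> x + \<psi> x) x = taylor_remainder (2 * K) \<phi> x + taylor_remainder (2 * K) \<psi> x" for x
    by (simp add: taylor_remainder_def ray_deriv_linear \<phi> \<psi> add_divide_distrib sum.distrib)
  thus "regularised f K a (\<lambda>x. \<phi> x + \<psi> x) = regularised f K a \<phi> + regularised f K a \<psi>"
    by (simp add: regularised_def lap_iter_linear \<phi> \<psi> distrib_left sum.distrib Bochner_Integration.integral_add[OF i[OF \<phi>] i[OF \<psi>]])
next
  fix c and \<phi> :: "'a \<Rightarrow> complex" assume \<phi>: "smooth \<phi>"
  have t: "taylor_remainder (2 * K) (\<lambda>x. c * \<phi> x) x = c * taylor_remainder (2 * K) \<phi> x" for x
    by (simp add: taylor_remainder_def ray_deriv_linear \<phi> right_diff_distrib sum_distrib_left)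
  have "(\<integral>x. complex_of_real (f x) * (c * taylor_remainder (2 * K) \<phi> x) \<partial>lborel)
      = (\<integral>x. c * (complex_of_real (f x) * taylor_remainder (2 * K) \<phi> x) \<partial>lborel)" by (simp only: mult.left_commute)
  also have "\<dots> = c * (\<integral>x. complex_of_real (f x) * taylor_remainder (2 * K) \<phi> x \<partial>lborel)" by (rule integral_mult_right_zero)
  finally show "regularised f K a (\<lambda>x. c * \<phi> x) = c * regularised f K a \<phi>"
    unfolding regularised_def t lap_iter_linear(2)[OF \<phi>] by (simp add: distrib_left sum_distrib_left mult.left_commute)
next
  define A where "A = (\<integral>x. norm (f x * norm x ^ (2 * K)) \<partial>lborel)"
  define C where "C = A * real DIM('a) ^ (2 * K) + (\<Sum>k<K. \<bar>a k\<bar> * real DIM('a) ^ k)"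
  have "norm (regularised f K a \<phi>) \<le> C * ball_seminorm (2 * K) \<phi>" if \<phi>: "smooth \<phi>" for \<phi>
  proof -
    have "norm (\<integral>x. complex_of_real (f x) * taylor_remainder (2 * K) \<phi> x \<partial>lborel)
        \<le> (\<integral>x. norm (f x * norm x ^ (2 * K)) * (real DIM('a) ^ (2 * K) * ball_seminorm (2 * K) \<phi>) \<partial>lborel)"
    proof (rule Bochner_Integration.integral_norm_bound_integral)
      show "integrable lborel (\<lambda>x. complex_of_real (f x) * taylor_remainder (2 * K) \<phi> x)"
        by (rule regularised_integrable(2)[OF f(1) _ f(3) K \<phi>]) (rule f(2))
      show "norm (complex_of_real (f x) * taylor_remainder (2 * K) \<phi> x)
          \<le> norm (f x * norm x ^ (2 * K)) * (real DIM('a) ^ (2 * K) * ball_seminorm (2 * K) \<phi>)" for x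
        by (rule regularised_integrable(1)[OF f(1) _ f(3) K \<phi>]) (rule f(2))
    qed (intro integrable_mult_left integrable_norm f(3))
    also have "\<dots> = A * (real DIM('a) ^ (2 * K) * ball_seminorm (2 * K) \<phi>)" unfolding A_def by (rule integral_mult_left_zero)
    finally have 1: "norm (\<integral>x. complex_of_real (f x) * taylor_remainder (2 * K) \<phi> x \<partial>lborel) \<le> A * real DIM('a) ^ (2 * K) * ball_seminorm (2 * K) \<phi>"
      by (simp only: mult.assoc)
    have "norm (\<Sum>k<K. complex_of_real (a k) * lap_iter k \<phi> 0) \<le> (\<Sum>k<K. \<bar>a k\<bar> * (real DIM('a) ^ k * ball_seminorm (2 * K) \<phi>))"
    proof (rule sum_norm_le)
      fix k assume k: "k \<in> {..<K}"
      have "norm (lap_iter k \<phi> 0) \<le> real DIM('a) ^ k * ball_seminorm (2 * K) \<phi>"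
        by (rule lap_iter_bound) (use k in \<open>auto intro!: partial_le_ball_seminorm \<phi>\<close>)
      thus "norm (complex_of_real (a k) * lap_iter k \<phi> 0) \<le> \<bar>a k\<bar> * (real DIM('a) ^ k * ball_seminorm (2 * K) \<phi>)"
        by (simp add: norm_mult mult_left_mono)
    qed
    also have "\<dots> = (\<Sum>k<K. \<bar>a k\<bar> * real DIM('a) ^ k) * ball_seminorm (2 * K) \<phi>" by (simp add: sum_distrib_right mult.assoc)
    finally have 2: "norm (\<Sum>k<K. complex_of_real (a k) * lap_iter k \<phi> 0) \<le> (\<Sum>k<K. \<bar>a k\<bar> * real DIM('a) ^ k) * ball_seminorm (2 * K) \<phi>" .
    show ?thesis unfolding regularised_def C_def distrib_right
      by (rule order_trans[OF norm_triangle_ineq add_mono[OF 1 2]])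
  qed
  thus "\<exists>S m C. compact S \<and> S \<noteq> {} \<and> (\<forall>\<phi>. smooth \<phi> \<longrightarrow>
      norm (regularised f K a \<phi>) \<le> C * (\<Sum>is | set is \<subseteq> Basis \<and> length is \<le> m. SUP x\<in>S. norm (iter_partial is \<phi> x)))"
    unfolding ball_seminorm_def by (intro exI[of _ "cball 0 1"] exI[of _ "2 * K"] exI[of _ C]) auto
qed

text \<open>The Taylor polynomial and the Dirac terms see only derivatives at the origin, so the
  regularisation is invisible to test functions supported away from it.\<close>

lemma regularised_away_from_0:
  assumes "\<And>is. set is \<subseteq> Basis \<Longrightarrow> iter_partial is \<phi> 0 = 0"
  shows "regularised f K a \<phi> = (\<integral>x. complex_of_real (f x) * \<phi> x \<partial>lborel)"
proof -
  have "ray_deriv j x \<phi> 0 = 0" for j x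
    using ray_deriv_bound[of j \<phi> 0 0 x] assms by simp
  moreover have "lap_iter k \<phi> 0 = 0" for k
    using lap_iter_bound[of k \<phi> 0 0] assms by simp
  ultimately show ?thesis by (simp add: regularised_def taylor_remainder_def)
qed

section \<open>The Fourier transform of the regularised distribution\<close>

lemma ray_deriv_wave: "ray_deriv j x (wave \<xi>) y = (- \<i> * complex_of_real (\<xi> \<bullet> x)) ^ j * wave \<xi> y"
proof (induction j)
  case (Suc j)
  have "ray_deriv (Suc j) x (wave \<xi>) y
      = (\<Sum>b\<in>Basis. complex_of_real (x \<bullet> b) * ((- \<i> * complex_of_real (\<xi> \<bullet> b)) * ray_deriv j x (wave \<xi>) y))"
    unfolding ray_deriv.simps partial_deriv_wave(2) ray_deriv_linear(2)[OF smooth_wave] ..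
  also have "\<dots> = (- \<i> * complex_of_real (\<Sum>b\<in>Basis. (\<xi> \<bullet> b) * (x \<bullet> b))) * ray_deriv j x (wave \<xi>) y"
    by (simp add: sum_distrib_left sum_distrib_right sum_negf mult_ac)
  also have "(\<Sum>b\<in>Basis. (\<xi> \<bullet> b) * (x \<bullet> b)) = \<xi> \<bullet> x" by (rule euclidean_inner[symmetric])
  finally show ?case by (simp only: Suc.IH power_Suc mult.assoc)
qed simp

lemma lap_iter_wave: "lap_iter k (wave \<xi>) y = complex_of_real ((- (norm \<xi>)\<^sup>2) ^ k) * wave \<xi> y"
proof (induction k)
  case (Suc k)
  have pp: "partial_deriv b (partial_deriv b (wave \<xi>)) = (\<lambda>x. complex_of_real (- (\<xi> \<bullet> b)\<^sup>2) * wave \<xi> x)" if "b \<in> Basis" for b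
    unfolding partial_deriv_wave(2) partial_deriv_linear(2)[OF smooth_wave that]
    by (simp add: fun_eq_iff power2_eq_square algebra_simps)
  have "lap_iter (Suc k) (wave \<xi>) y = (\<Sum>b\<in>Basis. complex_of_real (- (\<xi> \<bullet> b)\<^sup>2) * lap_iter k (wave \<xi>) y)"
    unfolding lap_iter.simps by (intro sum.cong refl) (simp only: pp lap_iter_linear(2)[OF smooth_wave])
  also have "\<dots> = complex_of_real (- (\<Sum>b\<in>Basis. (\<xi> \<bullet> b)\<^sup>2)) * lap_iter k (wave \<xi>) y"
    by (simp add: sum_distrib_right sum_negf)
  also have "(\<Sum>b\<in>Basis. (\<xi> \<bullet> b)\<^sup>2) = (norm \<xi>)\<^sup>2"
    unfolding power2_norm_eq_inner by (subst euclidean_inner) (simp add: power2_eq_square)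
  finally show ?case by (simp only: Suc.IH power_Suc of_real_mult mult.assoc)
qed simp

definition cos_remainder :: "nat \<Rightarrow> real \<Rightarrow> real" where
  "cos_remainder K \<theta> = cos \<theta> - (\<Sum>k<K. (- 1) ^ k / fact (2 * k) * \<theta> ^ (2 * k))"

lemma cos_remainder_sums: "(\<lambda>i. (- 1) ^ (i + K) / fact (2 * (i + K)) * \<theta> ^ (2 * (i + K))) sums cos_remainder K \<theta>"
  unfolding cos_remainder_def by (subst sums_iff_shift) (simp only: diff_add_cancel cos_paired)

text \<open>Adding the values at x and -x cancels the odd Taylor terms and leaves twice the tail of
  the cosine series.\<close>

lemma taylor_remainder_wave:
  "taylor_remainder (2 * K) (wave \<xi>) x + taylor_remainder (2 * K) (wave \<xi>) (- x) = 2 * complex_of_real (cos_remainder K (\<xi> \<bullet> x))"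
proof -
  define z where "z = \<i> * complex_of_real (\<xi> \<bullet> x)"
  have z2: "z\<^sup>2 = - complex_of_real ((\<xi> \<bullet> x)\<^sup>2)" by (simp add: z_def power_mult_distrib)
  have even: "(- z) ^ (2 * k) = (- 1) ^ k * complex_of_real ((\<xi> \<bullet> x) ^ (2 * k))" "z ^ (2 * k) = (- z) ^ (2 * k)" for k
  proof -
    have "(- z) ^ (2 * k) = (z\<^sup>2) ^ k" by (simp only: power_mult power2_minus)
    also have "\<dots> = (- 1) ^ k * complex_of_real ((\<xi> \<bullet> x)\<^sup>2) ^ k" unfolding z2 by (rule power_minus)
    finally show "(- z) ^ (2 * k) = (- 1) ^ k * complex_of_real ((\<xi> \<bullet> x) ^ (2 * k))" by (simp only: power_mult of_real_power)
    show "z ^ (2 * k) = (- z) ^ (2 * k)" by simp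
  qed
  have S: "(\<Sum>j<2 * K. (- z) ^ j / fact j + z ^ j / fact j) = 2 * complex_of_real (\<Sum>k<K. (- 1) ^ k / fact (2 * k) * (\<xi> \<bullet> x) ^ (2 * k))"
  proof (induction K)
    case (Suc K)
    have "(- z) ^ Suc (2 * K) / fact (Suc (2 * K)) + z ^ Suc (2 * K) / fact (Suc (2 * K)) = 0"
      unfolding power_Suc even(2) by simp
    moreover have "(- z) ^ (2 * K) / fact (2 * K) + z ^ (2 * K) / fact (2 * K)
        = 2 * complex_of_real ((- 1) ^ K / fact (2 * K) * (\<xi> \<bullet> x) ^ (2 * K))"
      unfolding even by simp
    moreover have "2 * Suc K = Suc (Suc (2 * K))" by simp
    ultimately show ?case using Suc.IH by (simp only: sum.lessThan_Suc of_real_add distrib_left) simp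
  qed simp
  have w: "wave \<xi> x + wave \<xi> (- x) = 2 * complex_of_real (cos (\<xi> \<bullet> x))"
    by (simp add: cos_of_real[symmetric] cos_exp_eq)
  have t: "taylor_remainder (2 * K) (wave \<xi>) y = wave \<xi> y - (\<Sum>j<2 * K. (- \<i> * complex_of_real (\<xi> \<bullet> y)) ^ j / fact j)" for y
    by (simp only: taylor_remainder_def ray_deriv_wave) simp
  have "taylor_remainder (2 * K) (wave \<xi>) x + taylor_remainder (2 * K) (wave \<xi>) (- x)
      = (wave \<xi> x + wave \<xi> (- x)) - (\<Sum>j<2 * K. (- z) ^ j / fact j + z ^ j / fact j)"
    unfolding t by (simp add: z_def sum.distrib)
  thus ?thesis unfolding S w by (simp only: cos_remainder_def of_real_diff right_diff_distrib)
qed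

text \<open>As f is even, only the even part of the remainder contributes, and this is a cosine
  tail. The tail starts at order \<open>2 * K\<close>, so each of its terms is dominated by
  \<open>|f| * |x| ^ (2 * K)\<close> and the series may be integrated termwise.\<close>

lemma regularised_fourier:
  fixes f :: "'a::euclidean_space \<Rightarrow> real"
  assumes f[measurable]: "f \<in> borel_measurable borel" "\<And>x. norm x \<ge> 1 \<Longrightarrow> f x = 0" "\<And>x. f (- x) = f x"
    "integrable lborel (\<lambda>x. f x * norm x ^ (2 * K))" and K: "K > 0"
  shows "(\<lambda>i. complex_of_real ((- 1) ^ (i + K) * (\<integral>x. f x * (\<xi> \<bullet> x) ^ (2 * (i + K)) \<partial>lborel) / fact (2 * (i + K))))
     sums (\<integral>x. complex_of_real (f x) * taylor_remainder (2 * K) (wave \<xi>) x \<partial>lborel)"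
proof -
  define u where "u i x = f x * ((- 1) ^ (i + K) / fact (2 * (i + K)) * (\<xi> \<bullet> x) ^ (2 * (i + K)))" for i x
  have [measurable]: "u i \<in> borel_measurable borel" for i unfolding u_def by measurable
  \<comment> \<open>Terms of the exponential series of \<open>|\<xi>|^2\<close>: on the unit ball
    the surplus powers of |x| are at most 1, and \<open>fact (2 * n) >= fact n\<close>.\<close>
  define c where "c i = ((norm \<xi>)\<^sup>2) ^ (i + K) / fact (i + K)" for i
  have bound: "norm (u i x) \<le> c i * norm (f x * norm x ^ (2 * K))" for i x
  proof (cases "norm x < 1")
    case True
    have "\<bar>\<xi> \<bullet> x\<bar> ^ (2 * (i + K)) \<le> (norm \<xi> * norm x) ^ (2 * (i + K))" by (intro power_mono Cauchy_Schwarz_ineq2) auto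
    also have "\<dots> = ((norm \<xi>)\<^sup>2) ^ (i + K) * (norm x ^ (2 * i) * norm x ^ (2 * K))"
      by (simp add: power_mult_distrib power_mult[symmetric] power_add[symmetric] distrib_left)
    also have "\<dots> \<le> ((norm \<xi>)\<^sup>2) ^ (i + K) * (1 * norm x ^ (2 * K))"
      using True by (intro mult_left_mono mult_right_mono power_le_one) auto
    finally have 1: "\<bar>\<xi> \<bullet> x\<bar> ^ (2 * (i + K)) \<le> ((norm \<xi>)\<^sup>2) ^ (i + K) * norm x ^ (2 * K)" by simp
    have "\<bar>\<xi> \<bullet> x\<bar> ^ (2 * (i + K)) / fact (2 * (i + K)) \<le> ((norm \<xi>)\<^sup>2) ^ (i + K) * norm x ^ (2 * K) / fact (i + K)"
      by (rule frac_le[OF _ 1]) (auto intro!: fact_mono)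
    from mult_left_mono[OF this, of "\<bar>f x\<bar>"] show ?thesis
      by (simp add: u_def c_def abs_mult power_abs mult_ac)
  qed (simp add: u_def f(2))
  have iu: "integrable lborel (u i)" for i
  proof (rule Bochner_Integration.integrable_bound)
    show "integrable lborel (\<lambda>x. c i * norm (f x * norm x ^ (2 * K)))" by (intro integrable_mult_right integrable_norm f(4))
    show "AE x in lborel. norm (u i x) \<le> norm (c i * norm (f x * norm x ^ (2 * K)))"
      using order_trans[OF bound abs_ge_self] by (intro AE_I2) simp
  qed measurable
  have sc: "summable c" unfolding c_def
    using summable_ignore_initial_segment[OF summable_exp[of "(norm \<xi>)\<^sup>2"], of K] by (simp add: divide_inverse mult.commute)
  have au: "AE x in lborel. summable (\<lambda>i. norm (u i x))"
  proof (rule AE_I2)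
    show "summable (\<lambda>i. norm (u i x))" for x
      by (rule summable_comparison_test'[OF summable_mult2[OF sc, of "norm (f x * norm x ^ (2 * K))"], where N=0])
         (use bound[of _ x] in simp)
  qed
  have su: "summable (\<lambda>i. \<integral>x. norm (u i x) \<partial>lborel)"
  proof (rule summable_comparison_test'[OF summable_mult2[OF sc], where N=0])
    fix i
    have "(\<integral>x. norm (u i x) \<partial>lborel) \<le> (\<integral>x. c i * norm (f x * norm x ^ (2 * K)) \<partial>lborel)"
      by (intro integral_mono bound integrable_norm iu integrable_mult_right f(4))
    thus "norm (\<integral>x. norm (u i x) \<partial>lborel) \<le> c i * (\<integral>x. norm (f x * norm x ^ (2 * K)) \<partial>lborel)" by simp
  qed
  have us: "(\<lambda>i. u i x) sums (f x * cos_remainder K (\<xi> \<bullet> x))" for x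
    unfolding u_def by (rule sums_mult[OF cos_remainder_sums])
  have s1: "(\<lambda>i. \<integral>x. u i x \<partial>lborel) sums (\<integral>x. f x * cos_remainder K (\<xi> \<bullet> x) \<partial>lborel)"
    using sums_integral[OF iu au su] by (simp only: sums_unique[OF us, symmetric])
  have ic: "integrable lborel (\<lambda>x. f x * cos_remainder K (\<xi> \<bullet> x))"
    using integrable_suminf[OF iu au su] by (simp only: sums_unique[OF us, symmetric])
  define h where "h x = complex_of_real (f x) * taylor_remainder (2 * K) (wave \<xi>) x" for x
  have ih: "integrable lborel h" unfolding h_def
    by (rule regularised_integrable(2)[OF f(1) _ f(4) K smooth_wave]) (rule f(2))
  \<comment> \<open>The odd part of the integrand; its integral is its own negative under
    reflection.\<close>
  define g where "g x = h x - complex_of_real (f x * cos_remainder K (\<xi> \<bullet> x))" for x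
  have icc: "integrable lborel (\<lambda>x. complex_of_real (f x * cos_remainder K (\<xi> \<bullet> x)))" by (rule integrable_of_real[OF ic])
  have ig: "integrable lborel g" unfolding g_def by (rule Bochner_Integration.integrable_diff[OF ih icc])
  hence gm: "g \<in> borel_measurable borel" by simp
  have odd: "g (0 - x) = - g x" for x
  proof -
    have e: "taylor_remainder (2 * K) (wave \<xi>) (- x) = 2 * complex_of_real (cos_remainder K (\<xi> \<bullet> x)) - taylor_remainder (2 * K) (wave \<xi>) x"
      using taylor_remainder_wave[of K \<xi> x] by (simp add: algebra_simps)
    have c: "cos_remainder K (\<xi> \<bullet> - x) = cos_remainder K (\<xi> \<bullet> x)" by (simp add: cos_remainder_def)
    show ?thesis unfolding g_def h_def diff_0 f(3) e c by (simp add: algebra_simps)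
  qed
  have "(\<integral>x. g x \<partial>lborel) = - (\<integral>x. g x \<partial>lborel)"
    using integral_reflect_translate[OF gm, of 0] unfolding odd by simp
  hence "(\<integral>x. g x \<partial>lborel) = 0" by (simp add: eq_neg_iff_add_eq_0)
  moreover have "(\<integral>x. g x \<partial>lborel) = (\<integral>x. h x \<partial>lborel) - (\<integral>x. complex_of_real (f x * cos_remainder K (\<xi> \<bullet> x)) \<partial>lborel)"
    unfolding g_def by (rule Bochner_Integration.integral_diff[OF ih icc])
  ultimately have "(\<integral>x. h x \<partial>lborel) = complex_of_real (\<integral>x. f x * cos_remainder K (\<xi> \<bullet> x) \<partial>lborel)"
    using integral_complex_of_real[of lborel "\<lambda>x. f x * cos_remainder K (\<xi> \<bullet> x)"] by simp
  moreover have "(\<integral>x. u i x \<partial>lborel) = (- 1) ^ (i + K) * (\<integral>x. f x * (\<xi> \<bullet> x) ^ (2 * (i + K)) \<partial>lborel) / fact (2 * (i + K))" for i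
  proof -
    have "(\<integral>x. u i x \<partial>lborel) = (\<integral>x. ((- 1) ^ (i + K) / fact (2 * (i + K))) * (f x * (\<xi> \<bullet> x) ^ (2 * (i + K))) \<partial>lborel)"
      unfolding u_def by (simp only: mult.left_commute mult.assoc)
    also have "\<dots> = ((- 1) ^ (i + K) / fact (2 * (i + K))) * (\<integral>x. f x * (\<xi> \<bullet> x) ^ (2 * (i + K)) \<partial>lborel)" by (rule integral_mult_right_zero)
    finally show ?thesis by (simp only: times_divide_eq_left)
  qed
  ultimately show ?thesis using sums_of_real[OF s1, where 'a=complex] unfolding h_def by (simp only:)
qed

text \<open>For radial f the direction contributes only the sphere moment. Divided by
  \<open>fact (2 * k)\<close>, it is up to sign the coefficient in the Fourier series of the
  theorem.\<close>

lemma radial_directional_moment: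
  fixes f :: "'a::euclidean_space \<Rightarrow> real"
  assumes r: "\<And>x y. norm x = norm y \<Longrightarrow> f x = f y" and c: "continuous_on (ball 0 1 - {0}) f" and z: "\<And>x. x \<notin> ball 0 1 - {0} \<Longrightarrow> f x = 0"
  shows "(\<integral>x. f x * (\<xi> \<bullet> x) ^ (2 * k) \<partial>lborel) / fact (2 * k) =
    2 * pi powr (real DIM('a) / 2) * (norm \<xi> / 2) ^ (2 * k) / (fact k * Gamma (real k + real DIM('a) / 2))
      * (1 / sphere_area TYPE('a) * (LINT x:ball 0 1|lborel. f x * norm x ^ (2 * k)))"
proof -
  obtain u :: 'a where u: "norm u = 1" by (meson SOME_Basis norm_Basis)
  define \<Phi> where "\<Phi> t = f (t *\<^sub>R u)" for t
  have \<Phi>: "f x = \<Phi> (norm x)" for x unfolding \<Phi>_def by (rule r) (simp add: u)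
  have c\<Phi>: "continuous_on {0<..<1} \<Phi>" unfolding \<Phi>_def
    by (intro continuous_on_compose2[OF c] continuous_intros) (use u in auto)
  have fm[measurable]: "f \<in> borel_measurable borel" by (rule radial_measurable[OF c]) (rule z)
  obtain m where m: "\<And>k. (\<integral>\<^sup>+x. ennreal (((\<xi> \<bullet> x) / norm x) ^ (2 * k)) * indicator (ball (0::'a) 1) x \<partial>lborel) = ennreal (m k)"
    "\<And>k. m k \<ge> 0"
    "\<And>k. real DIM('a) * m k / fact (2 * k) =
       2 * pi powr (real DIM('a) / 2) * (norm \<xi> / 2) ^ (2 * k) / (fact k * Gamma (real k + real DIM('a) / 2))"
    by (rule sphere_moment) blast
  have "(LINT x:ball 0 1|lborel. f x * (\<xi> \<bullet> x) ^ (2 * k)) = real DIM('a) * m k * laplace (\<lambda>\<theta>. \<Phi> (exp (- \<theta>))) (real (2 * k) + real DIM('a))"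
  proof (rule ball_integral_log(3)[where hh="\<lambda>x. ((\<xi> \<bullet> x) / norm x) ^ (2 * k)"])
    show "((\<xi> \<bullet> t *\<^sub>R x) / norm (t *\<^sub>R x)) ^ (2 * k) = ((\<xi> \<bullet> x) / norm x) ^ (2 * k)" if "t > 0" for t and x :: 'a
      using that by simp
    show "f x * (\<xi> \<bullet> x) ^ (2 * k) = ((\<xi> \<bullet> x) / norm x) ^ (2 * k) * (\<Phi> (norm x) * norm x powr real (2 * k))" if "x \<noteq> 0" for x
    proof -
      have "norm x powr real (2 * k) = norm x ^ (2 * k)" by (rule powr_realpow) (use that in simp)
      thus ?thesis using that by (simp add: \<Phi>[of x] power_divide del: of_nat_mult)
    qed
  qed (use m c\<Phi> in \<open>simp_all\<close>)
  moreover have "(LINT x:ball 0 1|lborel. f x * (\<xi> \<bullet> x) ^ (2 * k)) = (\<integral>x. f x * (\<xi> \<bullet> x) ^ (2 * k) \<partial>lborel)"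
    unfolding set_lebesgue_integral_def
  proof (rule Bochner_Integration.integral_cong[OF refl])
    show "indicator (ball 0 1) x *\<^sub>R (f x * (\<xi> \<bullet> x) ^ (2 * k)) = f x * (\<xi> \<bullet> x) ^ (2 * k)" for x
      using z[of x] by (cases "x \<in> ball 0 1") auto
  qed
  moreover have "1 / sphere_area TYPE('a) * (LINT x:ball 0 1|lborel. f x * norm x ^ (2 * k)) = laplace (\<lambda>\<theta>. \<Phi> (exp (- \<theta>))) (2 * real k + real DIM('a))"
    by (rule radial_moments(2)[OF _ c\<Phi>]) (rule \<Phi>, rule z)
  ultimately show ?thesis unfolding m(3)[symmetric] by (simp only: of_nat_mult of_nat_numeral) simp
qed

text \<open>An explicit regularisation T0 has the prescribed transform and equals f away from 0. Any
  other distribution with this transform is the sum of the same series at every \<xi>, so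
  injectivity transfers the second property to it.\<close>

theorem born_distribution:
  fixes V :: "'a::euclidean_space \<Rightarrow> real"
  assumes f: "is_born V f"
  shows "\<exists>T. is_born_distribution V T" "is_born_distribution V T \<Longrightarrow> coincides_on (ball 0 1 - {0}) T f"
proof -
  let ?d = "real DIM('a)"
  note r = is_bornD(1)[OF f] and c = is_bornD(2)[OF f] and z = is_bornD(3)[OF f]
  have fm[measurable]: "f \<in> borel_measurable borel" by (rule radial_measurable[OF c]) (rule z)
  obtain s where s: "s > 0" "set_integrable lborel (ball 0 1) (\<lambda>x. f x * norm x powr (2 * s))" using is_bornD(4)[OF f] by blast
  obtain k0 where k0: "\<And>k. k \<ge> k0 \<Longrightarrow> 1 / sphere_area TYPE('a) * (LINT x:ball 0 1|lborel. f x * norm x ^ (2 * k)) = lambda V k - real k"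
    using is_bornD(5)[OF f] unfolding eventually_sequentially by blast
  \<comment> \<open>From K on the moments of f are the numbers \<open>lambda V k - k\<close>, and
    \<open>f * |x| ^ (2 * K)\<close> is integrable; \<open>K >= 1\<close> is for Taylor's
    formula.\<close>
  define K where "K = max 1 (max k0 (nat \<lceil>s\<rceil>))"
  have "K \<ge> nat \<lceil>s\<rceil>" unfolding K_def by (intro max.coboundedI2 order_refl)
  hence "real K \<ge> s" using real_nat_ceiling_ge[of s] by linarith
  moreover have "K > 0" "K \<ge> k0" by (simp_all add: K_def)
  ultimately have K: "K > 0" "K \<ge> k0" "real K \<ge> s" by blast+
  have z1: "f x = 0" if "norm x \<ge> 1" for x using that by (intro z) simp
  have iK: "integrable lborel (\<lambda>x. f x * norm x ^ (2 * K))"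
  proof (rule Bochner_Integration.integrable_bound)
    show "integrable lborel (\<lambda>x. indicator (ball 0 1) x *\<^sub>R (f x * norm x powr (2 * s)))"
      using s(2) unfolding set_integrable_def .
    show "AE x in lborel. norm (f x * norm x ^ (2 * K)) \<le> norm (indicator (ball 0 1) x *\<^sub>R (f x * norm x powr (2 * s)))"
    proof (rule AE_I2)
      fix x :: 'a
      show "norm (f x * norm x ^ (2 * K)) \<le> norm (indicator (ball 0 1) x *\<^sub>R (f x * norm x powr (2 * s)))"
      proof (cases "x \<in> ball 0 1 - {0}")
        case True
        hence "norm x ^ (2 * K) = norm x powr (2 * real K)" using powr_realpow[of "norm x" "2 * K"] by simp
        also have "\<dots> \<le> norm x powr (2 * s)" using True K(3) by (intro powr_mono') auto
        finally show ?thesis using True by (simp add: abs_mult mult_left_mono)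
      qed (simp add: z)
    qed
  qed measurable
  have mom: "(\<integral>x. f x * (\<xi> \<bullet> x) ^ (2 * k) \<partial>lborel) / fact (2 * k) =
      2 * pi powr (?d / 2) * (norm \<xi> / 2) ^ (2 * k) / (fact k * Gamma (real k + ?d / 2))
        * (1 / sphere_area TYPE('a) * (LINT x:ball 0 1|lborel. f x * norm x ^ (2 * k)))" for \<xi> k
    by (rule radial_directional_moment[OF _ c]) (rule r, assumption, rule z, assumption)
  define w where "w k = 2 * pi powr (?d / 2) / (fact k * Gamma (real k + ?d / 2)) * (lambda V k - real k)" for k
  define t where "t \<xi> k = 2 * pi powr (?d / 2) *
      ((- 1) ^ k / (fact k * Gamma (real k + ?d / 2)) * (norm \<xi> / 2) ^ (2 * k) * (lambda V k - real k))" for \<xi> :: 'a and k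
  have tw: "t \<xi> k = (- 1) ^ k * (norm \<xi> / 2) ^ (2 * k) * w k" for \<xi> k by (simp add: t_def w_def)
  \<comment> \<open>On an exponential, \<open>lap_iter k\<close> at 0 gives
    \<open>(- |\<xi>|^2) ^ k\<close>, whereas the series contains
    \<open>(|\<xi>| / 2) ^ (2 * k)\<close>; the divisor \<open>4 ^ k\<close> reconciles the two, and
    the first K terms are restored exactly.\<close>
  define T0 where "T0 = regularised f K (\<lambda>k. w k / 4 ^ k)"
  have cs: "cs_distribution T0" unfolding T0_def by (rule cs_distribution_regularised[OF fm _ iK K(1)]) (rule z1)
  have F: "(\<lambda>k. complex_of_real (t \<xi> k)) sums dist_fourier T0 \<xi>" for \<xi>
  proof -
    have "(- 1) ^ (i + K) * (\<integral>x. f x * (\<xi> \<bullet> x) ^ (2 * (i + K)) \<partial>lborel) / fact (2 * (i + K)) = t \<xi> (i + K)" for i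
    proof -
      have "(\<integral>x. f x * (\<xi> \<bullet> x) ^ (2 * (i + K)) \<partial>lborel) / fact (2 * (i + K)) = (norm \<xi> / 2) ^ (2 * (i + K)) * w (i + K)"
        unfolding mom k0[OF trans_le_add2[OF K(2)]] w_def by simp
      thus ?thesis by (simp only: tw mult.assoc times_divide_eq_right[symmetric])
    qed
    moreover have "(\<lambda>i. complex_of_real ((- 1) ^ (i + K) * (\<integral>x. f x * (\<xi> \<bullet> x) ^ (2 * (i + K)) \<partial>lborel) / fact (2 * (i + K))))
       sums (\<integral>x. complex_of_real (f x) * taylor_remainder (2 * K) (wave \<xi>) x \<partial>lborel)"
      by (rule regularised_fourier[OF fm _ _ iK K(1)]) (rule z1, assumption, rule r, simp)
    ultimately have "(\<lambda>i. complex_of_real (t \<xi> (i + K))) sums (\<integral>x. complex_of_real (f x) * taylor_remainder (2 * K) (wave \<xi>) x \<partial>lborel)"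
      by (simp only:)
    hence "(\<lambda>k. complex_of_real (t \<xi> k)) sums ((\<integral>x. complex_of_real (f x) * taylor_remainder (2 * K) (wave \<xi>) x \<partial>lborel) + (\<Sum>k<K. complex_of_real (t \<xi> k)))"
      by (subst (asm) sums_iff_shift[where f="\<lambda>k. complex_of_real (t \<xi> k)"])
    moreover have "complex_of_real (t \<xi> k) = complex_of_real (w k / 4 ^ k) * lap_iter k (wave \<xi>) 0" for k
    proof -
      have "(norm \<xi> / 2) ^ (2 * k) = (norm \<xi>)\<^sup>2 ^ k / 4 ^ k" by (simp add: power_mult power_divide)
      moreover have "(- (norm \<xi>)\<^sup>2) ^ k = (- 1) ^ k * (norm \<xi>)\<^sup>2 ^ k" by (rule power_minus)
      ultimately have "t \<xi> k = w k / 4 ^ k * (- (norm \<xi>)\<^sup>2) ^ k" unfolding tw by simp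
      thus ?thesis unfolding lap_iter_wave by (simp only: of_real_mult) simp
    qed
    ultimately show ?thesis unfolding dist_fourier_def T0_def regularised_def by (simp only:)
  qed
  have b0: "is_born_distribution V T0" using cs F unfolding is_born_distribution_def t_def by blast
  thus "\<exists>T. is_born_distribution V T" by blast
  assume T: "is_born_distribution V T"
  show "coincides_on (ball 0 1 - {0}) T f"
    unfolding coincides_on_def
  proof (intro allI impI, elim conjE)
    fix \<phi> :: "'a \<Rightarrow> complex" assume \<phi>: "smooth \<phi>" and supp: "closure {x. \<phi> x \<noteq> 0} \<subseteq> ball 0 1 - {0}"
    define U where "U = - closure {x. \<phi> x \<noteq> 0}"
    have U: "open U" "\<And>x. x \<in> U \<Longrightarrow> \<phi> x = 0" unfolding U_def using closure_subset[of "{x. \<phi> x \<noteq> 0}"] by auto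
    have zero: "iter_partial is \<phi> x = 0" if "x \<notin> ball 0 1 - {0}" for "is" x
      by (rule iter_partial_zero_on_open[OF U]) (use that supp in \<open>auto simp: U_def\<close>)
    have "dist_fourier T \<xi> = dist_fourier T0 \<xi>" for \<xi>
    proof -
      have "(\<lambda>k. complex_of_real (t \<xi> k)) sums dist_fourier T \<xi>" using T unfolding is_born_distribution_def t_def by blast
      from sums_unique2[OF this F] show ?thesis .
    qed
    moreover have "cs_distribution T" using T unfolding is_born_distribution_def by blast
    ultimately have "T \<phi> = T0 \<phi>"
      by (intro dist_fourier_inj[OF _ cs _ \<phi>]) (auto intro!: zero)
    also have "\<dots> = (\<integral>x. complex_of_real (f x) * \<phi> x \<partial>lborel)"
      unfolding T0_def by (rule regularised_away_from_0) (rule zero, simp)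
    finally show "T \<phi> = (\<integral>x. complex_of_real (f x) * \<phi> x \<partial>lborel)" .
  qed
qed

theorem mainTheorem5:
  fixes V :: "'a::euclidean_space \<Rightarrow> real" and q :: "real \<Rightarrow> real"
  assumes "DIM('a) \<ge> 2"
    and "\<And>x. x \<in> cball 0 1 \<Longrightarrow> V x = q (norm x)"
    and "C1_on (cball 0 1) V"
  shows "((\<exists>T. is_born_distribution V T) \<and>
          (\<forall>T. is_born_distribution V T \<longrightarrow> coincides_on (ball 0 1 - {0}) T (born V))) \<and>
         (\<exists>W. born_flow V W \<and>
            (\<forall>W'. born_flow V W' \<longrightarrow> (\<forall>r\<in>{0<..1}. \<forall>s\<in>{0<..1}. W' r s = W r s)) \<and>
            (\<forall>s\<in>{0<..1}. \<forall>x\<in>ball 0 1 - {0}. W (norm x) s = born (scaled V s) x / s\<^sup>2) \<and>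
            (\<forall>x\<in>ball 0 1 - {0}. W 1 (norm x) = V x))"
  using born_distribution[OF radial_flow(1)[of V q, OF assms]] radial_flow(2)[of V q, OF assms]
  by (intro conjI allI impI)

end
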